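(* Let $\alpha\in(0,1)$ and let $(\mathcal N_t)_{t\ge0}$ be an inhomogeneous Poisson process whose rate function $t\mapsto\lambda_t$ is in $\mathrm{RV}_{\alpha-1}$ and satisfies $\Lambda(t)=\int_0^t\lambda_s\,\mathrm ds<\infty$ for all $t>0$. Let $V=\Lambda^{-1}$, $v=1/(\lambda\circ V)$, $\gamma=(1-\alpha)/\alpha$ and $\ell(t)=t^{-\gamma}v(t)$. Assume that for every function $\epsilon(t)>0$ with $\epsilon(t)\to0$ as $t\to\infty$, $$\log(t)\Big(\frac{\ell([1+\epsilon(t)]t)}{\ell(t)}-1\Big)\to0\qquad\text{as }t\to\infty .$$ Put $$b_t=\log\Lambda(t)-\log\log t-\log(1-\alpha).$$ Then: (i) $\big(\lambda_tL_t-b_t,\ \frac{t-\sigma_t}{t}\log t\big)\to(G,E_{\alpha(1-\alpha)})$ in distribution as $t\to\infty$, where $G$ and $E_{\alpha(1-\alpha)}$ are independent, $G$ is Gumbel and $E_{\alpha(1-\alpha)}$ is exponential with rate $\alpha(1-\alpha)$. (ii) The point process $\xi_t$ on $(-\infty,\infty]^2$ consisting of the points $\big(\lambda_tR_i-b_t,\ \frac{t-T_i}{t}\log t\big)$, $i=1,2,\ldots$, converges in distribution as $t\to\infty$ to a Poisson point process with intensity measure $\mu(\mathrm dx,\mathrm dz)=e^{-x}\,\mathrm dx\times\alpha(1-\alpha)e^{-\alpha(1-\alpha)z}\,\mathrm dz$.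
   Context: $\mathrm{RV}_\rho$ ($\rho\in\mathbb R$) denotes the set of measurable functions $f:(0,\infty)\to(0,\infty)$ with $f(ut)/f(t)\to u^\rho$ as $t\to\infty$ for every $u>0$. Here $V$ is the inverse function of $\Lambda$ and $v$ is its derivative; $v\in\mathrm{RV}_\gamma$ and $\ell\in\mathrm{RV}_0$. The epochs (points) of $\mathcal N$ in increasing order are $0<T_1<T_2<\cdots$, with $T_0=0$, and the gaps are $R_i=T_i-T_{i-1}$, $i\ge1$. The longest gap before time $t$ and its right-end position are $L_t=\max_{i\ge1}\{R_i:T_i\le t\}$ and $\sigma_t=\min_{i\ge1}\{T_i:R_i=L_t\}$ (defined on $\{T_1\le t\}$, whose probability tends to $1$). The Gumbel distribution has distribution function $\exp(-e^{-x})$, $x\in\mathbb R$. The measure $\mu$ is carried by $\mathbb R^2$. The space $(-\infty,\infty]^2$ is the plane compactified at $+\infty$ in each coordinate, so that the sets $[x,\infty]\times[z,\infty]$, $x,z\in\mathbb R$, are compact. Convergence in distribution of point processes is with respect to the vague topology on the space of Radon measures on $(-\infty,\infty]^2$. *)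

theory Defs
  imports "HOL-Probability.Probability"
begin

section \<open>Regular variation\<close>

text \<open>Functions on \<open>(0,\<infinity>)\<close> are total functions on the reals whose values at
  arguments \<open>\<le> 0\<close> are never used.\<close>

definition RV :: "real \<Rightarrow> (real \<Rightarrow> real) set" where
  "RV \<rho> = {f. f \<in> borel_measurable (restrict_space borel {0<..}) \<and> (\<forall>t>0. f t > 0) \<and>
     (\<forall>u>0. ((\<lambda>t. f (u * t) / f t) \<longlongrightarrow> u powr \<rho>) at_top)}"


section \<open>Inhomogeneous Poisson processes on the half-line\<close>

definition cumulative_rate :: "(real \<Rightarrow> real) \<Rightarrow> real \<Rightarrow> real" where
  "cumulative_rate lam t = (LINT s:{0<..t}|lborel. lam s)"

text \<open>Written out because the library's \<open>poisson_pmf\<close> is specified only for a positive mean;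
  for \<open>m = 0\<close> this is the point mass at 0.\<close>

definition poisson_mass :: "real \<Rightarrow> nat \<Rightarrow> real" where
  "poisson_mass m k = m ^ k / fact k * exp (- m)"

definition poisson_process ::
    "'a measure \<Rightarrow> (real \<Rightarrow> real) \<Rightarrow> (real \<Rightarrow> 'a \<Rightarrow> nat) \<Rightarrow> bool" where
  "poisson_process M lam N \<longleftrightarrow>
     prob_space M \<and>
     (\<forall>t\<ge>0. N t \<in> measurable M (count_space UNIV)) \<and>
     (\<forall>\<omega>\<in>space M. N 0 \<omega> = 0 \<and> mono_on {0..} (\<lambda>t. N t \<omega>) \<and>
        (\<forall>t\<ge>0. continuous (at_right t) (\<lambda>s. N s \<omega>))) \<and>
     (\<forall>s t k. 0 \<le> s \<and> s \<le> t \<longrightarrow>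
        measure M {\<omega> \<in> space M. N t \<omega> - N s \<omega> = k}
          = poisson_mass (cumulative_rate lam t - cumulative_rate lam s) k) \<and>
     (\<forall>\<tau> :: nat \<Rightarrow> real. 0 \<le> \<tau> 0 \<and> mono \<tau> \<longrightarrow>
        prob_space.indep_vars M (\<lambda>_. count_space UNIV)
          (\<lambda>i \<omega>. N (\<tau> (Suc i)) \<omega> - N (\<tau> i) \<omega>) UNIV)"

text \<open>Almost surely the paths jump by 1 and (if the total rate is infinite) tend to infinity, so
  that all indices \<open>i \<ge> 1\<close> belong to \<open>epoch_indices\<close> and the epochs increase strictly. The index
  set and the counting of epochs with multiplicity only serve to give sensible values on the
  exceptional null event. Note that \<open>epoch N 0 \<omega> = 0\<close>.\<close>

definition epoch :: "(real \<Rightarrow> 'a \<Rightarrow> nat) \<Rightarrow> nat \<Rightarrow> 'a \<Rightarrow> real" where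
  "epoch N i \<omega> = Inf {s. 0 \<le> s \<and> i \<le> N s \<omega>}"

definition epoch_indices :: "(real \<Rightarrow> 'a \<Rightarrow> nat) \<Rightarrow> 'a \<Rightarrow> nat set" where
  "epoch_indices N \<omega> = {i. 1 \<le> i \<and> (\<exists>s\<ge>0. i \<le> N s \<omega>)}"

definition gap :: "(real \<Rightarrow> 'a \<Rightarrow> nat) \<Rightarrow> nat \<Rightarrow> 'a \<Rightarrow> real" where
  "gap N i \<omega> = epoch N i \<omega> - epoch N (i - 1) \<omega>"

text \<open>Before the first epoch, the next two quantities take unspecified values. That
  event has asymptotically vanishing probability, so the values do not affect limits in
  distribution.\<close>

definition longest_gap :: "(real \<Rightarrow> 'a \<Rightarrow> nat) \<Rightarrow> real \<Rightarrow> 'a \<Rightarrow> real" where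
  "longest_gap N t \<omega> = Max {gap N i \<omega> | i. i \<in> epoch_indices N \<omega> \<and> epoch N i \<omega> \<le> t}"

text \<open>The minimum is written with \<open>LEAST\<close>, as \<open>Min\<close> is specified for finite sets only.\<close>

definition longest_gap_end :: "(real \<Rightarrow> 'a \<Rightarrow> nat) \<Rightarrow> real \<Rightarrow> 'a \<Rightarrow> real" where
  "longest_gap_end N t \<omega> =
     (LEAST s. \<exists>i \<in> epoch_indices N \<omega>. s = epoch N i \<omega> \<and> gap N i \<omega> = longest_gap N t \<omega>)"


section \<open>Convergence in distribution\<close>

definition borel_of_top :: "'b topology \<Rightarrow> 'b measure" where
  "borel_of_top X = sigma (topspace X) {U. openin X U}"

definition conv_in_distribution ::
    "'b topology \<Rightarrow> 'a measure \<Rightarrow> ('i \<Rightarrow> 'a \<Rightarrow> 'b) \<Rightarrow> 'c measure \<Rightarrow> ('c \<Rightarrow> 'b) \<Rightarrow> 'i filter \<Rightarrow> bool"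
  where
  "conv_in_distribution X M \<xi> M' \<eta> F \<longleftrightarrow>
     prob_space M \<and> prob_space M' \<and>
     (\<forall>\<^sub>F t in F. \<xi> t \<in> measurable M (borel_of_top X)) \<and>
     \<eta> \<in> measurable M' (borel_of_top X) \<and>
     (\<forall>f. continuous_map X euclideanreal f \<and> bounded (f ` topspace X) \<longrightarrow>
        ((\<lambda>t. \<integral>\<omega>. f (\<xi> t \<omega>) \<partial>M) \<longlongrightarrow> (\<integral>\<omega>. f (\<eta> \<omega>) \<partial>M')) F)"

definition gumbel :: "real measure" where
  "gumbel = interval_measure (\<lambda>x. exp (- exp (- x)))"


section \<open>Radon measures, the vague topology and point processes\<close>

text \<open>The definitions are meant for a locally compact, second countable Hausdorff subspace \<open>E\<close>,
  where Borel measures that are finite on compact sets are automatically regular. Test functions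
  are total functions, but their values outside \<open>E\<close> are irrelevant.\<close>

definition radon_measures :: "'b::topological_space set \<Rightarrow> 'b measure set" where
  "radon_measures E = {m. sets m = sets (restrict_space borel E) \<and>
     (\<forall>K. compact K \<and> K \<subseteq> E \<longrightarrow> emeasure m K < \<infinity>)}"

definition Cc :: "'b::topological_space set \<Rightarrow> ('b \<Rightarrow> real) set" where
  "Cc E = {f. continuous_on E f \<and> (\<exists>K. compact K \<and> K \<subseteq> E \<and> (\<forall>x\<in>E - K. f x = 0))}"

text \<open>The coarsest topology making all \<open>m \<mapsto> \<integral>f dm\<close>, \<open>f\<close> in \<open>Cc E\<close>, continuous.\<close>

definition vague_topology :: "'b::topological_space set \<Rightarrow> 'b measure topology" where
  "vague_topology E = topology_generated_by
     {{m \<in> radon_measures E. (\<integral>x. f x \<partial>m) \<in> U} | f U. f \<in> Cc E \<and> open U}"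

lemma topspace_vague_topology: "topspace (vague_topology E) = radon_measures E"
proof -
  have "(\<lambda>_. 0) \<in> Cc E"
    by (auto simp: Cc_def intro!: exI[of _ "{}"])
  then have "radon_measures E \<in>
      {{m \<in> radon_measures E. (\<integral>x. f x \<partial>m) \<in> U} | f U. f \<in> Cc E \<and> open U}"
    by (intro CollectI exI[of _ "\<lambda>_. 0"] exI[of _ UNIV]) auto
  then show ?thesis
    unfolding vague_topology_def topology_generated_by_topspace by blast
qed

text \<open>The sum of the Dirac masses at \<open>p i\<close>, \<open>i \<in> I\<close> (all lying in \<open>E\<close>), counted with
  multiplicity.\<close>

definition point_measure_on :: "'b::topological_space set \<Rightarrow> 'i set \<Rightarrow> ('i \<Rightarrow> 'b) \<Rightarrow> 'b measure" where
  "point_measure_on E I p = distr (count_space I) (restrict_space borel E) p"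

definition point_process ::
    "'b::topological_space set \<Rightarrow> 'a measure \<Rightarrow> ('a \<Rightarrow> 'b measure) \<Rightarrow> bool" where
  "point_process E M \<eta> \<longleftrightarrow>
     (\<forall>\<omega>\<in>space M. \<eta> \<omega> \<in> radon_measures E \<and>
        (\<forall>A\<in>sets (restrict_space borel E). emeasure (\<eta> \<omega>) A \<in> range ennreal_of_enat)) \<and>
     (\<forall>A\<in>sets (restrict_space borel E). (\<lambda>\<omega>. emeasure (\<eta> \<omega>) A) \<in> borel_measurable M)"

definition poisson_point_process ::
    "'b::topological_space set \<Rightarrow> 'b measure \<Rightarrow> 'a measure \<Rightarrow> ('a \<Rightarrow> 'b measure) \<Rightarrow> bool" where
  "poisson_point_process E \<mu> M \<eta> \<longleftrightarrow>
     prob_space M \<and> \<mu> \<in> radon_measures E \<and> point_process E M \<eta> \<and>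
     (\<forall>A k. A \<in> sets (restrict_space borel E) \<and> emeasure \<mu> A < \<infinity> \<longrightarrow>
        measure M {\<omega> \<in> space M. emeasure (\<eta> \<omega>) A = of_nat k} = poisson_mass (measure \<mu> A) k) \<and>
     (\<forall>A :: nat \<Rightarrow> 'b set. range A \<subseteq> sets (restrict_space borel E) \<and> disjoint_family A \<longrightarrow>
        prob_space.indep_vars M (\<lambda>_. borel) (\<lambda>i \<omega>. emeasure (\<eta> \<omega>) (A i)) UNIV)"

definition ext_plane :: "(ereal \<times> ereal) set" where
  "ext_plane = {-\<infinity><..} \<times> {-\<infinity><..}"

text \<open>The measure \<open>e\<^sup>-\<^sup>x dx \<times> a e\<^sup>-\<^sup>a\<^sup>z dz\<close> on the whole plane (the second factor is
  not restricted to positive \<open>z\<close>, hence not a probability measure), transported to the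
  extended plane.\<close>

definition limit_intensity :: "real \<Rightarrow> (ereal \<times> ereal) measure" where
  "limit_intensity a =
     distr (density lborel (\<lambda>x. ennreal (exp (- x))) \<Otimes>\<^sub>M
            density lborel (\<lambda>z. ennreal (a * exp (- a * z))))
       (restrict_space borel ext_plane) (\<lambda>(x, z). (ereal x, ereal z))"

end

theory Submission
  imports Defs "HOL-Real_Asymp.Real_Asymp"
begin

text \<open>
The theorem is a Poisson limit for extremes of nearly independent gaps. In operational time
\<open>Lam\<close> the process has unit rate, so the gaps \<open>X i\<close> between consecutive values of \<open>Lam\<close> at the epochs
are independent standard exponential variables. A real gap is the integral of the inverse rate
\<open>v = 1 / (lam o V)\<close> over an operational gap, hence approximately \<open>v i * X i\<close>. Because
\<open>v\<close> grows like a power and \<open>X i\<close> has exponential tails, only indices within relative distance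
\<open>O(1 / ln t)\<close> of \<open>Lam t\<close> can produce the longest gap. There the slow-variation hypothesis makes \<open>lam t * v\<close>
linear with an error \<open>o(1 / ln t)\<close>; multiplied with a gap of order \<open>ln t\<close> this error disappears.

In the exponential coordinates \<open>p = exp (- x)\<close> and \<open>q = exp (- a z)\<close>, \<open>a = \<alpha> * (1 - \<alpha>)\<close>,
the limiting intensity is area in the quadrant. The surrogate points \<open>(P t i, Q t i)\<close> are built directly from the
independent variables \<open>X i\<close> with a deterministic second coordinate. Their void probabilities on finite unions of
small cells converge to those of a unit-intensity Poisson scatter (\<open>void_tendsto\<close>), double occupation of a
cell is negligible (\<open>double_small\<close>), and with high probability the actual points are uniformly close to the
surrogates inside every fixed square (\<open>close_prob\<close>).

Both parts now follow from one principle (\<open>conv_expectation_codes\<close>): encode a configuration by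
finitely many cells, compare the laws of the codes, and use that equal codes force nearby values of a continuous functional.
For the point process the code is the set of occupied cells, and the vague topology is controlled by matching points
of two configurations (\<open>matched_open\<close>, \<open>counts_matched\<close>). For the longest gap the code is the position of the lowest
surrogate point in the strip \<open>q \<le> 1\<close>, which corresponds to epochs before \<open>t\<close>; its law is a difference of two
void probabilities. The limiting Poisson process is constructed from independent tiles with a Poisson number of uniform points
(\<open>poisson_point_process_exists\<close>), whose laws are identified through generating functions.
\<close>

section \<open>The rate function and the inverse of the cumulative rate\<close>

locale rate_function =
 fixes lam :: "real => real" and al :: real
 assumes alpha: "0 < al" "al < 1"
 and RV: "lam : RV (al - 1)"
 and integ: "!!t. t > 0 ==> set_integrable lborel {0<..t} lam"
begin

abbreviation "Lam \<equiv> cumulative_rate lam"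
definition "V = the_inv_into {0..} Lam"
definition "v s = 1/lam (V s)"

lemma lam_pos: "t > 0 ==> lam t > 0"
 using RV by (auto simp: RV_def)

lemma lam_integrable: assumes "0 <= s" shows "set_integrable lborel {s<..t} lam"
proof (cases "s < t")
 case True
 thus ?thesis using assms by (intro set_integrable_subset[OF integ[of t]]) auto
qed (simp add: set_integrable_def)

lemma Lam_diff: assumes "0 <= s" "s <= t" shows "Lam t - Lam s = (LINT x:{s<..t}|lborel. lam x)"
proof -
 have eq: "{0<..t} = {0<..s} Un {s<..t}" using assms by auto
 have "Lam t = Lam s+(LINT x:{s<..t}|lborel. lam x)"
 unfolding cumulative_rate_def eq
 by (rule set_integral_Un) (use assms lam_integrable in auto)
 thus ?thesis by (simp add: cumulative_rate_def)
qed

lemma Lam_0 [simp]: "Lam 0 = 0"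
 by (simp add: cumulative_rate_def set_lebesgue_integral_def)

lemma Lam_diff_le:
 assumes "0 <= s" "s <= t" "!!x. s < x ==> x <= t ==> lam x <= C"
 shows "Lam t - Lam s <= C * (t - s)"
proof -
 have "(LINT x:{s<..t}|lborel. lam x) <= (LINT x:{s<..t}|lborel. C)"
 by (rule set_integral_mono) (use assms lam_integrable in \<open>auto simp: set_integrable_def\<close>)
 also have "... = C * (t - s)"
 using assms(2) by (simp add: set_lebesgue_integral_def)
 finally show ?thesis using Lam_diff[OF assms(1,2)] by simp
qed

lemma Lam_diff_ge:
 assumes "0 <= s" "s <= t" "!!x. s < x ==> x <= t ==> C <= lam x"
 shows "C * (t - s) <= Lam t - Lam s"
proof -
 have "C * (t - s) = (LINT x:{s<..t}|lborel. C)"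
 using assms(2) by (simp add: set_lebesgue_integral_def)
 also have "... <= (LINT x:{s<..t}|lborel. lam x)"
 by (rule set_integral_mono) (use assms lam_integrable in \<open>auto simp: set_integrable_def\<close>)
 finally show ?thesis using Lam_diff[OF assms(1,2)] by simp
qed

lemma Lam_less: assumes "0 <= s" "s < t" shows "Lam s < Lam t"
proof -
 have "0 < (LINT x:{s<..t}|lborel. lam x)"
 proof -
 have i: "integrable lborel (%x. indicator {s<..t} x *\<^sub>R lam x)"
 using lam_integrable[OF assms(1)] by (simp add: set_integrable_def)
 have nn: "AE x in lborel. 0 <= indicator {s<..t} x *\<^sub>R lam x"
 using lam_pos assms(1) by (auto simp: indicator_def less_imp_le)
 have "(LINT x|lborel. indicator {s<..t} x *\<^sub>R lam x) ~= 0"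
 proof
 assume "(LINT x|lborel. indicator {s<..t} x *\<^sub>R lam x) = 0"
 hence "AE x in lborel. indicator {s<..t} x *\<^sub>R lam x = 0"
 using integral_nonneg_eq_0_iff_AE[OF i nn] by simp
 hence "AE x in lborel. x ~: {s<..t}"
 proof (rule AE_mp, intro AE_I2 impI notI)
 fix x assume "indicator {s<..t} x *\<^sub>R lam x = 0" "x : {s<..t}"
 thus False using lam_pos[of x] assms(1) by auto
 qed
 hence "emeasure lborel {s<..t} = 0"
 using AE_iff_measurable[of "{s<..t}" lborel "%x. x ~: {s<..t}"]
 by (simp add: greaterThanAtMost_iff[symmetric] del: greaterThanAtMost_iff)
 thus False using assms(2) by simp
 qed
 moreover have "(LINT x|lborel. indicator {s<..t} x *\<^sub>R lam x) >= 0"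
 by (rule integral_nonneg_AE[OF nn])
 ultimately show ?thesis by (simp add: set_lebesgue_integral_def)
 qed
 thus ?thesis using Lam_diff[of s t] assms by simp
qed

lemma Lam_mono: "0 <= s ==> s <= t ==> Lam s <= Lam t"
 using Lam_less[of s t] by (cases "s = t") auto

lemma Lam_nonneg: "0 <= t ==> 0 <= Lam t"
 using Lam_mono[of 0 t] by simp

lemma Lam_le_iff: "0 <= s ==> 0 <= t ==> Lam s <= Lam t \<longleftrightarrow> s <= t"
 using Lam_less[of t s] Lam_mono[of s t] by linarith

lemma Lam_less_iff: "0 <= s ==> 0 <= t ==> Lam s < Lam t \<longleftrightarrow> s < t"
 using Lam_le_iff[of t s] by linarith

lemma Lam_eq_set_integral: "0 <= t ==> Lam t = integral {0..t} (%x. if x = 0 then 0 else lam x)"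
proof -
 assume "0 <= t"
 have eq: "(%x. indicator {0<..t} x *\<^sub>R lam x) = (%x. indicator {0..t} x *\<^sub>R (if x = 0 then 0 else lam x))"
 by (auto simp: indicator_def fun_eq_iff)
 have "set_integrable lborel {0..t} (%x. if x = 0 then 0 else lam x)"
 using lam_integrable[of 0 t] unfolding set_integrable_def eq by simp
 from set_borel_integral_eq_integral(2)[OF this] show ?thesis
 unfolding cumulative_rate_def set_lebesgue_integral_def eq .
qed

lemma Lam_continuous: "continuous_on {0..T} Lam"
proof -
 have eq: "(%x. indicator {0<..T} x *\<^sub>R lam x) = (%x. indicator {0..T} x *\<^sub>R (if x = 0 then 0 else lam x))"
 by (auto simp: indicator_def fun_eq_iff)
 have "set_integrable lborel {0..T} (%x. if x = 0 then 0 else lam x)"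
 using lam_integrable[of 0 T] unfolding set_integrable_def eq by simp
 from set_borel_integral_eq_integral(1)[OF this]
 have "continuous_on {0..T} (%t. integral {0..t} (%x. if x = 0 then 0 else lam x))"
 by (rule indefinite_integral_continuous_1)
 thus ?thesis
 by (rule continuous_on_eq) (simp add: Lam_eq_set_integral)
qed

lemma Lam_doubling_step:
 assumes "0 < s" and "!!x. x >= s ==> lam x <= 2 * lam (2 * x)"
 shows "Lam (2 * s) - Lam s <= Lam (4 * s) - Lam (2 * s)"
proof -
 have "Lam (4 * s) - Lam (2 * s) = (LINT x|lborel. indicator {2 * s<..4 * s} x *\<^sub>R lam x)"
 using assms Lam_diff[of "2 * s" "4 * s"] by (simp add: set_lebesgue_integral_def)
 also have "... = 2 * (LINT x|lborel. indicator {2 * s<..4 * s} (2 * x) *\<^sub>R lam (2 * x))"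
 using lborel_integral_real_affine[of 2 "%x. indicator {2 * s<..4 * s} x *\<^sub>R lam x" 0] by simp
 also have "... = (LINT x|lborel. 2 * (indicator {2 * s<..4 * s} (2 * x) *\<^sub>R lam (2 * x)))"
 by simp
 also have "... = (LINT x|lborel. indicator {s<..2 * s} x *\<^sub>R (2 * lam (2 * x)))"
 by (rule Bochner_Integration.integral_cong) (auto simp: indicator_def)
 also have "... >= (LINT x|lborel. indicator {s<..2 * s} x *\<^sub>R lam x)"
 proof (rule integral_mono)
 show "integrable lborel (%x. indicator {s<..2 * s} x *\<^sub>R lam x)"
 using lam_integrable[of s "2 * s"] assms(1) by (simp add: set_integrable_def)
 have "integrable lborel (%x. indicator {2 * s<..4 * s} x *\<^sub>R lam x)"
 using lam_integrable[of "2 * s" "4 * s"] assms(1) by (simp add: set_integrable_def)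
 hence "integrable lborel (%x. indicator {2 * s<..4 * s} (0+2 * x) *\<^sub>R lam (0+2 * x))"
 by (subst lborel_integrable_real_affine_iff) auto
 hence "integrable lborel (%x. 2 * (indicator {2 * s<..4 * s} (2 * x) *\<^sub>R lam (2 * x)))"
 by simp
 also have "(%x. 2 * (indicator {2 * s<..4 * s} (2 * x) *\<^sub>R lam (2 * x))) =
 (%x. indicator {s<..2 * s} x *\<^sub>R (2 * lam (2 * x)))"
 by (auto simp: indicator_def fun_eq_iff)
 finally show "integrable lborel (%x. indicator {s<..2 * s} x *\<^sub>R (2 * lam (2 * x)))" .
 qed (use assms in \<open>auto simp: indicator_def\<close>)
 also have "(LINT x|lborel. indicator {s<..2 * s} x *\<^sub>R lam x) = Lam (2 * s) - Lam s"
 using assms Lam_diff[of "s" "2 * s"] by (simp add: set_lebesgue_integral_def)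
 finally show ?thesis .
qed

lemma Lam_unbounded: "EX t>=0. Lam t > B"
proof -
 have "((%t. lam (2 * t)/lam t) \<longlongrightarrow> 2 powr (al - 1)) at_top"
 using RV by (auto simp: RV_def)
 moreover have "2 powr (al - 1) > (1/2::real)"
 using alpha powr_less_mono[of "-1" "al - 1" "2::real"] by (simp add: powr_minus)
 ultimately have "\<forall>\<^sub>F t in at_top. lam (2 * t)/lam t > 1/2"
 by (rule order_tendstoD)
 then obtain s0 where s0: "!!t. t >= s0 ==> lam (2 * t)/lam t > 1/2"
 by (auto simp: eventually_at_top_linorder)
 define s where "s = max s0 1"
 have s: "s > 0" by (simp add: s_def)
 have dbl: "lam x <= 2 * lam (2 * x)" if "x >= s" for x
 using s0[of x] that lam_pos[of x] by (auto simp: s_def field_simps)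
 have step: "Lam (2 * s) - Lam s <= Lam (2^Suc n * s) - Lam (2^n * s)" for n
 proof (induction n)
 case (Suc n)
 have "Lam (2 * (2^n * s)) - Lam (2^n * s) <= Lam (4 * (2^n * s)) - Lam (2 * (2^n * s))"
 proof (rule Lam_doubling_step)
 show "0 < 2^n * s" using s by simp
 have "s <= 2^n * s" using s by simp
 thus "!!x. 2^n * s <= x ==> lam x <= 2 * lam (2 * x)" using dbl by force
 qed
 with Suc show ?case by (simp add: mult.assoc)
 qed simp
 have lin: "Lam (2^n * s) >= n * (Lam (2 * s) - Lam s)" for n
 proof (induction n)
 case 0 thus ?case using s Lam_nonneg by simp
 next
 case (Suc n) thus ?case using step[of n] by (simp add: algebra_simps)
 qed
 have D: "Lam (2 * s) - Lam s > 0" using Lam_less[of s "2 * s"] s by simp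
 obtain n :: nat where "real n > B/(Lam (2 * s) - Lam s)" using reals_Archimedean2 by blast
 hence "Lam (2^n * s) > B" using lin[of n] D by (simp add: field_simps)
 thus ?thesis using s by (intro exI[of _ "2^n * s"]) auto
qed

lemma Lam_surj: assumes "u >= 0" shows "EX t>=0. Lam t = u"
proof -
 obtain T where T: "T >= 0" "Lam T > u" using Lam_unbounded by blast
 have "EX t. 0 <= t & t <= T & Lam t = u"
 by (rule IVT'[OF _ _ _ Lam_continuous]) (use T assms in auto)
 thus ?thesis by blast
qed

lemma Lam_inj: "inj_on Lam {0..}"
proof (rule inj_onI)
 fix x y assume "x : {0..}" "y : {0..}" "Lam x = Lam y"
 thus "x = y" using Lam_less[of x y] Lam_less[of y x] by (cases x y rule: linorder_cases) auto
qed

lemma V_Lam [simp]: "0 <= t ==> V (Lam t) = t"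
 unfolding V_def by (rule the_inv_into_f_f[OF Lam_inj]) simp

lemma Lam_V [simp]: "0 <= u ==> Lam (V u) = u" and V_nonneg [simp]: "0 <= u ==> 0 <= V u"
 using Lam_surj[of u] V_Lam by auto

lemma V_0 [simp]: "V 0 = 0" using V_Lam[of 0] by simp

lemma V_le_iff: "0 <= s ==> 0 <= t ==> V s <= V t \<longleftrightarrow> s <= t"
 using Lam_le_iff[of "V s" "V t"] by simp

lemma V_less_iff: "0 <= s ==> 0 <= t ==> V s < V t \<longleftrightarrow> s < t"
 by (simp add: V_le_iff not_le[symmetric])

lemma V_pos: "0 < u ==> 0 < V u"
 using V_less_iff[of 0 u] by simp

lemma v_pos: "0 < u ==> 0 < v u"
 unfolding v_def using V_pos lam_pos by simp

lemma Lam_pos: "0 < t ==> 0 < Lam t"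
 using Lam_less[of 0 t] by simp

lemma v_Lam: "0 < t ==> v (Lam t) = 1/lam t"
 by (simp add: v_def)

lemma Lam_at_top: "filterlim Lam at_top at_top"
 unfolding filterlim_at_top eventually_at_top_linorder
proof
 fix B obtain t where "t >= 0" "Lam t > B" using Lam_unbounded by blast
 thus "EX N. ALL n>=N. B <= Lam n" by (meson Lam_mono less_imp_le order_trans)
qed

lemma V_at_top: "filterlim V at_top at_top"
 unfolding filterlim_at_top eventually_at_top_linorder
proof
 fix B :: real
 show "EX N. ALL n>=N. B <= V n"
 proof (intro exI allI impI)
 fix u assume "Lam (max B 0) <= u"
 hence "V (Lam (max B 0)) <= V u" using Lam_nonneg[of "max B 0"] by (subst V_le_iff) auto
 thus "B <= V u" by simp
 qed
qed

text \<open>Increments of \<open>V\<close> are compared with values of its derivative \<open>v\<close>.\<close>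

lemma V_diff_le:
 assumes "0 <= u" "u <= u'" "C > 0" "!!x. u < x ==> x <= u' ==> v x <= C"
 shows "V u' - V u <= C * (u' - u)"
proof -
 have "1/C * (V u' - V u) <= Lam (V u') - Lam (V u)"
 proof (rule Lam_diff_ge)
 fix x assume x: "V u < x" "x <= V u'"
 have "0 < x" using x V_nonneg[of u] assms by linarith
 hence "v (Lam x) <= C"
 using x assms Lam_less[of "V u" x] Lam_mono[of x "V u'"] by (intro assms(4)) simp_all
 thus "1/C <= lam x" using v_Lam[of x] lam_pos[of x] \<open>0 < x\<close> assms(3) by (simp add: field_simps)
 qed (use assms V_le_iff in auto)
 thus ?thesis using assms by (simp add: field_simps)
qed

lemma V_diff_ge:
 assumes "0 <= u" "u <= u'" "C > 0" "!!x. u < x ==> x <= u' ==> C <= v x"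
 shows "C * (u' - u) <= V u' - V u"
proof -
 have "Lam (V u') - Lam (V u) <= 1/C * (V u' - V u)"
 proof (rule Lam_diff_le)
 fix x assume x: "V u < x" "x <= V u'"
 have "0 < x" using x V_nonneg[of u] assms by linarith
 hence "C <= v (Lam x)"
 using x assms Lam_less[of "V u" x] Lam_mono[of x "V u'"] by (intro assms(4)) simp_all
 thus "lam x <= 1/C" using v_Lam[of x] lam_pos[of x] \<open>0 < x\<close> assms(3) by (simp add: field_simps)
 qed (use assms V_le_iff in auto)
 thus ?thesis using assms by (simp add: field_simps)
qed

end

section \<open>Regular variation of the cumulative rate\<close>

context rate_function begin
definition "ga = (1 - al)/al"
definition "l t = t powr (- ga) * v t"
end

lemma geometric_induct:
 fixes T r w :: real
 assumes "0 < T" "1 < r" "T <= w"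
 and base: "!!w. T <= w ==> w <= r * T ==> P w"
 and step: "!!w. T <= w ==> P w ==> P (r * w)"
 shows "P w"
proof -
 have "P w" if "T <= w" "w <= r^Suc k * T" for k w
 using that
 proof (induction k arbitrary: w)
 case 0 thus ?case using base[of w] by simp
 next
 case (Suc k)
 show ?case
 proof (cases "w <= r * T")
 case True thus ?thesis using base Suc.prems by simp
 next
 case False
 have "P (r * (w/r))"
 proof (rule step)
 show T: "T <= w/r" using False assms by (simp add: field_simps)
 show "P (w/r)" using Suc.prems(2) assms by (intro Suc.IH T) (simp add: field_simps)
 qed
 thus ?thesis using assms by simp
 qed
 qed
 note * = this
 obtain k where "w/T < r^k" using real_arch_pow[OF assms(2)] by blast
 hence "w <= r^k * T" using assms by (simp add: field_simps)
 also have "... <= r^Suc k * T" using assms by simp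
 finally have "w <= r^Suc k * T" .
 thus ?thesis using * assms(3) by blast
qed

locale smooth_rate = rate_function +
 assumes slow: "!!ep :: real => real. (ALL t>0. ep t > 0) ==> (ep \<longlongrightarrow> 0) at_top ==>
 ((%t. ln t * (l ((1+ep t) * t)/l t - 1)) \<longlongrightarrow> 0) at_top"
begin

lemma gamma_pos: "0 < ga" and gamma1: "ga+1 = 1/al" and alpha_gamma: "al * ga = 1 - al"
 and inverse_gamma1: "inverse (ga+1) = al"
 using alpha by (auto simp: ga_def field_simps)

lemma l_pos: "0 < t ==> 0 < l t"
 using v_pos by (simp add: l_def)

lemma slow_uniform:
 assumes "K > 0"
 shows "EX d>0. EX W. ALL w>=W. ALL e. 0 < e --> e <= d --> \<bar>ln w * (l ((1+e) * w)/l w - 1)\<bar> <= K"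
proof (rule ccontr)
 assume "~ ?thesis"
 hence neg: "!!d W. d > 0 ==> EX w>=W. EX e>0. e <= d & ~ \<bar>ln w * (l ((1+e) * w)/l w - 1)\<bar> <= K"
 by meson
 have "ALL n::nat. EX w e. w >= real n & 0 < e & e <= 1/(real n+1) &
 ~ \<bar>ln w * (l ((1+e) * w)/l w - 1)\<bar> <= K"
 proof
 fix n :: nat show "EX w e. w >= real n & 0 < e & e <= 1/(real n+1) &
 ~ \<bar>ln w * (l ((1+e) * w)/l w - 1)\<bar> <= K"
 using neg[of "1/(real n+1)" "real n"] by auto
 qed
 then obtain w e where w: "!!n::nat. w n >= real n" and e: "!!n. 0 < e n" "!!n. e n <= 1/(real n+1)"
 and bad: "!!n. ~ \<bar>ln (w n) * (l ((1+e n) * w n)/l (w n) - 1)\<bar> <= K"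
 by metis
 define ep where "ep t = (if EX n. w n = t then e (SOME n. w n = t) else 1/(\<bar>t\<bar> + 1))" for t
 have pos: "ALL t>0. ep t > 0"
 using e by (auto simp: ep_def add_nonneg_pos)
 have lim: "(ep \<longlongrightarrow> 0) at_top"
 proof (rule tendstoI)
 fix r :: real assume r: "r > 0"
 obtain N :: nat where N: "1/(real N+1) < r"
 using reals_Archimedean[OF r] by (auto simp: field_simps)
 define T where "T = (\<Sum>n\<le>N. \<bar>w n\<bar>) + real N + 1"
 have wT: "w n < T" if "n \<le> N" for n
 proof -
 have "\<bar>w n\<bar> \<le> (\<Sum>n\<le>N. \<bar>w n\<bar>)" using that by (intro member_le_sum) auto
 thus ?thesis by (simp add: T_def)
 qed
 have "dist (ep t) 0 < r" if t: "t >= T" for t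
 proof (cases "EX n. w n = t")
 case True
 define m where "m = (SOME n. w n = t)"
 have m: "w m = t" unfolding m_def using someI_ex[OF True] .
 have "m > N" using wT[of m] m t by (cases "m <= N") auto
 hence "1/(real m+1) <= 1/(real N+1)" by (simp add: frac_le)
 hence "e m < r" using e(2)[of m] N by linarith
 thus ?thesis using e(1)[of m] True by (simp add: ep_def m_def)
 next
 case False
 have "0 <= (\<Sum>n\<le>N. \<bar>w n\<bar>)" by (simp add: sum_nonneg)
 hence "t >= real N" using t unfolding T_def by linarith
 hence "1/(\<bar>t\<bar> + 1) <= 1/(real N+1)" by (intro frac_le) auto
 thus ?thesis using False N by (simp add: ep_def)
 qed
 thus "\<forall>\<^sub>F t in at_top. dist (ep t) 0 < r" by (auto simp: eventually_at_top_linorder)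
 qed
 have "\<forall>\<^sub>F t in at_top. dist (ln t * (l ((1+ep t) * t)/l t - 1)) 0 < K"
 using tendstoD[OF slow[OF pos lim] assms] .
 then obtain T where T: "!!t. t >= T ==> \<bar>ln t * (l ((1+ep t) * t)/l t - 1)\<bar> < K"
 by (auto simp: eventually_at_top_linorder)
 obtain n :: nat where n: "real n >= T" using real_arch_simple by blast
 define m where "m = (SOME k. w k = w n)"
 have m: "w m = w n" unfolding m_def by (rule someI) simp
 have "ep (w n) = e m" by (auto simp: ep_def m_def)
 hence "\<bar>ln (w m) * (l ((1+e m) * w m)/l (w m) - 1)\<bar> < K"
 using T[of "w n"] w[of n] n m by auto
 with bad[of m] show False by simp
qed

text \<open>The working form: in logarithms, with the power factor put back.\<close>

lemma ln_v_diff: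
 assumes "0 < u" "0 < u'"
 shows "ln (v u') - ln (v u) - ga * (ln u' - ln u) = ln (l u') - ln (l u)"
 using assms v_pos[of u] v_pos[of u'] by (simp add: l_def ln_mult ln_powr algebra_simps)

lemma v_uniform:
 assumes "K > 0"
 shows "EX d>0. EX W>1. ALL u>=W. ALL u'. u <= u' --> u' <= (1+d) * u -->
 \<bar>ln (v u') - ln (v u) - ga * (ln u' - ln u)\<bar> <= K/ln u"
proof -
 from slow_uniform[of "K/2"] assms obtain d W where d: "d > 0"
 and W: "!!w e. w >= W ==> 0 < e ==> e <= d ==> \<bar>ln w * (l ((1+e) * w)/l w - 1)\<bar> <= K/2"
 by auto
 define W' where "W' = max W (exp (max 1 K))"
 have "exp (max 1 K) > exp (0::real)" by (subst exp_less_cancel_iff) simp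
 hence W'1: "W' > 1" by (simp add: W'_def less_max_iff_disj)
 have "\<bar>ln (v u') - ln (v u) - ga * (ln u' - ln u)\<bar> <= K/ln u"
 if u: "u >= W'" "u <= u'" "u' <= (1+d) * u" for u u'
 proof (cases "u = u'")
 case True thus ?thesis using assms u W'1 by simp
 next
 case False
 have u0: "0 < u" "0 < u'" using u W'1 by auto
 have "u >= exp (max 1 K)" using u(1) by (simp add: W'_def)
 hence "ln u >= max 1 K" using u0 ln_ge_iff by blast
 hence lnu: "ln u >= 1" "ln u >= K" by auto
 define e where "e = u'/u - 1"
 have e: "0 < e" "e <= d" "(1+e) * u = u'" using u u0 False by (auto simp: e_def field_simps)
 have b: "\<bar>ln u * (l u'/l u - 1)\<bar> <= K/2" using W[of u e] u(1) e by (simp add: W'_def)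
 define x where "x = l u'/l u - 1"
 have "\<bar>x\<bar> * ln u <= K/2" using b lnu by (simp add: x_def abs_mult mult.commute)
 hence x: "\<bar>x\<bar> <= K/2/ln u" using lnu by (simp only: pos_le_divide_eq)
 also have "... <= 1/2" using lnu by (simp add: field_simps)
 finally have x2: "\<bar>x\<bar> <= 1/2" .
 have "\<bar>ln (1+x)\<bar> <= 2 * \<bar>x\<bar>"
 using abs_ln_one_plus_x_minus_x_bound[OF x2] x2 power2_eq_square[of x] abs_mult_self_eq[of x]
 mult_mono[of "\<bar>x\<bar>" "1/2" "\<bar>x\<bar>" "\<bar>x\<bar>"] by (simp add: abs_if split: if_splits)
 also have "... <= K/ln u" using x by simp
 also have "ln (1+x) = ln (l u') - ln (l u)"
 using l_pos[of u] l_pos[of u'] u0 by (simp add: x_def ln_div)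
 finally show ?thesis using ln_v_diff[OF u0] by simp
 qed
 thus ?thesis using d W'1 by (intro exI[of _ d] exI[of _ W'] conjI) auto
qed

lemma ln_l_over_ln: "((%w. ln (l w)/ln w) \<longlongrightarrow> 0) at_top"
proof -
 obtain d W where d: "d > 0" and W1: "W > 1" and W: "!!u u'. u >= W ==> u <= u' ==> u' <= (1+d) * u ==>
 \<bar>ln (l u') - ln (l u)\<bar> <= 1/ln u"
 using v_uniform[of 1] by (smt (verit, ccfv_SIG) ln_v_diff)
 show ?thesis
 proof (rule tendstoI)
 fix r :: real assume r: "r > 0"
 define s where "s = r/2 * ln (1+d)"
 have s: "s > 0" using r d by (simp add: s_def)
 define T where "T = max W (exp (1/s))"
 have T1: "T > 1" using W1 by (simp add: T_def)
 have step: "\<bar>ln (l u') - ln (l u)\<bar> <= s" if "u >= T" "u <= u'" "u' <= (1+d) * u" for u u'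
 proof -
 have "u >= exp (1/s)" "u > 0" using that T1 by (auto simp: T_def)
 hence "ln u >= 1/s" by (simp add: ln_ge_iff)
 hence "1/ln u <= s" using s by (simp add: field_simps)
 (metis divide_pos_pos less_eq_real_def mult.commute order_less_le_trans zero_less_one mult_pos_pos pos_divide_le_eq)
 with W[of u u'] that show ?thesis by (simp add: T_def)
 qed
 have ld: "ln (1+d) > 0" using d by simp
 have chain: "\<bar>ln (l w) - ln (l T)\<bar> <= s * (ln (w/T)/ln (1+d)+1)" if "T <= w" for w
 proof (rule geometric_induct[of T "1+d" w])
 show "0 < T" "1 < 1+d" "T <= w" using T1 d that by auto
 next
 fix w assume w: "T <= w" "w <= (1+d) * T"
 have "ln (w/T) >= 0" using w T1 by simp
 hence "s * (ln (w/T)/ln (1+d)+1) >= s" using s ld by simp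
 thus "\<bar>ln (l w) - ln (l T)\<bar> <= s * (ln (w/T)/ln (1+d)+1)"
 using step[of T w] w by simp
 next
 fix w assume w: "T <= w" and IH: "\<bar>ln (l w) - ln (l T)\<bar> <= s * (ln (w/T)/ln (1+d)+1)"
 have "\<bar>ln (l ((1+d) * w)) - ln (l w)\<bar> <= s"
 using w d T1 by (intro step) auto
 moreover have "ln ((1+d) * w/T) = ln (1+d)+ln (w/T)"
 using w T1 d ln_mult[of "1+d" "w/T"] by simp
 ultimately show "\<bar>ln (l ((1+d) * w)) - ln (l T)\<bar> <= s * (ln ((1+d) * w/T)/ln (1+d)+1)"
 using IH ld by (simp add: add_divide_distrib algebra_simps)
 qed
 have main: "\<bar>ln (l w)\<bar> <= \<bar>ln (l T)\<bar> + s * 2+r/2 * ln w" if w: "w >= T" for w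
 proof -
 have "s * (ln (w/T)/ln (1+d)+1) = r/2 * ln (w/T)+s"
 using ld by (simp add: s_def algebra_simps)
 also have "... <= r/2 * ln w+s" using r w T1 by (simp add: ln_div)
 finally show ?thesis using chain[OF w] s by linarith
 qed
 have "LIM w at_top. ln (w::real) :> at_top" by (rule ln_at_top)
 hence "\<forall>\<^sub>F w in at_top. ln w > (\<bar>ln (l T)\<bar> + s * 2)/(r/2)"
 by (simp add: filterlim_at_top_dense)
 thus "\<forall>\<^sub>F w in at_top. dist (ln (l w)/ln w) 0 < r"
 using eventually_ge_at_top[of T]
 proof eventually_elim
 case (elim w)
 have "ln w > 0" using elim T1 by simp
 have "\<bar>ln (l T)\<bar> + s * 2 < r/2 * ln w" using elim(1) r by (simp add: field_simps)
 hence "\<bar>ln (l w)\<bar> < r * ln w" using main[OF elim(2)] by simp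
 thus ?case using \<open>ln w > 0\<close> by (simp add: dist_real_def abs_divide divide_less_eq)
 qed
 qed
qed

text \<open>Karamata's theorem for \<open>V\<close>: over a short geometric step, the increment of \<open>V\<close> is close to
  \<open>\<alpha>\<close> times the increment of \<open>w \<mapsto> w * v w\<close>, and the comparison can be summed over the steps.\<close>

lemma V_over_H: "((%w. V w/(w * v w)) \<longlongrightarrow> al) at_top"
proof (rule tendstoI)
 fix e :: real assume e: "e > 0"
 have L1: "((%s::real. (exp s - 1) * exp (ga * s+s\<^sup>2)/(exp ((ga+1) * s - s\<^sup>2) - 1)) \<longlongrightarrow> inverse (ga+1)) (at_right 0)"
 using gamma_pos by real_asymp
 have L2: "((%s::real. (exp s - 1) * exp (- s\<^sup>2)/(exp ((ga+1) * s+s\<^sup>2) - 1)) \<longlongrightarrow> inverse (ga+1)) (at_right 0)"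
 using gamma_pos by real_asymp
 obtain d W where d: "d > 0" and W1: "W > 1" and W: "!!u u'. u >= W ==> u <= u' ==> u' <= (1+d) * u ==>
 \<bar>ln (v u') - ln (v u) - ga * (ln u' - ln u)\<bar> <= 1/ln u"
 using v_uniform[of 1] by auto
 have "\<forall>\<^sub>F s in at_right 0. (exp s - 1) * exp (ga * s+s\<^sup>2)/(exp ((ga+1) * s - s\<^sup>2) - 1) < al+e/2"
 using L1 e inverse_gamma1 by (intro order_tendstoD) auto
 moreover have "\<forall>\<^sub>F s in at_right 0. (exp s - 1) * exp (- s\<^sup>2)/(exp ((ga+1) * s+s\<^sup>2) - 1) > al - e/2"
 using L2 e inverse_gamma1 by (intro order_tendstoD) auto
 moreover have "\<forall>\<^sub>F s in at_right 0. s < min (ln (1+d)) 1"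
 using d by (intro eventually_at_rightI[of 0 "min (ln (1+d)) 1"]) auto
 moreover have "\<forall>\<^sub>F s::real in at_right 0. 0 < s"
 by (simp add: eventually_at_right_less)
 ultimately have "\<forall>\<^sub>F s in at_right 0. (exp s - 1) * exp (ga * s+s\<^sup>2)/(exp ((ga+1) * s - s\<^sup>2) - 1) < al+e/2 &
 (exp s - 1) * exp (- s\<^sup>2)/(exp ((ga+1) * s+s\<^sup>2) - 1) > al - e/2 & s < min (ln (1+d)) 1 & 0 < s"
 by eventually_elim auto
 then obtain s where s: "0 < s" "s < 1" "s < ln (1+d)"
 and A: "(exp s - 1) * exp (ga * s+s\<^sup>2)/(exp ((ga+1) * s - s\<^sup>2) - 1) < al+e/2"
 and B: "(exp s - 1) * exp (- s\<^sup>2)/(exp ((ga+1) * s+s\<^sup>2) - 1) > al - e/2"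
 using eventually_happens'[OF trivial_limit_at_right_real] by (metis (no_types, lifting) min_less_iff_conj)
 define r where "r = exp s"
 have "exp s < exp (ln (1+d))" using s by (subst exp_less_cancel_iff)
 hence r: "1 < r" "r <= 1+d" using s d by (auto simp: r_def)
 define T where "T = max W (exp (1/s\<^sup>2))"
 have T1: "T > 1" using W1 by (simp add: T_def)
 have close: "\<bar>ln (v u') - ln (v u) - ga * (ln u' - ln u)\<bar> <= s\<^sup>2" if "u >= T" "u <= u'" "u' <= r * u" for u u'
 proof -
 have "u >= exp (1/s\<^sup>2)" "u > 0" using that T1 by (auto simp: T_def)
 hence lu: "ln u >= 1/s\<^sup>2" by (simp add: ln_ge_iff)
 have "1/s\<^sup>2 > 0" using s by simp
 hence "1/ln u <= 1/(1/s\<^sup>2)" using lu by (intro frac_le) linarith+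
 moreover have "r * u <= (1+d) * u" using r \<open>u > 0\<close> by simp
 ultimately show ?thesis using W[of u u'] that by (simp add: T_def)
 qed
 have vu: "v u * exp (- s\<^sup>2) <= v u'" "v u' <= v u * exp (ga * s+s\<^sup>2)"
 if u: "u >= T" "u <= u'" "u' <= r * u" for u u'
 proof -
 have p: "0 < u" "0 < u'" using u T1 by auto
 have ll: "0 <= ln u' - ln u" "ln u' - ln u <= s"
 proof -
 have "ln u' <= ln (r * u)" using u p r by (subst ln_le_cancel_iff) auto
 thus "ln u' - ln u <= s" using p by (simp add: ln_mult r_def)
 qed (use u p in simp)
 hence "0 <= ga * (ln u' - ln u)" "ga * (ln u' - ln u) <= ga * s" using gamma_pos by auto
 hence "ln (v u) - s\<^sup>2 <= ln (v u')" "ln (v u') <= ln (v u)+(ga * s+s\<^sup>2)"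
 using close[OF u] by linarith+
 hence "exp (ln (v u) - s\<^sup>2) <= exp (ln (v u'))" "exp (ln (v u')) <= exp (ln (v u)+(ga * s+s\<^sup>2))"
 by (simp_all only: exp_le_cancel_iff)
 thus "v u * exp (- s\<^sup>2) <= v u'" "v u' <= v u * exp (ga * s+s\<^sup>2)"
 using v_pos p by (simp_all add: exp_add exp_diff exp_minus divide_inverse)
 qed
 have vr: "v u * exp (ga * s - s\<^sup>2) <= v (r * u)" "v (r * u) <= v u * exp (ga * s+s\<^sup>2)" if u: "u >= T" for u
 proof -
 have p: "0 < u" "0 < r * u" "u <= r * u" using u T1 r by auto
 have "ln (r * u) - ln u = s" using p by (simp add: ln_mult r_def)
 hence "\<bar>ln (v (r * u)) - ln (v u) - ga * s\<bar> <= s\<^sup>2" using close[of u "r * u"] u p by simp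
 hence "ln (v u)+(ga * s - s\<^sup>2) <= ln (v (r * u))" by linarith
 hence "exp (ln (v u)+(ga * s - s\<^sup>2)) <= exp (ln (v (r * u)))"
 by (simp only: exp_le_cancel_iff)
 thus "v u * exp (ga * s - s\<^sup>2) <= v (r * u)"
 using v_pos p by (simp add: exp_add)
 show "v (r * u) <= v u * exp (ga * s+s\<^sup>2)" using vu[of u "r * u"] u p by simp
 qed
 define H where "H w = w * v w" for w
 have H0: "0 < H w" if "w >= T" for w using that T1 v_pos[of w] by (simp add: H_def)
 define a where "a = (exp s - 1) * exp (ga * s+s\<^sup>2)/(exp ((ga+1) * s - s\<^sup>2) - 1)"
 define b where "b = (exp s - 1) * exp (- s\<^sup>2)/(exp ((ga+1) * s+s\<^sup>2) - 1)"
 have "s\<^sup>2 < s" using s by (simp add: power2_eq_square)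
 moreover have "0 < ga * s" using gamma_pos s by simp
 ultimately have "1 < exp ((ga+1) * s - s\<^sup>2)" "1 < exp ((ga+1) * s+s\<^sup>2)"
 using s by (auto simp: algebra_simps add_pos_pos)
 hence den: "exp ((ga+1) * s - s\<^sup>2) - 1 > 0" "exp ((ga+1) * s+s\<^sup>2) - 1 > 0" by simp_all
 have ab: "a > 0" "b > 0" using den s by (simp_all add: a_def b_def)
 have Hstep: "H u * (exp ((ga+1) * s - s\<^sup>2) - 1) <= H (r * u) - H u"
 "H (r * u) - H u <= H u * (exp ((ga+1) * s+s\<^sup>2) - 1)" if u: "u >= T" for u
 proof -
 have e1: "exp ((ga+1) * s - s\<^sup>2) = r * exp (ga * s - s\<^sup>2)" "exp ((ga+1) * s+s\<^sup>2) = r * exp (ga * s+s\<^sup>2)"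
 by (simp_all add: r_def exp_add[symmetric] algebra_simps)
 have ru: "r * u >= 0" using u T1 r by simp
 show "H u * (exp ((ga+1) * s - s\<^sup>2) - 1) <= H (r * u) - H u"
 using mult_left_mono[OF vr(1)[OF u] ru] unfolding e1 by (simp add: H_def algebra_simps)
 show "H (r * u) - H u <= H u * (exp ((ga+1) * s+s\<^sup>2) - 1)"
 using mult_left_mono[OF vr(2)[OF u] ru] unfolding e1 by (simp add: H_def algebra_simps)
 qed
 have Vup: "V (r * u) - V u <= a * (H (r * u) - H u)" if u: "u >= T" for u
 proof -
 have "V (r * u) - V u <= (v u * exp (ga * s+s\<^sup>2)) * (r * u - u)"
 using u T1 r v_pos[of u] vu(2)[OF u] by (intro V_diff_le) auto
 also have "... = H u * ((exp s - 1) * exp (ga * s+s\<^sup>2))"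
 by (simp add: H_def r_def algebra_simps)
 also have "(exp s - 1) * exp (ga * s+s\<^sup>2) = a * (exp ((ga+1) * s - s\<^sup>2) - 1)"
 using den unfolding a_def by simp
 also have "H u * (a * (exp ((ga+1) * s - s\<^sup>2) - 1)) = a * (H u * (exp ((ga+1) * s - s\<^sup>2) - 1))"
 by (rule mult.left_commute)
 also have "... <= a * (H (r * u) - H u)" using ab Hstep(1)[OF u] by (intro mult_left_mono) auto
 finally show ?thesis .
 qed
 have Vlo: "b * (H (r * u) - H u) <= V (r * u) - V u" if u: "u >= T" for u
 proof -
 have "b * (H (r * u) - H u) <= b * (H u * (exp ((ga+1) * s+s\<^sup>2) - 1))"
 using ab Hstep(2)[OF u] by (intro mult_left_mono) auto
 also have "... = H u * (b * (exp ((ga+1) * s+s\<^sup>2) - 1))"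
 by (rule mult.left_commute)
 also have "b * (exp ((ga+1) * s+s\<^sup>2) - 1) = (exp s - 1) * exp (- s\<^sup>2)"
 using den unfolding b_def by simp
 also have "H u * ... = (v u * exp (- s\<^sup>2)) * (r * u - u)"
 by (simp add: H_def r_def algebra_simps)
 also have "... <= V (r * u) - V u"
 using u T1 r v_pos[of u] vu(1)[OF u] by (intro V_diff_ge) auto
 finally show ?thesis .
 qed
 define C where "C = r * T * (v T * exp (ga * s+s\<^sup>2))"
 have up: "V w <= V (r * T)+a * H w" if "w >= T" for w
 proof (rule geometric_induct[of T r w])
 fix w assume "T <= w" "w <= r * T"
 thus "V w <= V (r * T)+a * H w"
 using mult_pos_pos[OF ab(1) H0[of w]] T1 V_le_iff[of w "r * T"] r by auto
 next
 fix w assume "T <= w" "V w <= V (r * T)+a * H w"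
 thus "V (r * w) <= V (r * T)+a * H (r * w)"
 using Vup[of w] by (simp add: algebra_simps)
 qed (use T1 r that in auto)
 have lo: "b * (H w - C) <= V w" if "w >= T" for w
 proof (rule geometric_induct[of T r w])
 fix w assume w: "T <= w" "w <= r * T"
 have "H w <= C" unfolding H_def C_def using vu(2)[of T w] w T1 r v_pos[of w]
 by (intro mult_mono) auto
 hence "b * (H w - C) <= 0" using ab by (simp add: mult_nonneg_nonpos)
 also have "0 <= V w" using w T1 by simp
 finally show "b * (H w - C) <= V w" .
 next
 fix w assume "T <= w" "b * (H w - C) <= V w"
 thus "b * (H (r * w) - C) <= V (r * w)"
 using Vlo[of w] by (simp add: algebra_simps)
 qed (use T1 r that in auto)
 define D where "D = \<bar>V (r * T)\<bar> + b * \<bar>C\<bar> + 1"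
 have "\<forall>\<^sub>F w in at_top. V w > V (r * T)+a * (2 * D/e)"
 using V_at_top by (simp add: filterlim_at_top_dense)
 thus "\<forall>\<^sub>F w in at_top. dist (V w/(w * v w)) al < e"
 using eventually_ge_at_top[of T]
 proof eventually_elim
 case (elim w)
 have "a * (2 * D/e) < a * H w" using up[OF elim(2)] elim(1) by simp
 hence HD: "D < e/2 * H w" using ab e by (simp add: field_simps)
 have Hw: "H w > 0" using H0 elim by simp
 have "V w <= D+a * H w"
 using up[OF elim(2)] mult_nonneg_nonneg[of b "\<bar>C\<bar>"] ab unfolding D_def by linarith
 also have "a * H w < (al+e/2) * H w"
 using A Hw unfolding a_def[symmetric] by simp
 hence "D+a * H w < (al+e) * H w"
 using HD by (simp add: algebra_simps)
 finally have 1: "V w/H w < al+e" using Hw by (simp add: field_simps)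
 have "b * C <= b * \<bar>C\<bar>" using ab by simp
 hence "b * H w - D <= V w" using lo[OF elim(2)] unfolding D_def right_diff_distrib by linarith
 moreover have "(al - e/2) * H w < b * H w" using B Hw unfolding b_def[symmetric] by simp
 ultimately have "(al - e) * H w < V w" using HD by (simp add: algebra_simps)
 hence 2: "V w/H w > al - e" using Hw by (simp add: field_simps)
 from 1 2 show ?case by (auto simp: H_def dist_real_def)
 qed
qed

end

section \<open>Local and global control of the rate\<close>

context smooth_rate begin

text \<open>Karamata's theorem in the form needed here: the integral of a regularly varying function is governed by its value at the end point. It turns statements about \<open>\<Lambda>\<close> into statements about \<open>\<lambda>\<close> and gives \<open>\<beta> t\<close> its meaning as the spacing of the surrogate points.\<close>

lemma lam_Karamata: "((%t. Lam t/(t * lam t)) \<longlongrightarrow> 1/al) at_top"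
proof -
 have "((%t. V (Lam t)/(Lam t * v (Lam t))) \<longlongrightarrow> al) at_top"
 using filterlim_compose[OF V_over_H Lam_at_top] .
 hence "((%t. inverse (V (Lam t)/(Lam t * v (Lam t)))) \<longlongrightarrow> inverse al) at_top"
 using alpha by (intro tendsto_inverse) auto
 hence "((%t. Lam t/(t * lam t)) \<longlongrightarrow> inverse al) at_top"
 proof (rule Lim_transform_eventually)
 show "\<forall>\<^sub>F t in at_top. inverse (V (Lam t)/(Lam t * v (Lam t))) = Lam t/(t * lam t)"
 using eventually_gt_at_top[of 0] by eventually_elim (simp add: v_Lam field_simps)
 qed
 thus ?thesis by (simp add: inverse_eq_divide)
qed

lemma ln_Lam_over_ln: "((%t. ln (Lam t)/ln t) \<longlongrightarrow> al) at_top"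
proof -
 have y: "((%w. ln (V w/(w * v w))/ln w) \<longlongrightarrow> 0) at_top"
 proof -
 have 1: "((%w. ln (V w/(w * v w))) \<longlongrightarrow> ln al) at_top"
 by (rule tendsto_ln[OF V_over_H]) (use alpha in simp)
 have 2: "filterlim (%w::real. ln w) at_infinity at_top"
 by (rule filterlim_at_top_imp_at_infinity[OF ln_at_top])
 from tendsto_divide_0[OF 1 2] show ?thesis .
 qed
 have "((%w. ln (V w/(w * v w))/ln w+(1+ga)+ln (l w)/ln w) \<longlongrightarrow> 0+(1+ga)+0) at_top"
 by (intro tendsto_intros y ln_l_over_ln)
 hence "((%w. ln (V w)/ln w) \<longlongrightarrow> 0+(1+ga)+0) at_top"
 proof (rule Lim_transform_eventually)
 show "\<forall>\<^sub>F w in at_top. ln (V w/(w * v w))/ln w+(1+ga)+ln (l w)/ln w = ln (V w)/ln w"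
 using eventually_gt_at_top[of 1]
 proof eventually_elim
 case (elim w)
 have p: "V w > 0" "v w > 0" "w > 0" "ln w > 0" using elim V_pos v_pos by auto
 have "ln (V w/(w * v w))+(1+ga) * ln w+ln (l w) = ln (V w)"
 using p by (simp add: l_def ln_div ln_mult ln_powr algebra_simps)
 thus ?case using p by (simp add: field_simps)
 qed
 qed
 hence "((%w. inverse (ln (V w)/ln w)) \<longlongrightarrow> inverse (0+(1+ga)+0)) at_top"
 using gamma_pos by (intro tendsto_inverse) auto
 hence "((%w. ln w/ln (V w)) \<longlongrightarrow> al) at_top"
 using inverse_gamma1 by (simp add: add.commute inverse_eq_divide)
 from filterlim_compose[OF this Lam_at_top] show ?thesis
 by (rule Lim_transform_eventually)
 (use eventually_ge_at_top[of 0] in eventually_elim, simp)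
qed

lemma ln_Lam_bounds: "\<forall>\<^sub>F t in at_top. 1 < t & 1 < Lam t & 1 < ln t & 1 < ln (Lam t) & al/2 * ln t <= ln (Lam t) & ln (Lam t) <= ln t"
proof -
 have 1: "\<forall>\<^sub>F t in at_top. ln (Lam t)/ln t > al/2" "\<forall>\<^sub>F t in at_top. ln (Lam t)/ln t < 1"
 by (rule order_tendstoD[OF ln_Lam_over_ln]; use alpha in simp)+
 have 2: "\<forall>\<^sub>F t in at_top. ln t > (1::real)" "\<forall>\<^sub>F t in at_top. ln (Lam t) > 1"
 using ln_at_top filterlim_compose[OF ln_at_top Lam_at_top] by (auto simp: filterlim_at_top_dense)
 have 3: "\<forall>\<^sub>F t in at_top. Lam t > 1" using Lam_at_top by (simp add: filterlim_at_top_dense)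
 from 1 2 3 eventually_gt_at_top[of 1] show ?thesis by eventually_elim (auto simp: field_simps)
qed

lemma v_far:
 "EX c U0 Y W. 0 < c & c <= 1 & 1 < U0 & 0 < Y & (ALL w>=W. ALL u' u. U0 <= u' --> u' <= u -->
 u <= w * (1 - Y/ln w) --> v u'/v w <= 1 - c * (1 - u/w))"
proof -
 obtain d0 W1 where d0: "d0 > 0" and W1: "W1 > 1" and cl0: "!!u u'. u >= W1 ==> u <= u' ==> u' <= (1+d0) * u ==>
 \<bar>ln (v u') - ln (v u) - ga * (ln u' - ln u)\<bar> <= 1/ln u"
 using v_uniform[of 1] by auto
 define d where "d = min d0 1"
 have d: "0 < d" "d <= 1" using d0 by (auto simp: d_def)
 have cl: "\<bar>ln (v u') - ln (v u) - ga * (ln u' - ln u)\<bar> <= 1/ln u"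
 if "u >= W1" "u <= u'" "u' <= (1+d) * u" for u u'
 proof (rule cl0)
 have "(1+d) * u <= (1+d0) * u" using W1 that by (intro mult_right_mono) (auto simp: d_def)
 thus "u' <= (1+d0) * u" using that by simp
 qed (use that in auto)
 define ka where "ka = ga * ln (1+d)/4"
 have k: "ka > 0" using gamma_pos d by (simp add: ka_def)
 define U0 where "U0 = max W1 (exp (1/ka))"
 have U01: "U0 > 1" using W1 by (simp add: U0_def)
 have clk: "\<bar>ln (v u') - ln (v u) - ga * (ln u' - ln u)\<bar> <= ka"
 if "u >= U0" "u <= u'" "u' <= (1+d) * u" for u u'
 proof -
 have "u >= exp (1/ka)" "u > 0" using that U01 by (auto simp: U0_def)
 hence lu: "ln u >= 1/ka" by (simp add: ln_ge_iff)
 have "1/ka > 0" using k by simp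
 hence "1/ln u <= 1/(1/ka)" using lu by (intro frac_le) linarith+
 thus ?thesis using cl[of u u'] that by (simp add: U0_def)
 qed
 have up1: "ln (v u') >= ln (v u) - ka" if "u >= U0" "u <= u'" "u' <= (1+d) * u" for u u'
 proof -
 have "ga * (ln u' - ln u) >= 0" using gamma_pos that U01 by simp
 thus ?thesis using clk[OF that] by linarith
 qed
 have up2: "ln (v ((1+d) * u)) >= ln (v u)+3 * ka" if "u >= U0" for u
 proof -
 have "ln ((1+d) * u) - ln u = ln (1+d)" using that U01 d by (simp add: ln_mult)
 hence "ga * (ln ((1+d) * u) - ln u) = 4 * ka" by (simp add: ka_def)
 thus ?thesis using clk[of u "(1+d) * u"] that U01 d by simp
 qed
 have far: "ln (v w) >= ln (v u')+2 * ka" if u': "U0 <= u'" and w: "(1+d) * u' <= w" for u' w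
 proof (rule geometric_induct[of "(1+d) * u'" "1+d" w])
 have ge: "u' <= (1+d) * u'" using d u' U01 by simp
 show "0 < (1+d) * u'" "1 < 1+d" "(1+d) * u' <= w" using d w u' U01 by auto
 fix w assume w: "(1+d) * u' <= w"
 have "U0 <= (1+d) * u'" "U0 <= w" using ge u' w by linarith+
 thus "ln (v w) >= ln (v u')+2 * ka" if "w <= (1+d) * ((1+d) * u')"
 using up2[OF u'] up1[of "(1+d) * u'" w] w that by simp
 show "ln (v u')+2 * ka <= ln (v ((1+d) * w))" if "ln (v u')+2 * ka <= ln (v w)"
 using up2[of w] \<open>U0 <= w\<close> that k by simp
 qed
 define c where "c = min (2 * ka/(1+2 * ka)) ((ga/2)/(1+ga/2))"
 have c: "0 < c" "c <= 1" using k gamma_pos by (auto simp: c_def min_le_iff_disj)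
 define Y where "Y = 4/ga"
 have Y: "Y > 0" using gamma_pos by (simp add: Y_def)
 have expm: "exp (- x) <= 1/(1+x)" if "x >= 0" for x :: real
 using exp_ge_add_one_self[of x] that by (simp add: exp_minus inverse_eq_divide frac_le)
 have "v u'/v w <= 1 - c * (1 - u/w)"
 if w: "w >= max 4 (exp Y)" and u': "U0 <= u'" "u' <= u" and u: "u <= w * (1 - Y/ln w)" for w u' u
 proof -
 have w0: "w > 0" "ln w > 0" using w by auto
 have uw: "u/w <= 1 - Y/ln w" using u w0 by (simp add: field_simps)
 have "0 <= Y/ln w" using Y w0 by simp
 hence "u/w <= 1" using uw by linarith
 hence uw1: "u <= w" using w0 by simp
 have p: "u' > 0" "u > 0" using u' U01 by auto
 define x where "x = 1 - u/w"
 have x: "x >= Y/ln w" "x <= 1" "0 <= x" using uw p w0 \<open>u/w <= 1\<close> by (auto simp: x_def)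
 have vp: "v u' > 0" "v w > 0" using v_pos p w0 by auto
 have cx: "exp (- y) <= 1 - c * x" if y: "y >= 0" "c * x <= y/(1+y)" for y
 proof -
 have "1/(1+y) = 1 - y/(1+y)" using y by (simp add: field_simps)
 thus ?thesis using expm[OF y(1)] y(2) by linarith
 qed
 have "ln (v u') - ln (v w) <= ln (1 - c * x)" if "1 - c * x > 0" "exp (ln (v u') - ln (v w)) <= 1 - c * x"
 using that by (simp add: ln_ge_iff)
 have "exp (ln (v u') - ln (v w)) <= 1 - c * x"
 proof (cases "(1+d) * u' <= w")
 case True
 have "exp (ln (v u') - ln (v w)) <= exp (- (2 * ka))" using far[OF u'(1) True] by simp
 also have "... <= 1 - c * x"
 proof (rule cx)
 have "c * x <= c" using c x by (simp add: mult_left_le)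
 also have "c <= 2 * ka/(1+2 * ka)" by (simp add: c_def)
 finally show "c * x <= 2 * ka/(1+2 * ka)" .
 qed (use k in simp)
 finally show ?thesis .
 next
 case False
 have "u' <= w" using u' uw1 by simp
 hence 1: "\<bar>ln (v w) - ln (v u') - ga * (ln w - ln u')\<bar> <= 1/ln u'"
 using False u' by (intro cl) (auto simp: U0_def)
 have "(1+d) * u' <= 2 * u'" using d p by simp
 hence "u' >= w/2" using False by simp
 moreover have "sqrt w * sqrt w = w" "sqrt w >= 2" using w by (auto intro: real_le_rsqrt)
 hence "w/2 >= sqrt w" using mult_right_mono[of 2 "sqrt w" "sqrt w"] w0 by simp
 ultimately have "ln u' >= ln (sqrt w)" using p w0 by (subst ln_le_cancel_iff) auto
 hence lu: "ln u' >= ln w/2" using w0 by (simp add: ln_sqrt)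
 have "1/ln u' <= 1/(ln w/2)" using lu w0 by (intro frac_le) auto
 also have "... = 2/Y * (Y/ln w)" using Y w0 by simp
 also have "... <= 2/Y * x" using x Y by (intro mult_left_mono) auto
 also have "... = ga/2 * x" by (simp add: Y_def)
 finally have 2: "1/ln u' <= ga/2 * x" .
 have "ln (u/w) <= u/w - 1" using p w0 by (intro ln_le_minus_one) auto
 hence "ln w - ln u >= x" using p w0 by (simp add: ln_div x_def)
 moreover have "ln u' <= ln u" using p u' by simp
 ultimately have "ga * x <= ga * (ln w - ln u')" using gamma_pos by (intro mult_left_mono) auto
 hence "ln (v u') - ln (v w) <= - (ga/2 * x)" using 1 2 by linarith
 hence "exp (ln (v u') - ln (v w)) <= exp (- (ga/2 * x))" by simp
 also have "... <= 1 - c * x"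
 proof (rule cx)
 show "ga/2 * x >= 0" using gamma_pos x by simp
 have "c * x <= (ga/2)/(1+ga/2) * x" using x by (intro mult_right_mono) (auto simp: c_def)
 also have "... = ga/2 * x/(1+ga/2)" by simp
 also have "... <= ga/2 * x/(1+ga/2 * x)"
 proof (rule frac_le)
 show "0 <= ga/2 * x" using gamma_pos x by simp
 thus "0 < 1+ga/2 * x" by linarith
 show "1+ga/2 * x <= 1+ga/2" using gamma_pos x by (simp add: mult_left_le)
 qed simp
 finally show "c * x <= ga/2 * x/(1+ga/2 * x)" .
 qed
 finally show ?thesis .
 qed
 thus ?thesis using vp by (simp add: exp_diff x_def)
 qed
 thus ?thesis using c U01 Y by blast
qed

lemma abs_exp_minus_one_minus_self: "\<bar>exp x - 1 - x\<bar> <= x\<^sup>2" if "\<bar>x\<bar> <= 1" for x :: real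
proof (cases "x >= 0")
 case True
 thus ?thesis using exp_bound[of x] exp_ge_add_one_self[of x] that by (simp del: exp_ge_add_one_self)
next
 case False
 define y where "y = - x"
 have y: "0 < y" "y <= 1" using False that by (auto simp: y_def)
 have "exp (- y) <= 1/(1+y)"
 using exp_ge_add_one_self[of y] y by (simp add: exp_minus inverse_eq_divide frac_le del: exp_ge_add_one_self)
 also have "1/(1+y) <= 1 - y+y\<^sup>2"
 proof -
 have "(1 - y+y\<^sup>2) * (1+y) = 1+y^3" by (simp add: power2_eq_square power3_eq_cube algebra_simps)
 thus ?thesis using y by (simp add: pos_divide_le_eq)
 qed
 finally show ?thesis using exp_ge_add_one_self[of x] by (simp add: y_def del: exp_ge_add_one_self)
qed

lemma v_local_aux:
 assumes "ep > 0" "C > 0"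
 shows "\<forall>\<^sub>F w in at_top. ALL u. \<bar>u - w\<bar> <= C * w/ln w -->
 \<bar>v u/v w - 1 - ga * (u/w - 1)\<bar> <= ep/ln w"
proof -
 define K where "K = ep/4"
 obtain d W where d: "d > 0" and W: "W > 1" and cl: "!!u u'. u >= W ==> u <= u' ==> u' <= (1+d) * u ==>
 \<bar>ln (v u') - ln (v u) - ga * (ln u' - ln u)\<bar> <= K/ln u"
 using v_uniform[of K] assms by (auto simp: K_def)
 define B where "B = ga * C+2 * K+2 * ga * C\<^sup>2"
 have B: "B > 0" using assms gamma_pos by (auto simp: B_def K_def intro!: add_pos_pos add_nonneg_pos)
 have lnl: "LIM w at_top. ln (w::real) :> at_top" by (rule ln_at_top)
 have "\<forall>\<^sub>F w in at_top. ln w >= max 1 (max (2 * C) (max (2 * C/d) (max B (2 * (2 * ga * C\<^sup>2+B\<^sup>2)/ep))))"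
 using lnl unfolding filterlim_at_top by blast
 thus ?thesis using eventually_ge_at_top[of "max 4 (2 * W)"]
 proof eventually_elim
 case (elim w)
 hence w: "w >= 4" "w >= 2 * W" and L: "ln w >= 1" "ln w >= 2 * C" "ln w >= 2 * C/d" "ln w >= B"
 "ln w >= 2 * (2 * ga * C\<^sup>2+B\<^sup>2)/ep" by auto
 have L0: "ln w > 0" using L by simp
 show ?case
 proof (intro allI impI)
 fix u assume u: "\<bar>u - w\<bar> <= C * w/ln w"
 define th where "th = u/w - 1"
 have thw: "th = (u - w)/w" using w by (simp add: th_def diff_divide_distrib)
 have th: "\<bar>th\<bar> <= C/ln w" using u w by (simp add: thw abs_divide field_simps)
 have "C/ln w <= 1/2" "C/ln w <= d/2" using L L0 d by (simp_all add: field_simps)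
 hence th2: "\<bar>th\<bar> <= 1/2" "\<bar>th\<bar> <= d/2" using th by linarith+
 have uw: "u = (1+th) * w" using w by (simp add: th_def)
 have ug: "u >= w/2" using th2 w unfolding uw by (simp add: abs_le_iff)
 hence u0: "u > 0" using w by simp
 have mn: "ln (min u w) >= ln w/2"
 proof -
 have "sqrt w * sqrt w = w" "sqrt w >= 2" using w by (auto intro: real_le_rsqrt)
 hence "w/2 >= sqrt w" using mult_right_mono[of 2 "sqrt w" "sqrt w"] w by simp
 hence "ln (min u w) >= ln (sqrt w)" using u0 w ug by (subst ln_le_cancel_iff) auto
 thus ?thesis using w by (simp add: ln_sqrt)
 qed
 have "\<bar>ln (v u) - ln (v w) - ga * (ln u - ln w)\<bar> <= K/ln (min u w)"
 proof (cases "u <= w")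
 case True
 have "(1+d) * (1+th) >= 1"
 proof -
 have "(1+d) * (1+th) = 1+d+th+d * th" by (simp add: algebra_simps)
 moreover have "d * th >= d * (- (1/2))" using th2 d by (intro mult_left_mono) auto
 moreover have "th >= - (d/2)" using th2 by auto
 ultimately show ?thesis by simp
 qed
 hence "w <= (1+d) * u" using mult_right_mono[of 1 "(1+d) * (1+th)" w] w by (simp add: uw mult.assoc)
 thus ?thesis using cl[of u w] True ug w by simp (simp add: abs_minus_commute algebra_simps)
 next
 case False
 have "u <= (1+d) * w" unfolding uw using th2 d w by (intro mult_right_mono) auto
 thus ?thesis using cl[of w u] False w W by simp
 qed
 also have "... <= K/(ln w/2)" using mn L0 assms by (intro divide_left_mono) (auto simp: K_def intro!: mult_pos_pos)
 finally have 1: "\<bar>ln (v u) - ln (v w) - ga * (ln u - ln w)\<bar> <= 2 * K/ln w" by (simp add: mult.commute)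
 have "ln u - ln w = ln (1+th)" using u0 w by (simp add: th_def ln_div)
 hence "\<bar>ln u - ln w - th\<bar> <= 2 * th\<^sup>2" using abs_ln_one_plus_x_minus_x_bound[of th] th2 by simp
 also have "... <= 2 * (C/ln w)\<^sup>2" using th assms L0 by (simp add: abs_le_square_iff[symmetric])
 finally have 2: "ga * \<bar>ln u - ln w - th\<bar> <= ga * (2 * (C/ln w)\<^sup>2)" using gamma_pos by simp
 define x where "x = ln (v u) - ln (v w)"
 have tri: "\<bar>x - ga * th\<bar> <= \<bar>x - ga * (ln u - ln w)\<bar> + ga * \<bar>ln u - ln w - th\<bar>"
 proof -
 have "x - ga * th = (x - ga * (ln u - ln w))+ga * (ln u - ln w - th)" by (simp add: algebra_simps)
 hence "\<bar>x - ga * th\<bar> <= \<bar>x - ga * (ln u - ln w)\<bar> + \<bar>ga * (ln u - ln w - th)\<bar>"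
 using abs_triangle_ineq by metis
 thus ?thesis using gamma_pos by (simp add: abs_mult)
 qed
 have 3: "\<bar>x - ga * th\<bar> <= 2 * K/ln w+2 * ga * C\<^sup>2/(ln w)\<^sup>2"
 proof -
 have "ga * (2 * (C/ln w)\<^sup>2) = 2 * ga * C\<^sup>2/(ln w)\<^sup>2" by (simp add: power_divide)
 thus ?thesis using 1 2 tri unfolding x_def by linarith
 qed
 have "1/(ln w)\<^sup>2 <= 1/ln w" using L by (simp add: power2_eq_square field_simps)
 hence "2 * ga * C\<^sup>2 * (1/(ln w)\<^sup>2) <= 2 * ga * C\<^sup>2 * (1/ln w)"
 using gamma_pos by (intro mult_left_mono) auto
 moreover have "ga * \<bar>th\<bar> <= ga * (C/ln w)" using th gamma_pos by (intro mult_left_mono) auto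
 ultimately have xB: "\<bar>x\<bar> <= B/ln w"
 using 3 gamma_pos abs_mult[of ga th] by (simp add: B_def add_divide_distrib)
 also have "... <= 1" using L L0 by simp
 finally have "\<bar>exp x - 1 - x\<bar> <= x\<^sup>2" by (rule abs_exp_minus_one_minus_self)
 also have "x\<^sup>2 <= (B/ln w)\<^sup>2" using xB B L0 by (simp add: abs_le_square_iff[symmetric])
 finally have "\<bar>exp x - 1 - ga * th\<bar> <= 2 * K/ln w+2 * ga * C\<^sup>2/(ln w)\<^sup>2+B\<^sup>2/(ln w)\<^sup>2"
 using 3 by (simp add: power_divide)
 also have "... = (2 * K+(2 * ga * C\<^sup>2+B\<^sup>2)/ln w)/ln w"
 using L0 by (simp add: field_simps power2_eq_square)
 also have "... <= ep/ln w"
 proof -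
 have "(2 * ga * C\<^sup>2+B\<^sup>2)/ln w <= ep/2" using L(5) L0 assms by (simp add: field_simps)
 hence "2 * K+(2 * ga * C\<^sup>2+B\<^sup>2)/ln w <= ep" unfolding K_def by linarith
 thus ?thesis using L0 by (intro divide_right_mono) auto
 qed
 also have "exp x = v u/v w" using u0 w v_pos[of u] v_pos[of w] by (simp add: x_def exp_diff)
 finally show "\<bar>v u/v w - 1 - ga * (u/w - 1)\<bar> <= ep/ln w" by (simp add: th_def)
 qed
 qed
qed

text \<open>This is where the slow-variation hypothesis enters: on windows of relative width \<open>1 / ln t\<close> the rate is linear up to an error \<open>o(1 / ln t)\<close>. Such a window carries the whole limit, because the gaps there differ from the maximal one by bounded factors of \<open>1 / \<lambda> t\<close>.\<close>

lemma lam_local: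
 assumes "ep > 0" "C > 0"
 shows "\<forall>\<^sub>F t in at_top. ALL u. \<bar>u - Lam t\<bar> <= C * Lam t/ln t -->
 \<bar>lam t * v u - 1 - ga * (u/Lam t - 1)\<bar> <= ep/ln t"
proof -
 have "ep * al/2 > 0" using assms alpha by simp
 from eventually_compose_filterlim[OF v_local_aux[OF this assms(2)] Lam_at_top]
 have "\<forall>\<^sub>F t in at_top. ALL u. \<bar>u - Lam t\<bar> <= C * Lam t/ln (Lam t) -->
 \<bar>v u/v (Lam t) - 1 - ga * (u/Lam t - 1)\<bar> <= ep * al/2/ln (Lam t)" .
 thus ?thesis using ln_Lam_bounds eventually_gt_at_top[of 0]
 proof eventually_elim
 case (elim t)
 show ?case
 proof (intro allI impI)
 fix u assume u: "\<bar>u - Lam t\<bar> <= C * Lam t/ln t"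
 have "C * Lam t/ln t <= C * Lam t/ln (Lam t)"
 using elim assms Lam_pos[of t] by (intro frac_le) auto
 hence "\<bar>v u/v (Lam t) - 1 - ga * (u/Lam t - 1)\<bar> <= ep * al/2/ln (Lam t)"
 using elim(1) u by auto
 also have "... <= ep * al/2/(al/2 * ln t)"
 using elim assms alpha by (intro divide_left_mono) (auto intro!: mult_pos_pos)
 also have "... = ep/ln t" using alpha by simp
 finally show "\<bar>lam t * v u - 1 - ga * (u/Lam t - 1)\<bar> <= ep/ln t"
 using elim by (simp add: v_Lam mult.commute)
 qed
 qed
qed

lemma V_local:
 assumes "ep > 0" "C > 0"
 shows "\<forall>\<^sub>F t in at_top. ALL u. \<bar>u - Lam t\<bar> <= C * Lam t/ln t -->
 \<bar>(V u - t)/t * ln t - (u/Lam t - 1) * ln t/al\<bar> <= ep"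
proof -
 define ka where "ka = min (ep/(2 * C * (1/al+1))) (1/2)"
 have "ep/(2 * C * (1/al+1)) > 0"
 using assms alpha by (intro divide_pos_pos mult_pos_pos add_pos_pos) auto
 hence k: "ka > 0" "ka <= 1/2" by (simp add: ka_def) (simp only: ka_def min.cobounded2)
 define y where "y t = Lam t/(t * lam t)" for t
 have y: "\<forall>\<^sub>F t in at_top. dist (y t) (1/al) < min (ep/(2 * C)) 1"
 unfolding y_def by (rule tendstoD[OF lam_Karamata]) (use assms in simp)
 have "\<forall>\<^sub>F t in at_top. ln t >= max (2 * (ga * C+1)/ka) (2 * C)"
 using ln_at_top unfolding filterlim_at_top by blast
 with lam_local[OF zero_less_one assms(2)] show ?thesis
 using y ln_Lam_bounds eventually_gt_at_top[of 0]
 proof eventually_elim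
 case (elim t)
 have L: "ln t > 0" "ln t >= 2 * C" "ln t >= 2 * (ga * C+1)/ka" using elim by auto
 have w: "Lam t > 0" and lt: "lam t > 0" using elim Lam_pos lam_pos by auto
 show ?case
 proof (intro allI impI)
 fix u assume u: "\<bar>u - Lam t\<bar> <= C * Lam t/ln t"
 have Ck: "(ga * C+1)/ln t <= ka" using L k by (simp add: field_simps) (use mult_pos_pos[OF assms(2) gamma_pos] in linarith)
 have vx: "\<bar>lam t * v x - 1\<bar> <= ka" if x: "\<bar>x - Lam t\<bar> <= C * Lam t/ln t" for x
 proof -
 have "\<bar>x/Lam t - 1\<bar> = \<bar>x - Lam t\<bar>/Lam t" using w
 by (simp add: field_simps abs_if)
 also have "... <= C/ln t" using x w by (simp add: field_simps)
 finally have "ga * \<bar>x/Lam t - 1\<bar> <= ga * (C/ln t)" using gamma_pos by (intro mult_left_mono) auto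
 moreover have "\<bar>lam t * v x - 1 - ga * (x/Lam t - 1)\<bar> <= 1/ln t" using elim(1) x by blast
 ultimately have "\<bar>lam t * v x - 1\<bar> <= 1/ln t+ga * (C/ln t)"
 using abs_mult[of ga "x/Lam t - 1"] gamma_pos by linarith
 thus ?thesis using Ck by (simp add: add_divide_distrib)
 qed
 have "C * Lam t/ln t <= Lam t/2" using L w by (simp add: field_simps)
 hence u0: "u > 0" using u w by linarith
 have main: "\<bar>(V u - t) * lam t - (u - Lam t)\<bar> <= ka * \<bar>u - Lam t\<bar>"
 proof (cases "u >= Lam t")
 case True
 have b: "(1 - ka)/lam t <= v x" "v x <= (1+ka)/lam t" if "Lam t <= x" "x <= u" for x
 using vx[of x] that u lt by (auto simp: field_simps abs_le_iff)
 have "V u - V (Lam t) <= (1+ka)/lam t * (u - Lam t)"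
 using True w lt k b by (intro V_diff_le) auto
 moreover have "(1 - ka)/lam t * (u - Lam t) <= V u - V (Lam t)"
 using True w lt k b by (intro V_diff_ge) auto
 ultimately show ?thesis using True elim lt by (simp add: field_simps abs_le_iff)
 next
 case False
 have b: "(1 - ka)/lam t <= v x" "v x <= (1+ka)/lam t" if "u <= x" "x <= Lam t" for x
 using vx[of x] that u lt by (auto simp: field_simps abs_le_iff)
 have "V (Lam t) - V u <= (1+ka)/lam t * (Lam t - u)"
 using False u0 lt k b by (intro V_diff_le) auto
 moreover have "(1 - ka)/lam t * (Lam t - u) <= V (Lam t) - V u"
 using False u0 lt k b by (intro V_diff_ge) auto
 ultimately show ?thesis using False elim lt by (simp add: field_simps abs_le_iff)
 qed
 define th where "th = u/Lam t - 1"
 have um: "u - Lam t = th * Lam t" using w by (simp add: th_def field_simps)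
 have th: "\<bar>th\<bar> * ln t <= C" using u w L(1) unfolding um by (simp add: abs_mult field_simps)
 have yp: "y t > 0" "y t <= 1/al+1" "\<bar>y t - 1/al\<bar> <= ep/(2 * C)"
 using elim w lt by (auto simp: y_def dist_real_def)
 define z where "z = (V u - t)/t"
 have "\<bar>z * t * lam t - th * Lam t\<bar> <= ka * \<bar>th\<bar> * Lam t"
 using main w elim unfolding um by (simp add: z_def abs_mult)
 hence "\<bar>z * t * lam t - th * Lam t\<bar>/(t * lam t) <= ka * \<bar>th\<bar> * Lam t/(t * lam t)"
 using elim lt by (intro divide_right_mono) auto
 also have "\<bar>z * t * lam t - th * Lam t\<bar>/(t * lam t) = \<bar>z - th * y t\<bar>"
 proof -
 have "z - th * y t = (z * t * lam t - th * Lam t)/(t * lam t)"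
 using elim lt by (simp add: y_def field_simps)
 thus ?thesis using elim lt by (simp add: abs_mult)
 qed
 finally have 1: "\<bar>z - th * y t\<bar> <= ka * \<bar>th\<bar> * y t" by (simp add: y_def)
 have "\<bar>z - th/al\<bar> <= \<bar>z - th * y t\<bar> + \<bar>th * (y t - 1/al)\<bar>"
 using abs_triangle_ineq[of "z - th * y t" "th * (y t - 1/al)"] by (simp add: algebra_simps)
 also have "... <= ka * \<bar>th\<bar> * (1/al+1) + \<bar>th\<bar> * (ep/(2 * C))"
 proof (rule add_mono)
 show "\<bar>z - th * y t\<bar> <= ka * \<bar>th\<bar> * (1/al+1)"
 by (rule order_trans[OF 1 mult_left_mono[OF yp(2)]]) (use k in simp)
 show "\<bar>th * (y t - 1/al)\<bar> <= \<bar>th\<bar> * (ep/(2 * C))"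
 unfolding abs_mult using yp(3) by (intro mult_left_mono) auto
 qed
 also have "... = \<bar>th\<bar> * (ka * (1/al+1)+ep/(2 * C))" by (simp add: algebra_simps)
 also have "... <= \<bar>th\<bar> * (ep/C)"
 proof (rule mult_left_mono)
 have "ka * (1/al+1) <= ep/(2 * C * (1/al+1)) * (1/al+1)"
 using alpha by (intro mult_right_mono) (auto simp: ka_def intro!: add_nonneg_nonneg)
 also have "... = ep/(2 * C)"
 proof -
 have "1/al+1 ~= 0" using alpha by (simp add: add_eq_0_iff field_simps)
 thus ?thesis by simp
 qed
 finally show "ka * (1/al+1)+ep/(2 * C) <= ep/C" by simp
 qed simp
 finally have "\<bar>z - th/al\<bar> * ln t <= \<bar>th\<bar> * (ep/C) * ln t" using L by (intro mult_right_mono) auto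
 also have "... = \<bar>th\<bar> * ln t * (ep/C)" by simp
 also have "... <= C * (ep/C)" using th assms by (intro mult_right_mono) auto
 also have "... = ep" using assms by simp
 also have "\<bar>z - th/al\<bar> * ln t = \<bar>z * ln t - th * ln t/al\<bar>"
 proof -
 have "z * ln t - th * ln t/al = (z - th/al) * ln t" by (simp add: algebra_simps)
 thus ?thesis using L by (simp add: abs_mult)
 qed
 finally show "\<bar>(V u - t)/t * ln t - (u/Lam t - 1) * ln t/al\<bar> <= ep"
 by (simp add: z_def th_def)
 qed
 qed
qed

text \<open>Below the window the inverse rate must be smaller by a definite amount, so that early gaps cannot compete. A linear bound suffices, because \<open>\<gamma>\<close> is positive.\<close>

lemma lam_far:
 "EX c U0 Y. 0 < c & c <= 1 & 1 < U0 & 0 < Y & (\<forall>\<^sub>F t in at_top. ALL u' u. U0 <= u' --> u' <= u -->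
 u <= Lam t * (1 - Y/ln t) --> lam t * v u' <= 1 - c * (1 - u/Lam t))"
proof -
 obtain c U0 Y W where *: "0 < c" "c <= 1" "1 < U0" "0 < Y"
 and far: "!!w u' u. w >= W ==> U0 <= u' ==> u' <= u ==> u <= w * (1 - Y/ln w) ==> v u'/v w <= 1 - c * (1 - u/w)"
 using v_far by metis
 have "\<forall>\<^sub>F t in at_top. Lam t >= W" using Lam_at_top by (simp add: filterlim_at_top)
 hence "\<forall>\<^sub>F t in at_top. ALL u' u. U0 <= u' --> u' <= u -->
 u <= Lam t * (1 - (2 * Y/al)/ln t) --> lam t * v u' <= 1 - c * (1 - u/Lam t)"
 using ln_Lam_bounds eventually_gt_at_top[of 0]
 proof eventually_elim
 case (elim t)
 show ?case
 proof (intro allI impI)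
 fix u' u assume u: "U0 <= u'" "u' <= u" "u <= Lam t * (1 - (2 * Y/al)/ln t)"
 have "Y/ln (Lam t) <= Y/(al/2 * ln t)"
 using elim * alpha by (intro divide_left_mono) (auto intro!: mult_pos_pos)
 also have "... = (2 * Y/al)/ln t" using alpha by simp
 finally have "Lam t * (1 - (2 * Y/al)/ln t) <= Lam t * (1 - Y/ln (Lam t))"
 using Lam_pos[of t] elim by (intro mult_left_mono) auto
 hence "v u'/v (Lam t) <= 1 - c * (1 - u/Lam t)"
 using far[of "Lam t" u' u] elim(1) u by simp
 thus "lam t * v u' <= 1 - c * (1 - u/Lam t)" using elim by (simp add: v_Lam mult.commute)
 qed
 qed
 moreover have "0 < 2 * Y/al" using * alpha by simp
 ultimately show ?thesis using *(1-3) by blast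
qed

end

section \<open>Epochs of the Poisson process\<close>

lemma (in prob_space) indep_vars_past_present:
 fixes D :: "nat => 'a => nat"
 assumes ind: "indep_vars (%_. count_space UNIV) D UNIV"
 and Q: "{x : space (PiM {..<k} (%_. count_space UNIV)). Q x} : sets (PiM {..<k} (%_. count_space UNIV))"
 shows "prob {om : space M. Q (restrict (%j. D j om) {..<k}) & D k om = c} =
 prob {om : space M. Q (restrict (%j. D j om) {..<k})} * prob {om : space M. D k om = c}"
proof -
 define P where "P = PiM {..<k} (%_. count_space (UNIV :: nat set))"
 define R where "R = PiM {k} (%_. count_space (UNIV :: nat set))"
 have iv: "indep_var P (%om. restrict (%j. D j om) {..<k}) R (%om. restrict (%j. D j om) {k})"
 unfolding P_def R_def by (rule indep_var_restrict[OF ind]) auto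
 have "(%x. x k) -` {c} Int space R : sets R"
 unfolding R_def by (rule measurable_sets[OF measurable_component_singleton]) auto
 from indep_varD[OF iv Q[folded P_def] this] show ?thesis
 by (simp add: P_def R_def vimage_def Int_def space_PiM conj_commute PiE_iff extensional_def cong: conj_cong)
qed

locale rate_poisson = rate_function lam al for lam :: "real => real" and al +
 fixes M :: "'a measure" and N :: "real => 'a => nat"
 assumes PP: "poisson_process M lam N"
begin

sublocale prob_space M using PP by (simp add: poisson_process_def)

lemma N_meas [measurable]: "t >= 0 ==> N t : measurable M (count_space UNIV)"
 using PP by (simp add: poisson_process_def)

lemma N_0: "om : space M ==> N 0 om = 0"
 using PP by (simp add: poisson_process_def)

lemma N_mono: "om : space M ==> 0 <= s ==> s <= t ==> N s om <= N t om"
 using PP by (auto simp: poisson_process_def mono_on_def)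

lemma N_incr: "0 <= s ==> s <= t ==>
 prob {om : space M. N t om - N s om = k} = poisson_mass (Lam t - Lam s) k"
 using PP by (simp add: poisson_process_def)

lemma N_indep: "0 <= ta 0 ==> mono ta ==>
 indep_vars (%_. count_space UNIV) (%i om. N (ta (Suc i)) om - N (ta i) om) UNIV"
 using PP by (simp add: poisson_process_def)

lemma N_right: assumes "om : space M" "0 <= t" shows "EX d>0. ALL s. t <= s --> s < t+d --> N s om = N t om"
proof -
 have "((%s. N s om) \<longlongrightarrow> N t om) (at_right t)"
 using PP assms by (auto simp: poisson_process_def continuous_within)
 hence "\<forall>\<^sub>F s in at_right t. N s om = N t om"
 by (simp add: tendsto_discrete)
 then obtain b where "b > t" "!!s. t < s ==> s < b ==> N s om = N t om"
 unfolding eventually_at_right[OF less_add_one] by auto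
 thus ?thesis by (intro exI[of _ "b - t"]) (metis add.commute diff_add_cancel diff_gt_0_iff_gt order_le_less)
qed

definition "reached i om \<longleftrightarrow> (EX s>=0. i <= N s om)"

text \<open>Right continuity makes the infimum in the definition of an epoch a minimum.\<close>

lemma epoch_le_iff:
 assumes "om : space M" "reached i om" "0 <= s"
 shows "epoch N i om <= s \<longleftrightarrow> i <= N s om"
proof -
 define A where "A = {s. 0 <= s & i <= N s om}"
 have bdd: "bdd_below A" by (auto simp: A_def intro!: bdd_belowI[of _ 0])
 have ne: "A ~= {}" using assms(2) by (auto simp: A_def reached_def)
 have e: "epoch N i om = Inf A" by (simp add: epoch_def A_def)
 have I0: "0 <= Inf A" using ne by (intro cInf_greatest) (auto simp: A_def)
 obtain d where d: "d > 0" "!!s. Inf A <= s ==> s < Inf A+d ==> N s om = N (Inf A) om"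
 using N_right[OF assms(1) I0] by blast
 obtain s' where s': "s' : A" "s' < Inf A+d"
 using cInf_lessD[OF ne, of "Inf A+d"] d(1) by auto
 have "Inf A <= s'" using s' bdd by (intro cInf_lower)
 hence iN: "i <= N (Inf A) om" using d(2)[of s'] s' by (auto simp: A_def)
 show ?thesis
 proof
 assume "epoch N i om <= s"
 thus "i <= N s om" using iN N_mono[OF assms(1) I0] e by (metis order_trans)
 next
 assume "i <= N s om"
 hence "s : A" using assms(3) by (simp add: A_def)
 thus "epoch N i om <= s" unfolding e using bdd by (rule cInf_lower)
 qed
qed

lemma epoch_nonneg: assumes "reached i om" shows "0 <= epoch N i om"
 unfolding epoch_def using assms by (intro cInf_greatest) (auto simp: reached_def)

lemma reached_mono: "reached j om ==> i <= j ==> reached i om"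
 unfolding reached_def by (meson order_trans)

lemma reached_nat: assumes "om : space M" shows "reached i om \<longleftrightarrow> (EX n::nat. i <= N (real n) om)"
proof
 assume "reached i om"
 then obtain s where "s >= 0" "i <= N s om" by (auto simp: reached_def)
 moreover obtain n :: nat where "s <= real n" using real_arch_simple by blast
 ultimately have "i <= N (real n) om" using N_mono[OF assms, of s n] by simp
 thus "EX n::nat. i <= N (real n) om" by blast
next
 assume "EX n::nat. i <= N (real n) om"
 thus "reached i om" unfolding reached_def by (metis of_nat_0_le_iff)
qed

lemma reached_meas [measurable]: "Measurable.pred M (reached i)"
proof -
 have [measurable]: "N (real n) : measurable M (count_space UNIV)" for n by simp
 have "Measurable.pred M (%om. EX n::nat. i <= N (real n) om)" by measurable
 thus ?thesis by (rule measurable_cong[THEN iffD1, rotated]) (simp add: reached_nat)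
qed

lemma epoch_meas [measurable]: "epoch N i : borel_measurable M"
proof (rule borel_measurableI_le)
 fix x :: real
 have "{om : space M. epoch N i om <= x} =
 {om : space M. (reached i om & 0 <= x & i <= N (max 0 x) om) | (~ reached i om & Inf {} <= x)}"
 proof (rule Collect_cong, rule conj_cong[OF refl])
 fix om assume om: "om : space M"
 show "(epoch N i om <= x) \<longleftrightarrow> (reached i om & 0 <= x & i <= N (max 0 x) om) | (~ reached i om & Inf {} <= x)"
 proof (cases "reached i om")
 case True
 thus ?thesis using epoch_le_iff[OF om True, of x] epoch_nonneg[OF True] by (cases "x >= 0") auto
 next
 case False
 hence e: "{s. 0 <= s & i <= N s om} = {}" by (auto simp: reached_def)
 show ?thesis using False unfolding epoch_def e by simp
 qed
 qed
 also have "... : sets M" by measurable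
 finally show "{om : space M. epoch N i om <= x} : sets M" .
qed

text \<open>In the operational time \<open>u = Lam t\<close> the process has unit rate.\<close>

definition "U u = N (V u)"
definition "S i om = Lam (max 0 (epoch N i om))"

lemma U_meas [measurable]: "u >= 0 ==> U u : measurable M (count_space UNIV)"
 by (simp add: U_def)

lemma U_mono: "om : space M ==> 0 <= s ==> s <= t ==> U s om <= U t om"
 unfolding U_def by (rule N_mono) (auto simp: V_le_iff)

lemma U_0: "om : space M ==> U 0 om = 0" by (simp add: U_def N_0)

lemma U_incr: "0 <= s ==> s <= t ==>
 prob {om : space M. U t om - U s om = k} = poisson_mass (t - s) k"
 unfolding U_def using N_incr[of "V s" "V t" k] by (simp add: V_le_iff)

lemma U_indep: assumes "0 <= ta 0" "mono ta"
 shows "indep_vars (%_. count_space UNIV) (%i om. U (ta (Suc i)) om - U (ta i) om) UNIV"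
proof -
 have "0 <= ta i" for i using assms monoD[OF assms(2), of 0 i] by simp
 hence "mono (%i. V (ta i))" using assms(2) by (auto simp: mono_def V_le_iff)
 thus ?thesis unfolding U_def using assms(1) by (intro N_indep) simp_all
qed

lemma S_meas [measurable]: "S i : borel_measurable M"
proof -
 have "(%t. Lam (max 0 t)) : borel_measurable borel"
 by (rule borel_measurable_mono) (auto simp: mono_def intro!: Lam_mono)
 from measurable_compose[OF epoch_meas this] show ?thesis by (simp add: S_def[abs_def])
qed

lemma S_nonneg: "0 <= S i om" by (simp add: S_def Lam_nonneg)

lemma S_le_iff:
 assumes "om : space M" "reached i om" "0 <= u"
 shows "S i om <= u \<longleftrightarrow> i <= U u om"
proof -
 have "S i om <= u \<longleftrightarrow> epoch N i om <= V u"
 using Lam_le_iff[of "epoch N i om" "V u"] epoch_nonneg[OF assms(2)] assms(3) by (simp add: S_def)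
 thus ?thesis using epoch_le_iff[OF assms(1,2), of "V u"] assms(3) by (simp add: U_def)
qed

lemma U_right: assumes "om : space M" "0 <= u" shows "EX d>0. ALL s. u <= s --> s < u+d --> U s om = U u om"
proof -
 obtain d where d: "d > 0" "!!s. V u <= s ==> s < V u+d ==> N s om = N (V u) om"
 using N_right[OF assms(1), of "V u"] assms(2) by auto
 define e where "e = Lam (V u+d) - u"
 have e: "e > 0" using Lam_less[of "V u" "V u+d"] d assms by (simp add: e_def)
 have "U s om = U u om" if "u <= s" "s < u+e" for s
 proof -
 have "V s < V u+d"
 using that assms Lam_less_iff[of "V s" "V u+d"] d by (simp add: e_def)
 thus ?thesis unfolding U_def using that assms by (intro d(2)) (simp add: V_le_iff)
 qed
 thus ?thesis using e by blast
qed

lemma AE_reached: "AE om in M. ALL i. reached i om"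
 unfolding AE_all_countable
proof
 fix i
 have lim: "(%n. \<Sum>k<i. poisson_mass (real n) k) \<longlonglongrightarrow> (\<Sum>k<i. 0)"
 proof (rule tendsto_sum)
 fix k
 show "(%n. poisson_mass (real n) k) \<longlonglongrightarrow> 0"
 proof -
 have "((%x::real. x^k/exp x) \<longlongrightarrow> 0) at_top" by (rule tendsto_power_div_exp_0)
 from filterlim_compose[OF this filterlim_real_sequentially]
 have "(%n. real n^k/exp (real n)) \<longlonglongrightarrow> 0" .
 hence "(%n. 1/fact k * (real n^k/exp (real n))) \<longlonglongrightarrow> 1/fact k * 0"
 by (rule tendsto_mult_left)
 thus ?thesis by (simp add: poisson_mass_def exp_minus field_simps)
 qed
 qed
 have "prob {om : space M. ~ reached i om} <= (\<Sum>k<i. poisson_mass (real n) k)" for n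
 proof -
 have "prob {om : space M. ~ reached i om} <= prob (\<Union>k<i. {om : space M. U n om - U 0 om = k})"
 proof (rule finite_measure_mono)
 show "{om : space M. ~ reached i om} <= (\<Union>k<i. {om : space M. U n om - U 0 om = k})"
 proof
 fix om assume om: "om : {om : space M. ~ reached i om}"
 have "0 <= V (real n)" by simp
 hence "~ i <= U n om" using om unfolding reached_def U_def by blast
 thus "om : (\<Union>k<i. {om : space M. U n om - U 0 om = k})" using om by (auto simp: U_0)
 qed
 qed measurable
 also have "... <= (\<Sum>k<i. prob {om : space M. U n om - U 0 om = k})"
 by (rule finite_measure_subadditive_finite) auto
 also have "... = (\<Sum>k<i. poisson_mass (real n) k)" by (simp add: U_incr)
 finally show ?thesis .
 qed
 hence "prob {om : space M. ~ reached i om} <= 0"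
 using LIMSEQ_le_const[OF lim] by auto
 hence "prob {om : space M. ~ reached i om} = 0" using measure_le_0_iff by blast
 thus "AE om in M. reached i om"
 by (subst AE_iff_measurable[OF _ refl]) (auto simp: emeasure_eq_measure)
qed

lemma poisson_mass_ge2: assumes "h >= 0" shows "1 - poisson_mass h 0 - poisson_mass h 1 <= h\<^sup>2"
proof -
 have "exp (- h) >= 1 - h" using exp_ge_add_one_self[of "-h"] by simp
 hence "(1+h) * exp (- h) >= (1+h) * (1 - h)" using assms by (intro mult_left_mono) auto
 thus ?thesis by (simp add: poisson_mass_def power2_eq_square algebra_simps)
qed

lemma AE_simple: "AE om in M. ALL i. U (S i om) om = i"
proof -
 define X where "X n k om = U (real (Suc k)/2^n) om - U (real k/2^n) om" for n k :: nat and om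
 have [measurable]: "X n k : measurable M (count_space UNIV)" for n k
 unfolding X_def by measurable
 define D where "D m n = {om : space M. EX k<m * 2^n. X n k om >= 2}" for m n :: nat
 have [measurable]: "D m n : sets M" for m n unfolding D_def by measurable
 have PX: "prob {om : space M. X n k om >= 2} <= (1/2^n)\<^sup>2" for n k
 proof -
 have d: "real (Suc k)/2^n - real k/2^n = 1/2^n" by (simp add: diff_divide_distrib[symmetric])
 have le: "real k/2^n <= real (Suc k)/2^n" by (intro divide_right_mono) auto
 have P: "prob {om : space M. X n k om = c} = poisson_mass (1/2^n) c" for c
 unfolding X_def using U_incr[OF _ le, of c] by (simp only: d) simp
 have "prob ({om : space M. X n k om = 0} Un {om : space M. X n k om = 1}) =
 prob {om : space M. X n k om = 0} + prob {om : space M. X n k om = 1}"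
 by (rule finite_measure_Union) auto
 moreover have "prob {om : space M. X n k om >= 2} =
 1 - prob ({om : space M. X n k om = 0} Un {om : space M. X n k om = 1})"
 by (subst prob_compl[symmetric]) (auto intro!: arg_cong[where f=prob])
 ultimately show ?thesis using poisson_mass_ge2[of "1/2^n"] by (simp add: P)
 qed
 have PD: "prob (D m n) <= real m/2^n" for m n
 proof -
 have "D m n = (\<Union>k<m * 2^n. {om : space M. X n k om >= 2})" by (auto simp: D_def)
 hence "prob (D m n) <= (\<Sum>k<m * 2^n. prob {om : space M. X n k om >= 2})"
 by (simp only:) (rule finite_measure_subadditive_finite, auto)
 also have "... <= (\<Sum>k<m * 2^n. (1/2^n)\<^sup>2)" by (rule sum_mono) (rule PX)
 also have "... = real m/2^n" by (simp add: power2_eq_square field_simps)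
 finally show ?thesis .
 qed
 have nullD: "AE om in M. EX n. om ~: D m n" for m
 proof -
 have "(%n. real m * (1/2)^n) \<longlonglongrightarrow> real m * 0"
 by (intro tendsto_mult_left LIMSEQ_realpow_zero) auto
 hence "(%n. real m/2^n) \<longlonglongrightarrow> 0" by (simp add: power_one_over field_simps)
 moreover have "prob {om : space M. ~ (EX n. om ~: D m n)} <= real m/2^n" for n
 by (rule order_trans[OF finite_measure_mono PD[of m n]]) auto
 ultimately have "prob {om : space M. ~ (EX n. om ~: D m n)} <= 0"
 using LIMSEQ_le_const by blast
 hence "prob {om : space M. ~ (EX n. om ~: D m n)} = 0" using measure_le_0_iff by blast
 thus ?thesis by (subst AE_iff_measurable[OF _ refl]) (auto simp: emeasure_eq_measure)
 qed
 hence "AE om in M. ALL m. EX n. om ~: D m n" by (simp add: AE_all_countable)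
 thus ?thesis using AE_reached AE_space
 proof eventually_elim
 case (elim om)
 show ?case
 proof
 fix i
 have ge: "i <= U (S i om) om" using S_le_iff[OF elim(3), of i "S i om"] elim S_nonneg by auto
 show "U (S i om) om = i"
 proof (rule ccontr)
 assume "U (S i om) om ~= i"
 hence gt: "U (S i om) om >= i+1" using ge by simp
 have S0: "S i om > 0"
 proof (rule ccontr)
 assume "~ ?thesis"
 hence "S i om = 0" using S_nonneg[of i om] by simp
 thus False using gt U_0[OF elim(3)] by simp
 qed
 obtain m :: nat where m: "S i om <= m" using real_arch_simple by blast
 obtain n where n: "om ~: D m n" using elim(1) by blast
 define k where "k = nat (\<lceil>S i om * 2^n\<rceil> - 1)"
 have "\<lceil>S i om * 2^n\<rceil> >= 1" using S0 by (simp add: one_le_ceiling)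
 hence k: "real k < S i om * 2^n" "S i om * 2^n <= real k+1"
 unfolding k_def by linarith+
 have "S i om * 2^n <= real m * 2^n" using m by (rule mult_right_mono) simp
 hence "real k < real m * 2^n" using k(1) by linarith
 hence km: "k < m * 2^n" by (simp flip: of_nat_less_iff[where 'a=real])
 have "real k/2^n < S i om" using k(1) by (simp add: field_simps)
 hence "U (real k/2^n) om < i"
 using S_le_iff[OF elim(3), of i "real k/2^n"] elim(2) by auto
 moreover have "S i om <= real (Suc k)/2^n" using k(2) by (simp add: field_simps)
 hence "U (S i om) om <= U (real (Suc k)/2^n) om" by (rule U_mono[OF elim(3) S_nonneg])
 ultimately have "X n k om >= 2" using gt by (simp add: X_def)
 thus False using n km elim(3) by (auto simp: D_def)
 qed
 qed
 qed
qed

lemma AE_S_less: "AE om in M. S 0 om = 0 & (ALL i. S i om < S (Suc i) om)"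
 using AE_simple AE_reached AE_space
proof eventually_elim
 case (elim om)
 have "S 0 om <= 0" using S_le_iff[OF elim(3), of 0 0] elim by simp
 moreover have "S i om < S (Suc i) om" for i
 using S_le_iff[OF elim(3), of "Suc i" "S i om"] elim S_nonneg[of i om] by (metis Suc_n_not_le_n not_le)
 ultimately show ?case using S_nonneg[of 0 om] by simp
qed

end

section \<open>Exponential gaps in operational time\<close>

context rate_poisson begin

lemma S_0: "om : space M ==> S 0 om = 0"
 using S_le_iff[of om 0 0] S_nonneg[of 0 om] by (auto simp: reached_def)

definition "X i om = S (Suc i) om - S i om"

lemma X_meas [measurable]: "X i : borel_measurable M"
 unfolding X_def[abs_def] by measurable

lemma prob_tendsto_eventually_eq:
 assumes [measurable]: "!!m. T m : sets M" "T' : sets M"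
 and ev: "AE om in M. \<forall>\<^sub>F m::nat in sequentially. om : T m \<longleftrightarrow> om : T'"
 shows "(%m. prob (T m)) \<longlonglongrightarrow> prob T'"
proof -
 have "(%m. \<integral>om. (indicator (T m) om :: real) \<partial>M) \<longlonglongrightarrow> (\<integral>om. indicator T' om \<partial>M)"
 proof (rule integral_dominated_convergence[where w="%_. 1"])
 show "AE om in M. (%m. indicator (T m) om) \<longlonglongrightarrow> (indicator T' om :: real)"
 using ev
 proof eventually_elim
 case (elim om)
 hence "\<forall>\<^sub>F m in sequentially. indicator (T m) om = (indicator T' om :: real)"
 by eventually_elim (auto simp: indicator_def)
 thus ?case by (rule tendsto_eventually)
 qed
 qed auto
 thus ?thesis by simp
qed

text \<open>The strong Markov property at the \<open>n\<close>-th point, for events determined by the first \<open>n\<close>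
 points.\<close>

lemma strong_Markov:
 fixes u :: "nat => real"
 assumes u: "!!i. 0 <= u i" and x: "0 <= x"
 shows "prob {om : space M. (ALL i:{1..n}. U (u i) om < i) & X n om > x} =
 exp (- x) * prob {om : space M. ALL i:{1..n}. U (u i) om < i}"
proof -
 define K where "K m i = nat \<lfloor>u i * 2^m\<rfloor> + 1" for m i
 define B where "B m k = {om : space M. (ALL l<k. U (real l/2^m) om < n) & n <= U (real k/2^m) om &
 (ALL i:{1..n}. K m i < k & U (real (K m i)/2^m) om < i)}" for m k
 define C where "C m k = B m k Int {om : space M. U (real k/2^m+x) om - U (real k/2^m) om = 0}" for m k
 have [measurable]: "U (real k/2^m+x) : measurable M (count_space UNIV)" for k m
 using x by (intro U_meas) auto
 have [measurable]: "U (u i) : measurable M (count_space UNIV)" for i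
 using u by (intro U_meas) auto
 have [measurable]: "B m k : sets M" "C m k : sets M" for m k
 unfolding C_def B_def by measurable
 have disjB: "disjoint_family (B m)" for m
 unfolding disjoint_family_on_def
 proof (intro ballI impI)
 fix k k' :: nat assume "k ~= k'"
 thus "B m k Int B m k' = {}" unfolding B_def
 by (cases k k' rule: linorder_cases) (auto simp: not_le[symmetric])
 qed
 have disjC: "disjoint_family (C m)" for m
 using disjB[of m] by (auto simp: disjoint_family_on_def C_def)
 have PC: "prob (C m k) = exp (- x) * prob (B m k)" for m k
 proof -
 define ta where "ta l = (if l <= k then real l/2^m else real k/2^m+x)" for l
 have mono: "mono ta"
 proof (rule monoI)
 fix l l' :: nat assume "l <= l'"
 hence "real l/2^m <= real l'/2^m" by (intro divide_right_mono) auto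
 moreover have "l <= k ==> real l/2^m <= real k/2^m" by (intro divide_right_mono) auto
 ultimately show "ta l <= ta l'" using x \<open>l <= l'\<close> unfolding ta_def by (auto intro: order_trans add_increasing2)
 qed
 define D where "D l om = U (ta (Suc l)) om - U (ta l) om" for l om
 have ind: "indep_vars (%_. count_space UNIV) D UNIV"
 unfolding D_def[abs_def] by (rule U_indep[OF _ mono]) (simp add: ta_def)
 have sumD: "(\<Sum>j<l. D j om) = U (real l/2^m) om" if "l <= k" "om : space M" for l om
 using that
 proof (induction l)
 case 0 thus ?case by (simp add: U_0)
 next
 case (Suc l)
 have "U (real l/2^m) om <= U (real (Suc l)/2^m) om"
 using Suc.prems by (intro U_mono divide_right_mono) auto
 thus ?case using Suc by (simp add: D_def ta_def)
 qed
 define Q where "Q f \<longleftrightarrow> (ALL l<k. (\<Sum>j<l. f j) < n) & n <= (\<Sum>j<k. f j) &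
 (ALL i:{1..n}. K m i < k & (\<Sum>j<K m i. f j) < i)" for f :: "nat => nat"
 have QB: "Q (restrict (%j. D j om) {..<k}) \<longleftrightarrow> om : B m k" if "om : space M" for om
 proof -
 have r: "(\<Sum>j<l. restrict (%j. D j om) {..<k} j) = U (real l/2^m) om" if "l <= k" for l
 proof -
 have "(\<Sum>j<l. restrict (%j. D j om) {..<k} j) = (\<Sum>j<l. D j om)"
 using that by (intro sum.cong) auto
 thus ?thesis using sumD[OF that \<open>om : space M\<close>] by simp
 qed
 define f where "f = restrict (%j. D j om) {..<k}"
 have r': "(\<Sum>j<l. f j) = U (real l/2^m) om" if "l <= k" for l
 using r[OF that] by (simp add: f_def)
 have "K m i < k & (\<Sum>j<K m i. f j) < i \<longleftrightarrow> K m i < k & U (real (K m i)/2^m) om < i" for i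
 using r'[of "K m i"] by auto
 hence "Q f \<longleftrightarrow> om : B m k" unfolding Q_def B_def using that r'
 by (simp add: less_imp_le cong: conj_cong)
 thus ?thesis by (simp add: f_def)
 qed
 have "prob {om : space M. Q (restrict (%j. D j om) {..<k}) & D k om = 0} =
 prob {om : space M. Q (restrict (%j. D j om) {..<k})} * prob {om : space M. D k om = 0}"
 proof (rule indep_vars_past_present[OF ind])
 have rm: "(%f. real (f j)) : borel_measurable (PiM {..<k} (%_. count_space (UNIV :: nat set)))" if "j < k" for j
 using measurable_compose[OF measurable_component_singleton[of j "{..<k}" "%_. count_space UNIV"], of real borel] that by simp
 have sm: "(%f. \<Sum>j<l. real (f j)) : borel_measurable (PiM {..<k} (%_. count_space (UNIV :: nat set)))" if "l <= k" for l
 using that by (intro borel_measurable_sum rm) auto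
 have Qe: "Q f \<longleftrightarrow> (ALL l:{..<k}. (\<Sum>j<l. real (f j)) < real n) & real n <= (\<Sum>j<k. real (f j)) &
 (ALL i:{1..n}. K m i < k & (\<Sum>j<min k (K m i). real (f j)) < real i)" for f
 proof -
 have e: "K m i < k & (\<Sum>j<min k (K m i). f j) < i \<longleftrightarrow> K m i < k & (\<Sum>j<K m i. f j) < i" for i
 by (auto simp: min_def)
 show ?thesis
 unfolding Q_def of_nat_sum[symmetric] of_nat_less_iff of_nat_le_iff Ball_def lessThan_iff e ..
 qed
 let ?P = "PiM {..<k} (%_. count_space (UNIV :: nat set))"
 have lt: "Measurable.pred ?P (%f. (\<Sum>j<l. real (f j)) < c)" if "l <= k" for l c
 unfolding pred_def using borel_measurable_less[OF sm[OF that] borel_measurable_const] .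
 have ge: "Measurable.pred ?P (%f. c <= (\<Sum>j<k. real (f j)))" for c
 unfolding pred_def using borel_measurable_le[OF borel_measurable_const sm[OF order_refl]] .
 have "Measurable.pred ?P Q"
 unfolding Qe by (intro pred_intros_logic pred_intros_finite lt ge) auto
 thus "{f : space ?P. Q f} : sets ?P" by (simp add: pred_def)
 qed
 moreover have "{om : space M. Q (restrict (%j. D j om) {..<k}) & D k om = 0} = C m k"
 using QB by (auto simp: C_def D_def ta_def B_def)
 moreover have "{om : space M. Q (restrict (%j. D j om) {..<k})} = B m k"
 using QB by (auto simp: B_def)
 moreover have "prob {om : space M. D k om = 0} = exp (- x)"
 using U_incr[of "real k/2^m" "real k/2^m+x" 0] x by (simp add: D_def ta_def poisson_mass_def)
 ultimately show ?thesis by simp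
 qed
 have PUC: "prob (\<Union>k. C m k) = exp (- x) * prob (\<Union>k. B m k)" for m
 proof -
 have "(%k. prob (C m k)) sums prob (\<Union>k. C m k)" by (rule finite_measure_UNION) (auto simp: disjC)
 moreover have "(%k. prob (B m k)) sums prob (\<Union>k. B m k)" by (rule finite_measure_UNION) (auto simp: disjB)
 hence "(%k. prob (C m k)) sums (exp (- x) * prob (\<Union>k. B m k))"
 unfolding PC by (rule sums_mult)
 ultimately show ?thesis by (rule sums_unique2)
 qed
 define A where "A = {om : space M. ALL i:{1..n}. U (u i) om < i}"
 define T where "T = {om : space M. (ALL i:{1..n}. U (u i) om < i) & X n om > x}"
 have [measurable]: "A : sets M" "T : sets M" unfolding A_def T_def by measurable
 have ev: "AE om in M. \<forall>\<^sub>F m in sequentially. (om : (\<Union>k. B m k) \<longleftrightarrow> om : A) & (om : (\<Union>k. C m k) \<longleftrightarrow> om : T)"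
 using AE_simple AE_reached AE_space
 proof eventually_elim
 case (elim om)
 define si where "si m = (LEAST k. n <= U (real k/2^m) om)" for m
 define s where "s m = real (si m)/2^m" for m :: nat
 have ex: "EX k. n <= U (real k/2^m) om" for m
 proof -
 obtain k :: nat where k: "S n om * 2^m <= real k" using real_arch_simple by blast
 hence "S n om <= real k/2^m" by (simp add: field_simps)
 hence "n <= U (real k/2^m) om" using S_le_iff[OF elim(3), of n "real k/2^m"] elim(2) by auto
 thus ?thesis ..
 qed
 have nU: "n <= U (s m) om" for m unfolding s_def si_def using ex[of m] by (rule LeastI_ex)
 have lt: "U (real l/2^m) om < n" if "l < si m" for l m
 using not_less_Least[of l "%k. n <= U (real k/2^m) om"] that by (auto simp: si_def)
 have s1: "S n om <= s m" for m
 using nU[of m] S_le_iff[OF elim(3), of n "s m"] elim(2) by (auto simp: s_def)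
 have s2: "s m <= S n om+1/2^m" for m
 proof (cases "si m")
 case 0 thus ?thesis using S_nonneg[of n om] by (simp add: s_def)
 next
 case (Suc l)
 hence "~ S n om <= real l/2^m"
 using lt[of l m] S_le_iff[OF elim(3), of n "real l/2^m"] elim(2) by auto
 thus ?thesis using Suc by (simp add: s_def add_divide_distrib)
 qed
 have inv2: "(%m::nat. 1/2^m :: real) \<longlonglongrightarrow> 0"
 using LIMSEQ_realpow_zero[of "1/2::real"] by (simp add: power_one_over)
 have near: "\<forall>\<^sub>F m in sequentially. U (f m) om = U a om"
 if a: "0 <= a" "!!m. a <= f m" "!!m. f m <= a+1/2^m" for f :: "nat => real" and a
 proof -
 obtain d where d: "d > 0" "!!t. a <= t ==> t < a+d ==> U t om = U a om"
 using U_right[OF elim(3) a(1)] by blast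
 have "\<forall>\<^sub>F m in sequentially. 1/2^m < d"
 using order_tendstoD(2)[OF inv2 d(1)] .
 thus ?thesis
 proof eventually_elim
 case (elim m)
 thus ?case using a(2,3)[of m] by (intro d(2)) linarith+
 qed
 qed
 have e1: "\<forall>\<^sub>F m in sequentially. U (s m) om = n"
 using near[OF S_nonneg s1 s2] elim(1) by simp
 have e2: "\<forall>\<^sub>F m in sequentially. U (s m+x) om = U (S n om+x) om"
 by (rule near) (use s1 s2 x S_nonneg in \<open>auto simp: algebra_simps\<close>)
 have e3: "\<forall>\<^sub>F m in sequentially. ALL i:{1..n}. U (real (K m i)/2^m) om = U (u i) om"
 proof (rule eventually_ball_finite)
 show "ALL i:{1..n}. \<forall>\<^sub>F m in sequentially. U (real (K m i)/2^m) om = U (u i) om"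
 proof
 fix i
 show "\<forall>\<^sub>F m in sequentially. U (real (K m i)/2^m) om = U (u i) om"
 proof (rule near[OF u])
 fix m
 have "u i * 2^m >= 0" using u by simp
 hence "u i * 2^m <= real (K m i)" "real (K m i) <= u i * 2^m+1" unfolding K_def by linarith+
 thus "u i <= real (K m i)/2^m" "real (K m i)/2^m <= u i+1/2^m"
 by (auto simp: field_simps)
 qed
 qed
 qed simp
 have U1: "X n om > x \<longleftrightarrow> U (S n om+x) om = n"
 proof -
 have "X n om > x \<longleftrightarrow> ~ S (Suc n) om <= S n om+x" by (auto simp: X_def)
 also have "... \<longleftrightarrow> ~ Suc n <= U (S n om+x) om"
 using S_le_iff[OF elim(3), of "Suc n" "S n om+x"] elim(2) x S_nonneg[of n om] by simp
 also have "... \<longleftrightarrow> U (S n om+x) om = n"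
 using U_mono[OF elim(3) S_nonneg[of n om], of "S n om+x"] elim(1) x by auto
 finally show ?thesis .
 qed
 show ?case using e1 e2 e3
 proof eventually_elim
 case (elim m)
 note el = elim
 have Km: "K m i < si m" if "i : {1..n}" "U (real (K m i)/2^m) om < i" for i
 proof (rule ccontr)
 assume "~ ?thesis"
 hence "s m <= real (K m i)/2^m" by (auto simp: s_def intro!: divide_right_mono)
 hence "U (s m) om <= U (real (K m i)/2^m) om"
 by (intro U_mono \<open>om : space M\<close>) (auto simp: s_def)
 thus False using that nU[of m] by auto
 qed
 have BA: "om : B m k \<longleftrightarrow> k = si m & om : A" for k
 proof
 assume B: "om : B m k"
 have "~ k < si m" using lt[of k m] B by (auto simp: B_def)
 moreover have "~ si m < k" using nU[of m] B by (auto simp: B_def s_def not_le[symmetric])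
 ultimately have "k = si m" by simp
 thus "k = si m & om : A" using B el by (auto simp: B_def A_def)
 next
 assume "k = si m & om : A"
 thus "om : B m k" using lt nU[of m] Km el by (auto simp: B_def A_def s_def)
 qed
 have "om : (\<Union>k. C m k) \<longleftrightarrow> om : A & U (s m+x) om - U (s m) om = 0"
 using BA \<open>om : space M\<close> by (auto simp: C_def s_def)
 also have "U (s m+x) om - U (s m) om = 0 \<longleftrightarrow> U (s m+x) om = U (s m) om"
 using U_mono[OF \<open>om : space M\<close>, of "s m" "s m+x"] x by (auto simp: s_def)
 finally show ?case using BA el U1 by (auto simp: A_def T_def)
 qed
 qed
 have "(%m. prob (\<Union>k. B m k)) \<longlonglongrightarrow> prob A"
 proof (rule prob_tendsto_eventually_eq)
 show "AE om in M. \<forall>\<^sub>F m in sequentially. (om : (\<Union>k. B m k)) = (om : A)"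
 using ev by eventually_elim (erule eventually_mono, blast)
 qed measurable
 hence "(%m. exp (- x) * prob (\<Union>k. B m k)) \<longlonglongrightarrow> exp (- x) * prob A" by (rule tendsto_mult_left)
 moreover have "(%m. prob (\<Union>k. C m k)) \<longlonglongrightarrow> prob T"
 proof (rule prob_tendsto_eventually_eq)
 show "AE om in M. \<forall>\<^sub>F m in sequentially. (om : (\<Union>k. C m k)) = (om : T)"
 using ev by eventually_elim (erule eventually_mono, blast)
 qed measurable
 ultimately show ?thesis unfolding PUC A_def T_def using LIMSEQ_unique by blast
qed

lemma X_tail: "0 <= x ==> prob {om : space M. X n om > x} = exp (- x)"
proof -
 assume x: "0 <= x"
 have "{om : space M. (ALL i:{1..n}. U 0 om < i) & X n om > x} = {om : space M. X n om > x}"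
 "{om : space M. ALL i:{1..n}. U 0 om < i} = space M"
 by (auto simp: U_0)
 thus ?thesis using strong_Markov[of "%_. 0" x n] x by (simp add: prob_space)
qed

text \<open>In operational time the process has unit rate. The waiting time after the n-th epoch is computed by discretizing the epoch on a dyadic grid from the right and using independence of increments at each grid point; right continuity of paths allows the passage to the limit.\<close>

lemma X_exponential: "distributed M lborel (X n) (exponential_density 1)"
 unfolding exponential_distributed_iff[OF zero_less_one]
proof (intro conjI allI impI)
 fix a :: real assume a: "0 <= a"
 have "{om : space M. X n om <= a} = space M - {om : space M. X n om > a}" by auto
 thus "\<P>(x in M. X n x <= a) = 1 - exp (- a * 1)" using X_tail[OF a, of n] by (simp add: prob_compl)
qed simp

text \<open>Events determined by the first \<open>n\<close> points, and a generator closed under intersections.\<close>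

definition "past n = {{om : space M. ALL i:{1..n}. U (u i) om < i} | u. ALL i. 0 <= u i}"

lemma past_events: "past n <= events"
proof -
 have "{om : space M. ALL i:{1..n}. U (u i) om < i} : events" if "ALL i. 0 <= u i" for u
 proof -
 have [measurable]: "U (u i) : measurable M (count_space UNIV)" for i using that by simp
 show ?thesis by measurable
 qed
 thus ?thesis by (auto simp: past_def)
qed

lemma past_Pow: "past n <= Pow (space M)"
proof
 fix a assume "a : past n"
 hence "a : events" using past_events by (rule subsetD[rotated])
 thus "a : Pow (space M)" using sets.sets_into_space by simp
qed

lemma past_Int_stable: "Int_stable (past n)"
proof (rule Int_stableI)
 fix a b assume "a : past n" "b : past n"
 then obtain u u' where u: "ALL i. 0 <= u i" "ALL i. 0 <= u' i"
 and ab: "a = {om : space M. ALL i:{1..n}. U (u i) om < i}" "b = {om : space M. ALL i:{1..n}. U (u' i) om < i}"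
 by (auto simp: past_def)
 have "U (max (u i) (u' i)) om < j \<longleftrightarrow> U (u i) om < j & U (u' i) om < j" if "om : space M" for i j om
 using U_mono[OF that, of "u i" "u' i"] U_mono[OF that, of "u' i" "u i"] u by (auto simp: max_def)
 hence "a Int b = {om : space M. ALL i:{1..n}. U (max (u i) (u' i)) om < i}"
 unfolding ab by blast
 thus "a Int b : past n" unfolding past_def using u by (auto intro!: exI[of _ "%i. max (u i) (u' i)"] simp: le_max_iff_disj)
qed

lemma S_past:
 assumes "i <= n" shows "S i : borel_measurable (sigma (space M) (past n))"
proof (rule borel_measurableI_le)
 let ?G = "sigma (space M) (past n)"
 note sp = past_Pow[of n]
 have U': "{om : space M. U c om < i} : sets ?G" if "c >= 0" "i >= 1" for c
 proof -
 have "{om : space M. U c om < i} = {om : space M. ALL j:{1..n}. U (if j = i then c else 0) om < j}"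
 using assms that by (auto simp: U_0)
 also have "... : past n" unfolding past_def using that by (auto intro!: exI[of _ "%j. if j = i then c else 0"])
 finally show ?thesis using sp by simp
 qed
 have UG: "{om : space M. i <= U c om} : sets ?G" if "c >= 0" for c
 proof (cases "i = 0")
 case False
 hence "{om : space M. i <= U c om} = space ?G - {om : space M. U c om < i}"
 using sp by (auto simp: space_measure_of)
 thus ?thesis using U'[OF that] False by auto
 next
 case True thus ?thesis using sets.top[of ?G] sp by (simp add: space_measure_of)
 qed
 have re: "{om : space M. reached i om} : sets ?G"
 proof -
 have "{om : space M. reached i om} = (\<Union>k::nat. {om : space M. i <= U (Lam (real k)) om})"
 using reached_nat[of _ i] by (auto simp: U_def)
 thus ?thesis using UG Lam_nonneg by auto
 qed
 fix x
 have "{om : space ?G. S i om <= x} =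
 ({om : space M. reached i om} Int (if 0 <= x then {om : space M. i <= U (max 0 x) om} else {})) Un
 ((space ?G - {om : space M. reached i om}) Int (if Lam (max 0 (Inf {})) <= x then space ?G else {}))"
 proof -
 have "S i om = Lam (max 0 (Inf {}))" if "~ reached i om" for om
 proof -
 have e: "{s. 0 <= s & i <= N s om} = {}" using that by (auto simp: reached_def)
 show ?thesis unfolding S_def epoch_def e ..
 qed
 note 1 = this
 have 2: "S i om <= x \<longleftrightarrow> 0 <= x & i <= U (max 0 x) om" if "reached i om" "om : space M" for om
 using S_le_iff[OF that(2,1), of x] S_nonneg[of i om] by (cases "0 <= x") auto
 show ?thesis unfolding space_measure_of[OF sp]
 proof (rule set_eqI)
 fix om
 show "om : {om : space M. S i om <= x} \<longleftrightarrow> om : ({om : space M. reached i om} Int (if 0 <= x then {om : space M. i <= U (max 0 x) om} else {})) Un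
 ((space M - {om : space M. reached i om}) Int (if Lam (max 0 (Inf {})) <= x then space M else {}))"
 proof (cases "om : space M & reached i om")
 case True
 thus ?thesis using 2[of om] by simp
 next
 case False
 thus ?thesis by (cases "om : space M") (use 1[of om] in simp_all)
 qed
 qed
 qed
 also have "... : sets ?G" using re UG[of "max 0 x"] by auto
 finally show "{om : space ?G. S i om <= x} : sets ?G" .
qed

lemma past_future_indep:
 assumes A: "A : sets (sigma (space M) (past n))" and B: "B : sets borel"
 shows "prob (A Int {om : space M. X n om : B}) = prob A * prob {om : space M. X n om : B}"
proof -
 define F where "F = {{om : space M. X n om > x} | x. 0 <= x}"
 have XF: "AE om in M. 0 < X n om" using AE_S_less by (auto simp: X_def)
 have ind: "indep_set (past n) F"
 proof (rule indep_setI)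
 show "past n <= events" by (rule past_events)
 show "F <= events" unfolding F_def by auto
 fix a b assume "a : past n" "b : F"
 then obtain u x where u: "ALL i. 0 <= u i" "0 <= x"
 and ab: "a = {om : space M. ALL i:{1..n}. U (u i) om < i}" "b = {om : space M. X n om > x}"
 by (auto simp: past_def F_def)
 have "a Int b = {om : space M. (ALL i:{1..n}. U (u i) om < i) & X n om > x}" unfolding ab by auto
 thus "prob (a Int b) = prob a * prob b"
 using strong_Markov[of u x n] X_tail[of x n] u by (simp add: ab mult.commute)
 qed
 have "Int_stable F"
 proof (rule Int_stableI)
 fix a b assume "a : F" "b : F"
 then obtain x y where "0 <= x" "0 <= y" "a = {om : space M. X n om > x}" "b = {om : space M. X n om > y}"
 by (auto simp: F_def)
 thus "a Int b : F" unfolding F_def by (auto intro!: exI[of _ "max x y"])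
 qed
 from indep_set_sigma_sets[OF ind past_Int_stable this]
 have ind': "indep_set (sigma_sets (space M) (past n)) (sigma_sets (space M) F)" .
 have FP: "F <= Pow (space M)" by (auto simp: F_def)
 note pP = past_Pow[of n]
 have Y: "(%om. max 0 (X n om)) : borel_measurable (sigma (space M) F)"
 proof (rule borel_measurableI_greater)
 fix x :: real
 have "{om : space (sigma (space M) F). x < max 0 (X n om)} =
 (if x < 0 then space M else {om : space M. X n om > x})" using FP by (auto simp: space_measure_of)
 also have "... : sets (sigma (space M) F)"
 proof (cases "x < 0")
 case True thus ?thesis using sets.top[of "sigma (space M) F"] FP by (simp add: space_measure_of)
 next
 case False
 hence "{om : space M. X n om > x} : F" unfolding F_def by (intro CollectI exI[of _ x]) auto
 thus ?thesis using FP False by simp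
 qed
 finally show "{om : space (sigma (space M) F). x < max 0 (X n om)} : sets (sigma (space M) F)" .
 qed
 define B' where "B' = {om : space M. max 0 (X n om) : B}"
 have "B' : sigma_sets (space M) F"
 using measurable_sets[OF Y B] FP by (simp add: B'_def vimage_def Int_def space_measure_of conj_commute)
 moreover have "A : sigma_sets (space M) (past n)" using A pP by simp
 ultimately have "prob (A Int B') = prob A * prob B'" by (intro indep_setD[OF ind'])
 moreover have "prob B' = prob {om : space M. X n om : B}"
 unfolding B'_def using XF B by (intro finite_measure_eq_AE) (auto elim!: eventually_mono simp: max_def)
 moreover have "A : sets M" using \<open>A : sigma_sets (space M) (past n)\<close> past_events sets.sigma_sets_subset by blast
 hence "prob (A Int B') = prob (A Int {om : space M. X n om : B})"
 unfolding B'_def using XF B by (intro finite_measure_eq_AE) (auto elim!: eventually_mono simp: max_def)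
 ultimately show ?thesis by simp
qed

lemma X_indep: "indep_vars (%_. borel) X UNIV"
proof -
 have prod: "prob {om : space M. ALL i<n. X i om : B i} = (\<Prod>i<n. prob {om : space M. X i om : B i})"
 if B: "!!i. B i : sets borel" for n and B :: "nat => real set"
 proof (induction n)
 case 0 show ?case by (simp add: prob_space)
 next
 case (Suc n)
 let ?G = "sigma (space M) (past n)"
 have sp: "space ?G = space M" using past_Pow by (simp add: space_measure_of)
 have [measurable]: "X i : borel_measurable ?G" if "i : {..<n}" for i
 unfolding X_def[abs_def] using that by (intro borel_measurable_diff S_past) auto
 note [measurable] = B
 have "{om : space ?G. ALL i:{..<n}. X i om : B i} : sets ?G"
 by measurable
 hence A: "{om : space M. ALL i<n. X i om : B i} : sets ?G"
 unfolding sp Ball_def lessThan_iff .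
 have "{om : space M. ALL i<Suc n. X i om : B i} =
 {om : space M. ALL i<n. X i om : B i} Int {om : space M. X n om : B n}"
 by (rule set_eqI) (simp add: All_less_Suc conj_ac)
 thus ?case using past_future_indep[OF A B[of n]] Suc by (simp add: mult.commute)
 qed
 show ?thesis unfolding indep_vars_def2
 proof (intro conjI ballI indep_setsI)
 fix A :: "nat => 'a set" and J :: "nat set"
 assume J: "J ~= {}" "finite J" and "ALL j:J. A j : {X j -` A Int space M |A. A : sets borel}"
 hence "ALL j:J. EX B. B : sets borel & A j = X j -` B Int space M" by auto
 from bchoice[OF this] obtain B
 where B: "!!j. j : J ==> B j : sets borel" "!!j. j : J ==> A j = X j -` B j Int space M"
 by blast
 define B' where "B' j = (if j : J then B j else UNIV)" for j
 obtain n where n: "J <= {..<n}" using finite_nat_bounded[OF J(2)] by auto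
 have "(\<Inter>j\<in>J. A j) = {om : space M. ALL i<n. X i om : B' i}"
 proof (rule set_eqI)
 fix om
 have "om : (\<Inter>j\<in>J. A j) \<longleftrightarrow> om : space M & (ALL j:J. X j om : B j)"
 using J(1) B(2) by (simp cong: ball_cong) blast
 also have "(ALL j:J. X j om : B j) \<longleftrightarrow> (ALL i<n. X i om : B' i)"
 using n unfolding B'_def by (metis UNIV_I lessThan_iff subsetD)
 finally show "om : (\<Inter>j\<in>J. A j) \<longleftrightarrow> om : {om : space M. ALL i<n. X i om : B' i}" by simp
 qed
 hence "prob (\<Inter>j\<in>J. A j) = (\<Prod>i<n. prob {om : space M. X i om : B' i})"
 using prod[of B' n] B(1) by (simp add: B'_def)
 also have "... = (\<Prod>i\<in>J. prob {om : space M. X i om : B' i})"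
 using n by (intro prod.mono_neutral_right) (auto simp: B'_def prob_space)
 also have "... = (\<Prod>j\<in>J. prob (A j))"
 by (intro prod.cong refl arg_cong[where f=prob]) (auto simp: B'_def B(2))
 finally show "prob (\<Inter>j\<in>J. A j) = (\<Prod>j\<in>J. prob (A j))" .
 qed auto
qed

end

section \<open>Convergence of expectations through finite codes\<close>

lemma conv_expectation_upper:
 fixes Y :: "'i => 'a => real" and Y' :: "'b => real" and F :: "'i filter"
 and ka :: "nat => 'i => 'a => 'c" and ka' :: "nat => 'b => 'c"
 assumes PM: "prob_space M" and PM': "prob_space M'"
 and B: "!!t om. om : space M ==> \<bar>Y t om\<bar> <= B" "!!om. om : space M' ==> \<bar>Y' om\<bar> <= B"
 and Ym: "\<forall>\<^sub>F t in F. Y t : borel_measurable M" "Y' : borel_measurable M'"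
 and fin: "!!n. finite (C n)"
 and km: "!!n t c. {om : space M. ka n t om = c} : sets M" "!!n c. {om : space M'. ka' n om = c} : sets M'"
 and lim: "!!n c. c : C n ==> ((%t. measure M {om : space M. ka n t om = c}) \<longlongrightarrow> pp n c) F"
 and approx: "(%n. \<Sum>c\<in>C n. \<bar>pp n c - measure M' {om : space M'. ka' n om = c}\<bar>) \<longlonglongrightarrow> 0"
 and G': "!!n. G' n : sets M'" "(%n. measure M' {om : space M'. ~ (om : G' n & ka' n om : C n)}) \<longlonglongrightarrow> 0"
 and G: "!!n t. G n t : sets M" "!!n. \<forall>\<^sub>F t in F. measure M (space M - G n t) <= de n" "de \<longlonglongrightarrow> 0"
 and match: "!!om' ep. om' : space M' ==> ep > 0 ==> \<forall>\<^sub>F n in sequentially. om' : G' n --> ka' n om' : C n -->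
 (ALL t. ALL om:G n t. ka n t om = ka' n om' --> Y t om <= Y' om' + ep)"
 and e: "e > 0"
 shows "\<forall>\<^sub>F t in F. (\<integral>om. Y t om \<partial>M) <= (\<integral>om. Y' om \<partial>M')+e"
proof -
 interpret M: prob_space M by fact
 interpret M': prob_space M' by fact
 note [measurable] = km Ym(2) G'(1) G(1)
 have B0: "B >= 0" using B(2) M'.not_empty by fastforce
 define V where "V n c = insert 0 {Y t om+B | t om. om : G n t & ka n t om = c}" for n c
 define f where "f n c = Sup (V n c)" for n c
 have GM: "om : space M" if "om : G n t" for om n t using sets.sets_into_space[OF G(1)] that by blast
 have V2: "x <= 2 * B" if "x : V n c" for x n c
 using that B(1)[OF GM] B0 by (fastforce simp: V_def abs_le_iff)
 have bdd: "bdd_above (V n c)" for n c by (rule bdd_aboveI[of _ "2 * B"]) (rule V2)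
 have f0: "0 <= f n c" for n c unfolding f_def by (rule cSup_upper[OF _ bdd]) (simp add: V_def)
 have f2: "f n c <= 2 * B" for n c unfolding f_def by (rule cSup_least, simp add: V_def, rule V2)
 have fY: "Y t om+B <= f n (ka n t om)" if "om : G n t" for n t om
 unfolding f_def by (rule cSup_upper[OF _ bdd]) (use that in \<open>auto simp: V_def\<close>)
 define P where "P n t c = M.prob {om : space M. ka n t om = c}" for n t c
 define P' where "P' n c = M'.prob {om : space M'. ka' n om = c}" for n c
 have decomp: "(\<Sum>c\<in>C n. f n c * indicator {om : space M. ka n t om = c} om) = (if ka n t om : C n then f n (ka n t om) else 0)"
 if "om : space M" for n t om
 using that fin[of n] by (simp add: indicator_def if_distrib sum.delta' cong: if_cong)
 have decomp': "(\<Sum>c\<in>C n. f n c * indicator {om : space M'. ka' n om = c} om) = (if ka' n om : C n then f n (ka' n om) else 0)"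
 if "om : space M'" for n om
 using that fin[of n] by (simp add: indicator_def if_distrib sum.delta' cong: if_cong)
 have mU: "(\<Union>c\<in>C n. {om : space M. ka n t om = c}) : sets M" for n t
 by (intro sets.finite_UN fin km)
 have mU': "(\<Union>c\<in>C n. {om : space M'. ka' n om = c}) : sets M'" for n
 by (intro sets.finite_UN fin km)
 have inC: "M.prob {om : space M. ka n t om ~: C n} = 1 - (\<Sum>c\<in>C n. P n t c)" for n t
 proof -
 have eq: "{om : space M. ka n t om ~: C n} = space M - (\<Union>c\<in>C n. {om : space M. ka n t om = c})" by auto
 have "M.prob (\<Union>c\<in>C n. {om : space M. ka n t om = c}) = (\<Sum>c\<in>C n. P n t c)"
 unfolding P_def by (rule M.finite_measure_finite_Union) (use fin km in \<open>auto simp: disjoint_family_on_def\<close>)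
 thus ?thesis unfolding eq by (simp add: M.prob_compl[OF mU])
 qed
 have mC: "{om : space M. ka n t om ~: C n} : sets M" for n t
 proof -
 have eq: "{om : space M. ka n t om ~: C n} = space M - (\<Union>c\<in>C n. {om : space M. ka n t om = c})" by auto
 show ?thesis unfolding eq by (intro sets.Diff sets.top mU)
 qed
 have mC': "{om : space M'. ~ (om : G' n & ka' n om : C n)} : sets M'" for n
 proof -
 have eq: "{om : space M'. ~ (om : G' n & ka' n om : C n)} = space M' - (G' n Int (\<Union>c\<in>C n. {om : space M'. ka' n om = c}))"
 using sets.sets_into_space[OF G'(1)] by auto
 show ?thesis unfolding eq by (intro sets.Diff sets.Int sets.top mU' G'(1))
 qed
 have inC': "1 - (\<Sum>c\<in>C n. P' n c) <= M'.prob {om : space M'. ~ (om : G' n & ka' n om : C n)}" for n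
 proof -
 have "M'.prob (\<Union>c\<in>C n. {om : space M'. ka' n om = c}) = (\<Sum>c\<in>C n. P' n c)"
 unfolding P'_def by (rule M'.finite_measure_finite_Union) (use fin km in \<open>auto simp: disjoint_family_on_def\<close>)
 hence "1 - (\<Sum>c\<in>C n. P' n c) = M'.prob (space M' - (\<Union>c\<in>C n. {om : space M'. ka' n om = c}))"
 by (simp add: M'.prob_compl[OF mU'])
 also have "... <= M'.prob {om : space M'. ~ (om : G' n & ka' n om : C n)}"
 by (rule M'.finite_measure_mono[OF _ mC']) auto
 finally show ?thesis .
 qed
 have up: "(\<integral>om. Y t om \<partial>M)+B <= (\<Sum>c\<in>C n. f n c * P n t c)+2 * B * M.prob (space M - G n t)+2 * B * (1 - (\<Sum>c\<in>C n. P n t c))"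
 if Yt: "Y t : borel_measurable M" for n t
 proof -
 have "(\<integral>om. Y t om+B \<partial>M) <= (\<integral>om. (\<Sum>c\<in>C n. f n c * indicator {om : space M. ka n t om = c} om) +
 2 * B * indicator (space M - G n t) om+2 * B * indicator {om : space M. ka n t om ~: C n} om \<partial>M)"
 proof (rule integral_mono)
 show "integrable M (%om. Y t om+B)"
 using B(1) Yt B0 by (intro Bochner_Integration.integrable_add M.integrable_const_bound[where B=B]) auto
 show "integrable M (%om. (\<Sum>c\<in>C n. f n c * indicator {om : space M. ka n t om = c} om) +
 2 * B * indicator (space M - G n t) om+2 * B * indicator {om : space M. ka n t om ~: C n} om)"
 using mC G(1) km by (intro Bochner_Integration.integrable_add Bochner_Integration.integrable_sum
 integrable_mult_right integrable_real_indicator) (auto simp: M.emeasure_eq_measure)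
 fix om assume om: "om : space M"
 have "Y t om+B <= 2 * B" using B(1)[OF om, of t] by (simp add: abs_le_iff)
 thus "Y t om+B <= (\<Sum>c\<in>C n. f n c * indicator {om : space M. ka n t om = c} om) +
 2 * B * indicator (space M - G n t) om+2 * B * indicator {om : space M. ka n t om ~: C n} om"
 unfolding decomp[OF om] using fY[of om n t] f0[of n "ka n t om"] B0 om by (auto simp: indicator_def)
 qed
 also have "... = (\<Sum>c\<in>C n. f n c * P n t c)+2 * B * M.prob (space M - G n t)+2 * B * M.prob {om : space M. ka n t om ~: C n}"
 using mC G(1) km
 by (subst Bochner_Integration.integral_add Bochner_Integration.integral_sum;
 (intro Bochner_Integration.integrable_add Bochner_Integration.integrable_sum
 integrable_mult_right integrable_real_indicator)?;
 simp add: M.emeasure_eq_measure P_def Int_def conj_commute set_diff_eq)+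
 also have "(\<integral>om. Y t om+B \<partial>M) = (\<integral>om. Y t om \<partial>M)+B"
 using B(1) Yt B0 by (subst Bochner_Integration.integral_add) (auto intro!: M.integrable_const_bound[where B=B] simp: M.prob_space)
 finally show ?thesis unfolding inC .
 qed
 define h where "h n om = (if om : G' n & ka' n om : C n then max 0 ((if ka' n om : C n then f n (ka' n om) else 0) - (Y' om+B)) else 0)" for n om
 have fm: "(%om. if ka' n om : C n then f n (ka' n om) else 0) : borel_measurable M'" for n
 proof -
 have "(%om. \<Sum>c\<in>C n. f n c * indicator {om : space M'. ka' n om = c} om) : borel_measurable M'"
 using km by measurable
 thus ?thesis by (rule measurable_cong[THEN iffD1, rotated]) (rule decomp')
 qed
 have hm: "h n : borel_measurable M'" for n
 proof -
 have "{om : space M'. om : G' n & ka' n om : C n} = space M' - {om : space M'. ~ (om : G' n & ka' n om : C n)}" by auto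
 hence A: "{om : space M'. om : G' n & ka' n om : C n} : sets M'"
 using sets.compl_sets[OF mC'] by (simp only:)
 show ?thesis unfolding h_def[abs_def]
 by (rule measurable_If[OF _ _ A])
 (intro borel_measurable_max borel_measurable_diff borel_measurable_add fm borel_measurable_const Ym(2))+
 qed
 have hb: "0 <= h n om & h n om <= 2 * B" if "om : space M'" for n om
 using B(2)[OF that] f2[of n "ka' n om"] B0 by (auto simp: h_def abs_le_iff)
 have hlim: "(%n. \<integral>om. h n om \<partial>M') \<longlonglongrightarrow> (\<integral>om. 0 \<partial>M')"
 proof (rule integral_dominated_convergence[where w="%_. 2 * B"])
 show "AE om in M'. (%n. h n om) \<longlonglongrightarrow> 0"
 proof (rule AE_I2)
 fix om assume om: "om : space M'"
 show "(%n. h n om) \<longlonglongrightarrow> 0"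
 proof (rule tendstoI)
 fix r :: real assume r: "r > 0"
 have YB: "0 <= Y' om+B" using B(2)[OF om] by (simp add: abs_le_iff)
 have "r/2 > 0" using r by simp
 from match[OF om this] show "\<forall>\<^sub>F n in sequentially. dist (h n om) 0 < r"
 proof eventually_elim
 case (elim n)
 note el = elim
 show ?case
 proof (cases "om : G' n & ka' n om : C n")
 case True
 have "f n (ka' n om) <= Y' om+B+r/2" unfolding f_def
 proof (rule cSup_least)
 fix x assume "x : V n (ka' n om)"
 then consider "x = 0" | t om0 where "x = Y t om0+B" "om0 : G n t" "ka n t om0 = ka' n om"
 by (auto simp: V_def)
 thus "x <= Y' om+B+r/2"
 proof cases
 case 1 thus ?thesis using YB r by simp
 next
 case (2 t om0)
 hence "Y t om0 <= Y' om+r/2" using el True by blast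
 thus ?thesis using 2 by simp
 qed
 qed (simp add: V_def)
 thus ?thesis using True r by (simp add: h_def dist_real_def)
 next
 case False thus ?thesis using r unfolding h_def by (subst if_not_P) auto
 qed
 qed
 qed
 qed
 qed (use hm hb in \<open>auto simp: abs_le_iff intro!: AE_I2\<close>)
 have low: "(\<Sum>c\<in>C n. f n c * P' n c) <= (\<integral>om. Y' om \<partial>M')+B+(\<integral>om. h n om \<partial>M') +
 2 * B * M'.prob {om : space M'. ~ (om : G' n & ka' n om : C n)}" for n
 proof -
 have ih: "integrable M' (h n)" using hb hm by (intro M'.integrable_const_bound[where B="2 * B"]) (auto simp: abs_le_iff)
 have iY: "integrable M' Y'" using B(2) by (intro M'.integrable_const_bound[where B=B]) auto
 have ii: "integrable M' (%om. 2 * B * indicator {om : space M'. ~ (om : G' n & ka' n om : C n)} om :: real)"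
 using mC' by (intro integrable_mult_right integrable_real_indicator) (auto simp: M'.emeasure_eq_measure)
 have "(\<Sum>c\<in>C n. f n c * P' n c) = (\<integral>om. (\<Sum>c\<in>C n. f n c * indicator {om : space M'. ka' n om = c} om) \<partial>M')"
 using km by (subst Bochner_Integration.integral_sum) (auto simp: P'_def Int_def conj_commute M'.emeasure_eq_measure)
 also have "... <= (\<integral>om. ((Y' om+B)+h n om)+2 * B * indicator {om : space M'. ~ (om : G' n & ka' n om : C n)} om \<partial>M')"
 proof (rule integral_mono)
 show "integrable M' (%om. \<Sum>c\<in>C n. f n c * indicator {om : space M'. ka' n om = c} om)"
 using km by (intro Bochner_Integration.integrable_sum integrable_mult_right integrable_real_indicator) (auto simp: M'.emeasure_eq_measure)
 show "integrable M' (%om. ((Y' om+B)+h n om)+2 * B * indicator {om : space M'. ~ (om : G' n & ka' n om : C n)} om)"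
 using ih iY ii by (intro Bochner_Integration.integrable_add) auto
 fix om assume om: "om : space M'"
 show "(\<Sum>c\<in>C n. f n c * indicator {om : space M'. ka' n om = c} om) <=
 ((Y' om+B)+h n om)+2 * B * indicator {om : space M'. ~ (om : G' n & ka' n om : C n)} om"
 unfolding decomp'[OF om] using f2[of n "ka' n om"] B(2)[OF om] B0 hb[OF om, of n] om
 by (auto simp: h_def indicator_def abs_le_iff)
 qed
 also have "... = ((\<integral>om. Y' om \<partial>M')+B+(\<integral>om. h n om \<partial>M')) +
 2 * B * M'.prob {om : space M'. ~ (om : G' n & ka' n om : C n)}"
 using ih iY ii mC'[of n] by (simp add: Bochner_Integration.integral_add M'.prob_space Int_def conj_commute)
 finally show ?thesis by simp
 qed
 define bad where "bad n = M'.prob {om : space M'. ~ (om : G' n & ka' n om : C n)}" for n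
 define \<Delta> where "\<Delta> n = (\<Sum>c\<in>C n. \<bar>pp n c - P' n c\<bar>)" for n
 have "(%n. (\<integral>om. h n om \<partial>M')+4 * B * bad n+4 * B * \<Delta> n+2 * B * de n) \<longlonglongrightarrow> 0+4 * B * 0+4 * B * 0+2 * B * 0"
 using hlim G'(2) approx G(3) by (intro tendsto_intros) (auto simp: bad_def \<Delta>_def P'_def)
 hence "\<forall>\<^sub>F n in sequentially. (\<integral>om. h n om \<partial>M')+4 * B * bad n+4 * B * \<Delta> n+2 * B * de n < e/2"
 using e by (intro order_tendstoD(2)) auto
 then obtain n where n: "(\<integral>om. h n om \<partial>M')+4 * B * bad n+4 * B * \<Delta> n+2 * B * de n < e/2"
 using eventually_happens'[OF sequentially_bot] by blast
 have s1: "(\<Sum>c\<in>C n. f n c * pp n c) <= (\<Sum>c\<in>C n. f n c * P' n c)+2 * B * \<Delta> n"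
 proof -
 have "(\<Sum>c\<in>C n. f n c * pp n c) <= (\<Sum>c\<in>C n. f n c * P' n c+2 * B * \<bar>pp n c - P' n c\<bar>)"
 proof (rule sum_mono)
 fix c
 have "f n c * (pp n c - P' n c) <= f n c * \<bar>pp n c - P' n c\<bar>" using f0 by (intro mult_left_mono) auto
 also have "... <= 2 * B * \<bar>pp n c - P' n c\<bar>" using f2 by (intro mult_right_mono) auto
 finally show "f n c * pp n c <= f n c * P' n c+2 * B * \<bar>pp n c - P' n c\<bar>" by (simp add: algebra_simps)
 qed
 thus ?thesis by (simp add: \<Delta>_def sum.distrib sum_distrib_left)
 qed
 have s2: "1 - (\<Sum>c\<in>C n. pp n c) <= bad n + \<Delta> n"
 proof -
 have "(\<Sum>c\<in>C n. P' n c) - \<Delta> n <= (\<Sum>c\<in>C n. pp n c)"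
 unfolding \<Delta>_def sum_subtractf[symmetric] by (rule sum_mono) linarith
 thus ?thesis using inC'[of n] by (simp add: bad_def)
 qed
 have "((%t. (\<Sum>c\<in>C n. f n c * P n t c)+2 * B * (1 - (\<Sum>c\<in>C n. P n t c))) \<longlongrightarrow>
 (\<Sum>c\<in>C n. f n c * pp n c)+2 * B * (1 - (\<Sum>c\<in>C n. pp n c))) F"
 unfolding P_def by (intro tendsto_intros lim) auto
 hence "\<forall>\<^sub>F t in F. (\<Sum>c\<in>C n. f n c * P n t c)+2 * B * (1 - (\<Sum>c\<in>C n. P n t c)) <
 (\<Sum>c\<in>C n. f n c * pp n c)+2 * B * (1 - (\<Sum>c\<in>C n. pp n c))+e/2"
 using e by (intro order_tendstoD(2)) auto
 with G(2)[of n] Ym(1) show ?thesis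
 proof eventually_elim
 case (elim t)
 have "2 * B * (1 - (\<Sum>c\<in>C n. pp n c)) <= 2 * B * (bad n + \<Delta> n)" using s2 B0 by (intro mult_left_mono) auto
 moreover have "2 * B * M.prob (space M - G n t) <= 2 * B * de n" using elim B0 by (intro mult_left_mono) auto
 ultimately have "(\<integral>om. Y t om \<partial>M)+B < (\<Sum>c\<in>C n. f n c * P' n c)+2 * B * \<Delta> n+2 * B * (bad n + \<Delta> n)+e/2+2 * B * de n"
 using up[OF elim(2), of n] elim(3) s1 by linarith
 also have "... = (\<Sum>c\<in>C n. f n c * P' n c)+2 * B * bad n+4 * B * \<Delta> n+e/2+2 * B * de n"
 by (simp add: algebra_simps)
 finally show ?case using low[of n] n unfolding bad_def by linarith
 qed
qed

text \<open>The main tool: convergence of expectations without tightness.\<close>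

text \<open>A continuous mapping argument without tightness: both sides carry a finite-valued code, the codes have asymptotically the same law, and on large events equal codes force nearby values of the functionals. Then the expectations converge, although the two sides live on different probability spaces.\<close>

lemma conv_expectation_codes:
 fixes Y :: "'i => 'a => real" and Y' :: "'b => real" and F :: "'i filter"
 and ka :: "nat => 'i => 'a => 'c" and ka' :: "nat => 'b => 'c"
 assumes PM: "prob_space M" and PM': "prob_space M'"
 and B: "!!t om. om : space M ==> \<bar>Y t om\<bar> <= B" "!!om. om : space M' ==> \<bar>Y' om\<bar> <= B"
 and Ym: "\<forall>\<^sub>F t in F. Y t : borel_measurable M" "Y' : borel_measurable M'"
 and fin: "!!n. finite (C n)"
 and km: "!!n t c. {om : space M. ka n t om = c} : sets M" "!!n c. {om : space M'. ka' n om = c} : sets M'"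
 and lim: "!!n c. c : C n ==> ((%t. measure M {om : space M. ka n t om = c}) \<longlongrightarrow> pp n c) F"
 and approx: "(%n. \<Sum>c\<in>C n. \<bar>pp n c - measure M' {om : space M'. ka' n om = c}\<bar>) \<longlonglongrightarrow> 0"
 and G': "!!n. G' n : sets M'" "(%n. measure M' {om : space M'. ~ (om : G' n & ka' n om : C n)}) \<longlonglongrightarrow> 0"
 and G: "!!n t. G n t : sets M" "!!n. \<forall>\<^sub>F t in F. measure M (space M - G n t) <= de n" "de \<longlonglongrightarrow> 0"
 and match: "!!om' ep. om' : space M' ==> ep > 0 ==> \<forall>\<^sub>F n in sequentially. om' : G' n --> ka' n om' : C n -->
 (ALL t. ALL om:G n t. ka n t om = ka' n om' --> \<bar>Y t om - Y' om'\<bar> <= ep)"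
 shows "((%t. \<integral>om. Y t om \<partial>M) \<longlongrightarrow> (\<integral>om. Y' om \<partial>M')) F"
proof (rule tendstoI)
 fix e :: real assume e: "e > 0"
 have 1: "\<forall>\<^sub>F t in F. (\<integral>om. Y t om \<partial>M) <= (\<integral>om. Y' om \<partial>M')+e/2"
 proof (rule conv_expectation_upper[OF PM PM' B Ym fin km lim approx G' G])
 fix om' and ep :: real assume a: "om' : space M'" "ep > 0"
 show "\<forall>\<^sub>F n in sequentially. om' : G' n --> ka' n om' : C n -->
 (ALL t. ALL om:G n t. ka n t om = ka' n om' --> Y t om <= Y' om' + ep)"
 using match[OF a] by (rule eventually_mono) (force simp: abs_le_iff)
 qed (use e in auto)
 have 2: "\<forall>\<^sub>F t in F. (\<integral>om. - Y t om \<partial>M) <= (\<integral>om. - Y' om \<partial>M')+e/2"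
 proof (rule conv_expectation_upper[OF PM PM' _ _ _ _ fin km lim approx G' G, where B=B])
 show "\<forall>\<^sub>F t in F. (%om. - Y t om) : borel_measurable M" using Ym(1) by (rule eventually_mono) simp
 show "(%om. - Y' om) : borel_measurable M'" using Ym(2) by simp
 fix om' and ep :: real assume a: "om' : space M'" "ep > 0"
 show "\<forall>\<^sub>F n in sequentially. om' : G' n --> ka' n om' : C n -->
 (ALL t. ALL om:G n t. ka n t om = ka' n om' --> - Y t om <= - Y' om' + ep)"
 using match[OF a] by (rule eventually_mono) (force simp: abs_le_iff)
 qed (use e B in auto)
 from 1 2 show "\<forall>\<^sub>F t in F. dist (\<integral>om. Y t om \<partial>M) (\<integral>om. Y' om \<partial>M') < e"
 by eventually_elim (use e in \<open>auto simp: dist_real_def\<close>)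
qed

section \<open>The surrogate points\<close>

lemma prod_one_minus_tendsto:
 fixes p :: "'i => 'j => real" and I :: "'i => 'j set"
 assumes fin: "!!t. finite (I t)"
 and p: "\<forall>\<^sub>F t in F. ALL i:I t. 0 <= p t i & p t i <= \<rho> t" and rho: "(\<rho> \<longlongrightarrow> 0) F"
 and sum: "((%t. \<Sum>i\<in>I t. p t i) \<longlongrightarrow> m) F"
 shows "((%t. \<Prod>i\<in>I t. 1 - p t i) \<longlongrightarrow> exp (- m)) F"
proof (rule tendsto_sandwich)
 have rho2: "\<forall>\<^sub>F t in F. \<rho> t < 1/2" by (rule order_tendstoD(2)[OF rho]) simp
 show "\<forall>\<^sub>F t in F. exp (- (\<Sum>i\<in>I t. p t i) - 2 * \<rho> t * (\<Sum>i\<in>I t. p t i)) <= (\<Prod>i\<in>I t. 1 - p t i)"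
 using p rho2
 proof eventually_elim
 case (elim t)
 have "exp (- (\<Sum>i\<in>I t. p t i) - 2 * \<rho> t * (\<Sum>i\<in>I t. p t i)) = exp (\<Sum>i\<in>I t. - p t i - 2 * \<rho> t * p t i)"
 by (simp add: sum_subtractf sum_negf sum_distrib_left)
 also have "... = (\<Prod>i\<in>I t. exp (- p t i - 2 * \<rho> t * p t i))" by (rule exp_sum[OF fin])
 also have "... <= (\<Prod>i\<in>I t. 1 - p t i)"
 proof (rule prod_mono)
 fix i assume i: "i : I t"
 have pi: "0 <= p t i" "p t i <= \<rho> t" "p t i <= 1/2" using elim i by force+
 have "p t i * p t i <= \<rho> t * p t i" using pi by (intro mult_right_mono) auto
 hence "- p t i - 2 * \<rho> t * p t i <= - p t i - 2 * (p t i)\<^sup>2" by (simp add: power2_eq_square)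
 also have "... <= ln (1 - p t i)" using pi by (intro ln_one_minus_pos_lower_bound)
 finally have "exp (- p t i - 2 * \<rho> t * p t i) <= exp (ln (1 - p t i))" by simp
 thus "0 <= exp (- p t i - 2 * \<rho> t * p t i) & exp (- p t i - 2 * \<rho> t * p t i) <= 1 - p t i" using pi by simp
 qed
 finally show ?case .
 qed
 show "\<forall>\<^sub>F t in F. (\<Prod>i\<in>I t. 1 - p t i) <= exp (- (\<Sum>i\<in>I t. p t i))"
 using p rho2
 proof eventually_elim
 case (elim t)
 have "(\<Prod>i\<in>I t. 1 - p t i) <= (\<Prod>i\<in>I t. exp (- p t i))"
 proof (rule prod_mono)
 fix i assume "i : I t"
 hence "p t i <= 1/2" using elim by force
 thus "0 <= 1 - p t i & 1 - p t i <= exp (- p t i)" using exp_ge_add_one_self[of "- p t i"] by simp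
 qed
 thus ?case by (simp add: exp_sum[OF fin] sum_negf[symmetric])
 qed
 show "((%t. exp (- (\<Sum>i\<in>I t. p t i) - 2 * \<rho> t * (\<Sum>i\<in>I t. p t i))) \<longlongrightarrow> exp (- m)) F"
 using tendsto_exp[OF tendsto_diff[OF tendsto_minus[OF sum] tendsto_mult[OF tendsto_mult_left[OF rho, of 2] sum]]] by simp
 show "((%t. exp (- (\<Sum>i\<in>I t. p t i))) \<longlongrightarrow> exp (- m)) F"
 by (intro tendsto_intros sum)
qed

context rate_poisson begin

lemma S_eq_sum: "om : space M ==> S n om = (\<Sum>i<n. X i om)"
proof (induction n)
 case (Suc n)
 thus ?case by (simp add: X_def)
qed (simp add: S_0)

lemma S_Chebyshev: assumes "y > 0"
 shows "prob {om : space M. \<bar>S n om - real n\<bar> >= y} <= real n/y\<^sup>2"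
proof (cases n)
 case 0
 hence e: "{om : space M. \<bar>S n om - real n\<bar> >= y} = {}" using assms by (auto simp: S_0)
 show ?thesis unfolding e using 0 by simp
next
 case (Suc k)
 have D: "distributed M lborel (%om. \<Sum>i<n. X i om) (erlang_density (card {..<n} - 1) 1)"
 using Suc by (intro exponential_distributed_sum indep_vars_subset[OF X_indep] X_exponential) auto
 hence D: "distributed M lborel (%om. \<Sum>i<n. X i om) (erlang_density k 1)" using Suc by simp
 have E: "expectation (%om. \<Sum>i<n. X i om) = real n"
 using erlang_ith_moment[OF zero_less_one D, of 1] Suc by simp
 have V: "expectation (%om. ((\<Sum>i<n. X i om) - real n)\<^sup>2) = real n"
 using erlang_distributed_variance[OF zero_less_one D] Suc unfolding E by simp
 have "prob {om : space M. \<bar>(\<Sum>i<n. X i om) - expectation (%om. \<Sum>i<n. X i om)\<bar> >= y} <= variance (%om. \<Sum>i<n. X i om)/y\<^sup>2"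
 using assms erlang_ith_moment_integrable[OF zero_less_one D, of 2] by (intro Chebyshev_inequality) auto
 moreover have "{om : space M. \<bar>S n om - real n\<bar> >= y} = {om : space M. \<bar>(\<Sum>i<n. X i om) - real n\<bar> >= y}"
 using S_eq_sum by auto
 ultimately show ?thesis unfolding E V by simp
qed

text \<open>Control at the multiples of \<open>m\<close> gives control in between by monotonicity.\<close>

lemma S_uniform_LLN:
 assumes m: "m > 0"
 shows "prob {om : space M. EX i<=k * m. \<bar>S i om - real i\<bar> > 2 * real m} <= 2 * (real k)\<^sup>2/real m"
proof -
 have mono: "AE om in M. ALL i j. i <= j --> S i om <= S j om"
 using AE_S_less
 proof eventually_elim
 case (elim om)
 thus ?case using lift_Suc_mono_le[of "%i. S i om"] by (simp add: less_imp_le)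
 qed
 define D where "D = (\<Union>j\<in>{..k}. {om : space M. \<bar>S (j * m) om - real (j * m)\<bar> >= real m})"
 have [measurable]: "D : sets M" unfolding D_def by measurable
 have "prob {om : space M. EX i<=k * m. \<bar>S i om - real i\<bar> > 2 * real m} <= prob D"
 proof (rule finite_measure_mono_AE)
 show "AE om in M. om : {om : space M. EX i<=k * m. \<bar>S i om - real i\<bar> > 2 * real m} --> om : D"
 using mono
 proof eventually_elim
 case (elim om)
 show ?case
 proof (rule impI, rule ccontr)
 assume a: "om : {om : space M. EX i<=k * m. \<bar>S i om - real i\<bar> > 2 * real m}" and nD: "om ~: D"
 then obtain i where i: "i <= k * m" "\<bar>S i om - real i\<bar> > 2 * real m" by auto
 have n: "\<bar>S (j * m) om - real (j * m)\<bar> < real m" if "j <= k" for j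
 using nD a that by (auto simp: D_def not_le)
 define j where "j = i div m"
 have j: "j * m <= i" "i < (j+1) * m" using m by (auto simp: j_def dividend_less_div_times)
 have "i div m <= k" using i(1) m by (metis div_le_mono nonzero_mult_div_cancel_right less_numeral_extra(3))
 hence jk: "j <= k" by (simp add: j_def)
 have ji: "real (j * m) <= real i" "real i < real (j * m)+real m"
 proof -
 show "real (j * m) <= real i" using j(1) of_nat_le_iff by blast
 have "real i < real ((j+1) * m)" using j(2) of_nat_less_iff by blast
 thus "real i < real (j * m)+real m" by (simp add: algebra_simps)
 qed
 have "S (j * m) om <= S i om" using elim j by blast
 hence lo: "S i om - real i > - 2 * real m" using n[OF jk] ji by linarith
 have "S i om - real i < 2 * real m"
 proof (cases "j = k")
 case True
 hence "i = j * m" using i(1) j by simp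
 thus ?thesis using n[OF jk] m by auto
 next
 case False
 hence "j+1 <= k" using jk by simp
 from n[OF this] have "S ((j+1) * m) om < real ((j+1) * m)+real m" by linarith
 moreover have "S i om <= S ((j+1) * m) om" using elim j by auto
 ultimately show ?thesis using ji by (simp add: algebra_simps)
 qed
 thus False using lo i(2) by linarith
 qed
 qed
 qed measurable
 also have "prob D <= (\<Sum>j\<in>{..k}. prob {om : space M. \<bar>S (j * m) om - real (j * m)\<bar> >= real m})"
 unfolding D_def by (rule finite_measure_subadditive_finite) auto
 also have "... <= (\<Sum>j\<in>{..k}. real (j * m)/(real m)\<^sup>2)"
 using m by (intro sum_mono S_Chebyshev) simp
 also have "... <= 2 * (real k)\<^sup>2/real m"
 proof (cases "k = 0")
 case False
 have "(\<Sum>j\<in>{..k}. real (j * m)/(real m)\<^sup>2) <= (\<Sum>j\<in>{..k}. real k/real m)"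
 using m by (intro sum_mono) (auto simp: power2_eq_square field_simps)
 also have "... = (real k+1) * real k/real m" by simp
 also have "... <= (2 * real k) * real k/real m"
 using False by (intro divide_right_mono mult_right_mono) auto
 finally show ?thesis by (simp add: power2_eq_square)
 qed simp
 finally show ?thesis .
qed

lemma X_prob_interval:
 assumes y: "0 <= y" "y <= y'" "y' <= 1"
 shows "prob {om : space M. y <= exp (- X i om) & exp (- X i om) < y'} = y' - y"
proof -
 have lt: "prob {om : space M. exp (- X i om) < c} = c" if c: "0 <= c" "c <= 1" for c
 proof (cases "c = 0")
 case True thus ?thesis by (simp add: not_less)
 next
 case False
 hence c0: "c > 0" using c by simp
 have "exp (- X i om) < c \<longleftrightarrow> X i om > - ln c" for om
 proof -
 have "exp (- X i om) < c \<longleftrightarrow> exp (- X i om) < exp (ln c)" using c0 by simp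
 also have "... \<longleftrightarrow> X i om > - ln c" by (simp only: exp_less_cancel_iff) linarith
 finally show ?thesis .
 qed
 hence "prob {om : space M. exp (- X i om) < c} = exp (- (- ln c))"
 using X_tail[of "- ln c" i] c c0 by (simp add: ln_le_zero_iff)
 thus ?thesis using c0 by simp
 qed
 have "{om : space M. y <= exp (- X i om) & exp (- X i om) < y'} =
 {om : space M. exp (- X i om) < y'} - {om : space M. exp (- X i om) < y}" by auto
 also have "prob ... = prob {om : space M. exp (- X i om) < y'} - prob {om : space M. exp (- X i om) < y}"
 using y by (intro finite_measure_Diff) auto
 finally show ?thesis using lt y by simp
qed

end

text \<open>The grid of squares of side \<open>h\<close>.\<close>

definition cell :: "real => nat \<times> nat => (real \<times> real) set" where
 "cell h c = {real (fst c) * h..<real (fst c+1) * h} \<times> {real (snd c) * h..<real (snd c+1) * h}"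

lemma cell_disjoint: assumes "h > 0" "x : cell h c" "x : cell h c'" shows "c = c'"
proof -
 have *: "j = j'" if "real j * h <= y" "y < real (j+1) * h" "real j' * h <= y" "y < real (j' + 1) * h" for j j' y
 proof -
 have "real j * h < real (j' + 1) * h" "real j' * h < real (j+1) * h" using that by linarith+
 hence "j < j' + 1" "j' < j+1" using assms(1) by (simp_all only: mult_less_cancel_right_pos of_nat_less_iff)
 thus ?thesis by simp
 qed
 show ?thesis using assms(2,3) *[of "fst c" "fst x" "fst c'"] *[of "snd c" "snd x" "snd c'"]
 by (intro prod_eqI) (auto simp: cell_def mem_Times_iff)
qed

locale gap_setting = smooth_rate lam al+rate_poisson lam al M N
 for lam :: "real => real" and al and M :: "'a measure" and N
begin

definition "a = al * (1 - al)"
definition "bt t = ln (Lam t) - ln (ln t) - ln (1 - al)"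
definition "be t = (1 - al) * ln t/Lam t"

text \<open>The surrogate for the point of the \<open>i\<close>-th gap (counted from 0).\<close>

definition "Q t i = exp (- (Lam t - real (Suc i)) * be t)"
definition "P t i om = exp (- X i om)/(be t * Q t i)"

lemma a_pos: "0 < a" using alpha by (simp add: a_def)

lemma Q_pos [simp]: "0 < Q t i" by (simp add: Q_def)

lemma large_t: "\<forall>\<^sub>F t in at_top. 1 < t & 1 < ln t & 1 < Lam t & 0 < be t & exp (- bt t) = be t"
 using ln_Lam_bounds
proof eventually_elim
 case (elim t)
 have "exp (- bt t) = (1 - al) * ln t/Lam t"
 using elim alpha by (simp add: bt_def exp_diff exp_add exp_minus field_simps)
 thus ?case using elim alpha by (simp add: be_def)
qed

lemma beta_tendsto: "(be \<longlongrightarrow> 0) at_top"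
proof -
 have "((%w::real. ln w/w) \<longlongrightarrow> 0) at_top" by real_asymp
 from filterlim_compose[OF this Lam_at_top] have 1: "((%t. ln (Lam t)/Lam t) \<longlongrightarrow> 0) at_top" .
 have "((%t. (1 - al) * (2/al) * (ln (Lam t)/Lam t)) \<longlongrightarrow> (1 - al) * (2/al) * 0) at_top"
 by (intro tendsto_mult_left 1)
 hence up: "((%t. (1 - al) * (2/al) * (ln (Lam t)/Lam t)) \<longlongrightarrow> 0) at_top" by simp
 show ?thesis
 proof (rule tendsto_sandwich[OF _ _ tendsto_const up])
 show "\<forall>\<^sub>F t in at_top. 0 <= be t" using large_t by eventually_elim simp
 show "\<forall>\<^sub>F t in at_top. be t <= (1 - al) * (2/al) * (ln (Lam t)/Lam t)"
 using ln_Lam_bounds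
 proof eventually_elim
 case (elim t)
 have "ln t <= 2/al * ln (Lam t)" using elim alpha by (simp add: field_simps)
 hence "(1 - al) * ln t <= (1 - al) * (2/al * ln (Lam t))" using alpha by (intro mult_left_mono) auto
 hence "(1 - al) * ln t/Lam t <= (1 - al) * (2/al * ln (Lam t))/Lam t"
 using elim by (intro divide_right_mono) auto
 also have "... = (1 - al) * (2/al) * (ln (Lam t)/Lam t)" by (simp add: field_simps)
 finally show ?case unfolding be_def .
 qed
 qed
qed

lemma Lam_beta: "\<forall>\<^sub>F t in at_top. Lam t * be t = (1 - al) * ln t"
 using ln_Lam_bounds by eventually_elim (simp add: be_def)

lemma Lam_beta_at_top: "LIM t at_top. Lam t * be t :> at_top"
proof -
 have "LIM t at_top. (1 - al) * ln t :> at_top"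
 using alpha by (intro filterlim_tendsto_pos_mult_at_top[OF tendsto_const _ ln_at_top]) auto
 thus ?thesis
 by (rule filterlim_cong[OF refl refl, THEN iffD1, rotated]) (use Lam_beta in \<open>auto elim: eventually_mono\<close>)
qed

lemma Q_Suc: "Q t (Suc i) = Q t i * exp (be t)"
 unfolding Q_def exp_add[symmetric] by (simp add: algebra_simps)

lemma Q_less_iff: assumes "be t > 0" "q > 0"
 shows "Q t i < q \<longleftrightarrow> real (Suc i) < Lam t+ln q/be t"
proof -
 have "Q t i < q \<longleftrightarrow> - (Lam t - real (Suc i)) * be t < ln q"
 using assms by (simp add: Q_def ln_less_cancel_iff[symmetric] del: ln_less_cancel_iff)
 also have "... \<longleftrightarrow> - (Lam t - real (Suc i)) < ln q/be t"
 using assms by (simp add: pos_less_divide_eq)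
 finally show ?thesis by linarith
qed

lemma Q_less_set: assumes "be t > 0" shows "EX m. {i. Q t i < q} = {..<m}"
proof (cases "q > 0")
 case True
 define x where "x = Lam t+ln q/be t"
 have "{i. Q t i < q} = {..<nat (\<lceil>x\<rceil> - 1)}"
 proof (rule set_eqI)
 fix i
 have "real (Suc i) < x \<longleftrightarrow> i < nat (\<lceil>x\<rceil> - 1)" by linarith
 thus "i : {i. Q t i < q} \<longleftrightarrow> i : {..<nat (\<lceil>x\<rceil> - 1)}"
 unfolding mem_Collect_eq Q_less_iff[OF assms True] x_def[symmetric] by simp
 qed
 thus ?thesis ..
next
 case False
 have "~ Q t i < q" for i using Q_pos[of t i] False by linarith
 hence "{i. Q t i < q} = {..<0}" by simp
 thus ?thesis ..
qed

lemma sum_Q: assumes "be t > 0" shows "(\<Sum>i<m. Q t i) = (Q t m - Q t 0)/(exp (be t) - 1)"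
proof -
 have "exp (be t) ~= 1" using assms by simp
 moreover have "(\<Sum>i<m. Q t i) * (exp (be t) - 1) = Q t m - Q t 0"
 by (induction m) (simp_all add: Q_Suc algebra_simps)
 ultimately show ?thesis by (simp add: field_simps)
qed

lemma Q_mass: assumes q: "q >= 0"
 shows "((%t. be t * (\<Sum>i | Q t i < q. Q t i)) \<longlongrightarrow> q) at_top"
proof (cases "q = 0")
 case True
 have "~ Q t i < q" for t i using Q_pos[of t i] True by linarith
 hence "{i. Q t i < q} = {}" for t by simp
 thus ?thesis using True by simp
next
 case False
 hence q0: "q > 0" using q by simp
 define K where "K t = be t/(exp (be t) - 1)" for t
 have "((%x::real. x/(exp x - 1)) \<longlongrightarrow> 1) (at_right 0)" by real_asymp
 moreover have "filterlim be (at_right 0) at_top"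
 using beta_tendsto large_t by (intro filterlim_at_withinI) (auto elim: eventually_mono)
 ultimately have K: "(K \<longlongrightarrow> 1) at_top" unfolding K_def by (rule filterlim_compose)
 have Q0: "((%t. Q t 0) \<longlongrightarrow> 0) at_top"
 proof -
 have "filterlim (%t. - (Lam t * be t)) at_bot at_top"
 using Lam_beta_at_top by (simp add: filterlim_uminus_at_bot)
 hence "((%t. exp (- (Lam t * be t))) \<longlongrightarrow> 0) at_top"
 by (rule filterlim_compose[OF exp_at_bot])
 hence "((%t. exp (- (Lam t * be t)) * exp (be t)) \<longlongrightarrow> 0 * exp 0) at_top"
 by (intro tendsto_mult tendsto_exp beta_tendsto)
 thus ?thesis by (simp add: Q_def exp_add[symmetric] algebra_simps)
 qed
 have Kq: "((%t. K t * (q - Q t 0)) \<longlongrightarrow> 1 * (q - 0)) at_top" by (intro tendsto_intros K Q0)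
 have Kq': "((%t. K t * (q * exp (be t) - Q t 0)) \<longlongrightarrow> 1 * (q * exp 0 - 0)) at_top"
 by (intro tendsto_intros K Q0 beta_tendsto)
 have ev: "\<forall>\<^sub>F t in at_top. be t > 0 & Q t 0 < q"
 using large_t order_tendstoD(2)[OF Q0 q0] by eventually_elim auto
 have bounds: "\<forall>\<^sub>F t in at_top. K t * (q - Q t 0) <= be t * (\<Sum>i | Q t i < q. Q t i) &
 be t * (\<Sum>i | Q t i < q. Q t i) <= K t * (q * exp (be t) - Q t 0)"
 using ev
 proof eventually_elim
 case (elim t)
 obtain m where m: "{i. Q t i < q} = {..<m}" using Q_less_set elim by blast
 have "m ~= 0" using m elim by auto
 then obtain k where k: "m = Suc k" by (cases m) auto
 have "m ~: {i. Q t i < q}" "k : {i. Q t i < q}" unfolding m by (auto simp: k)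
 hence Qm: "q <= Q t m" "Q t m <= q * exp (be t)" by (auto simp: k Q_Suc)
 have K0: "K t >= 0" using elim by (simp add: K_def)
 have "be t * (\<Sum>i | Q t i < q. Q t i) = K t * (Q t m - Q t 0)"
 using elim by (simp add: m sum_Q K_def)
 thus ?case using Qm K0 by (auto intro!: mult_left_mono)
 qed
 show ?thesis
 by (rule tendsto_sandwich[of "%t. K t * (q - Q t 0)" _ _ "%t. K t * (q * exp (be t) - Q t 0)"])
 (use bounds Kq Kq' in \<open>auto elim: eventually_mono\<close>)
qed

end

context gap_setting begin

lemma Q_nonneg [simp]: "0 <= Q t i"
 using Q_pos[of t i] by linarith

text \<open>The probability that surrogate \<open>i\<close> lies in a given cell.\<close>

lemma P_meas [measurable]: "P t i : borel_measurable M"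
 unfolding P_def[abs_def] by measurable

definition "pc t h c i = (if real (snd c) * h <= Q t i & Q t i < real (snd c+1) * h then h * (be t * Q t i) else 0)"

lemma cell_event [measurable]: "{om : space M. (P t i om, Q t i) : cell h c} : sets M"
 unfolding cell_def by measurable

lemma cell_events_finite: "{om : space M. EX c:Z. (P t i om, Q t i) : cell h c} : sets M" if "finite Z"
proof -
 have "{om : space M. EX c:Z. (P t i om, Q t i) : cell h c} = (\<Union>c\<in>Z. {om : space M. (P t i om, Q t i) : cell h c})" by auto
 thus ?thesis using that cell_event by auto
qed

lemma prob_cell:
 assumes "be t > 0" "h > 0" "real (fst c+1) * h * (be t * Q t i) <= 1"
 shows "prob {om : space M. (P t i om, Q t i) : cell h c} = pc t h c i"
proof (cases "real (snd c) * h <= Q t i & Q t i < real (snd c+1) * h")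
 case True
 define B where "B = be t * Q t i"
 have B: "B > 0" using assms by (simp add: B_def)
 have "(P t i om, Q t i) : cell h c \<longleftrightarrow> real (fst c) * h * B <= exp (- X i om) & exp (- X i om) < real (fst c+1) * h * B" for om
 using True B by (simp add: cell_def P_def B_def[symmetric] pos_le_divide_eq pos_divide_less_eq)
 hence "prob {om : space M. (P t i om, Q t i) : cell h c} = real (fst c+1) * h * B - real (fst c) * h * B"
 using assms B by (simp only:) (intro X_prob_interval, auto simp: B_def[symmetric] intro!: mult_right_mono)
 thus ?thesis using True by (simp add: pc_def B_def algebra_simps)
next
 case False
 hence e: "{om : space M. (P t i om, Q t i) : cell h c} = {}" by (auto simp: cell_def)
 show ?thesis unfolding e pc_def using False by (subst if_not_P) auto
qed

lemma prob_cells: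
 assumes "be t > 0" "h > 0" "finite Z" "!!c. c : Z ==> real (fst c+1) * h * (be t * Q t i) <= 1"
 shows "prob {om : space M. EX c:Z. (P t i om, Q t i) : cell h c} = (\<Sum>c\<in>Z. pc t h c i)"
proof -
 have "{om : space M. EX c:Z. (P t i om, Q t i) : cell h c} = (\<Union>c\<in>Z. {om : space M. (P t i om, Q t i) : cell h c})" by auto
 also have "prob ... = (\<Sum>c\<in>Z. prob {om : space M. (P t i om, Q t i) : cell h c})"
 using assms cell_disjoint[OF assms(2)]
 by (intro finite_measure_finite_Union) (auto simp: disjoint_family_on_def)
 also have "... = (\<Sum>c\<in>Z. pc t h c i)" using assms by (intro sum.cong refl prob_cell) auto
 finally show ?thesis .
qed

lemma sum_pc:
 assumes "h > 0" "real (snd c+1) * h <= H"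
 shows "((%t. \<Sum>i | Q t i < H. pc t h c i) \<longlongrightarrow> h * h) at_top"
proof -
 define q0 q1 where "q0 = real (snd c) * h" and "q1 = real (snd c+1) * h"
 have q: "0 <= q0" "q0 <= q1" "q1 - q0 = h" "q1 <= H"
 using assms by (auto simp: q0_def q1_def algebra_simps)
 have "((%t. h * (be t * (\<Sum>i | Q t i < q1. Q t i) - be t * (\<Sum>i | Q t i < q0. Q t i))) \<longlongrightarrow> h * (q1 - q0)) at_top"
 using q by (intro tendsto_intros Q_mass) auto
 hence "((%t. \<Sum>i | Q t i < H. pc t h c i) \<longlongrightarrow> h * (q1 - q0)) at_top"
 proof (rule Lim_transform_eventually)
 show "\<forall>\<^sub>F t in at_top. h * (be t * (\<Sum>i | Q t i < q1. Q t i) - be t * (\<Sum>i | Q t i < q0. Q t i)) =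
 (\<Sum>i | Q t i < H. pc t h c i)"
 using large_t
 proof eventually_elim
 case (elim t)
 have pcq: "pc t h c i = (if q0 <= Q t i & Q t i < q1 then h * (be t * Q t i) else 0)" for i
 by (simp add: pc_def q0_def q1_def)
 have fin: "finite {i. Q t i < q}" for q using Q_less_set[of t q] elim by (metis finite_lessThan)
 have "(\<Sum>i | Q t i < H. pc t h c i) = (\<Sum>i\<in>{i. Q t i < q1} - {i. Q t i < q0}. h * (be t * Q t i))"
 using q(1,2,4) fin by (intro sum.mono_neutral_cong_right) (auto simp: pcq not_less)
 also have "... = (\<Sum>i | Q t i < q1. h * (be t * Q t i)) - (\<Sum>i | Q t i < q0. h * (be t * Q t i))"
 using q fin by (intro sum_diff) auto
 finally show ?case by (simp add: sum_distrib_left algebra_simps)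
 qed
 qed
 thus ?thesis using q by simp
qed

text \<open>Void probabilities of finite unions of cells converge to those of the Poisson process.\<close>

definition "void t h Z = {om : space M. ALL i. ALL c:Z. (P t i om, Q t i) ~: cell h c}"

lemma void_event: "finite Z ==> void t h Z : sets M"
proof -
 assume "finite Z"
 have "void t h Z = space M - (\<Union>i. {om : space M. EX c:Z. (P t i om, Q t i) : cell h c})"
 by (auto simp: void_def)
 thus ?thesis using cell_events_finite[OF \<open>finite Z\<close>] by auto
qed

lemma window_bounds:
 assumes h: "h > 0" and fin: "finite (Z :: (nat \<times> nat) set)"
 shows "EX H>0. ALL c:Z. real (fst c+1) * h <= H & real (snd c+1) * h <= H"
proof -
 define H where "H = (\<Sum>c\<in>Z. real (fst c+1) * h+real (snd c+1) * h)+1"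
 have le: "real (fst c+1) * h+real (snd c+1) * h <= H" if "c : Z" for c
 using member_le_sum[of c Z "%c. real (fst c+1) * h+real (snd c+1) * h"] that fin h
 by (simp add: H_def)
 have nn: "0 <= real (fst c+1) * h" "0 <= real (snd c+1) * h" for c :: "nat \<times> nat" using h by auto
 have "0 <= (\<Sum>c\<in>Z. real (fst c+1) * h+real (snd c+1) * h)" using nn by (intro sum_nonneg add_nonneg_nonneg)
 hence "H > 0" by (simp add: H_def)
 moreover have "real (fst c+1) * h <= H & real (snd c+1) * h <= H" if "c : Z" for c
 using le[OF that] nn[of c] by linarith
 ultimately show ?thesis by blast
qed

text \<open>For independent points the probability of a void is a product, and \<open>P t i \<omega> < x\<close> has probability \<open>x \<beta> Q\<close> for an exponential variable up to boundary terms. The points \<open>Q t i\<close> form a geometric grid of mesh \<open>\<beta> t\<close>, so the exponent is a Riemann sum of the area.\<close>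

lemma void_tendsto:
 fixes h :: real
 assumes h: "h > 0" and fin: "finite Z"
 shows "((%t. prob (void t h Z)) \<longlongrightarrow> exp (- (h * h * card Z))) at_top"
proof -
 obtain H where H: "H > 0" "!!c. c : Z ==> real (fst c+1) * h <= H" "!!c. c : Z ==> real (snd c+1) * h <= H"
 using window_bounds[OF h fin] by blast
 define I where "I t = (if be t > 0 then {i. Q t i < H} else {})" for t
 have finI: "finite (I t)" for t
 proof (cases "be t > 0")
 case True
 then obtain m where "{i. Q t i < H} = {..<m}" using Q_less_set by blast
 thus ?thesis by (simp add: I_def)
 qed (simp add: I_def)
 have HH: "((%t. H * H * be t) \<longlongrightarrow> H * H * 0) at_top" by (intro tendsto_intros beta_tendsto)
 hence small: "\<forall>\<^sub>F t in at_top. H * H * be t < 1" by (intro order_tendstoD(2)) auto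
 have lim: "((%t. \<Prod>i\<in>I t. 1 - (\<Sum>c\<in>Z. pc t h c i)) \<longlongrightarrow> exp (- (\<Sum>c\<in>Z. h * h))) at_top"
 proof (rule prod_one_minus_tendsto[OF finI])
 show "\<forall>\<^sub>F t in at_top. ALL i:I t. 0 <= (\<Sum>c\<in>Z. pc t h c i) & (\<Sum>c\<in>Z. pc t h c i) <= card Z * (h * (be t * H))"
 using large_t
 proof eventually_elim
 case (elim t)
 show ?case
 proof (intro ballI conjI)
 fix i assume i: "i : I t"
 show "0 <= (\<Sum>c\<in>Z. pc t h c i)" using h elim by (intro sum_nonneg) (simp add: pc_def less_imp_le)
 have "(\<Sum>c\<in>Z. pc t h c i) <= (\<Sum>c\<in>Z. h * (be t * H))"
 using i h elim H(1) by (intro sum_mono) (auto simp: pc_def I_def intro!: mult_left_mono)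
 thus "(\<Sum>c\<in>Z. pc t h c i) <= card Z * (h * (be t * H))" by simp
 qed
 qed
 have "((%t. card Z * (h * (be t * H))) \<longlongrightarrow> card Z * (h * (0 * H))) at_top"
 by (intro tendsto_intros beta_tendsto)
 thus "((%t. card Z * (h * (be t * H))) \<longlongrightarrow> 0) at_top" by simp
 have "((%t. \<Sum>c\<in>Z. \<Sum>i | Q t i < H. pc t h c i) \<longlongrightarrow> (\<Sum>c\<in>Z. h * h)) at_top"
 using h H by (intro tendsto_sum sum_pc)
 thus "((%t. \<Sum>i\<in>I t. \<Sum>c\<in>Z. pc t h c i) \<longlongrightarrow> (\<Sum>c\<in>Z. h * h)) at_top"
 proof (rule Lim_transform_eventually)
 show "\<forall>\<^sub>F t in at_top. (\<Sum>c\<in>Z. \<Sum>i | Q t i < H. pc t h c i) = (\<Sum>i\<in>I t. \<Sum>c\<in>Z. pc t h c i)"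
 using large_t by eventually_elim (simp add: I_def sum.swap[of _ Z])
 qed
 qed
 have eq: "\<forall>\<^sub>F t in at_top. (\<Prod>i\<in>I t. 1 - (\<Sum>c\<in>Z. pc t h c i)) = prob (void t h Z)"
 using large_t small
 proof eventually_elim
 case (elim t)
 have I: "I t = {i. Q t i < H}" using elim by (simp add: I_def)
 have pr: "prob {om : space M. EX c:Z. (P t i om, Q t i) : cell h c} = (\<Sum>c\<in>Z. pc t h c i)" if "i : I t" for i
 proof (rule prob_cells)
 fix c assume "c : Z"
 hence "real (fst c+1) * h * (be t * Q t i) <= H * (be t * H)"
 using H elim that h by (intro mult_mono) (auto simp: I intro!: mult_nonneg_nonneg)
 also have "H * (be t * H) = H * H * be t" by simp
 finally show "real (fst c+1) * h * (be t * Q t i) <= 1" using elim by linarith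
 qed (use elim h fin in auto)
 define B where "B i = {y. ALL c:Z. (exp (- y)/(be t * Q t i), Q t i) ~: cell h c}" for i
 have Bm: "B i : sets borel" for i
 proof -
 have "B i = space borel - (\<Union>c\<in>Z. {y : space borel. (exp (- y)/(be t * Q t i), Q t i) : cell h c})" by (auto simp: B_def)
 moreover have "{y : space borel. (exp (- y)/(be t * Q t i), Q t i) : cell h c} : sets borel" for c
 proof -
 have "(%y. exp (- y)/(be t * Q t i)) : borel_measurable borel" by measurable
 from measurable_sets[OF this, of "{real (fst c) * h..<real (fst c+1) * h}"]
 have "{y : space borel. exp (- y)/(be t * Q t i) : {real (fst c) * h..<real (fst c+1) * h}} : sets borel"
 by (simp add: vimage_def Int_def conj_commute)
 thus ?thesis by (cases "Q t i : {real (snd c) * h..<real (snd c+1) * h}") (simp_all add: cell_def)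
 qed
 ultimately show ?thesis using fin by auto
 qed
 have XB: "X i -` B i Int space M = space M - {om : space M. EX c:Z. (P t i om, Q t i) : cell h c}" for i
 by (auto simp: B_def P_def)
 have XP: "prob (X i -` B i Int space M) = 1 - (\<Sum>c\<in>Z. pc t h c i)" if "i : I t" for i
 unfolding XB using pr[OF that] cell_events_finite[OF fin] by (subst prob_compl) auto
 show ?case
 proof (cases "I t = {}")
 case True
 have out: "(P t i om, Q t i) ~: cell h c" if "c : Z" for i om c
 using True H(3)[OF that] by (auto simp: I cell_def not_less dest!: spec[of _ i])
 hence "void t h Z = space M" by (auto simp: void_def)
 thus ?thesis using True by (simp add: prob_space)
 next
 case False
 have "void t h Z = (\<Inter>i\<in>I t. X i -` B i Int space M)"
 proof (rule set_eqI)
 fix om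
 have "(P t i om, Q t i) ~: cell h c" if "c : Z" "i ~: I t" for i c
 using H(3)[OF that(1)] that by (auto simp: I cell_def not_less)
 thus "om : void t h Z \<longleftrightarrow> om : (\<Inter>i\<in>I t. X i -` B i Int space M)"
 using False unfolding XB by (auto simp: void_def)
 qed
 hence "prob (void t h Z) = (\<Prod>i\<in>I t. prob (X i -` B i Int space M))"
 using indep_varsD[OF X_indep False finI, of B] Bm by simp
 thus ?thesis using XP by simp
 qed
 qed
 from Lim_transform_eventually[OF lim eq] show ?thesis by (simp add: mult.commute)
qed

text \<open>Two surrogates in one cell.\<close>

definition "double t h Z = {om : space M. EX c:Z. EX i j. i < j & (P t i om, Q t i) : cell h c & (P t j om, Q t j) : cell h c}"

lemma double_event: assumes "finite Z" shows "double t h Z : sets M"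
proof -
 have "double t h Z = (\<Union>c\<in>Z. \<Union>i. \<Union>j\<in>{i<..}. {om : space M. (P t i om, Q t i) : cell h c} Int {om : space M. (P t j om, Q t j) : cell h c})"
 by (auto simp: double_def)
 also have "... : sets M"
 using assms by (intro sets.finite_UN sets.countable_UN' sets.Int cell_event) auto
 finally show ?thesis .
qed

text \<open>Two independent points in one cell cost the square of the area of the cell, which is negligible after summing over a fine partition.\<close>

lemma double_small:
 fixes h :: real
 assumes h: "h > 0" and fin: "finite Z"
 shows "\<forall>\<^sub>F t in at_top. prob (double t h Z) <= card Z * (2 * (h * h) * (h * h))"
proof -
 obtain H where H: "H > 0" "!!c. c : Z ==> real (fst c+1) * h <= H" "!!c. c : Z ==> real (snd c+1) * h <= H"
 using window_bounds[OF h fin] by blast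
 have HH: "((%t. H * H * be t) \<longlongrightarrow> H * H * 0) at_top" by (intro tendsto_intros beta_tendsto)
 hence small: "\<forall>\<^sub>F t in at_top. H * H * be t < 1" by (intro order_tendstoD(2)) auto
 have "\<forall>\<^sub>F t in at_top. ALL c:Z. (\<Sum>i | Q t i < H. pc t h c i) * (\<Sum>i | Q t i < H. pc t h c i) < 2 * (h * h) * (h * h)"
 proof (rule eventually_ball_finite[OF fin], rule ballI)
 fix c assume "c : Z"
 hence "((%t. (\<Sum>i | Q t i < H. pc t h c i) * (\<Sum>i | Q t i < H. pc t h c i)) \<longlongrightarrow> (h * h) * (h * h)) at_top"
 using h H by (intro tendsto_mult sum_pc)
 thus "\<forall>\<^sub>F t in at_top. (\<Sum>i | Q t i < H. pc t h c i) * (\<Sum>i | Q t i < H. pc t h c i) < 2 * (h * h) * (h * h)"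
 using h by (intro order_tendstoD(2)) auto
 qed
 thus ?thesis using large_t small
 proof eventually_elim
 case (elim t)
 define I where "I = {i. Q t i < H}"
 have finI: "finite I" using Q_less_set[of t H] elim by (auto simp: I_def)
 define A where "A c i = {om : space M. (P t i om, Q t i) : cell h c}" for c i
 have [measurable]: "A c i : sets M" for c i unfolding A_def by (rule cell_event)
 have pA: "prob (A c i) = pc t h c i" if "c : Z" "i : I" for c i
 proof -
 have "real (fst c+1) * h * (be t * Q t i) <= H * (be t * H)"
 using H elim that h by (intro mult_mono) (auto simp: I_def intro!: mult_nonneg_nonneg)
 also have "H * (be t * H) = H * H * be t" by simp
 finally have "real (fst c+1) * h * (be t * Q t i) <= 1" using elim by linarith
 thus ?thesis unfolding A_def using elim h by (intro prob_cell) auto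
 qed
 have AI: "i : I" if "om : A c i" "c : Z" for om c i
 using that H(3)[OF that(2)] by (auto simp: A_def I_def cell_def)
 have pAA: "prob (A c i Int A c j) = prob (A c i) * prob (A c j)" if "i < j" for c i j
 proof -
 define B where "B k = {y : space borel. (exp (- y)/(be t * Q t k), Q t k) : cell h c}" for k
 have B: "B k : sets borel" for k unfolding B_def cell_def by measurable
 have AB: "A c k = X k -` B k Int space M" for k by (auto simp: A_def B_def P_def)
 have "prob (\<Inter>k\<in>{i, j}. X k -` B k Int space M) = (\<Prod>k\<in>{i, j}. prob (X k -` B k Int space M))"
 using B by (intro indep_varsD[OF X_indep]) auto
 thus ?thesis using that by (simp add: AB)
 qed
 have "prob (double t h Z) <= prob (\<Union>c\<in>Z. \<Union>(i, j)\<in>{(i, j). i : I & j : I & i < j}. A c i Int A c j)"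
 proof (rule finite_measure_mono)
 have "finite {(i, j). i : I & j : I & i < j}"
 by (rule finite_subset[OF _ finite_cartesian_product[OF finI finI]]) auto
 thus "(\<Union>c\<in>Z. \<Union>(i, j)\<in>{(i, j). i : I & j : I & i < j}. A c i Int A c j) : sets M"
 using fin by (intro sets.finite_UN) auto
 show "double t h Z <= (\<Union>c\<in>Z. \<Union>(i, j)\<in>{(i, j). i : I & j : I & i < j}. A c i Int A c j)"
 proof
 fix om assume "om : double t h Z"
 then obtain c i j where *: "c : Z" "i < j" "om : A c i" "om : A c j" by (auto simp: double_def A_def)
 moreover have "i : I" "j : I" using AI * by auto
 ultimately show "om : (\<Union>c\<in>Z. \<Union>(i, j)\<in>{(i, j). i : I & j : I & i < j}. A c i Int A c j)" by blast
 qed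
 qed
 also have "... <= (\<Sum>c\<in>Z. prob (\<Union>(i, j)\<in>{(i, j). i : I & j : I & i < j}. A c i Int A c j))"
 proof (rule finite_measure_subadditive_finite[OF fin], clarify)
 fix c1 c2
 have "finite {(i, j). i : I & j : I & i < j}"
 by (rule finite_subset[OF _ finite_cartesian_product[OF finI finI]]) auto
 thus "(\<Union>(i, j)\<in>{(i, j). i : I & j : I & i < j}. A (c1, c2) i Int A (c1, c2) j) : sets M"
 by (intro sets.finite_UN) auto
 qed
 also have "... <= (\<Sum>c\<in>Z. 2 * (h * h) * (h * h))"
 proof (rule sum_mono)
 fix c assume c: "c : Z"
 let ?J = "{(i, j). i : I & j : I & i < j}"
 have J: "?J <= I \<times> I" by auto
 have finJ: "finite ?J" by (rule finite_subset[OF J finite_cartesian_product[OF finI finI]])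
 have "prob (\<Union>(i, j)\<in>?J. A c i Int A c j) <= (\<Sum>x\<in>?J. prob (case x of (i, j) => A c i Int A c j))"
 by (rule finite_measure_subadditive_finite[OF finJ]) auto
 also have "... = (\<Sum>(i, j)\<in>?J. pc t h c i * pc t h c j)"
 using c by (intro sum.cong) (auto simp: pAA pA)
 also have "... <= (\<Sum>(i, j)\<in>I \<times> I. pc t h c i * pc t h c j)"
 using J finI h elim by (intro sum_mono2) (auto simp: pc_def less_imp_le)
 also have "... = (\<Sum>i\<in>I. pc t h c i) * (\<Sum>i\<in>I. pc t h c i)"
 by (simp add: sum_product sum.cartesian_product)
 also have "... <= 2 * (h * h) * (h * h)" using elim(1) c by (simp add: I_def less_imp_le)
 finally show "prob (\<Union>(i, j)\<in>?J. A c i Int A c j) <= 2 * (h * h) * (h * h)" .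
 qed
 finally show ?case by simp
 qed
qed

end

section \<open>Typical trajectories\<close>

context gap_setting begin

lemma ln_ln_over_ln: "((%t::real. ln (ln t)/ln t) \<longlongrightarrow> 0) at_top"
 by real_asymp

lemma bt_over_ln: "((%t. bt t/ln t) \<longlongrightarrow> al) at_top"
proof -
 have "((%t. ln (1 - al)/ln t) \<longlongrightarrow> 0) at_top"
 by (rule tendsto_divide_0[OF tendsto_const filterlim_at_top_imp_at_infinity[OF ln_at_top]])
 hence "((%t. ln (Lam t)/ln t - ln (ln t)/ln t - ln (1 - al)/ln t) \<longlongrightarrow> al - 0 - 0) at_top"
 by (intro tendsto_diff ln_Lam_over_ln ln_ln_over_ln)
 thus ?thesis by (simp add: bt_def diff_divide_distrib)
qed

lemma lam_tendsto_0: "(lam \<longlongrightarrow> 0) at_top"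
proof -
 have 1: "((%t. ln (Lam t)/ln t - 1) \<longlongrightarrow> al - 1) at_top" by (intro tendsto_intros ln_Lam_over_ln)
 have "filterlim (%t. (ln (Lam t)/ln t - 1) * ln t) at_bot at_top"
 by (rule filterlim_tendsto_neg_mult_at_bot[OF 1 _ ln_at_top]) (use alpha in simp)
 hence "((%t. exp ((ln (Lam t)/ln t - 1) * ln t)) \<longlongrightarrow> 0) at_top"
 by (rule filterlim_compose[OF exp_at_bot])
 hence 2: "((%t. Lam t/t) \<longlongrightarrow> 0) at_top"
 proof (rule Lim_transform_eventually)
 show "\<forall>\<^sub>F t in at_top. exp ((ln (Lam t)/ln t - 1) * ln t) = Lam t/t"
 using ln_Lam_bounds
 proof eventually_elim
 case (elim t)
 hence "(ln (Lam t)/ln t - 1) * ln t = ln (Lam t) - ln t" by (simp add: field_simps)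
 thus ?case using elim by (simp add: exp_diff)
 qed
 qed
 have "((%t. Lam t/t * inverse (Lam t/(t * lam t))) \<longlongrightarrow> 0 * inverse (1/al)) at_top"
 by (intro tendsto_mult 2 tendsto_inverse lam_Karamata) (use alpha in simp)
 hence 3: "((%t. Lam t/t * inverse (Lam t/(t * lam t))) \<longlongrightarrow> 0) at_top" by simp
 thus ?thesis
 proof (rule Lim_transform_eventually)
 show "\<forall>\<^sub>F t in at_top. Lam t/t * inverse (Lam t/(t * lam t)) = lam t"
 using ln_Lam_bounds by eventually_elim (simp add: field_simps)
 qed
qed

lemma w_over_ln: "LIM t at_top. Lam t/ln t :> at_top"
proof -
 have "LIM w at_top. w/ln (w::real) :> at_top" by real_asymp
 from filterlim_compose[OF this Lam_at_top] have 1: "LIM t at_top. Lam t/ln (Lam t) :> at_top" .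
 have "LIM t at_top. al/2 * (Lam t/ln (Lam t)) :> at_top"
 using alpha by (intro filterlim_tendsto_pos_mult_at_top[OF tendsto_const _ 1]) auto
 thus ?thesis
 proof (rule filterlim_at_top_mono)
 show "\<forall>\<^sub>F t in at_top. al/2 * (Lam t/ln (Lam t)) <= Lam t/ln t"
 using ln_Lam_bounds
 proof eventually_elim
 case (elim t)
 have "al/2 * ln t * Lam t <= ln (Lam t) * Lam t" using elim by (intro mult_right_mono) auto
 thus ?case using elim by (simp add: field_simps)
 qed
 qed
qed

text \<open>The point positions follow their indices closely.\<close>

definition "lln t mu = {om : space M. ALL i. real i <= 2 * Lam t --> \<bar>S i om - real i\<bar> <= mu * Lam t/ln t}"

lemma lln_event: "lln t mu : sets M"
 unfolding lln_def by measurable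

text \<open>Doob-free law of large numbers: Chebyshev at the scale \<open>Lam t / ln t\<close>, which is larger than the square root of \<open>Lam t\<close>, is enough for all indices at once by monotonicity along a finite grid.\<close>

lemma lln_prob:
 assumes "mu > 0" "et > 0"
 shows "\<forall>\<^sub>F t in at_top. prob (space M - lln t mu) <= et"
proof -
 have "((%w::real. 2 * (8/mu * (2/al * ln w)+1)\<^sup>2 * (4 * (2/al * ln w)/(mu * w))) \<longlongrightarrow> 0) at_top"
 using assms alpha by real_asymp
 from filterlim_compose[OF this Lam_at_top]
 have "((%t. 2 * (8/mu * (2/al * ln (Lam t))+1)\<^sup>2 * (4 * (2/al * ln (Lam t))/(mu * Lam t))) \<longlongrightarrow> 0) at_top" .
 from order_tendstoD(2)[OF this assms(2)]
 have 1: "\<forall>\<^sub>F t in at_top. 2 * (8/mu * (2/al * ln (Lam t))+1)\<^sup>2 * (4 * (2/al * ln (Lam t))/(mu * Lam t)) < et" .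
 have 2: "\<forall>\<^sub>F t in at_top. Lam t/ln t >= 4/mu" using w_over_ln unfolding filterlim_at_top by blast
 show ?thesis using 1 2 ln_Lam_bounds
 proof eventually_elim
 case (elim t)
 define w L where "w = Lam t" and "L = ln t"
 have wL: "w > 0" "L > 1" "L <= 2/al * ln w" using elim alpha by (auto simp: w_def L_def field_simps)
 define m where "m = nat \<lfloor>mu * w/(2 * L)\<rfloor>"
 define k where "k = nat \<lceil>8 * L/mu\<rceil>"
 have "mu * w/(2 * L) >= 2" using elim(2) assms wL by (simp add: w_def L_def field_simps)
 hence m: "real m <= mu * w/(2 * L)" "real m >= mu * w/(4 * L)" "m > 0"
 unfolding m_def by (linarith | simp)+
 have "8 * L/mu >= 0" using wL assms by simp
 hence k: "real k >= 8 * L/mu" "real k <= 8 * L/mu+1" unfolding k_def by linarith+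
 have "real k * real m >= 8 * L/mu * (mu * w/(4 * L))"
 using k m wL assms by (intro mult_mono) auto
 hence km: "real (k * m) >= 2 * w" using wL assms by simp
 have "prob (space M - lln t mu) <= prob {om : space M. EX i<=k * m. \<bar>S i om - real i\<bar> > 2 * real m}"
 proof (rule finite_measure_mono)
 show "space M - lln t mu <= {om : space M. EX i<=k * m. \<bar>S i om - real i\<bar> > 2 * real m}"
 proof
 fix om assume "om : space M - lln t mu"
 then obtain i where i: "om : space M" "real i <= 2 * w" "~ \<bar>S i om - real i\<bar> <= mu * w/L"
 by (auto simp: lln_def w_def L_def)
 have "real i <= real (k * m)" using i(2) km by linarith
 hence "i <= k * m" by (simp only: of_nat_le_iff)
 moreover have "2 * real m <= mu * w/L" using m(1) by simp
 ultimately show "om : {om : space M. EX i<=k * m. \<bar>S i om - real i\<bar> > 2 * real m}"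
 using i by fastforce
 qed
 qed measurable
 also have "... <= 2 * (real k)\<^sup>2/real m" using m by (intro S_uniform_LLN)
 also have "... <= 2 * (8/mu * (2/al * ln w)+1)\<^sup>2 * (4 * (2/al * ln w)/(mu * w))"
 proof -
 have "real k <= 8/mu * (2/al * ln w)+1"
 using k(2) mult_left_mono[OF wL(3), of "8/mu"] assms by simp
 hence a: "(real k)\<^sup>2 <= (8/mu * (2/al * ln w)+1)\<^sup>2" by (intro power_mono) auto
 have "1/real m <= 1/(mu * w/(4 * L))" using m wL assms by (intro frac_le) auto
 also have "... = 4 * L/(mu * w)" by simp
 also have "... <= 4 * (2/al * ln w)/(mu * w)" using wL assms by (intro divide_right_mono mult_left_mono) auto
 finally have b: "1/real m <= 4 * (2/al * ln w)/(mu * w)" .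
 have "2 * (real k)\<^sup>2 * (1/real m) <= 2 * (8/mu * (2/al * ln w)+1)\<^sup>2 * (4 * (2/al * ln w)/(mu * w))"
 using a b by (intro mult_mono) auto
 thus ?thesis by simp
 qed
 also have "... < et" using elim(1) by (simp add: w_def)
 finally show ?case by simp
 qed
qed

text \<open>The distance of index \<open>i\<close> from \<open>Lam t\<close>, in the scale of the theorem up to the factor \<open>\<alpha>\<close>.\<close>

definition "s t i = (1 - real (Suc i)/Lam t) * ln t"

lemma Q_s: "Lam t > 0 ==> Q t i = exp (- (1 - al) * s t i)"
 by (simp add: Q_def s_def be_def field_simps)

text \<open>No exceptionally long gap near \<open>t\<close>.\<close>

definition "nolong t C D = {om : space M. ALL i. \<bar>s t i\<bar> <= C --> X i om <= bt t+D}"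

lemma nolong_event: "nolong t C D : sets M"
 unfolding nolong_def by measurable

lemma bt_large: "\<forall>\<^sub>F t in at_top. bt t >= B"
proof -
 have "LIM t at_top. bt t/ln t * ln t :> at_top"
 by (rule filterlim_tendsto_pos_mult_at_top[OF bt_over_ln _ ln_at_top]) (use alpha in simp)
 hence "\<forall>\<^sub>F t in at_top. bt t/ln t * ln t >= B" unfolding filterlim_at_top by blast
 thus ?thesis using ln_Lam_bounds by eventually_elim simp
qed

text \<open>Only \<open>O(Lam t / ln t)\<close> indices belong to the window, and \<open>bt t\<close> is the logarithm of this number; so exceeding it by \<open>D\<close> has probability \<open>O(exp (- D))\<close>.\<close>

lemma nolong_prob:
 assumes "C > 0"
 shows "\<forall>\<^sub>F t in at_top. prob (space M - nolong t C D) <= 4 * C * exp (- D)"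
proof -
 have "\<forall>\<^sub>F t in at_top. Lam t/ln t >= 1/C" using w_over_ln unfolding filterlim_at_top by blast
 thus ?thesis using large_t bt_large[of "- D"]
 proof eventually_elim
 case (elim t)
 define w L where "w = Lam t" and "L = ln t"
 have wL: "w > 1" "L > 1" "w/L >= 1/C" using elim by (auto simp: w_def L_def)
 define J where "J = {i. \<bar>s t i\<bar> <= C}"
 define lo hi where "lo = nat \<lceil>w - C * w/L\<rceil>" and "hi = nat \<lfloor>w+C * w/L\<rfloor>"
 have J: "Suc i : {lo..hi}" if "i : J" for i
 proof -
 have "\<bar>1 - real (Suc i)/w\<bar> * L <= C" using that wL by (simp add: J_def s_def w_def L_def abs_mult)
 hence "\<bar>1 - real (Suc i)/w\<bar> <= C/L" using wL by (simp add: field_simps)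
 hence "\<bar>1 - real (Suc i)/w\<bar> * w <= C/L * w" using wL by (intro mult_right_mono) auto
 also have "\<bar>1 - real (Suc i)/w\<bar> * w = \<bar>w - real (Suc i)\<bar>"
 proof -
 have "w - real (Suc i) = (1 - real (Suc i)/w) * w" using wL by (simp add: field_simps)
 hence "\<bar>w - real (Suc i)\<bar> = \<bar>1 - real (Suc i)/w\<bar> * \<bar>w\<bar>" by (simp only: abs_mult)
 thus ?thesis using wL by simp
 qed
 finally have "\<bar>w - real (Suc i)\<bar> <= C * w/L" by simp
 hence "real (Suc i) >= w - C * w/L" "real (Suc i) <= w+C * w/L" by linarith+
 thus ?thesis unfolding lo_def hi_def atLeastAtMost_iff by linarith
 qed
 have JS: "Suc ` J <= {lo..hi}" using J by auto
 have finJ: "finite J" using finite_subset[OF JS] by (simp add: finite_image_iff)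
 have "card J = card (Suc ` J)" by (simp add: card_image)
 also have "... <= card {lo..hi}" using JS by (intro card_mono) auto
 finally have "card J <= Suc hi - lo" by simp
 moreover have "C * w/L >= 1" using wL(3) assms wL by (simp add: field_simps)
 moreover have "w+C * w/L > 0" using wL \<open>C * w/L >= 1\<close> by linarith
 ultimately have cJ: "real (card J) <= 4 * (C * w/L)"
 unfolding lo_def hi_def by linarith
 have "prob (space M - nolong t C D) <= prob (\<Union>i\<in>J. {om : space M. X i om > bt t+D})"
 using finJ by (intro finite_measure_mono) (auto simp: nolong_def J_def not_le)
 also have "... <= (\<Sum>i\<in>J. prob {om : space M. X i om > bt t+D})"
 by (rule finite_measure_subadditive_finite[OF finJ]) auto
 also have "... = (\<Sum>i\<in>J. be t * exp (- D))"
 proof (rule sum.cong[OF refl])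
 fix i
 have "prob {om : space M. X i om > bt t+D} = exp (- bt t + - D)"
 using elim X_tail[of "bt t+D" i] by simp
 thus "prob {om : space M. X i om > bt t+D} = be t * exp (- D)"
 using elim unfolding exp_add by simp
 qed
 also have "... = card J * (be t * exp (- D))" by simp
 also have "... <= 4 * (C * w/L) * (be t * exp (- D))" using cJ elim by (intro mult_right_mono) auto
 also have "... = 4 * C * (1 - al) * exp (- D)" using wL by (simp add: be_def w_def[symmetric] L_def[symmetric])
 also have "... <= 4 * C * 1 * exp (- D)" using assms alpha by (intro mult_right_mono mult_left_mono) auto
 finally show ?case by simp
 qed
qed

text \<open>No long gap long before \<open>t\<close>; the threshold grows linearly with the distance from \<open>t\<close>.\<close>

definition "nofar t c Y B = {om : space M. ALL i. s t i >= Y --> X i om <= (bt t - B) * (1+c * s t i/ln t)}"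

lemma nofar_event: "nofar t c Y B : sets M"
 unfolding nofar_def by measurable

text \<open>Away from the window the permitted size grows linearly with the distance, hence the union bound is a geometric series whose tail is small for a large cut-off.\<close>

lemma nofar_prob:
 assumes c: "0 < c" "c <= 1" and Y: "Y > 0" and B: "B >= 0"
 shows "\<forall>\<^sub>F t in at_top. prob (space M - nofar t c Y B) <= 4 * exp B/(al * c) * exp (- c * Y * al/2)"
proof -
 have lim: "((%t. bt t/ln t - B/ln t) \<longlongrightarrow> al - 0) at_top"
 by (intro tendsto_diff bt_over_ln tendsto_divide_0[OF tendsto_const filterlim_at_top_imp_at_infinity[OF ln_at_top]])
 have "\<forall>\<^sub>F t in at_top. bt t/ln t - B/ln t > al/2"
 by (rule order_tendstoD(1)[OF lim]) (use alpha in simp)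
 moreover have "\<forall>\<^sub>F t in at_top. bt t/ln t - B/ln t < 1"
 by (rule order_tendstoD(2)[OF lim]) (use alpha in simp)
 moreover have "\<forall>\<^sub>F t in at_top. Lam t/ln t >= 1" using w_over_ln unfolding filterlim_at_top by blast
 ultimately show ?thesis using large_t
 proof eventually_elim
 case (elim t)
 define w L b where "w = Lam t" and "L = ln t" and "b = bt t - B"
 have wL: "w > 1" "L > 1" "w >= L" using elim by (auto simp: w_def L_def field_simps)
 have b: "b/L > al/2" "b/L < 1" using elim by (auto simp: b_def L_def diff_divide_distrib)
 hence b0: "b > 0" "b <= L" using wL alpha by (auto simp: field_simps) (smt (verit) mult_pos_pos)
 define th where "th = b * c/w"
 have th: "0 < th" "th <= 1"
 proof -
 show "0 < th" using b0 c wL by (simp add: th_def)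
 have "b * c <= w * 1" using b0 c wL by (intro mult_mono) auto
 thus "th <= 1" using wL by (simp add: th_def)
 qed
 define m where "m = nat \<lfloor>w - w * Y/L\<rfloor>"
 define J where "J = {i. s t i >= Y}"
 have J: "J <= {..<m}"
 proof
 fix i assume "i : J"
 hence "Y <= (1 - real (Suc i)/w) * L" by (simp add: J_def s_def w_def L_def)
 hence "Y/L <= 1 - real (Suc i)/w" using wL by (simp add: field_simps)
 hence "w * (Y/L) <= w * (1 - real (Suc i)/w)" using wL by (intro mult_left_mono) auto
 moreover have "w * (1 - real (Suc i)/w) = w - real (Suc i)" using wL by (simp add: field_simps)
 ultimately have "real (Suc i) <= w - w * Y/L" by simp
 thus "i : {..<m}" unfolding m_def lessThan_iff by linarith
 qed
 have finJ: "finite J" using J finite_subset by blast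
 have "(bt t - B) * (1+c * s t i/ln t) = b+th * (w - real (Suc i))" for i
 using wL by (simp add: s_def b_def[symmetric] w_def[symmetric] L_def[symmetric] th_def field_simps)
 note thr = this
 have "prob (space M - nofar t c Y B) <= prob (\<Union>i\<in>J. {om : space M. X i om > b+th * (w - real (Suc i))})"
 using finJ by (intro finite_measure_mono) (auto simp: nofar_def J_def not_le thr)
 also have "... <= (\<Sum>i\<in>J. prob {om : space M. X i om > b+th * (w - real (Suc i))})"
 by (rule finite_measure_subadditive_finite[OF finJ]) auto
 also have "... = (\<Sum>i\<in>J. exp (- b) * exp (- th * (w - real (Suc i))))"
 proof (rule sum.cong[OF refl])
 fix i assume "i : J"
 hence "i < m" using J by auto
 hence "real (Suc i) <= w - w * Y/L" unfolding m_def by linarith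
 hence "real (Suc i) <= w" using wL Y by (smt (verit) divide_nonneg_pos mult_pos_pos)
 hence "0 <= b+th * (w - real (Suc i))" using b0 th by simp
 thus "prob {om : space M. X i om > b+th * (w - real (Suc i))} = exp (- b) * exp (- th * (w - real (Suc i)))"
 using X_tail[of "b+th * (w - real (Suc i))" i] by (simp add: exp_add[symmetric])
 qed
 also have "... <= (\<Sum>i<m. exp (- b) * exp (- th * (w - real (Suc i))))"
 using J by (intro sum_mono2) auto
 also have "... = exp (- b) * (\<Sum>i<m. exp (- th * (w - real (Suc i))))" by (simp add: sum_distrib_left)
 also have "... <= exp (- b) * (2/th * exp (- th * (w * Y/L)))"
 proof (rule mult_left_mono)
 have geo: "(\<Sum>i<m. exp (- th * (w - real (Suc i)))) * (1 - exp (- th)) = exp (- th * (w - real m)) - exp (- th * w)"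
 proof (induction m)
 case (Suc n)
 have "exp (- th * (w - real (Suc n))) * exp (- th) = exp (- th * (w - real n))"
 by (simp add: exp_add[symmetric] algebra_simps)
 thus ?case using Suc by (simp add: algebra_simps)
 qed simp
 have e1: "1 - exp (- th) >= th/2"
 proof -
 have "exp (- th) <= 1/(1+th)"
 using exp_ge_add_one_self[of th] th by (simp add: exp_minus inverse_eq_divide frac_le)
 also have "... <= 1 - th/2"
 proof -
 have "(1 - th/2) * (1+th) = 1+th/2 * (1 - th)" by (simp add: field_simps)
 also have "... >= 1" using th by simp
 finally show ?thesis using th by (simp add: pos_divide_le_eq)
 qed
 finally show ?thesis by simp
 qed
 show "(\<Sum>i<m. exp (- th * (w - real (Suc i)))) <= 2/th * exp (- th * (w * Y/L))"
 proof (cases "m = 0")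
 case False
 hence "real m <= w - w * Y/L" unfolding m_def by linarith
 hence "th * (w * Y/L) <= th * (w - real m)"
 using th by (intro mult_left_mono) auto
 hence "exp (- th * (w - real m)) <= exp (- th * (w * Y/L))"
 by (simp only: exp_le_cancel_iff mult_minus_left neg_le_iff_le)
 hence "(\<Sum>i<m. exp (- th * (w - real (Suc i)))) * (1 - exp (- th)) <= exp (- th * (w * Y/L))"
 using geo exp_gt_zero[of "- th * w"] by linarith
 moreover have "(\<Sum>i<m. exp (- th * (w - real (Suc i)))) * (th/2) <= (\<Sum>i<m. exp (- th * (w - real (Suc i)))) * (1 - exp (- th))"
 using e1 by (intro mult_left_mono sum_nonneg) auto
 ultimately have "(\<Sum>i<m. exp (- th * (w - real (Suc i)))) * (th/2) <= exp (- th * (w * Y/L))" by linarith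
 thus ?thesis using th by (simp add: field_simps)
 qed (use th in simp)
 qed simp
 also have "... = exp B * be t * (2/th * exp (- (c * Y * (b/L))))"
 proof -
 have "- b = B + - bt t" by (simp add: b_def)
 hence "exp (- b) = exp B * be t" using elim by (simp only: exp_add)
 moreover have "- th * (w * Y/L) = - (c * Y * (b/L))" using wL by (simp add: th_def field_simps)
 ultimately show ?thesis by (simp only:)
 qed
 also have "... = exp B * (1 - al) * (2/(c * (b/L))) * exp (- (c * Y * (b/L)))"
 using wL b0 c by (simp add: be_def w_def[symmetric] L_def[symmetric] th_def field_simps)
 also have "... <= exp B * 1 * (2/(c * (al/2))) * exp (- (c * Y * (al/2)))"
 proof (intro mult_mono)
 show "2/(c * (b/L)) <= 2/(c * (al/2))"
 proof (rule frac_le)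
 show "c * (al/2) <= c * (b/L)" using b c by (intro mult_left_mono) auto
 qed (use c alpha in auto)
 have "c * Y * (al/2) <= c * Y * (b/L)" using b c Y by (intro mult_left_mono) auto
 thus "exp (- (c * Y * (b/L))) <= exp (- (c * Y * (al/2)))"
 by (simp only: exp_le_cancel_iff neg_le_iff_le)
 qed (use alpha b c b0 wL in auto)
 also have "... = 4 * exp B/(al * c) * exp (- c * Y * al/2)" using c alpha by (simp add: field_simps)
 finally show ?case .
 qed
qed

end

context gap_setting begin

definition "tame = {om : space M. (ALL i. reached i om) & (ALL i. S i om < S (Suc i) om)}"

lemma tame_event: "tame : sets M"
 unfolding tame_def by measurable

lemma tame_prob: "prob (space M - tame) = 0"
proof -
 have "AE om in M. om : tame"
 using AE_reached AE_S_less AE_space by eventually_elim (simp add: tame_def)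
 hence "prob tame = 1" using prob_eq_1[OF tame_event] by simp
 thus ?thesis by (simp add: prob_compl[OF tame_event])
qed

lemma tame_epoch: "om : tame ==> epoch N i om = V (S i om)"
 using epoch_nonneg[of i om] by (simp add: tame_def S_def)

lemma tame_gap: "om : tame ==> gap N (Suc i) om = V (S (Suc i) om) - V (S i om)"
 by (simp add: gap_def tame_epoch)

lemma tame_S: assumes "om : tame" shows "S i om < S (Suc i) om" "0 < X i om" "0 < S (Suc i) om"
proof -
 show 1: "S i om < S (Suc i) om" using assms by (simp add: tame_def)
 show "0 < X i om" "0 < S (Suc i) om" using 1 S_nonneg[of i om] by (auto simp: X_def)
qed

text \<open>The actual points in the coordinates in which the limit is Lebesgue measure.\<close>

definition "pa t i om = exp (bt t - lam t * gap N (Suc i) om)"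
definition "qa t i om = exp (- a * ((t - epoch N (Suc i) om)/t * ln t))"

lemma pa_meas [measurable]: "pa t i : borel_measurable M"
 unfolding pa_def[abs_def] gap_def[abs_def] by measurable

lemma qa_meas [measurable]: "qa t i : borel_measurable M"
 unfolding qa_def[abs_def] by measurable

lemma P_alt:
 assumes "exp (- bt t) = be t" "Lam t > 0"
 shows "P t i om = exp (bt t - X i om+(1 - al) * s t i)"
proof -
 have "exp (bt t - X i om+(1 - al) * s t i) * (exp (- bt t) * exp (- (1 - al) * s t i)) = exp (- X i om)"
 unfolding exp_add[symmetric] by (rule arg_cong[where f=exp]) (simp add: algebra_simps)
 note eq = this
 show ?thesis unfolding P_def Q_s[OF assms(2)] assms(1)[symmetric] eq[symmetric]
 by (rule nonzero_mult_div_cancel_right) simp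
qed

lemma Suc_index: "Lam t > 0 ==> ln t > 0 ==> real (Suc i) = Lam t * (1 - s t i/ln t)"
proof -
 assume "Lam t > 0" "ln t > 0"
 moreover from this have "Lam t * (1 - s t i/ln t) = Lam t * (real (Suc i)/Lam t)" by (simp add: s_def)
 ultimately show ?thesis by simp
qed

lemma far_p:
 assumes om: "om : tame"
 and F: "!!u' u. U0 <= u' ==> u' <= u ==> u <= Lam t * (1 - Y/ln t) ==> lam t * v u' <= 1 - c * (1 - u/Lam t)"
 and c: "0 < c" "c <= 1" "0 <= c'" "c' <= c/2" and U0: "0 < U0" and t: "t > 0" "Lam t > 0" "ln t > 1"
 and lln: "S (Suc i) om <= real (Suc i)+mu * Lam t/ln t" and Y: "Y+mu <= s t i" "2 * mu <= s t i" "0 < s t i"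
 and X: "X i om <= (bt t - B) * (1+c' * s t i/ln t)" and B: "0 <= bt t - B"
 and small: "lam t * V U0 <= d"
 shows "lam t * gap N (Suc i) om <= bt t - B+d"
proof -
 define u w L where "u = S (Suc i) om" and "w = Lam t" and "L = ln t"
 note S = tame_S[OF om, of i]
 have wL: "w > 0" "L > 0" "lam t > 0" using t lam_pos[of t] unfolding w_def L_def by linarith+
 have si: "real (Suc i) = w * (1 - s t i/L)" unfolding w_def L_def by (rule Suc_index) (use t in linarith)+
 have ul: "u <= w * (1 - (s t i - mu)/L)"
 proof -
 have "w * (1 - (s t i - mu)/L) = w * (1 - s t i/L)+mu * w/L" using wL by (simp add: field_simps)
 thus ?thesis using lln unfolding si u_def[symmetric] w_def[symmetric] L_def[symmetric] by linarith
 qed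
 have "Y/L <= (s t i - mu)/L" using Y wL by (intro divide_right_mono) auto
 hence "w * (1 - (s t i - mu)/L) <= w * (1 - Y/L)" using wL by (intro mult_left_mono) auto
 hence uY: "u <= w * (1 - Y/L)" using ul by linarith
 have u0: "u > 0" using S by (simp add: u_def)
 define A where "A = 1 - c * (1 - u/w)"
 have uw: "1 - u/w >= s t i/(2 * L)"
 proof -
 have "u/w <= 1 - (s t i - mu)/L" using ul wL by (simp add: pos_divide_le_eq mult.commute)
 moreover have "s t i/(2 * L) <= (s t i - mu)/L" using Y wL by (simp add: field_simps)
 ultimately show ?thesis by linarith
 qed
 have A: "A > 0" "A <= 1 - c/2 * (s t i/L)"
 proof -
 have "0 <= s t i/(2 * L)" using Y wL by simp
 hence "0 <= 1 - u/w" using uw by linarith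
 hence "c * (1 - u/w) <= 1 * (1 - u/w)" using c by (intro mult_right_mono) auto
 also have "... < 1" using u0 wL by simp
 finally show "A > 0" by (simp add: A_def)
 have "c * (s t i/(2 * L)) <= c * (1 - u/w)" using uw c by (intro mult_left_mono) auto
 thus "A <= 1 - c/2 * (s t i/L)" by (simp add: A_def)
 qed
 have vb: "v x <= A/lam t" if "U0 <= x" "x <= u" for x
 proof -
 have "lam t * v x <= A" using F[OF that] uY by (simp add: A_def w_def L_def)
 thus ?thesis using wL by (simp add: pos_le_divide_eq mult.commute)
 qed
 have gp: "gap N (Suc i) om <= V U0+A/lam t * X i om"
 proof (cases "u <= U0")
 case True
 have "V u <= V U0" using True u0 U0 by (subst V_le_iff) auto
 moreover have "0 <= V (S i om)" by (simp add: S_nonneg)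
 moreover have "0 <= A/lam t * X i om" using A wL S by simp
 ultimately show ?thesis using tame_gap[OF om, of i] by (simp add: u_def)
 next
 case False
 define m where "m = max (S i om) U0"
 have m: "m <= u" "U0 <= m" "S i om <= m" using False S by (auto simp: m_def u_def)
 have 1: "V u - V m <= A/lam t * (u - m)"
 proof (rule V_diff_le)
 show "0 <= m" "m <= u" using m U0 by linarith+
 show "0 < A/lam t" using A wL by simp
 show "v x <= A/lam t" if "m < x" "x <= u" for x using vb[of x] that m by linarith
 qed
 have "A/lam t * (u - m) <= A/lam t * X i om"
 proof (rule mult_left_mono)
 show "u - m <= X i om" using m by (simp add: X_def u_def)
 show "0 <= A/lam t" using A wL by simp
 qed
 moreover have "V m - V (S i om) <= V U0" using U0 S_nonneg[of i om] by (auto simp: m_def max_def)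
 ultimately show ?thesis using 1 tame_gap[OF om, of i] by (simp add: u_def)
 qed
 have "lam t * gap N (Suc i) om <= lam t * (V U0+A/lam t * X i om)" using gp wL by (intro mult_left_mono) auto
 also have "... = lam t * V U0+A * X i om" using wL by (simp add: algebra_simps)
 also have "... <= d+A * ((bt t - B) * (1+c' * s t i/L))"
 proof (rule add_mono[OF small mult_left_mono])
 show "X i om <= (bt t - B) * (1+c' * s t i/L)" using X by (simp add: L_def)
 show "0 <= A" using A by simp
 qed
 also have "A * ((bt t - B) * (1+c' * s t i/L)) <= (1 - c/2 * (s t i/L)) * ((bt t - B) * (1+c/2 * (s t i/L)))"
 proof (rule mult_mono)
 have "0 <= s t i/L" using Y wL by simp
 hence "c' * (s t i/L) <= c/2 * (s t i/L)" using c by (intro mult_right_mono)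
 moreover have "c' * s t i/L = c' * (s t i/L)" by (rule times_divide_eq_right[symmetric])
 ultimately have "1+c' * s t i/L <= 1+c/2 * (s t i/L)" by linarith
 thus "(bt t - B) * (1+c' * s t i/L) <= (bt t - B) * (1+c/2 * (s t i/L))"
 by (rule mult_left_mono[OF _ B])
 show "0 <= 1 - c/2 * (s t i/L)" using A by linarith
 show "0 <= (bt t - B) * (1+c' * s t i/L)" using B c Y wL by (intro mult_nonneg_nonneg add_nonneg_nonneg) auto
 qed (rule A)
 also have "... = (bt t - B) * (1 - (c/2 * (s t i/L))\<^sup>2)"
 proof -
 have "(1 - z) * (y * (1+z)) = y * (1 - z\<^sup>2)" for y z :: real
 by (simp add: power2_eq_square algebra_simps)
 thus ?thesis by blast
 qed
 also have "... <= (bt t - B) * 1"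
 by (rule mult_left_mono[OF _ B]) simp
 finally show ?thesis by simp
qed

lemma far_P:
 assumes c': "0 <= c'" "c' <= 1 - al" and t: "exp (- bt t) = be t" "Lam t > 0" "ln t > 1" and s: "0 <= s t i"
 and X: "X i om <= (bt t - B) * (1+c' * s t i/ln t)" and B: "0 <= bt t - B" "bt t - B <= ln t"
 shows "exp B <= P t i om"
proof -
 have "(bt t - B) * (c' * s t i/ln t) <= ln t * (c' * s t i/ln t)"
 using B c' s t by (intro mult_right_mono) auto
 also have "... = c' * s t i" using t by simp
 also have "... <= (1 - al) * s t i" using c' s by (intro mult_right_mono) auto
 finally have "X i om <= bt t - B+(1 - al) * s t i" using X by (simp add: algebra_simps)
 thus ?thesis unfolding P_alt[OF t(1,2)] by simp
qed

text \<open>The position coordinate: replace the operational time \<open>S\<close> by its mean and linearize the inverse of the cumulative rate.\<close>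

lemma window_q:
 assumes om: "om : tame" and t: "t > 0" "Lam t > 0" "ln t > 0"
 and VL: "!!u. \<bar>u - Lam t\<bar> <= C0 * Lam t/ln t ==> \<bar>(V u - t)/t * ln t - (u/Lam t - 1) * ln t/al\<bar> <= ep"
 and lln: "\<bar>S (Suc i) om - real (Suc i)\<bar> <= mu * Lam t/ln t" and s: "\<bar>s t i\<bar> <= K" and C0: "K+mu <= C0"
 shows "\<bar>a * ((t - epoch N (Suc i) om)/t * ln t) - (1 - al) * s t i\<bar> <= a * (ep+mu/al)"
proof -
 define u w L where "u = S (Suc i) om" and "w = Lam t" and "L = ln t"
 have wL: "w > 0" "L > 0" using t by (auto simp: w_def L_def)
 have si: "real (Suc i) = w - w * s t i/L" using Suc_index[of t i] t by (simp add: w_def L_def algebra_simps)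
 define de where "de = (u - real (Suc i)) * L/w"
 have d: "\<bar>de\<bar> <= mu"
 proof -
 have "\<bar>de\<bar> = \<bar>u - real (Suc i)\<bar> * L/w" using wL by (simp add: de_def abs_mult abs_divide)
 also have "... <= mu * w/L * L/w"
 using lln wL unfolding u_def w_def L_def by (intro divide_right_mono mult_right_mono) auto
 finally show ?thesis using wL by simp
 qed
 have "de * w/L = u - real (Suc i)" using wL by (simp add: de_def)
 hence ud: "u = w - w * s t i/L+de * w/L" using si by linarith
 have "u - w = (de - s t i) * w/L" unfolding ud by (simp add: algebra_simps diff_divide_distrib)
 hence "\<bar>u - w\<bar> = \<bar>de - s t i\<bar> * w/L" using wL by (simp add: abs_mult abs_divide)
 also have "... <= C0 * w/L" using d s C0 wL by (intro divide_right_mono mult_right_mono) auto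
 finally have 1: "\<bar>(V u - t)/t * L - (u/w - 1) * L/al\<bar> <= ep" using VL[of u] by (simp add: w_def L_def)
 have 2: "(u/w - 1) * L = de - s t i" unfolding ud using wL by (simp add: field_simps)
 have T: "epoch N (Suc i) om = V u" using tame_epoch[OF om] by (simp add: u_def)
 have 3: "(t - V u)/t * L - s t i/al = - ((V u - t)/t * L - (de - s t i)/al) - de/al"
 proof -
 have "(t - V u)/t * L = - ((V u - t)/t * L)"
 by (metis minus_diff_eq minus_divide_left minus_mult_left)
 moreover have "(de - s t i)/al = de/al - s t i/al" by (rule diff_divide_distrib)
 ultimately show ?thesis by linarith
 qed
 have "\<bar>de/al\<bar> <= mu/al" using d alpha by (simp add: abs_divide divide_right_mono)
 hence "\<bar>(t - V u)/t * L - s t i/al\<bar> <= ep+mu/al" unfolding 3 using 1[unfolded 2] by linarith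
 hence "a * \<bar>(t - V u)/t * L - s t i/al\<bar> <= a * (ep+mu/al)" using a_pos by (intro mult_left_mono) auto
 also have "a * \<bar>(t - V u)/t * L - s t i/al\<bar> = \<bar>a * ((t - V u)/t * L) - (1 - al) * s t i\<bar>"
 proof -
 have "a * ((t - V u)/t * L) - (1 - al) * s t i = a * ((t - V u)/t * L - s t i/al)"
 proof -
 have "a * (s t i/al) = (1 - al) * s t i" using alpha by (simp add: a_def)
 thus ?thesis by (simp only: right_diff_distrib)
 qed
 thus ?thesis using a_pos by (simp add: abs_mult)
 qed
 finally show ?thesis by (simp add: T L_def)
qed

text \<open>The size coordinate: a gap is the integral of the inverse rate \<open>v\<close> over an operational gap, and \<open>v\<close> is almost constant there.\<close>

lemma window_p:
 assumes om: "om : tame" and t: "t > 0" "Lam t > 0" "ln t > 0"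
 and VL: "!!u. \<bar>u - Lam t\<bar> <= C0 * Lam t/ln t ==> \<bar>lam t * v u - 1 - ga * (u/Lam t - 1)\<bar> <= ep/ln t"
 and lln: "\<bar>S (Suc i) om - real (Suc i)\<bar> <= mu * Lam t/ln t" "\<bar>S i om - real i\<bar> <= mu * Lam t/ln t"
 and mu: "1 <= mu * Lam t/ln t"
 and s: "\<bar>s t i\<bar> <= K" and C0: "K+2 * mu <= C0" and ka: "ep+2 * ga * mu <= ka" and L: "ga * K+ka < ln t" and k0: "0 <= ka"
 shows "\<bar>lam t * gap N (Suc i) om - X i om * (1 - ga * s t i/ln t)\<bar> <= X i om * ka/ln t"
proof -
 define w L where "w = Lam t" and "L = ln t"
 have wL: "w > 0" "L > 0" "lam t > 0" using t lam_pos by (auto simp: w_def L_def)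
 have si: "real (Suc i) = w - w * s t i/L" using Suc_index[of t i] t by (simp add: w_def L_def algebra_simps)
 note S = tame_S[OF om, of i]
 have vb: "(1 - ga * s t i/L - ka/L)/lam t <= v u & v u <= (1 - ga * s t i/L+ka/L)/lam t"
 if u: "S i om <= u" "u <= S (Suc i) om" for u
 proof -
 have ub: "\<bar>u - real (Suc i)\<bar> <= 2 * mu * w/L"
 proof -
 have "2 * mu * w/L = mu * w/L+mu * w/L" by (simp add: add_divide_distrib[symmetric])
 moreover have "real (Suc i) = real i+1" by simp
 ultimately show ?thesis using u lln mu unfolding w_def[symmetric] L_def[symmetric] abs_le_iff by linarith
 qed
 define de where "de = (u - real (Suc i)) * L/w"
 have d: "\<bar>de\<bar> <= 2 * mu"
 proof -
 have "\<bar>de\<bar> = \<bar>u - real (Suc i)\<bar> * L/w" using wL by (simp add: de_def abs_mult abs_divide)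
 also have "... <= 2 * mu * w/L * L/w"
 using ub wL by (intro divide_right_mono mult_right_mono) auto
 finally show ?thesis using wL by simp
 qed
 have "de * w/L = u - real (Suc i)" using wL by (simp add: de_def)
 hence ud: "u = w - w * s t i/L+de * w/L" using si by linarith
 have "u - w = (de - s t i) * w/L" unfolding ud by (simp add: algebra_simps diff_divide_distrib)
 hence "\<bar>u - w\<bar> = \<bar>de - s t i\<bar> * w/L" using wL by (simp add: abs_mult abs_divide)
 also have "... <= C0 * w/L" using d s C0 wL by (intro divide_right_mono mult_right_mono) auto
 finally have 1: "\<bar>lam t * v u - 1 - ga * (u/w - 1)\<bar> <= ep/L" using VL[of u] by (simp add: w_def L_def)
 have 2: "u/w - 1 = (de - s t i)/L" unfolding ud using wL by (simp add: field_simps)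
 have "ga * \<bar>de\<bar> <= ga * (2 * mu)" using d gamma_pos by (intro mult_left_mono) auto
 hence "ep/L + \<bar>ga * de/L\<bar> <= (ep+ga * (2 * mu))/L"
 using wL gamma_pos by (simp add: abs_mult abs_divide add_divide_distrib divide_right_mono)
 also have "... <= ka/L" using ka wL by (intro divide_right_mono) auto
 finally have 3: "ep/L + \<bar>ga * de/L\<bar> <= ka/L" .
 have "ga * (u/w - 1) = ga * de/L - ga * s t i/L" unfolding 2 by (simp add: algebra_simps diff_divide_distrib)
 hence "\<bar>lam t * v u - (1 - ga * s t i/L)\<bar> <= ka/L" using 1 3 by linarith
 hence "1 - ga * s t i/L - ka/L <= lam t * v u" "lam t * v u <= 1 - ga * s t i/L+ka/L" by linarith+
 thus ?thesis using wL by (simp add: pos_divide_le_eq pos_le_divide_eq mult.commute)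
 qed
 have "ga * \<bar>s t i\<bar> <= ga * K" using s gamma_pos by (intro mult_left_mono) auto
 moreover have "\<bar>ga * s t i\<bar> = ga * \<bar>s t i\<bar>" using gamma_pos by (simp add: abs_mult)
 ultimately have "\<bar>ga * s t i\<bar> + ka < L" using L unfolding L_def by linarith
 hence "ga * s t i+ka < L" "ga * s t i - ka < L" using k0 by linarith+
 hence "(ga * s t i+ka)/L < 1" "(ga * s t i - ka)/L < 1" using wL by (simp_all add: divide_less_eq)
 hence pos: "0 < 1 - ga * s t i/L - ka/L" "0 < 1 - ga * s t i/L+ka/L"
 unfolding add_divide_distrib diff_divide_distrib by linarith+
 have "S i om >= 0" by (rule S_nonneg)
 have "(1 - ga * s t i/L - ka/L)/lam t * X i om <= gap N (Suc i) om &
 gap N (Suc i) om <= (1 - ga * s t i/L+ka/L)/lam t * X i om"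
 proof -
 have "(1 - ga * s t i/L - ka/L)/lam t * (S (Suc i) om - S i om) <= V (S (Suc i) om) - V (S i om)"
 by (rule V_diff_ge) (use S_nonneg[of i om] S(1) pos wL vb in simp_all)
 moreover have "V (S (Suc i) om) - V (S i om) <= (1 - ga * s t i/L+ka/L)/lam t * (S (Suc i) om - S i om)"
 by (rule V_diff_le) (use S_nonneg[of i om] S(1) pos wL vb in simp_all)
 ultimately show ?thesis by (simp add: tame_gap[OF om] X_def)
 qed
 hence "(1 - ga * s t i/L - ka/L) * X i om <= gap N (Suc i) om * lam t"
 "gap N (Suc i) om * lam t <= (1 - ga * s t i/L+ka/L) * X i om"
 using wL by (simp_all add: pos_divide_le_eq pos_le_divide_eq)
 note bnd = this
 have alg: "(y - k/d) * x = x * y - x * k/d" "(y+k/d) * x = x * y+x * k/d" for x y k d :: real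
 by (simp_all add: algebra_simps)
 show ?thesis
 using bnd unfolding abs_diff_le_iff L_def[symmetric] mult.commute[of "lam t"] alg by blast
qed

end

section \<open>The actual points follow the surrogate points\<close>

lemma abs_diff3_le:
 fixes x A B C k :: real
 assumes "x = A - B - C" "\<bar>A\<bar> <= k/3" "\<bar>B\<bar> <= k/3" "\<bar>C\<bar> <= k/3"
 shows "\<bar>x\<bar> <= k"
 using assms by linarith

lemma abs_exp_diff_le:
 fixes x y k :: real
 assumes "\<bar>x - y\<bar> <= k" shows "\<bar>exp x - exp y\<bar> <= exp y * (exp k - 1)"
proof -
 have "exp x <= exp (y+k)" "exp (y - k) <= exp x" using assms by (auto simp: abs_le_iff)
 hence 1: "exp x <= exp y * exp k" "exp y * exp (- k) <= exp x" by (simp_all add: exp_add[symmetric])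
 have "1 - k <= exp (- k)" "1+k <= exp k" using exp_ge_add_one_self[of "-k"] exp_ge_add_one_self[of k] by auto
 hence "1 - exp (- k) <= exp k - 1" by linarith
 hence "exp y * (1 - exp (- k)) <= exp y * (exp k - 1)" by (intro mult_left_mono) auto
 with 1 show ?thesis by (simp add: abs_le_iff algebra_simps)
qed

context gap_setting begin

definition "close t R ep = {om : space M. ALL i. (pa t i om < R & qa t i om < R) | (P t i om < R & Q t i < R) -->
 \<bar>pa t i om - P t i om\<bar> <= ep & \<bar>qa t i om - Q t i\<bar> <= ep}"

lemma close_event: "close t R ep : sets M"
 unfolding close_def by measurable

text \<open>The factor \<open>1 - \<gamma> s / ln t\<close> multiplies a gap of order \<open>\<alpha> ln t\<close>; the product contributes the shift \<open>(1 - \<alpha>) s\<close>, which is exactly the exponent in the surrogate point.\<close>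

lemma window_p_close:
 assumes w: "\<bar>lam t * gap N (Suc i) om - X i om * (1 - ga * s t i/ln t)\<bar> <= X i om * ka/ln t"
 and X0: "0 <= X i om" and s: "\<bar>s t i\<bar> <= K" and K: "0 <= K" and k: "0 < ka" "ka <= 1" "6 * ka <= ka3"
 and t: "exp (- bt t) = be t" "Lam t > 0" "ln t > 1"
 and XD: "X i om <= bt t+D" and D: "0 <= D" "D <= ln t"
 and D2: "ln R+(1 - al) * K <= D2" "ln R+ga * K+1 <= D2" and D20: "0 <= D2" and R: "1 <= R"
 and bt: "ga * K * \<bar>bt t/ln t - al\<bar> <= ka3/3" "bt t <= ln t" and L: "ga * K * (D+D2)/ln t <= ka3/3"
 and small: "R * (exp ka3 - 1) <= ep"
 and either: "pa t i om < R | P t i om < R"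
 shows "\<bar>pa t i om - P t i om\<bar> <= ep"
proof -
 define L x Dv where "L = ln t" and "x = lam t * gap N (Suc i) om" and "Dv = X i om - bt t"
 have L0: "L > 1" using t by (simp add: L_def)
 have gs: "\<bar>ga * s t i\<bar> <= ga * K" using s gamma_pos by (simp add: abs_mult mult_left_mono)
 have pa: "pa t i om = exp (bt t - x)" by (simp add: pa_def x_def)
 have P: "P t i om = exp (bt t - X i om+(1 - al) * s t i)" using P_alt t by simp
 have Dv: "- D2 <= Dv"
 proof (rule ccontr)
 assume "~ - D2 <= Dv"
 hence XD2: "X i om < bt t - D2" by (simp add: Dv_def)
 have "\<bar>(1 - al) * s t i\<bar> <= (1 - al) * K" using s alpha by (simp add: abs_mult mult_left_mono)
 hence "ln R <= bt t - X i om+(1 - al) * s t i" using XD2 D2(1) by (simp add: abs_le_iff)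
 hence "exp (ln R) <= P t i om" unfolding P by (subst exp_le_cancel_iff)
 hence 1: "R <= P t i om" using R by simp
 have "x <= X i om * (1 - ga * s t i/L)+X i om * ka/L" using w by (simp add: x_def L_def abs_le_iff)
 also have "... = X i om+X i om * (ka - ga * s t i)/L" by (simp add: algebra_simps diff_divide_distrib)
 also have "... <= X i om+X i om * (1+ga * K)/L"
 using X0 gs k L0 by (intro add_left_mono divide_right_mono mult_left_mono) (auto simp: abs_le_iff)
 also have "... <= X i om+L * (1+ga * K)/L"
 proof -
 have "X i om <= L" using XD2 D20 bt(2) by (simp add: L_def)
 thus ?thesis using L0 gamma_pos K by (intro add_left_mono divide_right_mono mult_right_mono) auto
 qed
 also have "... = X i om+(1+ga * K)" using L0 by simp
 finally have "ln R <= bt t - x" using XD2 D2(2) by linarith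
 hence "exp (ln R) <= pa t i om" unfolding pa by (subst exp_le_cancel_iff)
 hence "R <= pa t i om" using R by simp
 with 1 either show False by linarith
 qed
 have DvD: "\<bar>Dv\<bar> <= D+D2" using Dv XD D D20 by (simp add: Dv_def abs_le_iff)
 define y where "y = X i om - (1 - al) * s t i"
 have "x - y = (x - X i om * (1 - ga * s t i/L)) - ga * s t i * (bt t/L - al) - ga * s t i * (Dv/L)"
 proof -
 have "X i om = bt t+Dv" by (simp add: Dv_def)
 hence "X i om * (ga * s t i/L) = ga * s t i * (bt t/L)+ga * s t i * (Dv/L)" using L0 by (simp add: field_simps)
 moreover have "ga * s t i * al = (1 - al) * s t i" unfolding alpha_gamma[symmetric] by simp
 ultimately show ?thesis by (simp add: y_def algebra_simps)
 qed
 moreover have "\<bar>x - X i om * (1 - ga * s t i/L)\<bar> <= ka3/3"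
 proof -
 have "X i om <= 2 * L" using XD D bt(2) by (simp add: L_def)
 hence "X i om * ka/L <= 2 * L * ka/L" using k L0 by (intro divide_right_mono mult_right_mono) auto
 also have "... = 2 * ka" using L0 by simp
 finally show ?thesis using w k by (simp add: x_def L_def)
 qed
 moreover have "\<bar>ga * s t i * (bt t/L - al)\<bar> <= ka3/3"
 proof -
 have "\<bar>ga * s t i\<bar> * \<bar>bt t/L - al\<bar> <= ga * K * \<bar>bt t/L - al\<bar>" using gs by (intro mult_right_mono) auto
 thus ?thesis using bt(1) by (simp add: abs_mult L_def)
 qed
 moreover have "\<bar>ga * s t i * (Dv/L)\<bar> <= ka3/3"
 proof -
 have "\<bar>ga * s t i\<bar> * (\<bar>Dv\<bar>/L) <= ga * K * ((D+D2)/L)"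
 using gs DvD L0 gamma_pos K by (intro mult_mono divide_right_mono) auto
 also have "... <= ka3/3" using L by (simp add: L_def)
 finally have 1: "\<bar>ga * s t i\<bar> * (\<bar>Dv\<bar>/L) <= ka3/3" .
 have 2: "\<bar>ga * s t i * (Dv/L)\<bar> = \<bar>ga * s t i\<bar> * (\<bar>Dv\<bar>/L)"
 using L0 by (simp add: abs_mult)
 show ?thesis unfolding 2 by (rule 1)
 qed
 ultimately have xy: "\<bar>x - y\<bar> <= ka3" by (rule abs_diff3_le)
 have Py: "P t i om = exp (bt t - y)" unfolding P y_def by (simp add: algebra_simps)
 have ek: "0 <= exp ka3 - 1" using k by simp
 from either show ?thesis
 proof
 assume *: "pa t i om < R"
 have "\<bar>P t i om - pa t i om\<bar> <= pa t i om * (exp ka3 - 1)"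
 unfolding pa Py using xy by (intro abs_exp_diff_le) (simp add: abs_le_iff)
 also have "... <= R * (exp ka3 - 1)" using * ek by (intro mult_right_mono) auto
 finally show ?thesis using small by (simp add: abs_minus_commute)
 next
 assume *: "P t i om < R"
 have "\<bar>pa t i om - P t i om\<bar> <= P t i om * (exp ka3 - 1)"
 unfolding pa Py using xy by (intro abs_exp_diff_le) (simp add: abs_le_iff)
 also have "... <= R * (exp ka3 - 1)" using * ek by (intro mult_right_mono) auto
 finally show ?thesis using small by simp
 qed
qed

lemma tame_epoch_mono: assumes "om : tame" "i <= j" shows "epoch N i om <= epoch N j om"
proof -
 have "S i om <= S j om"
 using assms lift_Suc_mono_le[of "%i. S i om"] by (simp add: tame_def less_imp_le)
 thus ?thesis using assms by (simp add: tame_epoch V_le_iff S_nonneg)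
qed

text \<open>With probability tending to one, inside any fixed window the actual points and the surrogates
  are close to each other.\<close>

lemma close_prob:
 assumes R: "1 <= R" and ep: "0 < ep" "ep <= 1" and et: "0 < et"
 shows "\<forall>\<^sub>F t in at_top. prob (space M - close t R ep) <= et"
proof -
 obtain c U0 Y where c: "0 < c" "c <= 1" and U0: "1 < U0" and Y: "0 < Y"
 and far: "\<forall>\<^sub>F t in at_top. ALL u' u. U0 <= u' --> u' <= u --> u <= Lam t * (1 - Y/ln t) --> lam t * v u' <= 1 - c * (1 - u/Lam t)"
 using lam_far by blast
 define c' where "c' = min (c/2) (1 - al)"
 have c': "0 < c'" "c' <= c/2" "c' <= 1 - al" "c' <= 1"
 proof -
 show "0 < c'" using c alpha by (simp add: c'_def)
 show "c' <= c/2" "c' <= 1 - al" unfolding c'_def by (rule min.cobounded1, rule min.cobounded2)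
 thus "c' <= 1" using alpha by linarith
 qed
 define B where "B = ln (2 * R)"
 have B: "0 <= B" using R by (simp add: B_def)
 have "((%y. 4 * exp B/(al * c') * exp (- c' * y * al/2)) \<longlongrightarrow> 0) at_top"
 using c' alpha by real_asymp
 hence "\<forall>\<^sub>F y in at_top. 4 * exp B/(al * c') * exp (- c' * y * al/2) < et/4"
 using et by (intro order_tendstoD(2)) auto
 hence "\<forall>\<^sub>F y in at_top. y >= Y+1 & y >= 2 & 4 * exp B/(al * c') * exp (- c' * y * al/2) < et/4"
 using eventually_ge_at_top[of "Y+1"] eventually_ge_at_top[of 2] by eventually_elim auto
 then obtain Y1 where Y1: "Y1 >= Y+1" "Y1 >= 2" "4 * exp B/(al * c') * exp (- c' * Y1 * al/2) < et/4"
 using eventually_happens'[OF trivial_limit_at_top_linorder] by blast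
 define C where "C = ln (R+2)/(1 - al)"
 have C: "C > 0" using R alpha by (simp add: C_def)
 define K where "K = C+1+Y1"
 have K: "K > 0" using C Y1 by (simp add: K_def)
 define D where "D = max 0 (ln (16 * K/et))"
 have D: "0 <= D" "4 * K * exp (- D) <= et/4"
 proof -
 have "exp (- D) <= exp (- ln (16 * K/et))" by (simp add: D_def)
 also have "... = et/(16 * K)" using K et by (simp add: exp_minus)
 finally have "4 * K * exp (- D) <= 4 * K * (et/(16 * K))" using K by (intro mult_left_mono) auto
 thus "4 * K * exp (- D) <= et/4" using K by simp
 qed (simp add: D_def)
 define ka3 where "ka3 = ln (1+ep/R)"
 have k3: "ka3 > 0" "R * (exp ka3 - 1) <= ep" using ep R by (auto simp: ka3_def add_pos_pos)
 define ka2 where "ka2 = min 1 (ka3/6)"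
 have k2: "0 < ka2" "ka2 <= 1" "6 * ka2 <= ka3" using k3 by (auto simp: ka2_def min_def)
 define ka1 where "ka1 = ln (1+ep * exp (- (1 - al) * K))"
 have k1: "ka1 > 0" "exp ((1 - al) * K) * (exp ka1 - 1) = ep"
 proof -
 have "ep * exp (- (1 - al) * K) > 0" using ep by simp
 thus "ka1 > 0" by (simp add: ka1_def)
 have "exp ka1 = 1+ep * exp (- (1 - al) * K)"
 unfolding ka1_def by (rule exp_ln) (use \<open>ep * exp (- (1 - al) * K) > 0\<close> in linarith)
 hence "exp ((1 - al) * K) * (exp ka1 - 1) = ep * (exp ((1 - al) * K) * exp (- (1 - al) * K))"
 by (simp only: mult.assoc mult.left_commute add_diff_cancel_left')
 also have "... = ep" unfolding mult_exp_exp by (simp add: algebra_simps)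
 finally show "exp ((1 - al) * K) * (exp ka1 - 1) = ep" .
 qed
 define D2 where "D2 = max 0 (max (ln R+(1 - al) * K) (ln R+ga * K+1))"
 define mu where "mu = min (min (ka1 * al/(2 * a)) (ka2/(4 * ga))) (1/2)"
 have mu: "0 < mu" "mu <= ka1 * al/(2 * a)" "mu <= ka2/(4 * ga)" "mu <= 1/2"
 using k1 k2 a_pos gamma_pos alpha by (auto simp: mu_def)
 define C0 where "C0 = K+1"
 have C0: "C0 > 0" using K by (simp add: C0_def)
 have e1: "ka1/(2 * a) > 0" and e2: "ka2/2 > 0" using k1 k2 a_pos by auto
 have amu: "a * (ka1/(2 * a)+mu/al) <= ka1"
 proof -
 have "mu/al <= ka1 * al/(2 * a)/al" using mu alpha by (intro divide_right_mono) auto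
 hence "a * (mu/al) <= a * (ka1 * al/(2 * a)/al)" using a_pos by (intro mult_left_mono) auto
 also have "... = ka1/2" using a_pos alpha by simp
 finally have 1: "a * (mu/al) <= ka1/2" .
 have 2: "a * (ka1/(2 * a)) = ka1/2" using a_pos by simp
 show ?thesis unfolding distrib_left using 1 2 by linarith
 qed
 have gmu: "ka2/2+2 * ga * mu <= ka2"
 proof -
 have "2 * ga * mu <= 2 * ga * (ka2/(4 * ga))" using mu gamma_pos by (intro mult_left_mono) auto
 also have "... = ka2/2" using gamma_pos by simp
 finally show ?thesis by simp
 qed
 define m where "m = max (max 2 D) (max (ga * K+2) (max K (3 * ga * K * (D+D2)/ka3)))"
 have Lbig: "\<forall>\<^sub>F t in at_top. ln t >= m" using ln_at_top unfolding filterlim_at_top by blast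
 have btl: "\<forall>\<^sub>F t in at_top. dist (bt t/ln t) al < ka3/(3 * ga * K)"
 by (rule tendstoD[OF bt_over_ln]) (use k3 gamma_pos K in simp)
 have bt1: "\<forall>\<^sub>F t in at_top. bt t/ln t < 1" by (rule order_tendstoD(2)[OF bt_over_ln]) (use alpha in simp)
 have ls: "\<forall>\<^sub>F t in at_top. lam t * V U0 < ln 2"
 proof -
 have "((%t. lam t * V U0) \<longlongrightarrow> 0 * V U0) at_top" by (intro tendsto_intros lam_tendsto_0)
 thus ?thesis by (intro order_tendstoD(2)) auto
 qed
 have wl: "\<forall>\<^sub>F t in at_top. Lam t/ln t >= max 1 (1/mu)" using w_over_ln unfolding filterlim_at_top by blast
 have pr1: "\<forall>\<^sub>F t in at_top. prob (space M - lln t mu) <= et/4" using lln_prob[OF mu(1), of "et/4"] et by simp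
 have pr2: "\<forall>\<^sub>F t in at_top. prob (space M - nolong t K D) <= 4 * K * exp (- D)" using nolong_prob[OF K] .
 have pr3: "\<forall>\<^sub>F t in at_top. prob (space M - nofar t c' Y1 B) <= 4 * exp B/(al * c') * exp (- c' * Y1 * al/2)"
 using nofar_prob[OF c'(1,4) _ B, of Y1] Y1 by simp
 have det: "\<forall>\<^sub>F t in at_top. tame Int lln t mu Int nolong t K D Int nofar t c' Y1 B <= close t R ep"
 using far V_local[OF e1 C0] lam_local[OF e2 C0] large_t bt_large[of B] Lbig btl bt1 ls wl
 proof eventually_elim
 case (elim t)
 note F = elim(1)[rule_format] and VL = elim(2)[rule_format] and LL = elim(3)[rule_format]
 have t: "1 < t" "1 < ln t" "1 < Lam t" "0 < be t" "exp (- bt t) = be t" using elim(4) by auto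
 have btB: "0 <= bt t - B" "bt t - B <= ln t" "bt t <= ln t" using elim(5,8) t B by (auto simp: field_simps)
 have L: "ln t >= 2" "ln t >= D" "ln t >= ga * K+2" "ln t >= K" "ln t >= 3 * ga * K * (D+D2)/ka3"
 using elim(6) by (auto simp: m_def)
 have w: "Lam t >= ln t" "1 <= mu * Lam t/ln t" proof -
 have "1 <= Lam t/ln t" "1/mu <= Lam t/ln t" using elim(10) by auto
 thus "Lam t >= ln t" "1 <= mu * Lam t/ln t" using t mu by (simp_all add: field_simps)
 qed
 have bk: "ga * K * \<bar>bt t/ln t - al\<bar> <= ka3/3"
 proof -
 have "ga * K * \<bar>bt t/ln t - al\<bar> <= ga * K * (ka3/(3 * ga * K))"
 using elim(7) gamma_pos K by (intro mult_left_mono) (auto simp: dist_real_def)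
 thus ?thesis using gamma_pos K by simp
 qed
 have Lk: "ga * K * (D+D2)/ln t <= ka3/3" using L(5) t k3 by (simp add: field_simps)
 show ?case
 proof
 fix om assume om: "om : tame Int lln t mu Int nolong t K D Int nofar t c' Y1 B"
 hence omt: "om : tame" and omM: "om : space M" by (auto simp: tame_def)
 have lln: "\<bar>S i om - real i\<bar> <= mu * Lam t/ln t" if "real i <= 2 * Lam t" for i
 using om that by (auto simp: lln_def)
 have Sin: "real (Suc i) = Lam t * (1 - s t i/ln t)" for i using Suc_index[of t i] t by simp
 have i2: "real (Suc i) <= 2 * Lam t" if "- K <= s t i" for i
 proof -
 have "- s t i/ln t <= 1" using that L(4) t by (simp add: field_simps)
 hence "Lam t * (1 - s t i/ln t) <= Lam t * 2" using t by (intro mult_left_mono) auto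
 thus ?thesis unfolding Sin by simp
 qed
 have winq: "\<bar>qa t i om - Q t i\<bar> <= ep" if s: "\<bar>s t i\<bar> <= K" for i
 proof -
 have "\<bar>a * ((t - epoch N (Suc i) om)/t * ln t) - (1 - al) * s t i\<bar> <= a * (ka1/(2 * a)+mu/al)"
 using t s mu lln[OF i2[of i]]
 by (intro window_q[OF omt _ _ _ VL _ s]) (auto simp: C0_def)
 hence "\<bar>a * ((t - epoch N (Suc i) om)/t * ln t) - (1 - al) * s t i\<bar> <= ka1" using amu by linarith
 hence "\<bar>- a * ((t - epoch N (Suc i) om)/t * ln t) - (- (1 - al) * s t i)\<bar> <= ka1"
 unfolding mult_minus_left by linarith
 hence "\<bar>qa t i om - Q t i\<bar> <= exp (- (1 - al) * s t i) * (exp ka1 - 1)"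
 unfolding qa_def using t by (subst Q_s) (auto intro: abs_exp_diff_le)
 also have "... <= exp ((1 - al) * K) * (exp ka1 - 1)"
 proof -
 have "- (1 - al) * s t i = (1 - al) * (- s t i)" by (simp add: algebra_simps)
 also have "... <= (1 - al) * K" using s alpha by (intro mult_left_mono) auto
 finally show ?thesis using k1 by (intro mult_right_mono) auto
 qed
 finally show ?thesis using k1 by simp
 qed
 show "om : close t R ep" unfolding close_def mem_Collect_eq
 proof (intro conjI omM allI impI)
 fix i assume A: "(pa t i om < R & qa t i om < R) | (P t i om < R & Q t i < R)"
 consider "s t i >= Y1" | "s t i < - (C+1)" | "- (C+1) <= s t i" "s t i < Y1" by linarith
 hence "\<bar>s t i\<bar> <= K"
 proof cases
 case 1
 hence s0: "0 < s t i" using Y1 by linarith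
 have Xf: "X i om <= (bt t - B) * (1+c' * s t i/ln t)" using om 1 by (auto simp: nofar_def)
 have "lam t * gap N (Suc i) om <= bt t - B+ln 2"
 proof (rule far_p[OF omt, where c'=c' and mu=mu and i=i and ?U0.0=U0 and Y=Y and c=c])
 show "lam t * v u' <= 1 - c * (1 - u/Lam t)" if "U0 <= u'" "u' <= u" "u <= Lam t * (1 - Y/ln t)" for u' u
 using F that by blast
 show "S (Suc i) om <= real (Suc i)+mu * Lam t/ln t" using lln[OF i2[of i]] s0 K by (simp add: abs_le_iff)
 qed (use c c' U0 t 1 Y1 mu Xf btB elim(9) s0 in auto)
 hence "exp (B - ln 2) <= pa t i om" by (simp add: pa_def)
 hence "R <= pa t i om" using R by (simp add: B_def exp_diff)
 moreover have "exp B <= P t i om"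
 using c' t s0 Xf btB by (intro far_P[where c'=c']) auto
 hence "R <= P t i om" using R by (simp add: B_def)
 ultimately show ?thesis using A by linarith
 next
 case 2
 define j where "j = nat \<lceil>Lam t * (1+C/ln t)\<rceil> - 1"
 have C1: "Lam t * (1+C/ln t) >= 1" using t C by (smt (verit) divide_pos_pos mult_less_cancel_left1)
 have j: "Lam t * (1+C/ln t) <= real (Suc j)" "real (Suc j) <= Lam t * (1+C/ln t)+1"
 using C1 unfolding j_def by linarith+
 have "1+C/ln t <= real (Suc j)/Lam t" using j(1) t by (simp add: field_simps)
 hence "s t j <= (- (C/ln t)) * ln t" unfolding s_def using t by (intro mult_right_mono) auto
 hence sj1: "s t j <= - C" using t by simp
 have "real (Suc j)/Lam t <= (Lam t * (1+C/ln t)+1)/Lam t" using j(2) t by (intro divide_right_mono) auto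
 also have "... = 1+C/ln t+1/Lam t" using t by (simp add: field_simps)
 also have "... <= 1+C/ln t+1/ln t" using w(1) t by (intro add_left_mono frac_le) auto
 finally have "- ((C+1)/ln t) <= 1 - real (Suc j)/Lam t" by (simp add: add_divide_distrib)
 hence "(- ((C+1)/ln t)) * ln t <= s t j" unfolding s_def using t by (intro mult_right_mono) auto
 hence sj2: "- (C+1) <= s t j" using t by simp
 have "\<bar>s t j\<bar> <= K" using sj1 sj2 C Y1 by (simp add: K_def abs_le_iff)
 hence qj: "Q t j - ep <= qa t j om" using winq[of j] by (simp add: abs_le_iff)
 have big: "R+2 <= Q t k" if "s t k <= - C" for k
 proof -
 have "(1 - al) * C <= (1 - al) * (- s t k)" using that alpha by (intro mult_left_mono) auto
 moreover have "(1 - al) * C = ln (R+2)" using alpha by (simp add: C_def)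
 moreover have "(1 - al) * (- s t k) = - (1 - al) * s t k" by (simp add: algebra_simps)
 ultimately have "exp (ln (R+2)) <= exp (- (1 - al) * s t k)" by (simp only: exp_le_cancel_iff)
 thus ?thesis using t R by (subst Q_s) auto
 qed
 have "j <= i"
 proof (rule ccontr)
 assume "~ j <= i"
 hence "real (Suc i) <= real (Suc j)" by simp
 hence "s t j <= s t i" unfolding s_def using t
 by (intro mult_right_mono diff_left_mono divide_right_mono) auto
 thus False using sj2 2 by linarith
 qed
 hence "epoch N (Suc j) om <= epoch N (Suc i) om" by (intro tame_epoch_mono[OF omt]) simp
 hence "qa t j om <= qa t i om"
 unfolding qa_def using a_pos t by (auto intro!: mult_left_mono mult_right_mono divide_right_mono)
 hence "R < qa t i om" using qj big[OF sj1] ep by linarith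
 moreover have "R < Q t i" using big[of i] 2 by linarith
 ultimately show ?thesis using A by linarith
 next
 case 3 thus ?thesis using C Y1 by (simp add: K_def abs_le_iff)
 qed
 note s = this
 have X0: "0 <= X i om" using tame_S(2)[OF omt, of i] by simp
 have sK: "- K <= s t i" using s by linarith
 have i2': "real i <= 2 * Lam t" using i2[OF sK] by simp
 have wp: "\<bar>lam t * gap N (Suc i) om - X i om * (1 - ga * s t i/ln t)\<bar> <= X i om * ka2/ln t"
 by (rule window_p[OF omt _ _ _ LL lln[OF i2[OF sK]] lln[OF i2'] w(2) s _ gmu])
 (use t L k2 mu in \<open>auto simp: C0_def\<close>)
 have "\<bar>pa t i om - P t i om\<bar> <= ep"
 proof (rule window_p_close[OF wp X0 s _ k2 t(5) _ t(2) _ D(1) L(2) _ _ _ R bk btB(3) Lk k3(2)])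
 show "X i om <= bt t+D" using om s by (auto simp: nolong_def)
 qed (use K t A in \<open>auto simp: D2_def\<close>)
 thus "\<bar>pa t i om - P t i om\<bar> <= ep" "\<bar>qa t i om - Q t i\<bar> <= ep" using winq[OF s] by auto
 qed
 qed
 qed
 show ?thesis using det pr1 pr2 pr3
 proof eventually_elim
 case (elim t)
 note [measurable] = tame_event lln_event nolong_event nofar_event
 have "prob (space M - close t R ep) <= prob ((space M - tame) Un ((space M - lln t mu) Un ((space M - nolong t K D) Un (space M - nofar t c' Y1 B))))"
 using elim(1) by (intro finite_measure_mono) auto
 also have "... <= prob (space M - tame)+(prob (space M - lln t mu)+(prob (space M - nolong t K D)+prob (space M - nofar t c' Y1 B)))"
 by (intro order_trans[OF measure_Un_le] add_left_mono order_refl sets.Un sets.compl_sets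
 tame_event lln_event nolong_event nofar_event)
 also have "... <= 0+(et/4+(et/4+et/4))"
 using elim D(2) Y1(3) by (intro add_mono) (auto simp: tame_prob)
 also have "... <= et" using et by simp
 finally show ?case .
 qed
qed

end

section \<open>Vague convergence in exponential coordinates\<close>

definition decay :: "real => ereal => real" where
 "decay c x = (if x = \<infinity> then 0 else exp (- c * real_of_ereal x))"

definition undecay :: "real => real => ereal" where
 "undecay c p = (if p <= 0 then \<infinity> else ereal (- ln p/c))"

definition chart :: "real => ereal \<times> ereal => real \<times> real" where
 "chart a e = (decay 1 (fst e), decay a (snd e))"

definition unchart :: "real => real \<times> real => ereal \<times> ereal" where
 "unchart a y = (undecay 1 (fst y), undecay a (snd y))"

lemma undecay_decay: "c > 0 ==> x ~= -\<infinity> ==> undecay c (decay c x) = x"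
 by (cases x) (auto simp: undecay_def decay_def)

lemma decay_undecay: "c > 0 ==> 0 <= p ==> decay c (undecay c p) = p"
 by (auto simp: undecay_def decay_def)

lemma undecay_neq_MInfty: "undecay c p ~= -\<infinity>" by (simp add: undecay_def)

lemma unchart_in: "unchart a y : ext_plane"
proof -
 have "- \<infinity> < undecay c p" for c p using undecay_neq_MInfty[of c p] by (cases "undecay c p") auto
 thus ?thesis by (simp add: unchart_def ext_plane_def)
qed

lemma chart_unchart: "a > 0 ==> 0 <= fst y ==> 0 <= snd y ==> chart a (unchart a y) = y"
 by (simp add: unchart_def chart_def decay_undecay)

lemma undecay_continuous: assumes "c > 0" shows "continuous_on {0..} (undecay c)"
 unfolding continuous_on_def
proof
 fix p :: real assume p: "p : {0..}"
 show "(undecay c \<longlongrightarrow> undecay c p) (at p within {0..})"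
 proof (cases "p = 0")
 case True
 have "(undecay c \<longlongrightarrow> \<infinity>) (at 0 within {0..})"
 unfolding tendsto_PInfty
 proof
 fix r :: real
 have "ereal r < undecay c y" if "y : {0..}" "y ~= 0" "dist y 0 < exp (- c * r)" for y
 proof -
 have "0 < y" "y < exp (- c * r)" using that by (auto simp: dist_real_def)
 hence "ln y < ln (exp (- c * r))" by (subst ln_less_cancel_iff) auto
 hence "r * c < - ln y" by (simp add: mult.commute)
 hence "r < - ln y/c" using assms by (subst pos_less_divide_eq)
 thus ?thesis using \<open>0 < y\<close> by (simp add: undecay_def)
 qed
 thus "\<forall>\<^sub>F y in at 0 within {0..}. ereal r < undecay c y"
 unfolding eventually_at by (intro exI[of _ "exp (- c * r)"]) auto
 qed
 thus ?thesis using True by (simp add: undecay_def)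
 next
 case False
 hence p0: "p > 0" using p by simp
 have "((%y. ereal (- ln y/c)) \<longlongrightarrow> ereal (- ln p/c)) (at p within {0..})"
 using p0 assms by (intro tendsto_intros) auto
 hence "(undecay c \<longlongrightarrow> ereal (- ln p/c)) (at p within {0..})"
 proof (rule Lim_transform_eventually)
 have "\<forall>\<^sub>F y in at p within {0..}. y > 0"
 using p0 order_tendstoD(1)[OF tendsto_ident_at p0] by simp
 thus "\<forall>\<^sub>F y in at p within {0..}. ereal (- ln y/c) = undecay c y"
 by eventually_elim (simp add: undecay_def)
 qed
 thus ?thesis using p0 by (simp add: undecay_def)
 qed
qed

lemma unchart_continuous: assumes "a > 0" shows "continuous_on ({0..} \<times> {0..}) (unchart a)"
 unfolding unchart_def
 by (intro continuous_intros continuous_on_compose2[OF undecay_continuous]) (use assms in auto)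

lemma decay_measurable [measurable]: "decay c : borel_measurable borel"
 unfolding decay_def[abs_def] by measurable

lemma undecay_measurable [measurable]: "undecay c : borel_measurable borel"
 unfolding undecay_def[abs_def] by measurable

lemma unchart_measurable [measurable]: "unchart a : borel_measurable borel"
 unfolding unchart_def[abs_def]
 by (intro borel_measurable_Pair measurable_compose[OF borel_measurable_continuous_onI undecay_measurable] continuous_intros)

lemma chart_measurable [measurable]: "chart a : borel_measurable borel"
 unfolding chart_def[abs_def]
 by (intro borel_measurable_Pair measurable_compose[OF borel_measurable_continuous_onI decay_measurable] continuous_intros)

lemma ext_plane_borel: "ext_plane : sets borel"
 unfolding ext_plane_def by (intro borel_open open_Times) auto

lemma compact_chart_bounded:
 assumes a: "a > 0" and K: "compact K" "K <= ext_plane"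
 shows "EX R>=0. ALL e:K. fst (chart a e) <= R & snd (chart a e) <= R"
proof (cases "K = {}")
 case True thus ?thesis by (intro exI[of _ 0]) auto
next
 case False
 have bound: "EX R. ALL e:K. decay c (pp e) <= R" if c: "c > 0" and pp: "continuous_on K pp" "!!e. e : K ==> pp e ~= -\<infinity>"
 for c and pp :: "ereal \<times> ereal => ereal"
 proof -
 obtain e0 where e0: "e0 : K" "!!e. e : K ==> pp e0 <= pp e"
 using continuous_attains_inf[OF K(1) False pp(1)] by blast
 have "decay c (pp e) <= decay c (pp e0)" if "e : K" for e
 using e0(2)[OF that] pp(2)[OF that] pp(2)[OF e0(1)] c
 by (cases "pp e"; cases "pp e0") (auto simp: decay_def)
 thus ?thesis by blast
 qed
 have "EX R. ALL e:K. decay 1 (fst e) <= R"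
 using K(2) by (intro bound continuous_intros) (auto simp: ext_plane_def)
 moreover have "EX R. ALL e:K. decay a (snd e) <= R"
 using K(2) a by (intro bound continuous_intros) (auto simp: ext_plane_def)
 ultimately obtain R1 R2 where "ALL e:K. decay 1 (fst e) <= R1" "ALL e:K. decay a (snd e) <= R2" by blast
 thus ?thesis by (intro exI[of _ "max 0 (max R1 R2)"]) (auto simp: chart_def le_max_iff_disj)
qed

text \<open>Locally finite configurations, in the chart.\<close>

definition qbox :: "real => (real \<times> real) set" where
 "qbox R = {0..R} \<times> {0..R}"

definition config :: "'i set => ('i => real \<times> real) => bool" where
 "config I x \<longleftrightarrow> (ALL i:I. 0 <= fst (x i) & 0 <= snd (x i)) & (ALL R. finite {i\<in>I. x i : qbox R})"

definition PM :: "real => 'i set => ('i => real \<times> real) => (ereal \<times> ereal) measure" where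
 "PM a I x = point_measure_on ext_plane I (%i. unchart a (x i))"

lemma space_restrict_ext_plane [simp]: "space (restrict_space borel ext_plane) = ext_plane"
 by (simp add: space_restrict_space)

lemma PM_point_measurable: "(%i. unchart a (x i)) : measurable (count_space I) (restrict_space borel ext_plane)"
 by (simp add: unchart_in)

lemma emeasure_PM:
 assumes "A : sets (restrict_space borel ext_plane)"
 shows "emeasure (PM a I x) A = emeasure (count_space I) {i\<in>I. unchart a (x i) : A}"
 unfolding PM_def point_measure_on_def
 by (subst emeasure_distr[OF PM_point_measurable assms]) (simp add: vimage_def Int_def conj_commute)

lemma PM_sets: "sets (PM a I x) = sets (restrict_space borel ext_plane)"
 by (simp add: PM_def point_measure_on_def)

lemma PM_radon:
 assumes a: "a > 0" and c: "config I x"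
 shows "PM a I x : radon_measures ext_plane"
 unfolding radon_measures_def
proof (intro CollectI conjI allI impI)
 show "sets (PM a I x) = sets (restrict_space borel ext_plane)" by (rule PM_sets)
 fix K :: "(ereal \<times> ereal) set" assume K: "compact K & K <= ext_plane"
 then obtain R where R: "ALL e:K. fst (chart a e) <= R & snd (chart a e) <= R"
 using compact_chart_bounded[OF a] by blast
 have "closed K" using K by (intro compact_imp_closed) auto
 hence Ks: "K : sets (restrict_space borel ext_plane)"
 using K ext_plane_borel by (auto simp: sets_restrict_space_iff)
 have "{i\<in>I. unchart a (x i) : K} <= {i\<in>I. x i : qbox R}"
 proof safe
 fix i assume i: "i : I" "unchart a (x i) : K"
 hence "chart a (unchart a (x i)) = x i" using c a by (intro chart_unchart) (auto simp: config_def)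
 thus "x i : qbox R" using R i c by (auto simp: qbox_def config_def mem_Times_iff)
 qed
 hence "finite {i\<in>I. unchart a (x i) : K}" by (rule finite_subset) (use c in \<open>simp add: config_def\<close>)
 thus "emeasure (PM a I x) K < \<infinity>"
 by (simp add: emeasure_PM[OF Ks] emeasure_count_space_finite less_top[symmetric])
qed

lemma Cc_measurable: "f : Cc E ==> f : borel_measurable (restrict_space borel E)"
 by (auto simp: Cc_def intro: borel_measurable_continuous_on_restrict)

lemma integral_PM:
 assumes f: "f : Cc ext_plane" and fin: "finite {i\<in>I. f (unchart a (x i)) ~= 0}"
 shows "(\<integral>e. f e \<partial>PM a I x) = (\<Sum>i | i : I & f (unchart a (x i)) ~= 0. f (unchart a (x i)))"
 unfolding PM_def point_measure_on_def
 by (subst integral_distr[OF PM_point_measurable Cc_measurable[OF f]])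
 (rule lebesgue_integral_count_space_finite_support[OF fin])

text \<open>Two configurations match up to \<open>R\<close> with precision \<open>\<epsilon>\<close> if their points are paired with this
  precision, where at least all points in the square of side \<open>R\<close> have partners.\<close>

definition matched ::
 "real => real => 'i set => ('i => real \<times> real) => 'j set => ('j => real \<times> real) => bool" where
 "matched R ep I x I' x' \<longleftrightarrow> (EX J J' be. J <= I & J' <= I' & bij_betw be J J' &
 (ALL i:I. x i : qbox R --> i : J) & (ALL i:I'. x' i : qbox R --> i : J') &
 (ALL i:J. \<bar>fst (x i) - fst (x' (be i))\<bar> <= ep & \<bar>snd (x i) - snd (x' (be i))\<bar> <= ep))"

lemma matched_integral:
 fixes I' :: "'j set"
 assumes a: "a > 0" and f: "f : Cc ext_plane" and c': "config I' x'" and e: "e > 0"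
 shows "EX R0. EX d>0. ALL R>=R0. ALL ep<=d. ALL I x. config (I :: 'i set) x --> matched R ep I x I' x' -->
 \<bar>(\<integral>e. f e \<partial>PM a I x) - (\<integral>e. f e \<partial>PM a I' x')\<bar> < e"
proof -
 obtain K where K: "compact K" "K <= ext_plane" "!!y. y : ext_plane - K ==> f y = 0" and fc: "continuous_on ext_plane f"
 using f by (auto simp: Cc_def)
 obtain R1 where R1: "R1 >= 0" "ALL e:K. fst (chart a e) <= R1 & snd (chart a e) <= R1"
 using compact_chart_bounded[OF a K(1,2)] by blast
 define g where "g y = f (unchart a y)" for y
 have g0: "y : qbox R1" if "g y ~= 0" "0 <= fst y" "0 <= snd y" for y
 proof -
 have "unchart a y : K" using that(1) K(3)[of "unchart a y"] unchart_in[of a y] unfolding g_def by blast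
 thus ?thesis using R1(2) chart_unchart[OF a that(2,3)] that(2,3) by (auto simp: qbox_def mem_Times_iff)
 qed
 have "continuous_on (qbox (R1+1)) g"
 unfolding g_def
 by (rule continuous_on_compose2[OF fc continuous_on_subset[OF unchart_continuous[OF a]]])
 (auto simp: qbox_def unchart_in)
 hence "uniformly_continuous_on (qbox (R1+1)) g"
 by (intro compact_uniformly_continuous) (auto simp: qbox_def intro: compact_Times)
 moreover define F' where "F' = {i\<in>I'. x' i : qbox (R1+1)}"
 have finF': "finite F'" using c' by (simp add: config_def F'_def)
 moreover have "e/(real (card F')+1) > 0" using e by (simp add: add_nonneg_pos)
 ultimately obtain d0 where d0: "d0 > 0" "!!y y'. y : qbox (R1+1) ==> y' : qbox (R1+1) ==> dist y' y < d0 ==>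
 dist (g y') (g y) < e/(real (card F')+1)"
 unfolding uniformly_continuous_on_def by metis
 define d where "d = min (d0/3) 1"
 have d: "d > 0" "d <= 1" "2 * d < d0" using d0(1) by (auto simp: d_def)
 have main: "\<bar>(\<integral>e. f e \<partial>PM a I x) - (\<integral>e. f e \<partial>PM a I' x')\<bar> < e"
 if R: "R >= R1+1" and ep: "ep <= d" and c: "config I x" and m: "matched R ep I x I' x'" for R ep and I :: "'i set" and x
 proof -
 obtain J J' be where J: "J <= I" "J' <= I'" "bij_betw be J J'"
 "!!i. i : I ==> x i : qbox R ==> i : J" "!!i. i : I' ==> x' i : qbox R ==> i : J'"
 "!!i. i : J ==> \<bar>fst (x i) - fst (x' (be i))\<bar> <= ep & \<bar>snd (x i) - snd (x' (be i))\<bar> <= ep"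
 using m unfolding matched_def by blast
 have nn: "0 <= fst (x i)" "0 <= snd (x i)" if "i : I" for i using c that by (auto simp: config_def)
 have nn': "0 <= fst (x' i)" "0 <= snd (x' i)" if "i : I'" for i using c' that by (auto simp: config_def)
 have boxR: "y : qbox R" if "y : qbox (R1+1)" for y using that R by (auto simp: qbox_def)
 have box1: "y : qbox (R1+1)" if "y : qbox R1" for y using that by (auto simp: qbox_def)
 have beI: "be i : I'" if "i : J" for i using J that by (auto simp: bij_betw_def)
 define J1 where "J1 = {i\<in>J. x i : qbox R1 | x' (be i) : qbox R1}"
 have J1b: "x i : qbox (R1+1) & x' (be i) : qbox (R1+1)" if "i : J1" for i
 proof -
 have i: "i : J" "i : I" "be i : I'" using that J beI by (auto simp: J1_def)
 have "\<bar>fst (x i) - fst (x' (be i))\<bar> <= 1" "\<bar>snd (x i) - snd (x' (be i))\<bar> <= 1" using J(6)[OF i(1)] ep d by auto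
 thus ?thesis using that nn[OF i(2)] nn'[OF i(3)] unfolding J1_def qbox_def mem_Times_iff mem_Collect_eq atLeastAtMost_iff
 by linarith
 qed
 have inj: "inj_on be J1" using J(3) by (auto simp: bij_betw_def J1_def inj_on_def)
 have "be ` J1 <= F'" using J1b beI by (auto simp: F'_def J1_def)
 hence finbe: "finite (be ` J1)" by (rule finite_subset[OF _ finF'])
 have finJ1: "finite J1" by (rule finite_imageD[OF finbe inj])
 have cJ1: "card J1 <= card F'"
 using card_mono[OF finF' \<open>be ` J1 <= F'\<close>] by (simp add: card_image[OF inj])
 have "(\<integral>e. f e \<partial>PM a I x) = (\<Sum>i | i : I & g (x i) ~= 0. g (x i))"
 proof -
 have sub: "{i\<in>I. f (unchart a (x i)) ~= 0} <= {i\<in>I. x i : qbox R1}" using g0 nn unfolding g_def by blast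
 have "finite {i\<in>I. f (unchart a (x i)) ~= 0}" by (rule finite_subset[OF sub]) (use c in \<open>simp add: config_def\<close>)
 thus ?thesis using integral_PM[OF f] by (simp add: g_def)
 qed
 also have "... = (\<Sum>i\<in>J1. g (x i))"
 proof (rule sum.mono_neutral_left[OF finJ1])
 show "{i. i : I & g (x i) ~= 0} <= J1"
 proof
 fix i assume "i : {i. i : I & g (x i) ~= 0}"
 hence i: "i : I" "x i : qbox R1" using g0 nn by blast+
 hence "i : J" using J(4) boxR box1 by blast
 thus "i : J1" using i by (simp add: J1_def)
 qed
 have "J1 <= I" using J(1) unfolding J1_def by blast
 thus "ALL i:J1 - {i. i : I & g (x i) ~= 0}. g (x i) = 0" by blast
 qed
 finally have 1: "(\<integral>e. f e \<partial>PM a I x) = (\<Sum>i\<in>J1. g (x i))" .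
 have "(\<integral>e. f e \<partial>PM a I' x') = (\<Sum>i | i : I' & g (x' i) ~= 0. g (x' i))"
 proof -
 have sub: "{i\<in>I'. f (unchart a (x' i)) ~= 0} <= {i\<in>I'. x' i : qbox R1}" using g0 nn' unfolding g_def by blast
 have "finite {i\<in>I'. f (unchart a (x' i)) ~= 0}" by (rule finite_subset[OF sub]) (use c' in \<open>simp add: config_def\<close>)
 thus ?thesis using integral_PM[OF f] by (simp add: g_def)
 qed
 also have "... = (\<Sum>i\<in>be ` J1. g (x' i))"
 proof (rule sum.mono_neutral_left)
 show "{i. i : I' & g (x' i) ~= 0} <= be ` J1"
 proof
 fix i assume "i : {i. i : I' & g (x' i) ~= 0}"
 hence i: "i : I'" "x' i : qbox R1" using g0 nn' by blast+
 hence "i : J'" using J(5) boxR box1 by blast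
 then obtain k where "k : J" "be k = i" using J(3) by (auto simp: bij_betw_def)
 thus "i : be ` J1" using i by (auto simp: J1_def)
 qed
 have "be ` J1 <= I'" using beI unfolding J1_def by blast
 thus "ALL i:be ` J1 - {i. i : I' & g (x' i) ~= 0}. g (x' i) = 0" by blast
 qed (rule finbe)
 also have "... = (\<Sum>i\<in>J1. g (x' (be i)))" using inj by (simp add: sum.reindex)
 finally have 2: "(\<integral>e. f e \<partial>PM a I' x') = (\<Sum>i\<in>J1. g (x' (be i)))" .
 have "\<bar>(\<integral>e. f e \<partial>PM a I x) - (\<integral>e. f e \<partial>PM a I' x')\<bar> <= (\<Sum>i\<in>J1. \<bar>g (x i) - g (x' (be i))\<bar>)"
 unfolding 1 2 sum_subtractf[symmetric] by (rule sum_abs)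
 also have "... <= (\<Sum>i\<in>J1. e/(real (card F')+1))"
 proof (rule sum_mono)
 fix i assume i: "i : J1"
 have "dist (x i) (x' (be i)) <= \<bar>fst (x i) - fst (x' (be i))\<bar> + \<bar>snd (x i) - snd (x' (be i))\<bar>"
 unfolding dist_prod_def dist_real_def by (rule sqrt_sum_squares_le_sum) auto
 also have "... <= 2 * d" using J(6)[of i] i ep by (simp add: J1_def)
 also have "... < d0" by (rule d)
 finally show "\<bar>g (x i) - g (x' (be i))\<bar> <= e/(real (card F')+1)"
 using d0(2)[of "x' (be i)" "x i"] J1b[OF i] by (simp add: dist_real_def)
 qed
 also have "... = real (card J1) * (e/(real (card F')+1))" by simp
 also have "... <= real (card F') * (e/(real (card F')+1))" using cJ1 e by (intro mult_right_mono) auto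
 also have "... < e" using e by (simp add: field_simps)
 finally show ?thesis .
 qed
 show ?thesis using d(1) main by (intro exI[of _ "R1+1"] exI[of _ d]) blast
qed

text \<open>Sufficiently precise matching respects basic vague neighbourhoods, hence all vaguely open sets.\<close>

lemma matched_open:
 fixes I' :: "'j set"
 assumes a: "a > 0" and U: "openin (vague_topology ext_plane) U"
 and c': "config I' x'" "PM a I' x' : U"
 shows "EX R0. EX d>0. ALL R>=R0. ALL ep<=d. ALL I x. config (I :: 'i set) x --> matched R ep I x I' x' --> PM a I x : U"
proof -
 have "generate_topology_on {{m : radon_measures ext_plane. (\<integral>x. f x \<partial>m) : U} | f U. f : Cc ext_plane & open U} U"
 using U unfolding vague_topology_def by (rule openin_topology_generated_by)
 thus ?thesis using c'(2)
 proof (induction rule: generate_topology_on.induct)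
 case Empty thus ?case by simp
 next
 case (Int A B)
 then obtain RA dA RB dB where "dA > 0" "dB > 0"
 and A: "ALL R>=RA. ALL ep<=dA. ALL I x. config (I :: 'i set) x --> matched R ep I x I' x' --> PM a I x : A"
 and B: "ALL R>=RB. ALL ep<=dB. ALL I x. config (I :: 'i set) x --> matched R ep I x I' x' --> PM a I x : B"
 by blast
 show ?case
 proof (rule exI[of _ "max RA RB"], rule exI[of _ "min dA dB"], intro conjI allI impI)
 show "min dA dB > 0" using \<open>dA > 0\<close> \<open>dB > 0\<close> by simp
 next
 fix R ep and I :: "'i set" and x
 assume "R >= max RA RB" "ep <= min dA dB" "config I x" "matched R ep I x I' x'"
 thus "PM a I x : A Int B" using A B by (auto dest: spec)
 qed
 next
 case (UN K)
 then obtain k where k: "k : K" "PM a I' x' : k" by blast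
 from UN.IH[OF this] show ?case using k(1) by (meson UnionI)
 next
 case (Basis s)
 then obtain f W where f: "f : Cc ext_plane" "open W" "s = {m : radon_measures ext_plane. (\<integral>x. f x \<partial>m) : W}" by blast
 hence "(\<integral>x. f x \<partial>PM a I' x') : W" using Basis by simp
 then obtain e where e: "e > 0" "!!y. dist y (\<integral>x. f x \<partial>PM a I' x') < e ==> y : W"
 using f(2) unfolding open_dist by blast
 obtain R0 d where d: "d > 0" "ALL R>=R0. ALL ep<=d. ALL I x. config (I :: 'i set) x --> matched R ep I x I' x' -->
 \<bar>(\<integral>e. f e \<partial>PM a I x) - (\<integral>e. f e \<partial>PM a I' x')\<bar> < e"
 using matched_integral[OF a f(1) c'(1) e(1)] by blast
 have "PM a I x : s" if "R >= R0" "ep <= d" "config I x" "matched R ep I x I' x'" for R ep and I :: "'i set" and x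
 unfolding f(3) using PM_radon[OF a that(3)] e(2) d(2) that by (simp add: dist_real_def)
 thus ?case using d(1) by blast
 qed
qed

text \<open>The cells of side \<open>2\<^sup>-\<^sup>n\<close> in \<open>[0, n)\<^sup>2\<close>.\<close>

definition cells :: "nat => (nat \<times> nat) set" where
 "cells n = {..<n * 2^n} \<times> {..<n * 2^n}"

lemma finite_cells [simp]: "finite (cells n)" by (simp add: cells_def)

lemma in_some_cell:
 assumes "0 <= fst y" "fst y < real n" "0 <= snd y" "snd y < real n"
 shows "EX c:cells n. y : cell (1/2^n) c"
proof -
 have *: "EX j<n * 2^n. real j * (1/2^n) <= p & p < real (j+1) * (1/2^n)" if p: "0 <= p" "p < real n" for p
 proof (intro exI conjI)
 define j where "j = nat \<lfloor>p * 2^n\<rfloor>"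
 have "0 <= p * 2^n" using p by simp
 hence j: "real j <= p * 2^n" "p * 2^n < real j+1" unfolding j_def by linarith+
 have "p * 2^n < real n * 2^n" using p by simp
 also have "real n * 2^n = real (n * 2^n)" by simp
 finally have "real j < real (n * 2^n)" using j(1) by linarith
 thus "j < n * 2^n" by (simp only: of_nat_less_iff)
 show "real j * (1/2^n) <= p" "p < real (j+1) * (1/2^n)" using j by (auto simp: field_simps)
 qed
 from *[OF assms(1,2)] *[OF assms(3,4)] show ?thesis
 by (auto simp: cells_def cell_def mem_Times_iff intro!: bexI[of _ "(_, _)"])
qed

lemma cell_window:
 assumes "c : cells n" "y : cell (1/2^n) c"
 shows "0 <= fst y" "fst y < real n" "0 <= snd y" "snd y < real n"
proof -
 have *: "real (j+1) * (1/2^n) <= real n" if "j < n * 2^n" for j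
 proof -
 have "real (j+1) <= real (n * 2^n)" using that by (simp only: of_nat_le_iff)
 thus ?thesis by (simp add: field_simps)
 qed
 have j: "fst c < n * 2^n" "snd c < n * 2^n" using assms(1) by (auto simp: cells_def)
 have y: "real (fst c) * (1/2^n) <= fst y" "fst y < real (fst c+1) * (1/2^n)"
 "real (snd c) * (1/2^n) <= snd y" "snd y < real (snd c+1) * (1/2^n)"
 using assms(2) by (auto simp: cell_def mem_Times_iff)
 have "0 <= real (fst c) * (1/2^n)" "0 <= real (snd c) * (1/2^n)" by simp_all
 thus "0 <= fst y" "fst y < real n" "0 <= snd y" "snd y < real n" using *[OF j(1)] *[OF j(2)] y by linarith+
qed

lemma cell_close:
 assumes "y : cell h c" "y' : cell h c"
 shows "\<bar>fst y - fst y'\<bar> <= h" "\<bar>snd y - snd y'\<bar> <= h"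
proof -
 have *: "\<bar>p - p'\<bar> <= h" if "real j * h <= p" "p < real (j+1) * h" "real j * h <= p'" "p' < real (j+1) * h" for p p' j
 proof -
 have "real (j+1) * h = real j * h+h" by (simp add: algebra_simps)
 thus ?thesis using that by linarith
 qed
 show "\<bar>fst y - fst y'\<bar> <= h" using *[of "fst c" "fst y" "fst y'"] assms by (auto simp: cell_def mem_Times_iff)
 show "\<bar>snd y - snd y'\<bar> <= h" using *[of "snd c" "snd y" "snd y'"] assms by (auto simp: cell_def mem_Times_iff)
qed

text \<open>Equal cell counts give a matching, also if the counted points \<open>y i\<close> are only close to the
  points \<open>x i\<close> of the configuration.\<close>

lemma counts_matched:
 assumes cy: "!!c. c : cells n ==> finite {i\<in>I. y i : cell (1/2^n) c}"
 and cx': "!!c. c : cells n ==> finite {i\<in>I'. x' i : cell (1/2^n) c}"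
 and pos: "!!i. i : I ==> 0 <= fst (y i) & 0 <= snd (y i)"
 and eq: "!!c. c : cells n ==> card {i\<in>I. y i : cell (1/2^n) c} = card {i\<in>I'. x' i : cell (1/2^n) c}"
 and cl: "!!i. i : I ==> (fst (x i) < real n & snd (x i) < real n) | (fst (y i) < real n & snd (y i) < real n) ==>
 \<bar>fst (x i) - fst (y i)\<bar> <= ep & \<bar>snd (x i) - snd (y i)\<bar> <= ep"
 and e: "ep <= 1"
 shows "matched (real n - 2) (1/2^n+ep) I x I' x'"
proof -
 define h where "h = 1/(2::real)^n"
 define A A' where "A c = {i\<in>I. y i : cell h c}" and "A' c = {i\<in>I'. x' i : cell h c}" for c
 have "ALL c:cells n. EX be. bij_betw be (A c) (A' c)"
 using cy cx' eq by (auto simp: A_def A'_def h_def intro!: finite_same_card_bij)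
 from bchoice[OF this] obtain be where be: "!!c. c : cells n ==> bij_betw (be c) (A c) (A' c)" by blast
 have h0: "h > 0" by (simp add: h_def)
 define B where "B i = be (THE c. y i : cell h c) i" for i
 have the: "(THE c. y i : cell h c) = c" if "y i : cell h c" for i c
 using that cell_disjoint[OF h0] by blast
 have Bc: "bij_betw B (A c) (A' c)" if "c : cells n" for c
 using be[OF that] by (subst bij_betw_cong[of _ B "be c"]) (auto simp: B_def the A_def)
 define J J' where "J = (\<Union>c\<in>cells n. A c)" and "J' = (\<Union>c\<in>cells n. A' c)"
 have bij: "bij_betw B J J'"
 unfolding J_def J'_def
 proof (rule bij_betw_UNION_disjoint)
 show "disjoint_family_on A' (cells n)"
 using cell_disjoint[OF h0] unfolding disjoint_family_on_def A'_def by blast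
 qed (rule Bc)
 show ?thesis unfolding matched_def
 proof (intro exI conjI)
 show "J <= I" "J' <= I'" by (auto simp: J_def J'_def A_def A'_def)
 show "bij_betw B J J'" by (rule bij)
 show "ALL i:I. x i : qbox (real n - 2) --> i : J"
 proof (intro ballI impI)
 fix i assume i: "i : I" "x i : qbox (real n - 2)"
 hence "\<bar>fst (x i) - fst (y i)\<bar> <= ep & \<bar>snd (x i) - snd (y i)\<bar> <= ep" by (intro cl) (auto simp: qbox_def mem_Times_iff)
 hence "fst (y i) < real n" "snd (y i) < real n" using i(2) e by (auto simp: qbox_def mem_Times_iff)
 hence "EX c:cells n. y i : cell h c" using pos[OF i(1)] in_some_cell by (auto simp: h_def)
 thus "i : J" using i(1) by (auto simp: J_def A_def)
 qed
 show "ALL i:I'. x' i : qbox (real n - 2) --> i : J'"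
 proof (intro ballI impI)
 fix i assume i: "i : I'" "x' i : qbox (real n - 2)"
 hence "EX c:cells n. x' i : cell h c" unfolding h_def by (intro in_some_cell) (auto simp: qbox_def mem_Times_iff)
 thus "i : J'" using i(1) by (auto simp: J'_def A'_def)
 qed
 show "ALL i:J. \<bar>fst (x i) - fst (x' (B i))\<bar> <= 1/2^n+ep & \<bar>snd (x i) - snd (x' (B i))\<bar> <= 1/2^n+ep"
 proof
 fix i assume "i : J"
 then obtain c where c: "c : cells n" "i : A c" by (auto simp: J_def)
 hence i: "i : I" "y i : cell h c" by (auto simp: A_def)
 have "B i : A' c" using Bc[OF c(1)] c(2) by (auto simp: bij_betw_def)
 hence B: "x' (B i) : cell h c" by (auto simp: A'_def)
 have "\<bar>fst (x i) - fst (y i)\<bar> <= ep & \<bar>snd (x i) - snd (y i)\<bar> <= ep"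
 using cell_window[OF c(1)] i by (intro cl) (auto simp: h_def)
 thus "\<bar>fst (x i) - fst (x' (B i))\<bar> <= 1/2^n+ep & \<bar>snd (x i) - snd (x' (B i))\<bar> <= 1/2^n+ep"
 using cell_close[OF i(2) B] unfolding h_def by linarith
 qed
 qed
qed

lemma config_cell_finite: assumes "config I x" "c : cells n" shows "finite {i\<in>I. x i : cell (1/2^n) c}"
proof (rule finite_subset)
 show "finite {i\<in>I. x i : qbox (real n)}" using assms(1) by (simp add: config_def)
 show "{i\<in>I. x i : cell (1/2^n) c} <= {i\<in>I. x i : qbox (real n)}"
 proof safe
 fix i assume i: "x i : cell (1/2^n) c"
 show "x i : qbox (real n)"
 using cell_window[OF assms(2) i] by (auto simp: qbox_def mem_Times_iff)
 qed
qed

text \<open>Inside the point configurations, every vaguely open set is a countable union of sets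
  defined by finitely many cell counts; so measurability can be checked on cell counts.\<close>

lemma PM_measurable:
 assumes a: "a > 0" and cfg: "!!om. om : space M ==> config (I om) (x om)"
 and meas: "!!n c k. c : cells n ==> {om : space M. card {i\<in>I om. x om i : cell (1/2^n) c} = k} : sets M"
 shows "(%om. PM a (I om) (x om)) : measurable M (borel_of_top (vague_topology ext_plane))"
 unfolding borel_of_top_def
proof (rule measurable_measure_of)
 show "{U. openin (vague_topology ext_plane) U} <= Pow (topspace (vague_topology ext_plane))"
 using openin_subset by blast
 show "(%om. PM a (I om) (x om)) : space M \<rightarrow> topspace (vague_topology ext_plane)"
 using PM_radon[OF a cfg] by (auto simp: topspace_vague_topology)
 fix U assume "U : {U. openin (vague_topology ext_plane) U}"
 hence U: "openin (vague_topology ext_plane) U" by simp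
 define L where "L n = (SOME l. set l = cells n)" for n
 have L: "set (L n) = cells n" for n unfolding L_def by (rule someI_ex[OF finite_list[OF finite_cells]])
 define code where "code n om = map (%c. card {i\<in>I om. x om i : cell (1/2^n) c}) (L n)" for n om
 define good where "good n = {k. ALL om:space M. code n om = k --> PM a (I om) (x om) : U}" for n
 have code_meas: "{om : space M. code n om = k} : sets M" for n k
 proof -
 have m: "{om : space M. map (%c. card {i\<in>I om. x om i : cell (1/2^n) c}) l = k} : sets M" if "set l <= cells n" for l k
 using that
 proof (induction l arbitrary: k)
 case Nil thus ?case by (cases "k = []") auto
 next
 case (Cons c l)
 show ?case
 proof (cases k)
 case (Cons k0 k')
 have "{om : space M. map (%c. card {i\<in>I om. x om i : cell (1/2^n) c}) (c # l) = k} =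
 {om : space M. card {i\<in>I om. x om i : cell (1/2^n) c} = k0} Int
 {om : space M. map (%c. card {i\<in>I om. x om i : cell (1/2^n) c}) l = k'}" using Cons by auto
 moreover have "set l <= cells n" "c : cells n" using Cons.prems by auto
 ultimately show ?thesis using sets.Int[OF meas[of c n k0] Cons.IH[of k']] by (simp only:)
 qed simp
 qed
 show ?thesis unfolding code_def by (rule m) (simp add: L)
 qed
 have "(%om. PM a (I om) (x om)) -` U Int space M = (\<Union>n. \<Union>k\<in>good n. {om : space M. code n om = k})"
 proof safe
 fix om assume om: "om : space M" "PM a (I om) (x om) : U"
 obtain R0 d where d: "d > 0" "ALL R>=R0. ALL ep<=d. ALL I' x'. config (I' :: 'b set) x' --> matched R ep I' x' (I om) (x om) --> PM a I' x' : U"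
 using matched_open[OF a U cfg[OF om(1)] om(2)] by (elim exE conjE) (rule that)
 have "(%n::nat. (1/2::real)^n) \<longlonglongrightarrow> 0" by (rule LIMSEQ_realpow_zero) auto
 hence "\<forall>\<^sub>F n in sequentially. (1/2::real)^n < d" using d(1) by (rule order_tendstoD)
 moreover have "\<forall>\<^sub>F n in sequentially. real n >= R0+2"
 using filterlim_real_sequentially unfolding filterlim_at_top by blast
 ultimately have "\<forall>\<^sub>F n in sequentially. (1/2::real)^n < d & real n >= R0+2" by eventually_elim auto
 then obtain n where n: "(1/2::real)^n < d" "real n >= R0+2" using eventually_happens'[OF sequentially_bot] by blast
 have "PM a (I om') (x om') : U" if om': "om' : space M" "code n om' = code n om" for om'
 proof -
 have "matched (real n - 2) (1/2^n+0) (I om') (x om') (I om) (x om)"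
 proof (rule counts_matched[where y="x om'"])
 fix c assume c: "c : cells n"
 show "card {i\<in>I om'. x om' i : cell (1/2^n) c} = card {i\<in>I om. x om i : cell (1/2^n) c}"
 proof -
 have "ALL c:set (L n). card {i\<in>I om'. x om' i : cell (1/2^n) c} = card {i\<in>I om. x om i : cell (1/2^n) c}"
 using om'(2) by (simp only: code_def map_eq_conv)
 with c show ?thesis unfolding L by (rule bspec[rotated])
 qed
 next
 show "finite {i\<in>I om'. x om' i : cell (1/2^n) c}" if "c : cells n" for c
 by (rule config_cell_finite[OF cfg[OF om'(1)] that])
 show "finite {i\<in>I om. x om i : cell (1/2^n) c}" if "c : cells n" for c
 by (rule config_cell_finite[OF cfg[OF om(1)] that])
 show "0 <= fst (x om' i) & 0 <= snd (x om' i)" if "i : I om'" for i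
 using cfg[OF om'(1)] that unfolding config_def by blast
 qed simp_all
 moreover have "real n - 2 >= R0" "1/2^n+0 <= d" using n by (simp_all add: power_one_over)
 ultimately show ?thesis using d(2)[rule_format] cfg[OF om'(1)] by blast
 qed
 hence "code n om : good n" by (auto simp: good_def)
 thus "om : (\<Union>n. \<Union>k\<in>good n. {om : space M. code n om = k})" using om(1) by blast
 qed (auto simp: good_def)
 also have "... : sets M"
 proof (rule sets.countable_UN, safe)
 fix n show "(\<Union>k\<in>good n. {om : space M. code n om = k}) : sets M"
 proof (rule sets.countable_UN')
 show "countable (good n)" by (rule countableI_type)
 show "(%k. {om : space M. code n om = k}) ` good n <= sets M" using code_meas by (rule image_subsetI)
 qed
 qed
 finally show "(%om. PM a (I om) (x om)) -` U Int space M : sets M" .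
qed

section \<open>Independent Poisson counts from generating functions\<close>

text \<open>Successive coefficients vanish because the remainder of the series is \<open>O(z)\<close> near zero; values at positive arguments suffice.\<close>

lemma power_series_zero_unique:
 fixes d :: "nat => real"
 assumes B: "!!i. \<bar>d i\<bar> <= B" and z: "!!z. 0 < z ==> z < 1 ==> (%i. d i * z^i) sums 0"
 shows "d m = 0"
proof (induction m rule: less_induct)
 case (less m)
 have B0: "0 <= B" using B[of 0] by linarith
 have bound: "\<bar>d m\<bar> <= B * (z/(1 - z))" if zz: "0 < z" "z < 1" for z
 proof -
 have "(%i. d (i+m) * z^(i+m)) sums 0"
 using z[OF zz] less by (subst sums_iff_shift) simp
 hence "(%i. d (i+m) * z^(i+m)/z^m) sums (0/z^m)" by (rule sums_divide)
 hence "(%i. d (i+m) * z^i) sums 0" using zz by (simp add: power_add)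
 hence 1: "(%i. d (Suc i+m) * z^Suc i) sums (- d m)"
 by (subst sums_Suc_iff) simp
 have "(%i. B * (z * z^i)) sums (B * (z * (1/(1 - z))))"
 using zz by (intro sums_mult geometric_sums) auto
 hence 2: "(%i. B * z^Suc i) sums (B * (z/(1 - z)))" by simp
 have le: "\<bar>d (Suc i+m) * z^Suc i\<bar> <= B * z^Suc i" for i
 using zz B by (simp add: abs_mult mult_right_mono)
 have "- d m <= B * (z/(1 - z))"
 by (rule sums_le[OF _ 1 2]) (use le in \<open>simp add: abs_le_iff\<close>)
 moreover have "- (B * (z/(1 - z))) <= - d m"
 by (rule sums_le[OF _ sums_minus[OF 2] 1]) (use le in \<open>simp only: abs_le_iff minus_le_iff\<close>)
 ultimately show ?thesis by linarith
 qed
 have "((%z. B * (z/(1 - z))) \<longlongrightarrow> B * (0/(1 - 0))) (at_right 0)"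
 by (intro tendsto_intros) auto
 moreover have "\<forall>\<^sub>F z in at_right (0::real). \<bar>d m\<bar> <= B * (z/(1 - z))"
 using eventually_at_right_real[OF zero_less_one] by eventually_elim (rule bound; simp)
 ultimately have "\<bar>d m\<bar> <= B * (0/(1 - 0))"
 by (rule tendsto_lowerbound) simp
 thus ?case by simp
qed

lemma poisson_mass_nonneg: "0 <= mu ==> 0 <= poisson_mass mu m"
 by (simp add: poisson_mass_def)

lemma poisson_mass_sums: "(%m. poisson_mass mu m * z^m) sums exp (- ((1 - z) * mu))"
proof -
 have "(%m. (mu * z)^m /\<^sub>R fact m * exp (- mu)) sums (exp (mu * z) * exp (- mu))"
 by (intro sums_mult2 exp_converges)
 moreover have "(mu * z)^m /\<^sub>R fact m * exp (- mu) = poisson_mass mu m * z^m" for m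
 by (simp add: poisson_mass_def power_mult_distrib divide_inverse ac_simps)
 moreover have "exp (mu * z) * exp (- mu) = exp (- ((1 - z) * mu))"
 by (simp add: mult_exp_exp algebra_simps)
 ultimately show ?thesis by simp
qed

lemma poisson_mass_le_1: assumes "0 <= mu" shows "poisson_mass mu m <= 1"
proof -
 have "poisson_mass mu sums 1" using poisson_mass_sums[of mu 1] by simp
 from sum_le_suminf[OF sums_summable[OF this], of "{m}"] sums_unique[OF this] show ?thesis
 using poisson_mass_nonneg[OF assms] by simp
qed

text \<open>Extracting one coefficient at a time keeps the remaining factors as a bounded weight, so that joint laws follow from one-dimensional power series.\<close>

lemma (in prob_space) poisson_coefficient:
 fixes K :: "'a => nat" and Y :: "'a => real"
 assumes K [measurable]: "K : measurable M (count_space UNIV)" and Y [measurable]: "Y : borel_measurable M"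
 and Y01: "!!om. om : space M ==> 0 <= Y om & Y om <= 1"
 and c: "0 <= c" "c <= 1" and mu: "0 <= mu"
 and E: "!!z. 0 <= z ==> z <= 1 ==> (\<integral>om. z^K om * Y om \<partial>M) = exp (- ((1 - z) * mu)) * c"
 shows "(\<integral>om. (if K om = m then Y om else 0) \<partial>M) = poisson_mass mu m * c"
proof -
 define A where "A m = (\<integral>om. (if K om = m then Y om else 0) \<partial>M)" for m
 have int: "integrable M (%om. if K om = m then Y om else 0)" for m
 by (rule integrable_const_bound[of _ 1]) (use Y01 in auto)
 have A01: "0 <= A m" "A m <= 1" for m
 proof -
 show "0 <= A m" unfolding A_def by (rule Bochner_Integration.integral_nonneg_AE) (use Y01 in auto)
 have "A m <= (\<integral>om. 1 \<partial>M)" unfolding A_def by (rule integral_mono[OF int]) (use Y01 in auto)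
 thus "A m <= 1" by (simp add: prob_space)
 qed
 have sums: "(%m. A m * z^m) sums (exp (- ((1 - z) * mu)) * c)" if z: "0 < z" "z < 1" for z
 proof -
 let ?f = "%m om. (if K om = m then Y om else 0) * z^m"
 have pw: "(%m. ?f m om) sums (z^K om * Y om)" for om
 proof -
 have "(%m. ?f m om) = (%m. if m = K om then z^m * Y om else 0)" by (rule ext) simp
 thus ?thesis using sums_single[of "K om" "%m. z^m * Y om"] by (simp only:)
 qed
 have pwn: "norm (?f m om) = ?f m om" if "om : space M" for m om using Y01[OF that] z by simp
 have "(%m. \<integral>om. ?f m om \<partial>M) sums (\<integral>om. (\<Sum>m. ?f m om) \<partial>M)"
 proof (rule sums_integral)
 show "integrable M (?f m)" for m using int by (rule integrable_mult_left)
 show "AE om in M. summable (%m. norm (?f m om))"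
 proof (rule AE_I2)
 fix om assume "om : space M"
 hence "(%m. norm (?f m om)) = (%m. ?f m om)" by (intro ext pwn)
 thus "summable (%m. norm (?f m om))" using sums_summable[OF pw] by (simp only:)
 qed
 have "(\<integral>om. norm (?f m om) \<partial>M) = A m * z^m" for m
 proof -
 have "(\<integral>om. norm (?f m om) \<partial>M) = (\<integral>om. ?f m om \<partial>M)" by (rule Bochner_Integration.integral_cong[OF refl pwn])
 thus ?thesis by (simp add: A_def)
 qed
 hence eq: "(%m. \<integral>om. norm (?f m om) \<partial>M) = (%m. A m * z^m)" by (rule ext)
 show "summable (%m. \<integral>om. norm (?f m om) \<partial>M)" unfolding eq
 proof (rule summable_comparison_test'[of "%m. z^m" 0])
 show "summable (%m. z^m)" using z by (intro summable_geometric) simp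
 show "norm (A m * z^m) <= z^m" for m
 using A01[of m] z mult_right_mono[of "A m" 1 "z^m"] by (simp add: abs_mult)
 qed
 qed
 moreover have "(\<Sum>m. ?f m om) = z^K om * Y om" for om using sums_unique[OF pw] by simp
 ultimately show ?thesis using E[of z] z by (simp add: A_def)
 qed
 have "A m - poisson_mass mu m * c = 0"
 proof (rule power_series_zero_unique)
 fix i
 have "0 <= poisson_mass mu i * c" "poisson_mass mu i * c <= 1"
 by (rule mult_nonneg_nonneg[OF poisson_mass_nonneg[OF mu] c(1)])
 (rule mult_le_one[OF poisson_mass_le_1[OF mu] c])
 thus "\<bar>A i - poisson_mass mu i * c\<bar> <= 1" using A01[of i] by linarith
 next
 fix z :: real assume z: "0 < z" "z < 1"
 have "(%i. A i * z^i - poisson_mass mu i * z^i * c) sums (exp (- ((1 - z) * mu)) * c - exp (- ((1 - z) * mu)) * c)"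
 by (intro sums_diff sums[OF z] sums_mult2 poisson_mass_sums)
 thus "(%i. (A i - poisson_mass mu i * c) * z^i) sums 0" by (simp add: algebra_simps)
 qed
 thus ?thesis by (simp add: A_def)
qed

lemma (in prob_space) poisson_joint:
 fixes K :: "'i => 'a => nat"
 assumes K [measurable]: "!!j. K j : measurable M (count_space UNIV)" and mu: "!!j. 0 <= mu j"
 and E: "!!J z. finite J ==> (!!j. 0 <= z j & z j <= (1::real)) ==>
 (\<integral>om. (\<Prod>j\<in>J. z j^K j om) \<partial>M) = (\<Prod>j\<in>J. exp (- ((1 - z j) * mu j)))"
 and J: "finite J1" "finite J2" "J1 Int J2 = {}" and z: "!!j. 0 <= z j & z j <= (1::real)"
 shows "(\<integral>om. (if ALL j:J1. K j om = m j then (\<Prod>j\<in>J2. z j^K j om) else 0) \<partial>M) =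
 (\<Prod>j\<in>J1. poisson_mass (mu j) (m j)) * (\<Prod>j\<in>J2. exp (- ((1 - z j) * mu j)))"
 using J z
proof (induction J1 arbitrary: J2 z rule: finite_induct)
 case empty thus ?case using E by simp
next
 case (insert j J1)
 let ?Y = "%om. if ALL j:J1. K j om = m j then (\<Prod>j\<in>J2. z j^K j om) else 0"
 let ?c = "(\<Prod>j\<in>J1. poisson_mass (mu j) (m j)) * (\<Prod>j\<in>J2. exp (- ((1 - z j) * mu j)))"
 have z: "0 <= z i" "z i <= 1" for i using insert.prems(3) by auto
 have meas [measurable]: "?Y : borel_measurable M"
 by (intro measurable_If sets.sets_Collect_finite_All insert.hyps(1)) measurable
 have "(\<integral>om. (if K j om = m j then ?Y om else 0) \<partial>M) = poisson_mass (mu j) (m j) * ?c"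
 proof (rule poisson_coefficient[OF K meas _ _ _ mu])
 show "0 <= ?Y om & ?Y om <= 1" for om using z by (auto intro!: prod_nonneg prod_le_1 power_le_one)
 show "0 <= ?c" using poisson_mass_nonneg mu by (auto intro!: mult_nonneg_nonneg prod_nonneg)
 show "?c <= 1" using poisson_mass_nonneg poisson_mass_le_1 mu z by (intro mult_le_one prod_le_1 prod_nonneg) auto
 fix x :: real assume x: "0 <= x" "x <= 1"
 let ?z = "z(j := x)"
 have j: "j ~: J1" "j ~: J2" using insert by auto
 have eq: "(\<Prod>i\<in>J2. f (?z i) i) = (\<Prod>i\<in>J2. f (z i) i)" for f :: "real => 'i => real"
 using j by (intro prod.cong) auto
 have "(\<integral>om. (if ALL j:J1. K j om = m j then (\<Prod>i\<in>insert j J2. ?z i^K i om) else 0) \<partial>M) =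
 (\<Prod>j\<in>J1. poisson_mass (mu j) (m j)) * (\<Prod>i\<in>insert j J2. exp (- ((1 - ?z i) * mu i)))"
 using insert.prems insert.hyps x by (intro insert.IH) auto
 moreover have "(if ALL j:J1. K j om = m j then (\<Prod>i\<in>insert j J2. ?z i^K i om) else 0) = x^K j om * ?Y om" for om
 using j insert.prems(1) eq[of "%x i. x^K i om"] by simp
 moreover have "(\<Prod>i\<in>insert j J2. exp (- ((1 - ?z i) * mu i))) = exp (- ((1 - x) * mu j)) * (\<Prod>i\<in>J2. exp (- ((1 - z i) * mu i)))"
 using j insert.prems(1) eq[of "%x i. exp (- ((1 - x) * mu i))"] by simp
 ultimately show "(\<integral>om. x^K j om * ?Y om \<partial>M) = exp (- ((1 - x) * mu j)) * ?c" by (simp only: mult.left_commute)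
 qed
 moreover have "(if K j om = m j then ?Y om else 0) = (if ALL j:insert j J1. K j om = m j then (\<Prod>j\<in>J2. z j^K j om) else 0)" for om
 by auto
 ultimately show ?case using insert.hyps by (simp only: prod.insert mult.assoc if_False if_True not_False_eq_True)
qed

text \<open>A generating function that factorizes into Poisson ones identifies independent Poisson variables.\<close>

lemma (in prob_space) independent_poisson_counts:
 fixes K :: "'i => 'a => nat"
 assumes K [measurable]: "!!j. K j : measurable M (count_space UNIV)" and mu: "!!j. 0 <= mu j"
 and E: "!!J z. finite J ==> (!!j. 0 <= z j & z j <= (1::real)) ==>
 (\<integral>om. (\<Prod>j\<in>J. z j^K j om) \<partial>M) = (\<Prod>j\<in>J. exp (- ((1 - z j) * mu j)))"
 shows "prob {om : space M. K j om = k} = poisson_mass (mu j) k"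
 and "indep_vars (%_. count_space UNIV) K UNIV"
proof -
 have joint: "prob {om : space M. ALL j:J. K j om = m j} = (\<Prod>j\<in>J. poisson_mass (mu j) (m j))" if "finite J" for J m
 proof -
 have [measurable]: "{om : space M. ALL j:J. K j om = m j} : events"
 by (intro sets.sets_Collect_finite_All that) measurable
 have "(\<integral>om. (if ALL j:J. K j om = m j then (\<Prod>j\<in>{}. (1::real)^K j om) else 0) \<partial>M) =
 (\<Prod>j\<in>J. poisson_mass (mu j) (m j)) * (\<Prod>j\<in>{}. exp (- ((1 - 1) * mu j)))"
 by (rule poisson_joint[OF K mu E that, where z="%_. 1"]) (assumption | simp)+
 hence "(\<integral>om. (if ALL j:J. K j om = m j then (1::real) else 0) \<partial>M) = (\<Prod>j\<in>J. poisson_mass (mu j) (m j))"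
 unfolding prod.empty mult_1_right .
 moreover have "(\<integral>om. (if ALL j:J. K j om = m j then (1::real) else 0) \<partial>M) = (\<integral>om. indicator {om : space M. ALL j:J. K j om = m j} om \<partial>M)"
 by (rule Bochner_Integration.integral_cong) (simp_all add: indicator_def)
 ultimately show ?thesis by simp
 qed
 show P: "prob {om : space M. K j om = k} = poisson_mass (mu j) k" for j k
 using joint[of "{j}" "%_. k"] by simp
 define G where "G j = insert {} (range (%k. {om : space M. K j om = k}))" for j
 have "indep_sets G UNIV"
 proof (rule indep_setsI)
 show "G j <= events" for j by (auto simp: G_def)
 fix A J assume J: "J ~= {}" "finite J" "ALL j:J. A j : G j"
 show "prob (\<Inter>j\<in>J. A j) = (\<Prod>j\<in>J. prob (A j))"
 proof (cases "EX j:J. A j = {}")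
 case True
 then obtain j where "j : J" "A j = {}" by blast
 hence "(\<Inter>j\<in>J. A j) = {}" "EX j:J. prob (A j) = 0" by (auto intro!: bexI[of _ j])
 thus ?thesis using J(2) by (simp add: prod_zero)
 next
 case False
 hence "ALL j:J. EX k. A j = {om : space M. K j om = k}" using J(3) by (auto simp: G_def image_iff)
 then obtain m where m: "!!j. j : J ==> A j = {om : space M. K j om = m j}" using bchoice by metis
 have "(\<Inter>j\<in>J. A j) = {om : space M. ALL j:J. K j om = m j}" using J(1) m by auto
 thus ?thesis using joint[OF J(2), of m] m P by simp
 qed
 qed
 moreover have "Int_stable (G j)" for j
 unfolding Int_stable_def G_def
 proof (intro ballI)
 fix a b assume ab: "a : insert {} (range (%k. {om : space M. K j om = k}))" "b : insert {} (range (%k. {om : space M. K j om = k}))"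
 have "{om : space M. K j om = k} Int {om : space M. K j om = k'} = (if k = k' then {om : space M. K j om = k} else {})" for k k' by auto
 thus "a Int b : insert {} (range (%k. {om : space M. K j om = k}))" using ab by auto
 qed
 ultimately have "indep_sets (%j. sigma_sets (space M) (G j)) UNIV" by (rule indep_sets_sigma)
 hence "indep_sets (%j. {K j -` A Int space M | A. A : sets (count_space UNIV)}) UNIV"
 proof (rule indep_sets_mono_sets)
 fix j
 show "{K j -` A Int space M | A. A : sets (count_space UNIV)} <= sigma_sets (space M) (G j)"
 proof safe
 fix A :: "nat set"
 have G: "G j <= Pow (space M)" by (auto simp: G_def)
 have "K j -` A Int space M = (\<Union>k\<in>A. {om : space M. K j om = k})" by auto
 also have "... : sigma_sets (space M) (G j)"
 proof -
 interpret sigma_algebra "space M" "sigma_sets (space M) (G j)" using G by (rule sigma_algebra_sigma_sets)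
 show ?thesis by (rule countable_UN'') (auto intro!: sigma_sets.Basic simp: G_def)
 qed
 finally show "K j -` A Int space M : sigma_sets (space M) (G j)" .
 qed
 qed
 thus "indep_vars (%_. count_space UNIV) K UNIV"
 unfolding indep_vars_def2 by simp
qed

section \<open>A Poisson scatter of unit intensity in the open quadrant\<close>

lemma nn_integral_PiM_finite_prod:
 assumes D: "!!i. prob_space (D i)" and J: "finite J" and f: "!!i. i : J ==> f i : borel_measurable (D i)"
 shows "(\<integral>\<^sup>+om. (\<Prod>i\<in>J. f i (om i)) \<partial>PiM UNIV D) = (\<Prod>i\<in>J. \<integral>\<^sup>+x. f i x \<partial>D i)"
proof -
 interpret product_prob_space D UNIV by (rule product_prob_spaceI) (rule D)
 have m: "(%x. \<Prod>i\<in>J. f i (x i)) : borel_measurable (PiM J D)"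
 by (intro borel_measurable_prod_ennreal)
 (rule measurable_compose[OF measurable_component_singleton], assumption, erule f)
 have "(\<Prod>i\<in>J. \<integral>\<^sup>+x. f i x \<partial>D i) = (\<integral>\<^sup>+x. (\<Prod>i\<in>J. f i (x i)) \<partial>PiM J D)"
 by (rule product_nn_integral_prod[symmetric, OF J f])
 also have "... = (\<integral>\<^sup>+x. (\<Prod>i\<in>J. f i (x i)) \<partial>distr (PiM UNIV D) (PiM J D) (%x. restrict x J))"
 using distr_PiM_restrict_finite[OF J] by simp
 also have "... = (\<integral>\<^sup>+om. (\<Prod>i\<in>J. f i (restrict om J i)) \<partial>PiM UNIV D)"
 by (subst nn_integral_distr[OF measurable_restrict_subset]) (use m in simp_all)
 finally show ?thesis by simp
qed

definition unit_square :: "(real \<times> real) set" where "unit_square = {0<..1} \<times> {0<..1}"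

definition corner :: "nat => real \<times> real" where
 "corner k = (real (fst (prod_decode k)), real (snd (prod_decode k)))"

definition tile :: "nat => (real \<times> real) set" where
 "tile k = {fst (corner k)<..fst (corner k)+1} \<times> {snd (corner k)<..snd (corner k)+1}"

abbreviation "uniform_point \<equiv> restrict_space (lborel :: (real \<times> real) measure) unit_square"

definition tile_law :: "(nat \<times> (nat => real \<times> real)) measure" where
 "tile_law = measure_pmf (poisson_pmf 1) \<Otimes>\<^sub>M PiM UNIV (%_. uniform_point)"

definition scatter :: "(nat => nat \<times> (nat => real \<times> real)) measure" where
 "scatter = PiM UNIV (%_. tile_law)"

lemma borel_Times_real: "A : sets borel ==> B : sets borel ==> A \<times> B : sets (borel :: (real \<times> real) measure)"
 unfolding borel_prod[symmetric] by (rule pair_measureI)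

lemma emeasure_lborel_Times:
 fixes A B :: "real set"
 assumes "A : sets borel" "B : sets borel"
 shows "emeasure lborel (A \<times> B) = emeasure lborel A * emeasure lborel B"
 unfolding lborel_prod[symmetric] using assms by (simp add: lborel.emeasure_pair_measure_Times)

lemma tile_borel: "tile k : sets borel"
 unfolding tile_def by (intro borel_Times_real) auto

lemma emeasure_tile: "emeasure lborel (tile k) = 1"
 unfolding tile_def by (simp add: emeasure_lborel_Times)

lemma unit_square_borel: "unit_square : sets borel"
 unfolding unit_square_def by (intro borel_Times_real) auto

lemma prob_uniform_point: "prob_space uniform_point"
proof (rule prob_spaceI)
 have "emeasure lborel unit_square = 1" unfolding unit_square_def by (simp add: emeasure_lborel_Times)
 thus "emeasure uniform_point (space uniform_point) = 1"
 using unit_square_borel by (simp add: space_restrict_space emeasure_restrict_space)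
qed

lemma space_uniform_point: "space uniform_point = unit_square"
 by (simp add: space_restrict_space)

lemma prob_tile_law: "prob_space tile_law"
proof -
 interpret U: product_prob_space "%_::nat. uniform_point" UNIV by (rule product_prob_spaceI) (rule prob_uniform_point)
 interpret P: pair_prob_space "measure_pmf (poisson_pmf 1)" "PiM UNIV (%_::nat. uniform_point)" ..
 show ?thesis unfolding tile_law_def by (rule P.prob_space_axioms)
qed

lemma prob_scatter: "prob_space scatter"
 unfolding scatter_def by (rule prob_space_PiM) (rule prob_tile_law)

lemma tile_points_measurable:
 assumes g: "!!i. g i : borel_measurable (borel :: (real \<times> real) measure)"
 shows "(%xi. \<Prod>i<fst xi. g i (snd xi i) :: real) : borel_measurable tile_law"
 "(%xi. \<Sum>i<fst xi. g i (snd xi i) :: real) : borel_measurable tile_law"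
proof -
 have f: "fst : measurable tile_law (count_space UNIV)" unfolding tile_law_def
 using measurable_fst[of "measure_pmf (poisson_pmf 1)" "PiM UNIV (%_::nat. uniform_point)"] by (simp cong: measurable_cong_sets)
 have s: "(%xi. snd xi i) : measurable tile_law borel" for i :: nat
 proof -
 have "(%x. x) : measurable uniform_point borel" by (rule measurable_restrict_space1) simp
 from measurable_compose[OF measurable_compose[OF measurable_snd measurable_component_singleton[of i UNIV]] this]
 show ?thesis by (simp add: tile_law_def)
 qed
 note [measurable] = measurable_compose[OF s g]
 show "(%xi. \<Prod>i<fst xi. g i (snd xi i)) : borel_measurable tile_law"
 by (rule measurable_compose_countable[OF _ f, of "%n xi. \<Prod>i<n. g i (snd xi i)"]) measurable
 show "(%xi. \<Sum>i<fst xi. g i (snd xi i)) : borel_measurable tile_law"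
 by (rule measurable_compose_countable[OF _ f, of "%n xi. \<Sum>i<n. g i (snd xi i)"]) measurable
qed

text \<open>A Poisson number of independent points turns the geometric mean \<open>W ^ n\<close> into \<open>exp (W - 1)\<close>.\<close>

lemma tile_functional:
 assumes w [measurable]: "w : borel_measurable borel" and w01: "!!y. 0 <= w y"
 and W: "(\<integral>\<^sup>+x. ennreal (w x) \<partial>uniform_point) = ennreal W" "0 <= W"
 shows "(\<integral>\<^sup>+xi. ennreal (\<Prod>i<fst xi. w (snd xi i)) \<partial>tile_law) = ennreal (exp (W - 1))"
proof -
 interpret U: product_prob_space "%_::nat. uniform_point" UNIV by (rule product_prob_spaceI) (rule prob_uniform_point)
 let ?X = "PiM UNIV (%_::nat. uniform_point)"
 have wU: "(%x. ennreal (w x)) : borel_measurable uniform_point"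
 by (rule measurable_restrict_space1) simp
 have m: "(%xi. ennreal (\<Prod>i<fst xi. w (snd xi i))) : borel_measurable (measure_pmf (poisson_pmf 1) \<Otimes>\<^sub>M ?X)"
 using tile_points_measurable(1)[of "%_. w", OF w] by (simp add: tile_law_def)
 have "(\<integral>\<^sup>+xi. ennreal (\<Prod>i<fst xi. w (snd xi i)) \<partial>tile_law) =
 (\<integral>\<^sup>+n. \<integral>\<^sup>+x. ennreal (\<Prod>i<n. w (x i)) \<partial>?X \<partial>measure_pmf (poisson_pmf 1))"
 unfolding tile_law_def using U.nn_integral_fst[OF m] by simp
 also have "... = (\<integral>\<^sup>+n. ennreal W^n \<partial>measure_pmf (poisson_pmf 1))"
 proof (rule nn_integral_cong)
 fix n :: nat
 have "(\<integral>\<^sup>+x. ennreal (\<Prod>i<n. w (x i)) \<partial>?X) = (\<integral>\<^sup>+x. (\<Prod>i<n. ennreal (w (x i))) \<partial>?X)"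
 using w01 by (simp add: prod_ennreal)
 also have "... = (\<Prod>i<n. \<integral>\<^sup>+x. ennreal (w x) \<partial>uniform_point)"
 using prob_uniform_point wU by (intro nn_integral_PiM_finite_prod) auto
 finally show "(\<integral>\<^sup>+x. ennreal (\<Prod>i<n. w (x i)) \<partial>?X) = ennreal W^n" using W by simp
 qed
 also have "... = (\<Sum>n. ennreal (poisson_mass 1 n * W^n))"
 using W(2) by (simp add: nn_integral_measure_pmf nn_integral_count_space_nat poisson_mass_def ennreal_power ennreal_mult'[symmetric] mult_ac)
 also have "... = ennreal (exp (- ((1 - W) * 1)))"
 using W(2) by (intro suminf_ennreal_eq poisson_mass_sums) (simp add: poisson_mass_nonneg)
 finally show ?thesis by simp
qed

definition tile_count :: "nat => (real \<times> real) set => nat \<times> (nat => real \<times> real) => nat" where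
 "tile_count k B xi = card {i. i < fst xi & corner k+snd xi i : B}"

definition count :: "nat => (real \<times> real) set => (nat => nat \<times> (nat => real \<times> real)) => nat" where
 "count n B om = (\<Sum>k<n. tile_count k B (om k))"

definition area :: "nat => (real \<times> real) set => real" where
 "area n B = measure lborel (B Int (\<Union>k<n. tile k))"

lemma shift_measurable: "(%x::real \<times> real. c+x) : borel_measurable borel"
 by (intro borel_measurable_continuous_onI continuous_intros)

lemma tile_count_measurable:
 assumes B: "B : sets borel" shows "tile_count k B : measurable tile_law (count_space UNIV)"
proof -
 have "(%xi. \<Sum>i<fst xi. indicator B (corner k+snd xi i) :: real) : borel_measurable tile_law"
 by (intro tile_points_measurable(2)[of "%_ x. indicator B (corner k+x)"] measurable_compose[OF shift_measurable] borel_measurable_indicator B)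
 moreover have "(\<Sum>i<fst xi. indicator B (corner k+snd xi i) :: real) = real (tile_count k B xi)" for xi
 unfolding tile_count_def indicator_def
 by (simp flip: sum.inter_filter) (rule arg_cong[of _ _ card], auto)
 ultimately have [measurable]: "(%xi. real (tile_count k B xi)) : borel_measurable tile_law" by simp
 have "(%xi. nat \<lfloor>real (tile_count k B xi)\<rfloor>) : measurable tile_law (count_space UNIV)" by measurable
 thus ?thesis by simp
qed

lemma count_measurable:
 assumes B: "B : sets borel" shows "count n B : measurable scatter (count_space UNIV)"
proof -
 have [measurable]: "(%om. real (tile_count k B (om k))) : borel_measurable scatter" for k
 unfolding scatter_def
 by (rule measurable_compose[OF measurable_compose[OF measurable_component_singleton[of k UNIV] tile_count_measurable[OF B]]]) auto
 have "(%om. nat \<lfloor>\<Sum>k<n. real (tile_count k B (om k))\<rfloor>) : measurable scatter (count_space UNIV)" by measurable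
 thus ?thesis by (simp add: count_def[abs_def] flip: of_nat_sum)
qed

lemma tile_disjoint: "disjoint_family tile"
 unfolding disjoint_family_on_def
proof (intro ballI impI)
 fix k k' :: nat assume "k ~= k'"
 have *: "i = j" if "real i < x" "x <= real i+1" "real j < x" "x <= real j+1" for i j :: nat and x :: real
 proof -
 have "real i < real j+1" "real j < real i+1" using that by linarith+
 thus ?thesis by linarith
 qed
 have "k = k'" if "y : tile k" "y : tile k'" for y
 proof -
 have "fst (prod_decode k) = fst (prod_decode k')" "snd (prod_decode k) = snd (prod_decode k')"
 using that by (auto simp: tile_def corner_def intro: *)
 hence "prod_decode k = prod_decode k'" by (rule prod_eqI)
 thus ?thesis by simp
 qed
 with \<open>k ~= k'\<close> show "tile k Int tile k' = {}" by blast
qed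

lemma area_sum: assumes B: "B : sets borel" shows "area n B = (\<Sum>k<n. measure lborel (B Int tile k))"
proof -
 have eq: "B Int (\<Union>k<n. tile k) = (\<Union>k<n. B Int tile k)" by blast
 show ?thesis unfolding area_def eq
 proof (rule measure_finite_Union)
 show "(%k. B Int tile k) ` {..<n} <= sets lborel" using B tile_borel by auto
 show "disjoint_family_on (%k. B Int tile k) {..<n}"
 using tile_disjoint by (auto simp: disjoint_family_on_def)
 fix k
 have "emeasure lborel (B Int tile k) <= emeasure lborel (tile k)" using tile_borel by (intro emeasure_mono) auto
 thus "emeasure lborel (B Int tile k) ~= \<infinity>" by (auto simp: emeasure_tile top_unique)
 qed simp
qed

lemma uniform_point_shift:
 assumes B: "B : sets borel"
 shows "measure uniform_point {x : unit_square. corner k+x : B} = measure lborel (B Int tile k)"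
proof -
 have eq: "{x : unit_square. corner k+x : B} = (+) (corner k) -` (B Int tile k) Int space lborel"
 by (cases "corner k") (auto simp: unit_square_def tile_def)
 have "measure lborel (B Int tile k) = measure (distr lborel borel ((+) (corner k))) (B Int tile k)"
 by (simp add: lborel_distr_plus)
 also have "... = measure lborel ((+) (corner k) -` (B Int tile k) Int space lborel)"
 using B tile_borel shift_measurable by (intro measure_distr) auto
 also have "... = measure uniform_point {x : unit_square. corner k+x : B}"
 unfolding eq[symmetric] using unit_square_borel by (intro measure_restrict_space[symmetric]) auto
 finally show ?thesis by simp
qed

lemma disjoint_weights:
 fixes z :: "'j => real"
 assumes "finite J" "disjoint_family_on B J"
 shows "(\<Prod>j\<in>J. if y : B j then z j else 1) = 1 - (\<Sum>j\<in>J. (1 - z j) * indicator (B j) y)"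
 using assms
proof (induction J)
 case (insert j J)
 have d: "disjoint_family_on B J" using insert.prems by (auto simp: disjoint_family_on_def)
 show ?case
 proof (cases "y : B j")
 case True
 hence "indicator (B i) y = (0::real)" if "i : J" for i
 using insert.prems insert.hyps that by (auto simp: disjoint_family_on_def indicator_def)
 hence s0: "(\<Sum>i\<in>J. (1 - z i) * indicator (B i) y) = 0" by simp
 show ?thesis
 unfolding prod.insert[OF insert.hyps] sum.insert[OF insert.hyps] insert.IH[OF d] s0 using True by simp
 next
 case False
 thus ?thesis unfolding prod.insert[OF insert.hyps] sum.insert[OF insert.hyps] insert.IH[OF d] by simp
 qed
qed simp

text \<open>For disjoint sets the product of the weights over all points is the generating function of the counts, and the tiles are independent.\<close>

lemma count_functional:
 fixes B :: "'j => (real \<times> real) set"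
 assumes B: "!!j. B j : sets borel" and dis: "disjoint_family B" and J: "finite J" and z: "!!j. 0 <= z j & z j <= (1::real)"
 shows "(\<integral>om. (\<Prod>j\<in>J. z j^count n (B j) om) \<partial>scatter) = (\<Prod>j\<in>J. exp (- ((1 - z j) * area n (B j))))"
proof -
 interpret U: prob_space uniform_point by (rule prob_uniform_point)
 define w where "w y = (\<Prod>j\<in>J. if y : B j then z j else 1)" for y
 have w01: "0 <= w y" "w y <= 1" for y unfolding w_def using z by (auto intro!: prod_nonneg prod_le_1)
 have wm [measurable]: "w : borel_measurable borel" unfolding w_def using B by measurable
 have weq: "w y = 1 - (\<Sum>j\<in>J. (1 - z j) * indicator (B j) y)" for y
 unfolding w_def using J dis by (intro disjoint_weights) (auto simp: disjoint_family_on_def)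
 define W where "W k = 1 - (\<Sum>j\<in>J. (1 - z j) * measure lborel (B j Int tile k))" for k
 have Wk: "(\<integral>\<^sup>+xi. ennreal (\<Prod>i<fst xi. w (corner k+snd xi i)) \<partial>tile_law) = ennreal (exp (W k - 1))" for k
 proof (rule tile_functional)
 show wk: "(%x. w (corner k+x)) : borel_measurable borel" by (rule measurable_compose[OF shift_measurable wm])
 show "0 <= w (corner k+x)" for x by (rule w01)
 have wU: "(%x. w (corner k+x)) : borel_measurable uniform_point"
 by (rule measurable_restrict_space1) (simp add: wk)
 have int: "integrable uniform_point (%x. w (corner k+x))"
 by (rule U.integrable_const_bound[of _ 1]) (use w01 wU in auto)
 have A: "{x : unit_square. corner k+x : B j} : sets uniform_point" for j
 proof -
 have "(%x. corner k+x) : measurable uniform_point borel"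
 by (rule measurable_restrict_space1) (simp add: shift_measurable)
 from measurable_sets[OF this B[of j]] show ?thesis by (simp add: space_uniform_point vimage_def Int_def conj_commute)
 qed
 have "(\<integral>x. w (corner k+x) \<partial>uniform_point) = (\<integral>x. 1 - (\<Sum>j\<in>J. (1 - z j) * indicator {x : unit_square. corner k+x : B j} x) \<partial>uniform_point)"
 by (rule Bochner_Integration.integral_cong) (auto simp: weq indicator_def space_uniform_point intro!: sum.cong)
 also have "... = 1 - (\<Sum>j\<in>J. (1 - z j) * measure uniform_point {x : unit_square. corner k+x : B j})"
 proof -
 have i1: "integrable uniform_point (%x. (1 - z j) * indicator {x : unit_square. corner k+x : B j} x :: real)" for j
 using A by (intro integrable_mult_right integrable_real_indicator) (simp_all add: U.emeasure_eq_measure)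
 have s: "{x : unit_square. corner k+x : B j} Int space uniform_point = {x : unit_square. corner k+x : B j}" for j
 by (auto simp: space_uniform_point)
 show ?thesis
 by (subst Bochner_Integration.integral_diff, simp, rule Bochner_Integration.integrable_sum, rule i1)
 (simp add: Bochner_Integration.integral_sum[OF i1] s U.prob_space del: Collect_conj_eq)
 qed
 also have "... = W k" by (simp add: W_def uniform_point_shift[OF B])
 finally have WI: "(\<integral>x. w (corner k+x) \<partial>uniform_point) = W k" .
 show "(\<integral>\<^sup>+x. ennreal (w (corner k+x)) \<partial>uniform_point) = ennreal (W k)"
 unfolding WI[symmetric] by (rule nn_integral_eq_integral[OF int]) (simp add: w01)
 show "0 <= W k" unfolding WI[symmetric] by (rule Bochner_Integration.integral_nonneg_AE) (simp add: w01)
 qed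
 have prodeq: "(\<Prod>j\<in>J. z j^count n (B j) om) = (\<Prod>k<n. \<Prod>i<fst (om k). w (corner k+snd (om k) i))" for om
 proof -
 have "(\<Prod>j\<in>J. z j^count n (B j) om) = (\<Prod>j\<in>J. \<Prod>k<n. z j^tile_count k (B j) (om k))"
 by (simp add: count_def power_sum)
 also have "... = (\<Prod>j\<in>J. \<Prod>k<n. \<Prod>i<fst (om k). if corner k+snd (om k) i : B j then z j else 1)"
 by (simp add: tile_count_def flip: prod.inter_filter)
 also have "... = (\<Prod>k<n. \<Prod>j\<in>J. \<Prod>i<fst (om k). if corner k+snd (om k) i : B j then z j else 1)"
 by (rule prod.swap)
 also have "... = (\<Prod>k<n. \<Prod>i<fst (om k). w (corner k+snd (om k) i))"
 unfolding w_def by (intro prod.cong refl prod.swap)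
 finally show ?thesis .
 qed
 have "(\<integral>\<^sup>+om. ennreal (\<Prod>j\<in>J. z j^count n (B j) om) \<partial>scatter) =
 (\<integral>\<^sup>+om. (\<Prod>k<n. ennreal (\<Prod>i<fst (om k). w (corner k+snd (om k) i))) \<partial>scatter)"
 unfolding prodeq by (simp add: prod_ennreal prod_nonneg w01)
 also have "... = (\<Prod>k<n. ennreal (exp (W k - 1)))"
 proof -
 have m: "(%xi. ennreal (\<Prod>i<fst xi. w (corner k+snd xi i))) : borel_measurable tile_law" for k
 using tile_points_measurable(1)[of "%_ x. w (corner k+x)", OF measurable_compose[OF shift_measurable wm]] by simp
 show ?thesis unfolding scatter_def
 by (subst nn_integral_PiM_finite_prod[OF prob_tile_law _ m]) (simp_all add: Wk)
 qed
 also have "... = ennreal (\<Prod>j\<in>J. exp (- ((1 - z j) * area n (B j))))"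
 proof -
 have "(\<Sum>k<n. W k - 1) = (\<Sum>j\<in>J. - ((1 - z j) * area n (B j)))"
 by (simp add: W_def area_sum[OF B] sum_negf sum_distrib_left sum.swap[of _ J])
 thus ?thesis by (simp add: prod_ennreal exp_sum[symmetric] J)
 qed
 finally have nn: "(\<integral>\<^sup>+om. ennreal (\<Prod>j\<in>J. z j^count n (B j) om) \<partial>scatter) = ennreal (\<Prod>j\<in>J. exp (- ((1 - z j) * area n (B j))))" .
 have m: "(%om. \<Prod>j\<in>J. z j^count n (B j) om) : borel_measurable scatter"
 proof (intro borel_measurable_prod)
 fix j show "(%om. z j^count n (B j) om) : borel_measurable scatter"
 by (rule measurable_compose[OF count_measurable[OF B]]) simp
 qed
 show ?thesis
 by (subst integral_eq_nn_integral[OF m]) (use z in \<open>auto simp: nn prod_nonneg intro!: prod_nonneg\<close>)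
qed

lemma area_nonneg: "0 <= area n B" by (simp add: area_def)

lemma counts_poisson:
 fixes B :: "'j => (real \<times> real) set"
 assumes B: "!!j. B j : sets borel" and dis: "disjoint_family B"
 shows "measure scatter {om : space scatter. count n (B j) om = k} = poisson_mass (area n (B j)) k"
 "prob_space.indep_vars scatter (%_. count_space UNIV) (%j. count n (B j)) UNIV"
proof -
 interpret prob_space scatter by (rule prob_scatter)
 note * = count_measurable[OF B] area_nonneg count_functional[OF B dis]
 show "prob {om : space scatter. count n (B j) om = k} = poisson_mass (area n (B j)) k"
 by (rule independent_poisson_counts(1)[where K="%j. count n (B j)" and mu="%j. area n (B j)", OF *])
 show "indep_vars (%_. count_space UNIV) (%j. count n (B j)) UNIV"
 by (rule independent_poisson_counts(2)[where K="%j. count n (B j)" and mu="%j. area n (B j)", OF *])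
qed

definition ids :: "(nat => nat \<times> (nat => real \<times> real)) => (nat \<times> nat) set" where
 "ids om = {j. snd j < fst (om (fst j))}"

definition pts :: "(nat => nat \<times> (nat => real \<times> real)) => nat \<times> nat => real \<times> real" where
 "pts om j = corner (fst j)+snd (om (fst j)) (snd j)"

definition total :: "(real \<times> real) set => (nat => nat \<times> (nat => real \<times> real)) => ennreal" where
 "total B om = emeasure (count_space (ids om)) {j : ids om. pts om j : B}"

abbreviation "quadrant \<equiv> {0<..} \<times> {0<..} :: (real \<times> real) set"

lemma count_card: "finite {j : ids om. fst j < n & pts om j : B}"
 "count n B om = card {j : ids om. fst j < n & pts om j : B}"
proof -
 have eq: "{j : ids om. fst j < n & pts om j : B} = (SIGMA k:{..<n}. {i. i < fst (om k) & corner k+snd (om k) i : B})"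
 by (auto simp: ids_def pts_def)
 show "finite {j : ids om. fst j < n & pts om j : B}" unfolding eq by auto
 show "count n B om = card {j : ids om. fst j < n & pts om j : B}"
 unfolding eq count_def tile_count_def by (subst card_SigmaI) auto
qed

lemma total_SUP: "total B om = (SUP n. of_nat (count n B om))"
proof -
 let ?A = "%n. {j : ids om. fst j < n & pts om j : B}"
 have "(SUP n. emeasure (count_space (ids om)) (?A n)) = emeasure (count_space (ids om)) (\<Union>n. ?A n)"
 by (rule SUP_emeasure_incseq) (auto simp: incseq_def)
 moreover have "(\<Union>n. ?A n) = {j : ids om. pts om j : B}" by auto
 moreover have "emeasure (count_space (ids om)) (?A n) = of_nat (count n B om)" for n
 unfolding count_card(2) by (rule emeasure_count_space_finite) (use count_card(1) in auto)
 ultimately show ?thesis unfolding total_def by simp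
qed

lemma total_le_iff: "total B om <= r \<longleftrightarrow> (ALL n. of_nat (count n B om) <= r)"
 unfolding total_SUP by (simp add: SUP_le_iff)

lemma total_measurable:
 assumes "B : sets borel" shows "total B : borel_measurable scatter"
 unfolding total_SUP[abs_def]
 by (intro borel_measurable_SUP measurable_compose[OF count_measurable[OF assms]]) auto

lemma total_cases: "total B om = \<infinity> | (EX k. total B om = of_nat k)"
 unfolding total_def by (cases "finite {j : ids om. pts om j : B}") (auto simp: emeasure_count_space)

lemma count_mono: "m <= n ==> count m B om <= count n B om"
 unfolding count_card(2) by (rule card_mono[OF count_card(1)]) auto

lemma tiles_cover: "(\<Union>k. tile k) = quadrant"
proof (intro set_eqI iffI)
 fix y :: "real \<times> real" assume "y : (\<Union>k. tile k)"
 thus "y : quadrant" by (auto simp: tile_def corner_def intro: le_less_trans[OF of_nat_0_le_iff])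
next
 fix y :: "real \<times> real" assume y: "y : quadrant"
 have *: "EX i. real i < x & x <= real i+1" if x: "0 < x" for x
 proof (intro exI)
 have "\<lceil>x\<rceil> >= 1" using x by linarith
 hence "real (nat (\<lceil>x\<rceil> - 1)) = of_int \<lceil>x\<rceil> - 1" by simp
 thus "real (nat (\<lceil>x\<rceil> - 1)) < x & x <= real (nat (\<lceil>x\<rceil> - 1))+1" by linarith
 qed
 obtain i j where "real i < fst y" "fst y <= real i+1" "real j < snd y" "snd y <= real j+1"
 using *[of "fst y"] *[of "snd y"] y by auto
 hence "y : tile (prod_encode (i, j))" by (simp add: tile_def corner_def mem_Times_iff)
 thus "y : (\<Union>k. tile k)" by blast
qed

lemma area_tendsto:
 assumes B: "B : sets borel" and fin: "emeasure lborel (B Int quadrant) < \<infinity>"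
 shows "(%n. area n B) \<longlonglongrightarrow> measure lborel (B Int quadrant)"
proof -
 have "(%n. measure lborel (B Int (\<Union>k<n. tile k))) \<longlonglongrightarrow> measure lborel (\<Union>n. B Int (\<Union>k<n. tile k))"
 proof (rule Lim_measure_incseq)
 show "range (%n. B Int (\<Union>k<n. tile k)) <= sets lborel" using B tile_borel by auto
 show "incseq (%n. B Int (\<Union>k<n. tile k))" by (intro monoI Int_mono order_refl UN_mono) auto
 show "emeasure lborel (\<Union>n. B Int (\<Union>k<n. tile k)) ~= \<infinity>"
 proof -
 have "(\<Union>n. B Int (\<Union>k<n. tile k)) = B Int quadrant" unfolding tiles_cover[symmetric] by blast
 thus ?thesis using fin by simp
 qed
 qed
 moreover have "(\<Union>n. B Int (\<Union>k<n. tile k)) = B Int quadrant" unfolding tiles_cover[symmetric] by blast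
 ultimately show ?thesis by (simp add: area_def)
qed

text \<open>Counts over finitely many tiles increase to the total count, so lower events decrease; this transfers both Poisson laws and independence, also for sets of infinite measure.\<close>

lemma prob_le_limit:
 fixes B :: "'j => (real \<times> real) set"
 assumes B: "!!j. B j : sets borel" and J: "finite J"
 shows "(%n. measure scatter {om : space scatter. ALL j:J. of_nat (count n (B j) om) <= r j}) \<longlonglongrightarrow>
 measure scatter {om : space scatter. ALL j:J. total (B j) om <= (r j :: ennreal)}"
proof -
 interpret prob_space scatter by (rule prob_scatter)
 let ?A = "%n. {om : space scatter. ALL j:J. of_nat (count n (B j) om) <= r j}"
 have m: "?A n : sets scatter" for n
 proof (rule sets.sets_Collect_finite_All[OF _ J])
 fix j
 have "(%om. of_nat (count n (B j) om) :: ennreal) : borel_measurable scatter"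
 by (rule measurable_compose[OF count_measurable[OF B]]) auto
 thus "{om : space scatter. of_nat (count n (B j) om) <= r j} : sets scatter" by measurable
 qed
 have "(%n. prob (?A n)) \<longlonglongrightarrow> prob (\<Inter>n. ?A n)"
 proof (rule finite_Lim_measure_decseq)
 show "range ?A <= events" using m by blast
 show "decseq ?A" unfolding decseq_def
 proof safe
 fix m n om j assume "m <= n" "ALL j:J. of_nat (count n (B j) om) <= r j" "j : J"
 moreover have "(of_nat (count m (B j) om) :: ennreal) <= of_nat (count n (B j) om)"
 using count_mono[OF \<open>m <= n\<close>] by (simp add: of_nat_mono)
 ultimately show "of_nat (count m (B j) om) <= r j" by (meson order_trans)
 qed
 qed
 moreover have "(\<Inter>n. ?A n) = {om : space scatter. ALL j:J. total (B j) om <= r j}" by (auto simp: total_le_iff)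
 ultimately show ?thesis by simp
qed

lemma total_poisson:
 assumes B: "B : sets borel" and fin: "emeasure lborel (B Int quadrant) < \<infinity>"
 shows "measure scatter {om : space scatter. total B om = of_nat k} = poisson_mass (measure lborel (B Int quadrant)) k"
proof -
 interpret prob_space scatter by (rule prob_scatter)
 let ?mu = "measure lborel (B Int quadrant)"
 have C: "prob {om : space scatter. count n B om = i} = poisson_mass (area n B) i" for n i
 using counts_poisson(1)[of "%j::nat. if j = 0 then B else {}" n 0 i] B
 by (simp add: disjoint_family_on_def)
 have ms: "{om : space scatter. count n B om = i} : events" for n i
 using measurable_sets[OF count_measurable[OF B], of "{i}"] by (simp add: vimage_def Int_def conj_commute)
 have F: "prob {om \<in> space scatter. total B om \<le> of_nat m} = (\<Sum>i\<le>m. poisson_mass ?mu i)" for m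
 proof -
 have "prob {om \<in> space scatter. of_nat (count n B om) \<le> (of_nat m :: ennreal)} = (\<Sum>i\<le>m. poisson_mass (area n B) i)" for n
 proof -
 have "{om : space scatter. of_nat (count n B om) <= (of_nat m :: ennreal)} = (\<Union>i\<le>m. {om : space scatter. count n B om = i})"
 by auto
 thus ?thesis
 using finite_measure_finite_Union[of "{..m}" "%i. {om : space scatter. count n B om = i}"] ms C
 by (auto simp: disjoint_family_on_def)
 qed
 hence "(%n. \<Sum>i\<le>m. poisson_mass (area n B) i) \<longlonglongrightarrow> prob {om : space scatter. total B om <= of_nat m}"
 using prob_le_limit[of "%_::nat. B" "{0}" "%_. of_nat m"] B by simp
 moreover have "(%n. \<Sum>i\<le>m. poisson_mass (area n B) i) \<longlonglongrightarrow> (\<Sum>i\<le>m. poisson_mass ?mu i)"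
 unfolding poisson_mass_def by (intro tendsto_intros area_tendsto[OF B fin]) auto
 ultimately show ?thesis by (rule LIMSEQ_unique)
 qed
 have mt: "{om : space scatter. total B om <= of_nat m} : events" for m
 using total_measurable[OF B] by measurable
 show ?thesis
 proof (cases k)
 case 0
 thus ?thesis using F[of 0] by simp
 next
 case (Suc m)
 have "{om : space scatter. total B om = of_nat k} =
 {om : space scatter. total B om <= of_nat (Suc m)} - {om : space scatter. total B om <= of_nat m}"
 proof safe
 fix om assume "total B om <= of_nat (Suc m)" "~ total B om <= of_nat m"
 moreover obtain j where j: "total B om = of_nat j" using total_cases[of B om] calculation by (auto simp: top_unique)
 ultimately have le: "(of_nat j :: ennreal) <= of_nat (Suc m)" "~ (of_nat j :: ennreal) <= of_nat m" by simp_all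
 have "j <= Suc m" using le(1) unfolding of_nat_le_iff .
 moreover have "~ j <= m" using le(2) unfolding of_nat_le_iff .
 ultimately have "j = k" using Suc by linarith
 thus "total B om = of_nat k" using j by (simp only:)
 next
 fix om assume "total B om = of_nat k"
 hence e: "total B om = of_nat (Suc m)" unfolding Suc .
 show "total B om <= of_nat (Suc m)" unfolding e by (rule order_refl)
 next
 fix om assume "total B om = of_nat k" "total B om <= of_nat m"
 hence "(of_nat (Suc m) :: ennreal) <= of_nat m" unfolding Suc by metis
 thus False unfolding of_nat_le_iff by simp
 qed
 moreover have "{om : space scatter. total B om <= of_nat m} <= {om : space scatter. total B om <= of_nat (Suc m)}"
 by (auto intro: order_trans)
 ultimately show ?thesis using finite_measure_Diff[OF mt[of "Suc m"] mt[of m]] F[of m] F[of "Suc m"] Suc by simp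
 qed
qed

lemma total_indep:
 fixes B :: "nat => (real \<times> real) set"
 assumes B: "!!j. B j : sets borel" and dis: "disjoint_family B"
 shows "prob_space.indep_vars scatter (%_. borel) (%j. total (B j)) UNIV"
proof -
 interpret prob_space scatter by (rule prob_scatter)
 define G where "G j = {total (B j) -` {..r} Int space scatter | r. True}" for j
 have m: "total (B j) : borel_measurable scatter" for j by (rule total_measurable[OF B])
 have "indep_sets G UNIV"
 proof (rule indep_setsI)
 show "G j <= events" for j using measurable_sets[OF m[of j]] by (auto simp: G_def)
 fix A J assume J: "J ~= {}" "finite J" "ALL j:J. A j : G j"
 hence "ALL j:J. EX r. A j = total (B j) -` {..r} Int space scatter" by (simp add: G_def)
 from bchoice[OF this] obtain r where r: "!!j. j : J ==> A j = total (B j) -` {..r j} Int space scatter" by blast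
 let ?C = "%n j. {om : space scatter. of_nat (count n (B j) om) <= r j}"
 have prodeq: "prob {om : space scatter. ALL j:J. of_nat (count n (B j) om) <= r j} = (\<Prod>j\<in>J. prob (?C n j))" for n
 proof -
 have "indep_vars (%_. count_space UNIV) (%j. count n (B j)) J"
 by (rule indep_vars_subset[OF counts_poisson(2)[OF B dis]]) simp
 hence "prob (\<Inter>j\<in>J. count n (B j) -` {i. of_nat i <= r j} Int space scatter) =
 (\<Prod>j\<in>J. prob (count n (B j) -` {i. of_nat i <= r j} Int space scatter))"
 using J by (intro indep_varsD_finite) auto
 moreover have V: "count n (B j) -` {i. of_nat i <= r j} Int space scatter = ?C n j" for j by auto
 ultimately have "prob (\<Inter>j\<in>J. ?C n j) = (\<Prod>j\<in>J. prob (?C n j))" unfolding V by (simp only:)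
 moreover have "(\<Inter>j\<in>J. ?C n j) = {om : space scatter. ALL j:J. of_nat (count n (B j) om) <= r j}" using J(1) by auto
 ultimately show ?thesis by (simp only:)
 qed
 have Aj: "A j = {om : space scatter. total (B j) om <= r j}" if "j : J" for j using r[OF that] by auto
 have "(%n. prob (?C n j)) \<longlonglongrightarrow> prob (A j)" if "j : J" for j
 using prob_le_limit[where B=B and J="{j}" and r=r, OF B] Aj[OF that] by simp
 hence "(%n. \<Prod>j\<in>J. prob (?C n j)) \<longlonglongrightarrow> (\<Prod>j\<in>J. prob (A j))" by (intro tendsto_prod)
 moreover have "(\<Inter>j\<in>J. A j) = {om : space scatter. ALL j:J. total (B j) om <= r j}" using J(1) Aj by auto
 ultimately show "prob (\<Inter>j\<in>J. A j) = (\<Prod>j\<in>J. prob (A j))"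
 using prob_le_limit[where B=B and J=J and r=r, OF B J(2)] LIMSEQ_unique by (simp only: prodeq) blast
 qed
 moreover have "Int_stable (G j)" for j
 unfolding Int_stable_def
 proof (intro ballI)
 fix a b assume "a : G j" "b : G j"
 then obtain r r' where "a = total (B j) -` {..r} Int space scatter" "b = total (B j) -` {..r'} Int space scatter"
 by (auto simp: G_def)
 hence "a Int b = total (B j) -` {..min r r'} Int space scatter" by auto
 thus "a Int b : G j" unfolding G_def by blast
 qed
 ultimately have "indep_sets (%j. sigma_sets (space scatter) (G j)) UNIV" by (rule indep_sets_sigma)
 moreover have "{total (B j) -` A Int space scatter | A. A : sets borel} = sigma_sets (space scatter) (G j)" for j
 proof -
 have "sets (borel :: ennreal measure) = sigma_sets UNIV (range (%r. {r<..}))"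
 unfolding borel_Ioi by simp
 also have "... = sigma_sets UNIV (range (%r. {..r}))"
 proof (rule sigma_sets_eqI)
 fix a :: "ennreal set" assume "a : range (%r. {r<..})"
 then obtain r where "a = UNIV - {..r}" by (auto simp: Compl_eq_Diff_UNIV[symmetric])
 thus "a : sigma_sets UNIV (range (%r. {..r}))" by (auto intro: sigma_sets.Compl sigma_sets.Basic)
 next
 fix a :: "ennreal set" assume "a : range (%r. {..r})"
 then obtain r where "a = UNIV - {r<..}" by (auto simp: Compl_eq_Diff_UNIV[symmetric])
 thus "a : sigma_sets UNIV (range (%r. {r<..}))" by (auto intro: sigma_sets.Compl sigma_sets.Basic)
 qed
 finally have "sets (borel :: ennreal measure) = sigma_sets UNIV (range (%r. {..r}))" .
 hence "{total (B j) -` A Int space scatter | A. A : sets borel} = {total (B j) -` A Int space scatter | A. A : sigma_sets UNIV (range (%r. {..r}))}" by (simp only:)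
 also have "... = sigma_sets (space scatter) {total (B j) -` A Int space scatter | A. A : range (%r. {..r})}"
 by (rule sigma_sets_vimage_commute) simp
 also have "{total (B j) -` A Int space scatter | A. A : range (%r. {..r})} = G j" by (auto simp: G_def)
 finally show ?thesis .
 qed
 ultimately show ?thesis using m unfolding indep_vars_def2 by simp
qed

section \<open>The limiting Poisson point process\<close>

lemma exp_density_tail:
 assumes c: "c > 0"
 shows "emeasure (density lborel (%z. ennreal (c * exp (- c * z)))) {x<..} = ennreal (exp (- c * x))"
proof -
 have "emeasure (density lborel (%z. ennreal (c * exp (- c * z)))) {x<..} =
 (\<integral>\<^sup>+z. ennreal (c * exp (- c * z)) * indicator {x<..} z \<partial>lborel)"
 by (rule emeasure_density) auto
 also have "... = (\<integral>\<^sup>+z. ennreal (c * exp (- c * z)) * indicator {x..} z \<partial>lborel)"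
 by (rule nn_integral_cong_AE) (use AE_lborel_singleton[of x] in \<open>eventually_elim, auto simp: indicator_def\<close>)
 also have "... = ennreal (0 - - exp (- c * x))"
 proof (rule nn_integral_FTC_atLeast)
 show "((%z. - exp (- c * z)) \<longlongrightarrow> 0) at_top" using c by real_asymp
 qed (use c in \<open>auto intro!: derivative_eq_intros\<close>)
 finally show ?thesis by simp
qed

abbreviation "half_line \<equiv> density (lborel :: real measure) (indicator {0<..})"

text \<open>The image of Lebesgue measure on the half-line under \<open>p \<mapsto> - ln p / c\<close> is the measure with density \<open>c exp (- c z)\<close>.\<close>

lemma exp_density_distr:
 assumes c: "c > 0"
 shows "density lborel (%z. ennreal (c * exp (- c * z))) = distr half_line borel (%p. - ln p/c)"
proof (rule measure_eqI_lessThan)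
 fix x :: real
 have "emeasure (distr half_line borel (%p. - ln p/c)) {x<..} = emeasure half_line ((%p. - ln p/c) -` {x<..} Int space half_line)"
 by (rule emeasure_distr) auto
 also have "... = emeasure lborel ({0<..} Int ((%p. - ln p/c) -` {x<..} Int space half_line))"
 by (rule emeasure_restricted) (auto intro!: measurable_sets_borel[of _ borel])
 also have "{0<..} Int ((%p. - ln p/c) -` {x<..} Int space half_line) = {0<..<exp (- c * x)}"
 proof -
 have "(x < - ln p/c) = (p < exp (- c * x))" if "0 < p" for p
 proof -
 have "(x < - ln p/c) = (x * c < - ln p)" using c by (rule pos_less_divide_eq)
 also have "... = (ln p < - c * x)" by (auto simp: mult.commute)
 also have "... = (ln p < ln (exp (- c * x)))" by simp
 also have "... = (p < exp (- c * x))" using that by (subst ln_less_cancel_iff) auto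
 finally show ?thesis .
 qed
 thus ?thesis by auto
 qed
 finally show "emeasure (density lborel (%z. ennreal (c * exp (- c * z)))) {x<..} =
 emeasure (distr half_line borel (%p. - ln p/c)) {x<..}"
 using exp_density_tail[OF c] by simp
 show "emeasure (density lborel (%z. ennreal (c * exp (- c * z)))) {x<..} < \<infinity>"
 using exp_density_tail[OF c] by simp
qed auto

lemma half_line_pair:
 assumes B: "B : sets (borel :: (real \<times> real) measure)"
 shows "emeasure (half_line \<Otimes>\<^sub>M half_line) B = emeasure lborel (B Int quadrant)"
proof -
 have sf: "sigma_finite_measure half_line"
 by (subst sigma_finite_measure.sigma_finite_iff_density_finite[OF lborel.sigma_finite_measure_axioms]) (auto simp: indicator_def)
 interpret H: sigma_finite_measure half_line by (rule sf)
 have B2: "B : sets (lborel \<Otimes>\<^sub>M lborel)" "B : sets (half_line \<Otimes>\<^sub>M half_line)"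
 proof -
 have B0: "B : sets (borel \<Otimes>\<^sub>M borel)" using B by (simp only: borel_prod)
 have "sets (lborel \<Otimes>\<^sub>M lborel) = sets (borel \<Otimes>\<^sub>M borel :: (real \<times> real) measure)"
 "sets (half_line \<Otimes>\<^sub>M half_line) = sets (borel \<Otimes>\<^sub>M borel)"
 by (rule sets_pair_measure_cong; simp)+
 thus "B : sets (lborel \<Otimes>\<^sub>M lborel)" "B : sets (half_line \<Otimes>\<^sub>M half_line)" using B0 by (simp_all only:)
 qed
 have s: "Pair x -` B : sets borel" for x using sets_Pair1[OF B2(1)] by simp
 have "emeasure (half_line \<Otimes>\<^sub>M half_line) B = (\<integral>\<^sup>+x. emeasure half_line (Pair x -` B) \<partial>half_line)"
 by (rule H.emeasure_pair_measure_alt[OF B2(2)])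
 also have "... = (\<integral>\<^sup>+x. emeasure lborel ({0<..} Int Pair x -` B) \<partial>half_line)"
 using s by (simp add: emeasure_restricted)
 also have "... = (\<integral>\<^sup>+x. indicator {0<..} x * emeasure lborel ({0<..} Int Pair x -` B) \<partial>lborel)"
 proof (rule nn_integral_density)
 have "B Int UNIV \<times> {0<..} : sets (lborel \<Otimes>\<^sub>M lborel)" using B2(1) by (intro sets.Int pair_measureI) auto
 from lborel.measurable_emeasure_Pair[OF this]
 have "(%x. emeasure lborel (Pair x -` (B Int UNIV \<times> {0<..}))) : borel_measurable lborel" .
 moreover have "Pair x -` (B Int UNIV \<times> {0<..}) = {0<..} Int Pair x -` B" for x by auto
 ultimately show "(%x. emeasure lborel ({0<..} Int Pair x -` B)) : borel_measurable lborel" by simp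
 qed simp
 also have "... = (\<integral>\<^sup>+x. emeasure lborel (Pair x -` (B Int quadrant)) \<partial>lborel)"
 proof (rule nn_integral_cong)
 fix x :: real
 have "Pair x -` (B Int quadrant) = (if 0 < x then {0<..} Int Pair x -` B else {})" by auto
 thus "indicator {0<..} x * emeasure lborel ({0<..} Int Pair x -` B) = emeasure lborel (Pair x -` (B Int quadrant))"
 by (simp add: indicator_def)
 qed
 also have "... = emeasure (lborel \<Otimes>\<^sub>M lborel) (B Int quadrant)"
 using B2(1) by (intro lborel.emeasure_pair_measure_alt[symmetric] sets.Int pair_measureI) auto
 finally show ?thesis by (simp add: lborel_prod)
qed

lemma unchart_sets:
 assumes "A : sets (restrict_space borel ext_plane)"
 shows "{y. unchart a y : A} : sets borel"
proof -
 have "A : sets borel" using assms ext_plane_borel by (auto simp: sets_restrict_space_iff)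
 from measurable_sets_borel[OF unchart_measurable this] show ?thesis by (simp add: vimage_def)
qed

text \<open>In the coordinates \<open>(exp (- x), exp (- a z))\<close> the limiting intensity is plain area. This is the reason for all computations with unit-intensity cells.\<close>

lemma emeasure_limit_intensity:
 assumes a: "a > 0" and A: "A : sets (restrict_space borel ext_plane)"
 shows "emeasure (limit_intensity a) A = emeasure lborel ({y. unchart a y : A} Int quadrant)"
proof -
 let ?g = "%p::real. - ln p/1" and ?h = "%q::real. - ln q/a"
 let ?ps = "%(x, z). (ereal x, ereal z)" and ?ph = "%(p, q). (?g p, ?h q)"
 have AA: "A : sets borel" "A <= ext_plane" using A ext_plane_borel by (auto simp: sets_restrict_space_iff)
 have sf: "sigma_finite_measure (distr half_line borel ?h)"
 unfolding exp_density_distr[OF a, symmetric] by (subst sigma_finite_measure.sigma_finite_iff_density_finite[OF lborel.sigma_finite_measure_axioms]) auto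
 have pair: "distr half_line borel ?g \<Otimes>\<^sub>M distr half_line borel ?h = distr (half_line \<Otimes>\<^sub>M half_line) (borel \<Otimes>\<^sub>M borel) ?ph"
 by (rule pair_measure_distr[OF _ _ sf]) auto
 have psc: "?ps : borel_measurable borel"
 unfolding case_prod_beta
 by (intro borel_measurable_Pair measurable_compose[OF borel_measurable_continuous_onI borel_measurable_ereal] continuous_intros) auto
 have ps: "?ps : measurable (borel \<Otimes>\<^sub>M borel) (restrict_space borel ext_plane)"
 unfolding borel_prod by (rule measurable_restrict_space2[OF _ psc]) (auto simp: ext_plane_def)
 have ph: "?ph : measurable (half_line \<Otimes>\<^sub>M half_line) (borel \<Otimes>\<^sub>M borel)" by measurable
 let ?B = "?ph -` (?ps -` A Int space (borel \<Otimes>\<^sub>M borel)) Int space (half_line \<Otimes>\<^sub>M half_line)"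
 have "limit_intensity a = distr (distr (half_line \<Otimes>\<^sub>M half_line) (borel \<Otimes>\<^sub>M borel) ?ph) (restrict_space borel ext_plane) ?ps"
 unfolding limit_intensity_def pair[symmetric] exp_density_distr[OF a, symmetric] exp_density_distr[OF zero_less_one, symmetric]
 by simp
 hence "emeasure (limit_intensity a) A = emeasure (half_line \<Otimes>\<^sub>M half_line) ?B"
 using ph ps A measurable_sets[OF ps A] by (simp add: emeasure_distr)
 also have "... = emeasure lborel (?B Int quadrant)"
 proof (rule half_line_pair)
 have "sets (half_line \<Otimes>\<^sub>M half_line) = sets (borel :: (real \<times> real) measure)"
 unfolding borel_prod[symmetric] by (rule sets_pair_measure_cong) auto
 thus "?B : sets borel" using measurable_sets[OF ph measurable_sets[OF ps A]] by simp
 qed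
 also have "?B Int quadrant = {y. unchart a y : A} Int quadrant"
 by (auto simp: unchart_def undecay_def space_pair_measure)
 finally show ?thesis .
qed

lemma limit_intensity_radon: assumes a: "a > 0" shows "limit_intensity a : radon_measures ext_plane"
 unfolding radon_measures_def
proof (intro CollectI conjI allI impI)
 show "sets (limit_intensity a) = sets (restrict_space borel ext_plane)" by (simp add: limit_intensity_def)
 fix K :: "(ereal \<times> ereal) set" assume K: "compact K & K <= ext_plane"
 then obtain R where R: "R >= 0" "ALL e:K. fst (chart a e) <= R & snd (chart a e) <= R"
 using compact_chart_bounded[OF a] by blast
 have "closed K" using K by (intro compact_imp_closed) auto
 hence Ks: "K : sets (restrict_space borel ext_plane)"
 using K ext_plane_borel by (auto simp: sets_restrict_space_iff)
 have sub: "{y. unchart a y : K} Int quadrant <= {0<..R} \<times> {0<..R}"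
 proof
 fix y assume y: "y : {y. unchart a y : K} Int quadrant"
 hence "chart a (unchart a y) = y" by (intro chart_unchart[OF a]) auto
 thus "y : {0<..R} \<times> {0<..R}" using R(2) y by (metis Int_iff greaterThanAtMost_iff greaterThan_iff mem_Collect_eq mem_Times_iff)
 qed
 have "emeasure lborel ({y. unchart a y : K} Int quadrant) <= emeasure lborel ({0<..R} \<times> {0<..R})"
 by (rule emeasure_mono[OF sub]) (simp add: borel_Times_real)
 also have "... < \<infinity>" using R(1) by (simp add: emeasure_lborel_Times ennreal_mult_less_top)
 finally show "emeasure (limit_intensity a) K < \<infinity>" by (simp add: emeasure_limit_intensity[OF a Ks])
qed

text \<open>A random element can be replaced by the identity on its range, with the final sigma-algebra.\<close>

lemma image_space:
 assumes "prob_space \<Omega>"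
 shows "EX M'. prob_space M' & space M' = g ` space \<Omega> &
 (ALL A <= g ` space \<Omega>. g -` A Int space \<Omega> : sets \<Omega> --> A : sets M' & measure M' A = measure \<Omega> (g -` A Int space \<Omega>))"
proof -
 interpret prob_space \<Omega> by fact
 define F where "F = {A : Pow (g ` space \<Omega>). g -` A Int space \<Omega> : sets \<Omega>}"
 have "sigma_algebra (g ` space \<Omega>) F"
 unfolding sigma_algebra_iff2
 proof (intro conjI ballI allI impI)
 show "F <= Pow (g ` space \<Omega>)" "{} : F" by (auto simp: F_def)
 fix A assume A: "A : F"
 have "g -` (g ` space \<Omega> - A) Int space \<Omega> = space \<Omega> - (g -` A Int space \<Omega>)" by auto
 thus "g ` space \<Omega> - A : F" using A by (auto simp: F_def intro: sets.compl_sets)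
 next
 fix A :: "nat => _" assume A: "range A <= F"
 have "g -` (\<Union>i. A i) Int space \<Omega> = (\<Union>i. g -` A i Int space \<Omega>)" by auto
 moreover have "(\<Union>i. g -` A i Int space \<Omega>) : sets \<Omega>" using A by (intro sets.countable_UN) (auto simp: F_def)
 ultimately show "(\<Union>i. A i) : F" using A by (auto simp: F_def)
 qed
 hence s: "sets (sigma (g ` space \<Omega>) F) = F" "space (sigma (g ` space \<Omega>) F) = g ` space \<Omega>"
 by (auto simp: sigma_algebra.sets_measure_of_eq sigma_algebra.space_measure_of_eq)
 have m: "g : measurable \<Omega> (sigma (g ` space \<Omega>) F)"
 proof (rule measurableI)
 show "g x : space (sigma (g ` space \<Omega>) F)" if "x : space \<Omega>" for x using that by (simp add: s)
 show "g -` A Int space \<Omega> : sets \<Omega>" if "A : sets (sigma (g ` space \<Omega>) F)" for A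
 using that unfolding s by (simp add: F_def)
 qed
 show ?thesis
 proof (intro exI conjI allI impI)
 show "prob_space (distr \<Omega> (sigma (g ` space \<Omega>) F) g)" by (rule prob_space_distr[OF m])
 show "space (distr \<Omega> (sigma (g ` space \<Omega>) F) g) = g ` space \<Omega>" by (simp add: s)
 fix A assume "A <= g ` space \<Omega>" "g -` A Int space \<Omega> : sets \<Omega>"
 hence A: "A : sets (sigma (g ` space \<Omega>) F)" unfolding s by (simp add: F_def)
 thus "A : sets (distr \<Omega> (sigma (g ` space \<Omega>) F) g)" by simp
 show "measure (distr \<Omega> (sigma (g ` space \<Omega>) F) g) A = measure \<Omega> (g -` A Int space \<Omega>)"
 by (rule measure_distr[OF m A])
 qed
qed

lemma scatter_config: assumes "om : space scatter" shows "config (ids om) (pts om)"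
 unfolding config_def
proof (intro conjI ballI allI)
 have U: "snd (om k) i : unit_square" for k i
 proof -
 have "om k : space tile_law" using assms by (auto simp: scatter_def space_PiM PiE_iff)
 thus ?thesis by (auto simp: tile_law_def space_pair_measure space_PiM space_uniform_point PiE_iff mem_Times_iff)
 qed
 have pos: "fst (corner k) <= fst (pts om (k, i))" "snd (corner k) <= snd (pts om (k, i))" for k i
 using U[of k i] by (auto simp: pts_def unit_square_def mem_Times_iff)
 have c0: "0 <= fst (corner k)" "0 <= snd (corner k)" for k by (auto simp: corner_def)
 fix j assume "j : ids om"
 show "0 <= fst (pts om j)" "0 <= snd (pts om j)"
 using pos[of "fst j" "snd j"] c0[of "fst j"] by auto
next
 have U: "snd (om k) i : unit_square" for k i
 proof -
 have "om k : space tile_law" using assms by (auto simp: scatter_def space_PiM PiE_iff)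
 thus ?thesis by (auto simp: tile_law_def space_pair_measure space_PiM space_uniform_point PiE_iff mem_Times_iff)
 qed
 have pos: "fst (corner k) <= fst (pts om (k, i))" "snd (corner k) <= snd (pts om (k, i))" for k i
 using U[of k i] by (auto simp: pts_def unit_square_def mem_Times_iff)
 fix R :: real
 define m where "m = nat \<lceil>R\<rceil>"
 let ?K = "prod_encode ` ({..m} \<times> {..m})"
 show "finite {j : ids om. pts om j : qbox R}"
 proof (rule finite_subset)
 show "finite (SIGMA k:?K. {i. i < fst (om k)})" by auto
 show "{j : ids om. pts om j : qbox R} <= (SIGMA k:?K. {i. i < fst (om k)})"
 proof
 fix j assume "j : {j : ids om. pts om j : qbox R}"
 moreover obtain k i where ki: "j = (k, i)" by (cases j)
 ultimately have j: "(k, i) : ids om" "pts om (k, i) : qbox R" by simp_all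
 hence "fst (corner k) <= R" "snd (corner k) <= R" using pos[of k i] by (auto simp: qbox_def mem_Times_iff)
 hence "fst (prod_decode k) <= m" "snd (prod_decode k) <= m" by (auto simp: corner_def m_def le_nat_iff) linarith+
 hence "k : ?K" by (intro image_eqI[of _ _ "prod_decode k"]) (auto simp: mem_Times_iff)
 thus "j : (SIGMA k:?K. {i. i < fst (om k)})" using j(1) unfolding ki by (simp add: ids_def)
 qed
 qed
qed

lemma emeasure_scatter_PM:
 "A : sets (restrict_space borel ext_plane) ==> emeasure (PM a (ids om) (pts om)) A = total {y. unchart a y : A} om"
 by (simp add: emeasure_PM total_def)

text \<open>The scatter is transported to its range in the space of measures, so that the process becomes the identity and all realizations are sums of point masses of locally finite configurations.\<close>

lemma poisson_point_process_exists:
 assumes a: "a > 0"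
 shows "EX M' :: (ereal \<times> ereal) measure measure. poisson_point_process ext_plane (limit_intensity a) M' (%m. m) &
 (ALL m:space M'. EX (I :: (nat \<times> nat) set) x. config I x & m = PM a I x)"
proof -
 interpret S: prob_space scatter by (rule prob_scatter)
 define g where "g om = PM a (ids om) (pts om)" for om
 obtain M' where M': "prob_space M'" "space M' = g ` space scatter"
 and im: "!!A. A <= g ` space scatter ==> g -` A Int space scatter : sets scatter ==>
 A : sets M' & measure M' A = measure scatter (g -` A Int space scatter)"
 using image_space[OF prob_scatter, of g] by blast
 interpret M': prob_space M' by (rule M')
 have tr: "{m : space M'. emeasure m A : C} : sets M'"
 "g -` {m : space M'. emeasure m A : C} Int space scatter = {om : space scatter. total {y. unchart a y : A} om : C}"
 if A: "A : sets (restrict_space borel ext_plane)" and C: "C : sets borel" for A C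
 proof -
 show eq: "g -` {m : space M'. emeasure m A : C} Int space scatter = {om : space scatter. total {y. unchart a y : A} om : C}"
 using emeasure_scatter_PM[OF A] by (auto simp: g_def M'(2))
 have "{om : space scatter. total {y. unchart a y : A} om : C} : sets scatter"
 using measurable_sets[OF total_measurable[OF unchart_sets[OF A]] C] by (simp add: vimage_def Int_def conj_commute)
 thus "{m : space M'. emeasure m A : C} : sets M'" using im[of "{m : space M'. emeasure m A : C}"] eq M'(2) by auto
 qed
 have meas: "(%m. emeasure m A) : borel_measurable M'" if "A : sets (restrict_space borel ext_plane)" for A
 using tr(1)[OF that] by (intro measurableI) (auto simp: vimage_def Int_def conj_commute)
 have cfg: "EX (I :: (nat \<times> nat) set) x. config I x & m = PM a I x" if m: "m : space M'" for m
 proof -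
 obtain om where "om : space scatter" "m = g om" using m M'(2) by blast
 thus ?thesis using scatter_config unfolding g_def by blast
 qed
 have "poisson_point_process ext_plane (limit_intensity a) M' (%m. m)"
 unfolding poisson_point_process_def
 proof (intro conjI allI impI)
 show "prob_space M'" "limit_intensity a : radon_measures ext_plane" by (rule M', rule limit_intensity_radon[OF a])
 show "point_process ext_plane M' (%m. m)"
 unfolding point_process_def
 proof (intro conjI ballI)
 fix m assume m: "m : space M'"
 thus "m : radon_measures ext_plane" using cfg[OF m] PM_radon[OF a] by metis
 fix A assume A: "A : sets (restrict_space borel ext_plane)"
 obtain om where "m = g om" using m M'(2) by blast
 hence "emeasure m A = total {y. unchart a y : A} om" using emeasure_scatter_PM[OF A] by (simp add: g_def)
 moreover have "(\<infinity> :: ennreal) = ennreal_of_enat \<infinity>" "(of_nat k :: ennreal) = ennreal_of_enat (enat k)" for k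
 by (simp_all add: ennreal_of_enat_def)
 ultimately show "emeasure m A : range ennreal_of_enat"
 using total_cases[of "{y. unchart a y : A}" om] by (metis rangeI)
 qed (rule meas)
 next
 fix A :: "(ereal \<times> ereal) set" and k :: nat
 assume A: "A : sets (restrict_space borel ext_plane) & emeasure (limit_intensity a) A < \<infinity>"
 hence A1: "A : sets (restrict_space borel ext_plane)" by simp
 have fin: "emeasure lborel ({y. unchart a y : A} Int quadrant) < \<infinity>" using A emeasure_limit_intensity[OF a A1] by simp
 have "M'.prob {m : space M'. emeasure m A : {of_nat k}} = S.prob {om : space scatter. total {y. unchart a y : A} om : {of_nat k}}"
 using im[of "{m : space M'. emeasure m A : {of_nat k}}"] tr(2)[OF A1, of "{of_nat k}"]
 measurable_sets[OF total_measurable[OF unchart_sets[OF A1]], of "{of_nat k}"] M'(2)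
 by (auto simp: vimage_def Int_def conj_commute)
 thus "M'.prob {m : space M'. emeasure m A = of_nat k} = poisson_mass (measure (limit_intensity a) A) k"
 using total_poisson[OF unchart_sets[OF A1] fin, of k] emeasure_limit_intensity[OF a A1] by (simp add: measure_def)
 next
 fix A :: "nat => (ereal \<times> ereal) set"
 assume A: "range A <= sets (restrict_space borel ext_plane) & disjoint_family A"
 hence Aj: "A j : sets (restrict_space borel ext_plane)" for j by auto
 let ?B = "%j. {y. unchart a y : A j}"
 have dis: "disjoint_family ?B" using A by (auto simp: disjoint_family_on_def)
 have ind: "S.indep_vars (%_. borel) (%j. total (?B j)) UNIV" by (rule total_indep[OF unchart_sets[OF Aj] dis])
 show "M'.indep_vars (%_. borel) (%i m. emeasure m (A i)) UNIV"
 unfolding M'.indep_vars_def2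
 proof (intro conjI ballI M'.indep_setsI)
 show "(%m. emeasure m (A i)) : borel_measurable M'" for i by (rule meas[OF Aj])
 show "{(%m. emeasure m (A i)) -` C Int space M' | C. C : sets borel} <= M'.events" for i
 using measurable_sets[OF meas[OF Aj]] by auto
 fix E J assume J: "J ~= {}" "finite J" "ALL j:J. E j : {(%m. emeasure m (A j)) -` C Int space M' | C. C : sets borel}"
 hence "ALL j:J. EX C. C : sets borel & E j = (%m. emeasure m (A j)) -` C Int space M'" by blast
 from bchoice[OF this] obtain C where C: "!!j. j : J ==> C j : sets borel"
 "!!j. j : J ==> E j = (%m. emeasure m (A j)) -` C j Int space M'" by blast
 have E: "E j = {m : space M'. emeasure m (A j) : C j}" if "j : J" for j using C(2)[OF that] by auto
 have gE: "g -` E j Int space scatter = total (?B j) -` C j Int space scatter" if "j : J" for j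
 using tr(2)[OF Aj C(1)[OF that], of j] unfolding E[OF that] by auto
 have gEm: "g -` E j Int space scatter : sets scatter" if "j : J" for j
 unfolding gE[OF that] by (rule measurable_sets[OF total_measurable[OF unchart_sets[OF Aj]] C(1)[OF that]])
 have Esub: "E j <= g ` space scatter" if "j : J" for j using E[OF that] M'(2) by auto
 have "g -` (\<Inter>j\<in>J. E j) Int space scatter = (\<Inter>j\<in>J. g -` E j Int space scatter)" using J(1) by auto
 moreover have "(\<Inter>j\<in>J. g -` E j Int space scatter) : sets scatter"
 using J(1,2) gEm by (intro sets.finite_INT) auto
 moreover have "(\<Inter>j\<in>J. E j) <= g ` space scatter" using J(1) Esub by blast
 ultimately have "M'.prob (\<Inter>j\<in>J. E j) = S.prob (\<Inter>j\<in>J. g -` E j Int space scatter)" using im by auto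
 also have "... = S.prob (\<Inter>j\<in>J. total (?B j) -` C j Int space scatter)" by (rule arg_cong[where f=S.prob], rule INF_cong[OF refl], rule gE)
 also have "... = (\<Prod>j\<in>J. S.prob (total (?B j) -` C j Int space scatter))"
 using S.indep_vars_subset[OF ind, of J] J C(1) by (intro S.indep_varsD_finite) auto
 also have "... = (\<Prod>j\<in>J. M'.prob (E j))"
 using im[OF Esub gEm] gE by (intro prod.cong) auto
 finally show "M'.prob (\<Inter>j\<in>J. E j) = (\<Prod>j\<in>J. M'.prob (E j))" .
 qed
 qed
 thus ?thesis using cfg by blast
qed

section \<open>Convergence of the point processes\<close>

text \<open>Void probabilities determine all occupation patterns, by inclusion and exclusion.\<close>

lemma (in prob_space) pattern_prob:
 assumes V: "!!x. V x : events" and Z: "finite Z" and R: "finite R"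
 shows "prob {om : space M. (ALL x:Z. om : V x) & (ALL x:R. om ~: V x)} =
 (\<Sum>A\<in>Pow R. (- 1)^card A * prob {om : space M. ALL x:Z Un A. om : V x})"
 using R Z
proof (induction R arbitrary: Z rule: finite_induct)
 case empty thus ?case by simp
next
 case (insert r R)
 let ?p = "%Z R. {om : space M. (ALL x:Z. om : V x) & (ALL x:R. om ~: V x)}"
 let ?q = "%Z. prob {om : space M. ALL x:Z. om : V x}"
 have m: "?p Z' R : events" if "finite Z'" for Z'
 proof -
 have "{om : space M. om : V x} : events" "{om : space M. om ~: V x} : events" for x
 using sets.Int[OF sets.top V[of x]] sets.Diff[OF sets.top V[of x]] by (auto simp: Int_def set_diff_eq)
 thus ?thesis
 by (intro sets.sets_Collect_conj sets.sets_Collect_finite_All that insert.hyps(1))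
 qed
 have "?p Z (insert r R) = ?p Z R - ?p (insert r Z) R" by auto
 moreover have "?p (insert r Z) R <= ?p Z R" by auto
 ultimately have "prob (?p Z (insert r R)) = prob (?p Z R) - prob (?p (insert r Z) R)"
 using finite_measure_Diff[OF m[OF insert.prems] m[OF finite.insertI[OF insert.prems]]] by (simp only:)
 also have "... = (\<Sum>A\<in>Pow R. (- 1)^card A * ?q (Z Un A)) - (\<Sum>A\<in>Pow R. (- 1)^card A * ?q (insert r Z Un A))"
 by (simp only: insert.IH[OF insert.prems] insert.IH[OF finite.insertI[OF insert.prems]])
 also have "... = (\<Sum>A\<in>Pow (insert r R). (- 1)^card A * ?q (Z Un A))"
 proof -
 have inj: "inj_on (insert r) (Pow R)" using insert.hyps(2) by (auto simp: inj_on_def)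
 have "(\<Sum>A\<in>insert r ` Pow R. (- 1)^card A * ?q (Z Un A)) = (\<Sum>A\<in>Pow R. (- 1)^card (insert r A) * ?q (Z Un insert r A))"
 by (subst sum.reindex[OF inj]) simp
 also have "... = (\<Sum>A\<in>Pow R. - ((- 1)^card A * ?q (insert r Z Un A)))"
 proof (rule sum.cong[OF refl])
 fix A assume A: "A : Pow R"
 hence "finite A" "r ~: A" using insert.hyps finite_subset by auto
 hence "card (insert r A) = Suc (card A)" by simp
 moreover have "Z Un insert r A = insert r Z Un A" by auto
 ultimately show "(- 1)^card (insert r A) * ?q (Z Un insert r A) = - ((- 1)^card A * ?q (insert r Z Un A))"
 by (simp only: power_Suc mult_minus1 mult_minus_left)
 qed
 finally have 1: "(\<Sum>A\<in>insert r ` Pow R. (- 1)^card A * ?q (Z Un A)) = - (\<Sum>A\<in>Pow R. (- 1)^card A * ?q (insert r Z Un A))"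
 by (simp only: sum_negf)
 have "(\<Sum>A\<in>Pow R Un insert r ` Pow R. (- 1)^card A * ?q (Z Un A)) =
 (\<Sum>A\<in>Pow R. (- 1)^card A * ?q (Z Un A))+(\<Sum>A\<in>insert r ` Pow R. (- 1)^card A * ?q (Z Un A))"
 using insert.hyps by (intro sum.union_disjoint) auto
 thus ?thesis unfolding Pow_insert 1 by linarith
 qed
 finally show ?case .
qed

definition cell_set :: "real => real => nat \<times> nat => (ereal \<times> ereal) set" where
 "cell_set a h c = {e : ext_plane. chart a e : cell h c}"

lemma cell_borel: "cell h c : sets borel"
 unfolding cell_def by (intro borel_Times_real) auto

lemma cell_set_sets: "cell_set a h c : sets (restrict_space borel ext_plane)"
proof -
 have "chart a -` cell h c : sets borel" by (rule measurable_sets_borel[OF chart_measurable cell_borel])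
 hence "ext_plane Int chart a -` cell h c : sets borel" using ext_plane_borel by (intro sets.Int)
 moreover have "cell_set a h c = ext_plane Int chart a -` cell h c" by (auto simp: cell_set_def)
 ultimately show ?thesis using ext_plane_borel by (auto simp: sets_restrict_space_iff)
qed

lemma cell_nonneg: assumes "h > 0" "y : cell h c" shows "0 <= fst y" "0 <= snd y"
proof -
 have "0 <= real (fst c) * h" "0 <= real (snd c) * h" using assms by simp_all
 thus "0 <= fst y" "0 <= snd y" using assms(2) by (auto simp: cell_def mem_Times_iff)
qed

lemma unchart_in_cell_set:
 assumes a: "a > 0" and h: "h > 0" and y: "0 <= fst y" "0 <= snd y"
 shows "unchart a y : cell_set a h c \<longleftrightarrow> y : cell h c"
 using chart_unchart[OF a y] unchart_in[of a y] by (simp add: cell_set_def)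

lemma limit_intensity_cells:
 assumes a: "a > 0" and h: "h > 0" and Z: "finite Z"
 shows "emeasure (limit_intensity a) (\<Union>c\<in>Z. cell_set a h c) = ennreal (h * h * card Z)"
proof -
 have one: "emeasure (limit_intensity a) (cell_set a h c) = ennreal (h * h)" for c
 proof -
 have "{y. unchart a y : cell_set a h c} Int quadrant = ({0<..} Int {real (fst c) * h..<real (fst c+1) * h}) \<times> ({0<..} Int {real (snd c) * h..<real (snd c+1) * h})"
 proof (rule set_eqI)
 fix y :: "real \<times> real"
 have "unchart a y : cell_set a h c \<longleftrightarrow> y : cell h c" if "y : quadrant"
 using that by (intro unchart_in_cell_set[OF a h]) (auto simp: mem_Times_iff)
 thus "y : {y. unchart a y : cell_set a h c} Int quadrant \<longleftrightarrow>
 y : ({0<..} Int {real (fst c) * h..<real (fst c+1) * h}) \<times> ({0<..} Int {real (snd c) * h..<real (snd c+1) * h})"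
 unfolding cell_def mem_Times_iff by (cases y) auto
 qed
 moreover have "emeasure lborel ({0<..} Int {real k * h..<real (k+1) * h}) = ennreal h" for k :: nat
 proof (cases "k = 0")
 case True
 hence "{0<..} Int {real k * h..<real (k+1) * h} = {0<..<h}" by auto
 thus ?thesis using h by simp
 next
 case False
 hence k: "real k * h > 0" using h by simp
 hence "{0<..} Int {real k * h..<real (k+1) * h} = {real k * h..<real (k+1) * h}" by auto
 moreover have "real (k+1) * h = real k * h+h" by (simp add: algebra_simps)
 ultimately show ?thesis using h by simp
 qed
 ultimately show ?thesis
 using h by (simp only: emeasure_limit_intensity[OF a cell_set_sets])
 (subst emeasure_lborel_Times, auto simp: ennreal_mult)
 qed
 have "disjoint_family_on (cell_set a h) Z"
 unfolding disjoint_family_on_def cell_set_def using cell_disjoint[OF h] by blast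
 moreover have "cell_set a h c : sets (limit_intensity a)" for c using cell_set_sets by (simp add: limit_intensity_def)
 ultimately have "emeasure (limit_intensity a) (\<Union>c\<in>Z. cell_set a h c) = (\<Sum>c\<in>Z. emeasure (limit_intensity a) (cell_set a h c))"
 using Z by (intro sum_emeasure[symmetric]) auto
 also have "... = ennreal (h * h * card Z)"
 proof -
 have "(\<Sum>c\<in>Z. ennreal (h * h)) = ennreal (\<Sum>c\<in>Z. h * h)" using h by (intro sum_ennreal) simp
 thus ?thesis unfolding one by (simp add: mult.commute)
 qed
 finally show ?thesis .
qed

lemma emeasure_PM_cell:
 assumes a: "a > 0" and cfg: "config I x" and c: "c : cells n"
 shows "emeasure (PM a I x) (cell_set a (1/2^n) c) = of_nat (card {i\<in>I. x i : cell (1/2^n) c})"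
proof -
 have "{i\<in>I. unchart a (x i) : cell_set a (1/2^n) c} = {i\<in>I. x i : cell (1/2^n) c}"
 proof (rule Collect_cong, rule conj_cong[OF refl])
 fix i assume "i : I"
 thus "unchart a (x i) : cell_set a (1/2^n) c \<longleftrightarrow> x i : cell (1/2^n) c"
 using cfg by (intro unchart_in_cell_set[OF a]) (auto simp: config_def)
 qed
 thus ?thesis
 using config_cell_finite[OF cfg c] by (simp add: emeasure_PM[OF cell_set_sets] emeasure_count_space_finite)
qed

lemma vague_continuous_measurable:
 assumes "continuous_map X euclideanreal f" shows "f : measurable (borel_of_top X) borel"
proof (rule borel_measurableI)
 fix S :: "real set" assume "open S"
 hence "openin X {x : topspace X. f x : S}" using assms by (auto simp: continuous_map_def)
 moreover have U: "{U. openin X U} <= Pow (topspace X)" using openin_subset by blast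
 moreover have "f -` S Int topspace X = {x : topspace X. f x : S}" by auto
 ultimately show "f -` S Int space (borel_of_top X) : sets (borel_of_top X)"
 by (auto simp: borel_of_top_def space_measure_of sets_measure_of intro: sigma_sets.Basic)
qed

context gap_setting begin

definition "good n t = (if 1 < t then (tame Int close t (real n) (1/2^n)) - double t (1/2^n) (cells n) else {})"
definition "bad_bound n = real (card (cells n)) * (2 * ((1/2^n) * (1/2^n)) * ((1/2^n) * (1/2^n)))+1/(real n+1)"

lemma good_event: "good n t : sets M"
 unfolding good_def
 by (split if_split, intro conjI impI sets.Diff sets.Int tame_event close_event double_event finite_cells sets.empty_sets)

lemma card_cells: "real (card (cells n)) = (real n * 2^n) * (real n * 2^n)"
 by (simp add: cells_def card_cartesian_product)

lemma bad_bound_tendsto: "bad_bound \<longlonglongrightarrow> 0"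
proof -
 have eq: "bad_bound n = 2 * (real n/2^n)^2+1/(real n+1)" for n
 unfolding bad_bound_def card_cells by (simp add: power2_eq_square field_simps)
 show ?thesis unfolding eq[abs_def] by real_asymp
qed

lemma good_prob: "\<forall>\<^sub>F t in at_top. prob (space M - good n t) <= bad_bound n"
proof (cases "n = 0")
 case True
 have "prob A <= bad_bound 0" for A using prob_le_1[of A] by (simp add: bad_bound_def cells_def)
 thus ?thesis using True by simp
next
 case False
 have "\<forall>\<^sub>F t in at_top. prob (space M - close t (real n) (1/2^n)) <= 1/(real n+1)"
 using False by (intro close_prob) auto
 moreover have "\<forall>\<^sub>F t in at_top. prob (double t (1/2^n) (cells n)) <= card (cells n) * (2 * ((1/2^n) * (1/2^n)) * ((1/2^n) * (1/2^n)))"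
 by (rule double_small) auto
 ultimately show ?thesis using eventually_gt_at_top[of 1]
 proof eventually_elim
 case (elim t)
 have "prob (space M - good n t) <= prob ((space M - tame) Un ((space M - close t (real n) (1/2^n)) Un double t (1/2^n) (cells n)))"
 using elim(3) by (intro finite_measure_mono sets.Un sets.compl_sets tame_event close_event double_event) (auto simp: good_def)
 also have "... <= prob (space M - tame)+(prob (space M - close t (real n) (1/2^n))+prob (double t (1/2^n) (cells n)))"
 by (intro order_trans[OF measure_Un_le] add_left_mono order_refl sets.Un sets.compl_sets tame_event close_event double_event) auto
 finally show ?case using elim(1,2) tame_prob unfolding bad_bound_def by linarith
 qed
qed

definition "occupied n t om = {c : cells n. EX i. (P t i om, Q t i) : cell (1/2^n) c}"

lemma void_alt: "void t h Z = {om : space M. ALL c:Z. om : void t h {c}}"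
 by (auto simp: void_def)

lemma occupied_eq: assumes "C <= cells n"
 shows "{om : space M. occupied n t om = C} = {om : space M. (ALL c:cells n - C. om : void t (1/2^n) {c}) & (ALL c:C. om ~: void t (1/2^n) {c})}"
 using assms by (auto simp: occupied_def void_def)

lemma occupied_event: "{om : space M. occupied n t om = C} : sets M"
proof (cases "C <= cells n")
 case True
 have "{om : space M. om : void t (1/2^n) {c}} : events" "{om : space M. om ~: void t (1/2^n) {c}} : events" for c
 using sets.Int[OF sets.top void_event[of "{c}" t "1/2^n"]] sets.Diff[OF sets.top void_event[of "{c}" t "1/2^n"]]
 by (auto simp: Int_def set_diff_eq)
 thus ?thesis unfolding occupied_eq[OF True]
 using finite_subset[OF True] by (intro sets.sets_Collect_conj sets.sets_Collect_finite_All) auto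
next
 case False
 hence "{om : space M. occupied n t om = C} = {}" by (auto simp: occupied_def)
 thus ?thesis by (simp only: sets.empty_sets)
qed

lemma good_cell_count:
 assumes "om : good n t" "c : cells n"
 shows "finite {i. (P t i om, Q t i) : cell (1/2^n) c}"
 "card {i. (P t i om, Q t i) : cell (1/2^n) c} = (if c : occupied n t om then 1 else 0)"
proof -
 let ?A = "{i. (P t i om, Q t i) : cell (1/2^n) c}"
 have om: "om : space M" "om ~: double t (1/2^n) (cells n)" using assms(1) by (auto simp: good_def tame_def split: if_splits)
 have u: "i = j" if "i : ?A" "j : ?A" for i j
 proof (rule ccontr)
 assume "i ~= j"
 hence "i < j | j < i" by auto
 thus False using om that assms(2) unfolding double_def by blast
 qed
 show "finite ?A" by (cases "?A = {}") (use u in \<open>auto intro: finite_subset[of _ "{_}"]\<close>)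
 show "card ?A = (if c : occupied n t om then 1 else 0)"
 proof (cases "?A = {}")
 case True thus ?thesis by (auto simp: occupied_def)
 next
 case False
 then obtain i where "i : ?A" by blast
 hence "?A = {i}" using u by blast
 moreover have "c : occupied n t om" using \<open>i : ?A\<close> assms(2) by (auto simp: occupied_def)
 ultimately show ?thesis by simp
 qed
qed

lemma P_nonneg: "1 < t ==> 0 <= P t i om"
 using Lam_pos[of t] alpha by (simp add: P_def be_def)

definition "actual t om i = (pa t (i - 1) om, qa t (i - 1) om)"

definition "point_proc t om = PM a (epoch_indices N om) (actual t om)"

lemma point_proc_eq:
 "point_measure_on ext_plane (epoch_indices N om) (%i. (ereal (lam t * gap N i om - bt t), ereal ((t - epoch N i om)/t * ln t))) = point_proc t om"
proof -
 have eq: "unchart a (actual t om i) = (ereal (lam t * gap N i om - bt t), ereal ((t - epoch N i om)/t * ln t))" if "i : epoch_indices N om" for i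
 using that a_pos by (auto simp: epoch_indices_def actual_def unchart_def undecay_def pa_def qa_def)
 show ?thesis unfolding point_proc_def PM_def point_measure_on_def
 by (rule distr_cong) (simp_all add: eq)
qed

lemma actual_config:
 assumes t: "1 < t" and om: "om : space M" shows "config (epoch_indices N om) (actual t om)"
 unfolding config_def
proof (intro conjI ballI allI)
 show "0 <= fst (actual t om i)" "0 <= snd (actual t om i)" for i by (simp_all add: actual_def pa_def qa_def)
 fix R :: real
 define s where "s = max 0 (t+t * ln (max 1 R)/(a * ln t))"
 have lt: "0 < ln t" using t by simp
 show "finite {i : epoch_indices N om. actual t om i : qbox R}"
 proof (rule finite_subset)
 show "{i : epoch_indices N om. actual t om i : qbox R} <= {..N s om}"
 proof
 fix i assume "i : {i : epoch_indices N om. actual t om i : qbox R}"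
 hence i: "1 <= i" "reached i om" "qa t (i - 1) om <= R" by (auto simp: epoch_indices_def reached_def actual_def qbox_def)
 have "- a * ((t - epoch N i om)/t * ln t) <= ln (max 1 R)"
 proof (subst exp_le_cancel_iff[symmetric])
 have "exp (ln (max 1 R)) = max 1 R" by (rule exp_ln) simp
 thus "exp (- a * ((t - epoch N i om)/t * ln t)) <= exp (ln (max 1 R))" using i by (simp add: qa_def)
 qed
 hence "(epoch N i om - t) * (a * ln t/t) <= ln (max 1 R)" using t by (simp add: field_simps)
 hence "epoch N i om - t <= ln (max 1 R)/(a * ln t/t)"
 using lt a_pos t by (subst pos_le_divide_eq) auto
 hence "epoch N i om <= s" using t by (simp add: s_def max_def mult.commute)
 moreover have "0 <= s" by (simp add: s_def)
 ultimately show "i : {..N s om}" using epoch_le_iff[OF om i(2)] by simp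
 qed
 qed simp
qed

lemma point_proc_measurable:
 assumes t: "1 < t"
 shows "point_proc t : measurable M (borel_of_top (vague_topology ext_plane))"
 unfolding point_proc_def[abs_def]
proof (rule PM_measurable[OF a_pos actual_config[OF t]])
 fix n :: nat and c :: "nat \<times> nat" and k :: nat assume c: "c : cells n"
 let ?A = "%om. {i : epoch_indices N om. actual t om i : cell (1/2^n) c}"
 have m: "{om : space M. i : ?A om} : sets M" for i
 proof -
 have pm: "{om : space M. pa t (i - 1) om : B} : sets M" "{om : space M. qa t (i - 1) om : B} : sets M" if "B : sets borel" for B
 using measurable_sets[OF pa_meas that, of t "i - 1"] measurable_sets[OF qa_meas that, of t "i - 1"] by (auto simp: vimage_def Int_def conj_commute)
 have rm: "{om : space M. reached i om} : sets M" by measurable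
 have "{om : space M. i : ?A om} = {om : space M. 1 <= i & reached i om & pa t (i - 1) om : {real (fst c) * (1/2^n)..<real (fst c+1) * (1/2^n)}
 & qa t (i - 1) om : {real (snd c) * (1/2^n)..<real (snd c+1) * (1/2^n)}}"
 by (auto simp: epoch_indices_def reached_def actual_def cell_def)
 also have "... : sets M"
 by (intro sets.sets_Collect_conj pm rm sets.sets_Collect_const) auto
 finally show ?thesis .
 qed
 have "{om : space M. card (?A om) = k} = {om : space M. (\<Sum>i. indicator {om : space M. i : ?A om} om) = (of_nat k :: ennreal)}"
 proof (rule Collect_cong, rule conj_cong[OF refl])
 fix om assume om: "om : space M"
 have "(\<Sum>i. indicator {om : space M. i : ?A om} om) = (\<Sum>i. indicator (?A om) i :: ennreal)"
 using om by (intro suminf_cong) (simp add: indicator_def)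
 also have "... = emeasure (count_space UNIV) (?A om)"
 by (simp add: nn_integral_count_space_nat[symmetric])
 also have "... = of_nat (card (?A om))"
 using config_cell_finite[OF actual_config[OF t om] c] by (simp add: emeasure_count_space_finite)
 finally show "card (?A om) = k \<longleftrightarrow> (\<Sum>i. indicator {om : space M. i : ?A om} om) = (of_nat k :: ennreal)" by simp
 qed
 also have "... : sets M"
 proof -
 have "(%om. \<Sum>i. indicator {om : space M. i : ?A om} om :: ennreal) : borel_measurable M"
 by (intro borel_measurable_suminf_order borel_measurable_indicator m)
 from measurable_sets[OF this, of "{of_nat k}"] show ?thesis by (simp add: vimage_def Int_def conj_commute)
 qed
 finally show "{om : space M. card (?A om) = k} : sets M" .
qed

lemma good_matched:
 assumes om: "om : good n t" and cfg: "config I x"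
 and eq: "!!c. c : cells n ==> card {i\<in>I. x i : cell (1/2^n) c} = (if c : occupied n t om then 1 else 0)"
 shows "matched (real n - 2) (1/2^n+1/2^n) (epoch_indices N om) (actual t om) I x"
proof -
 have om': "1 < t" "om : tame" "om : close t (real n) (1/2^n)" "om : space M"
 using om by (auto simp: good_def tame_def split: if_splits)
 have cl: "ALL i. (pa t i om < real n & qa t i om < real n) | (P t i om < real n & Q t i < real n) -->
 \<bar>pa t i om - P t i om\<bar> <= 1/2^n & \<bar>qa t i om - Q t i\<bar> <= 1/2^n"
 using om'(3) unfolding close_def by blast
 define y where "y i = (P t (i - 1) om, Q t (i - 1))" for i
 have idx: "epoch_indices N om = Suc ` UNIV"
 proof -
 have "reached i om" for i using om'(2) by (simp add: tame_def)
 hence "epoch_indices N om = {i. 1 <= i}" by (auto simp: epoch_indices_def reached_def)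
 also have "... = Suc ` UNIV" by (auto simp: image_iff) (metis Suc_pred' le_simps(3))
 finally show ?thesis .
 qed
 have cnt: "{i : epoch_indices N om. y i : cell (1/2^n) c} = Suc ` {i. (P t i om, Q t i) : cell (1/2^n) c}" for c
 by (auto simp: idx y_def)
 show ?thesis
 proof (rule counts_matched[where y=y])
 fix c assume c: "c : cells n"
 show "finite {i : epoch_indices N om. y i : cell (1/2^n) c}" unfolding cnt using good_cell_count(1)[OF om c] by simp
 show "finite {i : I. x i : cell (1/2^n) c}" by (rule config_cell_finite[OF cfg c])
 show "card {i : epoch_indices N om. y i : cell (1/2^n) c} = card {i : I. x i : cell (1/2^n) c}"
 unfolding cnt eq[OF c] using good_cell_count(2)[OF om c] by (simp add: card_image)
 next
 fix i assume i: "i : epoch_indices N om"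
 show "0 <= fst (y i) & 0 <= snd (y i)"
 using Q_nonneg[of t "i - 1"] P_nonneg[OF om'(1)] by (simp add: y_def)
 assume "(fst (actual t om i) < real n & snd (actual t om i) < real n) | (fst (y i) < real n & snd (y i) < real n)"
 thus "\<bar>fst (actual t om i) - fst (y i)\<bar> <= 1/2^n & \<bar>snd (actual t om i) - snd (y i)\<bar> <= 1/2^n"
 using cl[rule_format, of "i - 1"] by (simp only: actual_def y_def fst_conv snd_conv)
 qed simp
qed

end

context gap_setting begin

lemma occupied_prob_tendsto:
 assumes C: "C <= cells n"
 shows "((%t. prob {om : space M. occupied n t om = C}) \<longlongrightarrow>
 (\<Sum>A\<in>Pow C. (- 1)^card A * exp (- ((1/2^n) * (1/2^n) * card ((cells n - C) Un A))))) at_top"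
proof -
 have fC: "finite C" using C finite_cells by (rule finite_subset)
 have "prob {om : space M. occupied n t om = C} = (\<Sum>A\<in>Pow C. (- 1)^card A * prob (void t (1/2^n) ((cells n - C) Un A)))" for t
 unfolding occupied_eq[OF C]
 by (subst pattern_prob) (auto simp: void_event fC void_alt[symmetric])
 moreover have "((%t. \<Sum>A\<in>Pow C. (- 1)^card A * prob (void t (1/2^n) ((cells n - C) Un A))) \<longlongrightarrow>
 (\<Sum>A\<in>Pow C. (- 1)^card A * exp (- ((1/2^n) * (1/2^n) * card ((cells n - C) Un A))))) at_top"
 by (intro tendsto_sum tendsto_mult tendsto_const void_tendsto finite_UnI) (auto intro: finite_subset[OF _ fC])
 ultimately show ?thesis by (simp only:)
qed

text \<open>The code is the set of occupied cells. Its law is determined by void probabilities, which converge to those of the Poisson process; when no cell is occupied twice, equal codes match the configurations.\<close>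

theorem gap_point_process_converges:
 shows "EX (M' :: (ereal \<times> ereal) measure measure) et.
 poisson_point_process ext_plane (limit_intensity a) M' et &
 conv_in_distribution (vague_topology ext_plane) M point_proc M' et at_top"
proof -
 obtain M' :: "(ereal \<times> ereal) measure measure" where ppp: "poisson_point_process ext_plane (limit_intensity a) M' (%m. m)"
 and "ALL m:space M'. EX (I :: (nat \<times> nat) set) x. config I x & m = PM a I x"
 using poisson_point_process_exists[OF a_pos] by blast
 hence "EX I x. ALL m:space M'. config (I m :: (nat \<times> nat) set) (x m) & m = PM a (I m) (x m)" by metis
 then obtain I x where cfg: "!!m. m : space M' ==> config (I m :: (nat \<times> nat) set) (x m)"
 and mPM: "!!m. m : space M' ==> m = PM a (I m) (x m)" by blast
 interpret M': prob_space M' using ppp by (simp add: poisson_point_process_def)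
 define E where "E n c = cell_set a (1/2^n) c" for n c
 have Es: "E n c : sets (restrict_space borel ext_plane)" for n c unfolding E_def by (rule cell_set_sets)
 have em: "emeasure m (E n c) = of_nat (card {i\<in>I m. x m i : cell (1/2^n) c})" if "m : space M'" "c : cells n" for m n c
 using emeasure_PM_cell[OF a_pos cfg[OF that(1)] that(2)] mPM[OF that(1)] unfolding E_def by metis
 have ev: "{m : space M'. emeasure m A : S} : sets M'" if "A : sets (restrict_space borel ext_plane)" "S : sets borel" for A S
 proof -
 have "(%m. emeasure m A) : borel_measurable M'"
 using ppp that(1) by (simp add: poisson_point_process_def point_process_def)
 from measurable_sets[OF this that(2)] show ?thesis by (simp add: vimage_def Int_def conj_commute)
 qed
 have pois: "M'.prob {m : space M'. emeasure m A = of_nat k} = poisson_mass (measure (limit_intensity a) A) k"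
 if "A : sets (restrict_space borel ext_plane)" "emeasure (limit_intensity a) A < \<infinity>" for A k
 using ppp that unfolding poisson_point_process_def by blast
 have idm: "(%m. m) : measurable M' (borel_of_top (vague_topology ext_plane))"
 proof -
 have "(%m. PM a (I m) (x m)) : measurable M' (borel_of_top (vague_topology ext_plane))"
 proof (rule PM_measurable[OF a_pos cfg])
 fix n :: nat and c :: "nat \<times> nat" and k :: nat assume c: "c : cells n"
 have "{m : space M'. card {i\<in>I m. x m i : cell (1/2^n) c} = k} = {m : space M'. emeasure m (E n c) : {of_nat k}}"
 using em[OF _ c] by auto
 thus "{m : space M'. card {i\<in>I m. x m i : cell (1/2^n) c} = k} : sets M'" using ev[OF Es, of "{of_nat k}"] by simp
 qed
 thus ?thesis using mPM by (subst measurable_cong[of M' _ "%m. PM a (I m) (x m)"]) auto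
 qed
 define ka' where "ka' n m = {c : cells n. emeasure m (E n c) ~= 0}" for n m
 define V' where "V' n c = {m : space M'. emeasure m (E n c) = 0}" for n c
 have V's: "V' n c : sets M'" for n c using ev[OF Es, of "{0}" n c] by (simp add: V'_def)
 have void': "M'.prob {m : space M'. ALL c:Z. m : V' n c} = exp (- ((1/2^n) * (1/2^n) * card Z))" if Z: "finite Z" for n Z
 proof -
 let ?A = "\<Union>c\<in>Z. E n c"
 have As: "?A : sets (restrict_space borel ext_plane)" using Z Es by (intro sets.finite_UN) auto
 have mu: "emeasure (limit_intensity a) ?A = ennreal ((1/2^n) * (1/2^n) * card Z)"
 unfolding E_def by (rule limit_intensity_cells[OF a_pos _ Z]) simp
 have "{m : space M'. ALL c:Z. m : V' n c} = {m : space M'. emeasure m ?A = of_nat 0}"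
 proof (rule Collect_cong, rule conj_cong[OF refl])
 fix m assume m: "m : space M'"
 hence sm: "sets m = sets (restrict_space borel ext_plane)" using mPM PM_sets by metis
 show "(ALL c:Z. m : V' n c) = (emeasure m ?A = of_nat 0)"
 proof
 assume "ALL c:Z. m : V' n c"
 hence 0: "emeasure m (E n c) = 0" if "c : Z" for c using that by (simp add: V'_def)
 have sub: "E n ` Z <= sets m" using Es sm by blast
 have "emeasure m ?A <= (\<Sum>c\<in>Z. emeasure m (E n c))" by (rule emeasure_subadditive_finite[OF Z sub])
 also have "... = (\<Sum>c\<in>Z. 0)" by (rule sum.cong[OF refl 0])
 finally show "emeasure m ?A = of_nat 0" by simp
 next
 assume 0: "emeasure m ?A = of_nat 0"
 have "emeasure m (E n c) <= emeasure m ?A" if "c : Z" for c using that As sm by (intro emeasure_mono) auto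
 thus "ALL c:Z. m : V' n c" using 0 m by (auto simp: V'_def)
 qed
 qed
 moreover have "M'.prob {m : space M'. emeasure m ?A = of_nat 0} = poisson_mass (measure (limit_intensity a) ?A) 0"
 by (rule pois[OF As]) (simp add: mu)
 ultimately show ?thesis using mu by (simp add: poisson_mass_def measure_def)
 qed
 have ka'eq: "{m : space M'. ka' n m = C} = {m : space M'. (ALL c:cells n - C. m : V' n c) & (ALL c:C. m ~: V' n c)}"
 if "C <= cells n" for n C using that by (auto simp: ka'_def V'_def)
 have ka'prob: "M'.prob {m : space M'. ka' n m = C} =
 (\<Sum>A\<in>Pow C. (- 1)^card A * exp (- ((1/2^n) * (1/2^n) * card ((cells n - C) Un A))))" if C: "C <= cells n" for n C
 proof -
 have fC: "finite C" using C finite_cells by (rule finite_subset)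
 have "M'.prob {m : space M'. ka' n m = C} =
 (\<Sum>A\<in>Pow C. (- 1)^card A * M'.prob {m : space M'. ALL c:(cells n - C) Un A. m : V' n c})"
 unfolding ka'eq[OF C] by (rule M'.pattern_prob[OF V's _ fC]) simp
 also have "... = (\<Sum>A\<in>Pow C. (- 1)^card A * exp (- ((1/2^n) * (1/2^n) * card ((cells n - C) Un A))))"
 proof (rule sum.cong[OF refl])
 fix A assume "A : Pow C"
 hence "finite ((cells n - C) Un A)" using fC by (auto intro: finite_subset)
 thus "(- 1)^card A * M'.prob {m : space M'. ALL c:(cells n - C) Un A. m : V' n c} =
 (- 1)^card A * exp (- ((1/2^n) * (1/2^n) * card ((cells n - C) Un A)))" by (simp only: void')
 qed
 finally show ?thesis .
 qed
 have ka'm: "{m : space M'. ka' n m = C} : sets M'" for n C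
 proof (cases "C <= cells n")
 case True
 have "{m : space M'. m : V' n c} : sets M'" "{m : space M'. m ~: V' n c} : sets M'" for c
 using sets.Int[OF sets.top V's[of n c]] sets.Diff[OF sets.top V's[of n c]] by (auto simp: Int_def set_diff_eq)
 thus ?thesis unfolding ka'eq[OF True]
 using finite_subset[OF True] by (intro sets.sets_Collect_conj sets.sets_Collect_finite_All) auto
 next
 case False
 hence "{m : space M'. ka' n m = C} = {}" by (auto simp: ka'_def)
 thus ?thesis by (simp only: sets.empty_sets)
 qed
 define H where "H n c = {m : space M'. emeasure m (E n c) : {0, 1}}" for n c
 have Hs: "H n c : sets M'" for n c unfolding H_def by (rule ev[OF Es]) auto
 define G' where "G' n = {m : space M'. ALL c:cells n. m : H n c}" for n
 have G's: "G' n : sets M'" for n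
 unfolding G'_def using sets.Int[OF sets.top Hs] by (intro sets.sets_Collect_finite_All finite_cells) (simp add: Int_def)
 have Hp: "M'.prob (space M' - H n c) <= ((1/2^n) * (1/2^n))\<^sup>2" for n c
 proof -
 let ?mu = "(1/2^n) * (1/2^n) :: real"
 have mu: "emeasure (limit_intensity a) (E n c) = ennreal ?mu"
 using limit_intensity_cells[OF a_pos, of "1/2^n" "{c}"] by (simp add: E_def)
 hence mu': "measure (limit_intensity a) (E n c) = ?mu" by (simp add: measure_def)
 have p: "M'.prob {m : space M'. emeasure m (E n c) = of_nat k} = poisson_mass ?mu k" for k
 using pois[OF Es, of n c k] mu mu' by simp
 have s: "{m : space M'. emeasure m (E n c) = of_nat k} : sets M'" for k using ev[OF Es, of "{of_nat k}" n c] by simp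
 have "H n c = {m : space M'. emeasure m (E n c) = of_nat 0} Un {m : space M'. emeasure m (E n c) = of_nat 1}"
 by (auto simp: H_def)
 moreover have "M'.prob ({m : space M'. emeasure m (E n c) = of_nat 0} Un {m : space M'. emeasure m (E n c) = of_nat 1}) = poisson_mass ?mu 0+poisson_mass ?mu 1"
 by (subst M'.finite_measure_Union[OF s s]) (auto simp only: p of_nat_eq_iff)
 ultimately have "M'.prob (H n c) = (1 + ?mu) * exp (- ?mu)" by (simp add: poisson_mass_def algebra_simps)
 moreover have "(1 + ?mu) * (1 - ?mu) <= (1 + ?mu) * exp (- ?mu)"
 using exp_ge_add_one_self[of "- ?mu"] by (intro mult_left_mono) auto
 moreover have "(1 + ?mu) * (1 - ?mu) = 1 - ?mu\<^sup>2" by (simp only: power2_eq_square) algebra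
 ultimately show ?thesis using M'.prob_compl[OF Hs[of n c]] by linarith
 qed
 have G'p: "(%n. M'.prob {m : space M'. ~ (m : G' n & ka' n m : Pow (cells n))}) \<longlonglongrightarrow> 0"
 proof (rule tendsto_sandwich[OF _ _ tendsto_const])
 show "\<forall>\<^sub>F n in sequentially. 0 <= M'.prob {m : space M'. ~ (m : G' n & ka' n m : Pow (cells n))}" by simp
 show "\<forall>\<^sub>F n in sequentially. M'.prob {m : space M'. ~ (m : G' n & ka' n m : Pow (cells n))} <= (real n/2^n)\<^sup>2"
 proof (rule always_eventually, rule allI)
 fix n
 have "{m : space M'. ~ (m : G' n & ka' n m : Pow (cells n))} = (\<Union>c\<in>cells n. space M' - H n c)"
 by (auto simp: G'_def ka'_def)
 hence "M'.prob {m : space M'. ~ (m : G' n & ka' n m : Pow (cells n))} <= (\<Sum>c\<in>cells n. M'.prob (space M' - H n c))"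
 using M'.finite_measure_subadditive_finite[of "cells n" "%c. space M' - H n c"] Hs by (auto simp: image_subset_iff)
 also have "... <= (\<Sum>c\<in>cells n. ((1/2^n) * (1/2^n))\<^sup>2)" by (rule sum_mono) (rule Hp)
 also have "... = (real n/2^n)\<^sup>2" by (simp add: card_cells power2_eq_square)
 finally show "M'.prob {m : space M'. ~ (m : G' n & ka' n m : Pow (cells n))} <= (real n/2^n)\<^sup>2" .
 qed
 show "(%n. (real n/2^n)\<^sup>2) \<longlonglongrightarrow> 0" by real_asymp
 qed
 have radon: "point_proc t om : topspace (vague_topology ext_plane)" if "1 < t" "om : space M" for t om
 unfolding point_proc_def topspace_vague_topology by (rule PM_radon[OF a_pos actual_config[OF that]])
 have radon': "m : topspace (vague_topology ext_plane)" if "m : space M'" for m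
 using PM_radon[OF a_pos cfg[OF that]] mPM[OF that] by (simp add: topspace_vague_topology)
 have conv: "((%t. \<integral>om. f (point_proc t om) \<partial>M) \<longlongrightarrow> (\<integral>m. f m \<partial>M')) at_top"
 if f: "continuous_map (vague_topology ext_plane) euclideanreal f" and bdd: "bounded (f ` topspace (vague_topology ext_plane))" for f
 proof -
 obtain B where B: "!!m. m : topspace (vague_topology ext_plane) ==> \<bar>f m\<bar> <= B"
 using bdd unfolding bounded_iff by auto
 have fm: "f : measurable (borel_of_top (vague_topology ext_plane)) borel" by (rule vague_continuous_measurable[OF f])
 define Y where "Y t om = (if 1 < t then f (point_proc t om) else 0)" for t om
 obtain m0 where m0: "m0 : space M'" using M'.not_empty by blast
 have B0: "0 <= B" using B[OF radon'[OF m0]] by linarith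
 have "((%t. \<integral>om. Y t om \<partial>M) \<longlongrightarrow> (\<integral>m. f m \<partial>M')) at_top"
 proof (rule conv_expectation_codes[OF prob_space_axioms M'.prob_space_axioms, where ka=occupied and ka'=ka' and C="%n. Pow (cells n)"
 and G'=G' and G=good and de=bad_bound and B=B and pp="%n C. M'.prob {m : space M'. ka' n m = C}"])
 show "\<bar>Y t om\<bar> <= B" if "om : space M" for t om using B[OF radon[OF _ that]] B0 by (simp add: Y_def)
 show "\<bar>f m\<bar> <= B" if "m : space M'" for m by (rule B[OF radon'[OF that]])
 show "\<forall>\<^sub>F t in at_top. Y t : borel_measurable M"
 using eventually_gt_at_top[of 1]
 proof eventually_elim
 case (elim t)
 hence "Y t = (%om. f (point_proc t om))" by (simp add: Y_def[abs_def])
 thus ?case using measurable_compose[OF point_proc_measurable[OF elim] fm] by simp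
 qed
 show "f : borel_measurable M'" using measurable_compose[OF idm fm] by simp
 show "finite (Pow (cells n))" for n by simp
 show "{om : space M. occupied n t om = c} : events" for n t c by (rule occupied_event)
 show "{m : space M'. ka' n m = c} : M'.events" for n c by (rule ka'm)
 show "((%t. prob {om : space M. occupied n t om = c}) \<longlongrightarrow> M'.prob {m : space M'. ka' n m = c}) at_top" if "c : Pow (cells n)" for n c
 using occupied_prob_tendsto[of c n] ka'prob[of c n] that by simp
 show "(%n. \<Sum>c\<in>Pow (cells n). \<bar>M'.prob {m : space M'. ka' n m = c} - M'.prob {m : space M'. ka' n m = c}\<bar>) \<longlonglongrightarrow> 0" by simp
 show "G' n : M'.events" for n by (rule G's)
 show "(%n. M'.prob {m : space M'. ~ (m : G' n & ka' n m : Pow (cells n))}) \<longlonglongrightarrow> 0" by (rule G'p)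
 show "good n t : events" for n t by (rule good_event)
 show "\<forall>\<^sub>F t in at_top. prob (space M - good n t) <= bad_bound n" for n by (rule good_prob)
 show "bad_bound \<longlonglongrightarrow> 0" by (rule bad_bound_tendsto)
 fix m and ep :: real assume m: "m : space M'" and ep: "ep > 0"
 let ?U = "{y : topspace (vague_topology ext_plane). f y : ball (f m) ep}"
 have U: "openin (vague_topology ext_plane) ?U"
 using f by (auto simp: continuous_map_def)
 have mU: "PM a (I m) (x m) : ?U" using mPM[OF m] radon'[OF m] ep by simp
 obtain R0 d where d: "d > 0" "ALL R>=R0. ALL ep<=d. ALL I' x'. config (I' :: nat set) x' --> matched R ep I' x' (I m) (x m) --> PM a I' x' : ?U"
 using matched_open[OF a_pos U cfg[OF m] mU] by (elim exE conjE) (rule that)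
 have "(%n. 1/2^n+1/2^n :: real) \<longlonglongrightarrow> 0" by real_asymp
 hence "\<forall>\<^sub>F n in sequentially. 1/2^n+1/2^n < d" using d(1) by (rule order_tendstoD)
 moreover have "\<forall>\<^sub>F n in sequentially. real n >= R0+2"
 using filterlim_real_sequentially unfolding filterlim_at_top by blast
 ultimately show "\<forall>\<^sub>F n in sequentially. m : G' n --> ka' n m : Pow (cells n) -->
 (ALL t. ALL om:good n t. occupied n t om = ka' n m --> \<bar>Y t om - f m\<bar> <= ep)"
 proof eventually_elim
 case (elim n)
 show ?case
 proof (intro impI allI ballI)
 fix t om assume mG: "m : G' n" and om: "om : good n t" and oc: "occupied n t om = ka' n m"
 have t: "1 < t" "om : space M" using om by (auto simp: good_def tame_def split: if_splits)
 have "matched (real n - 2) (1/2^n+1/2^n) (epoch_indices N om) (actual t om) (I m) (x m)"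
 proof (rule good_matched[OF om cfg[OF m]])
 fix c assume c: "c : cells n"
 have "emeasure m (E n c) : {0, 1}" using mG c by (simp add: G'_def H_def)
 hence "card {i\<in>I m. x m i : cell (1/2^n) c} : {0, 1}" unfolding em[OF m c] by auto
 moreover have "c : ka' n m \<longleftrightarrow> card {i\<in>I m. x m i : cell (1/2^n) c} ~= 0"
 unfolding ka'_def using em[OF m c] c by simp
 ultimately show "card {i\<in>I m. x m i : cell (1/2^n) c} = (if c : occupied n t om then 1 else 0)"
 unfolding oc by auto
 qed
 hence "point_proc t om : ?U" unfolding point_proc_def
 using d(2)[rule_format, of "real n - 2" "1/2^n+1/2^n"] elim actual_config[OF t] by simp
 thus "\<bar>Y t om - f m\<bar> <= ep" using t by (simp add: Y_def dist_real_def abs_minus_commute)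
 qed
 qed
 qed
 moreover have "\<forall>\<^sub>F t in at_top. (\<integral>om. Y t om \<partial>M) = (\<integral>om. f (point_proc t om) \<partial>M)"
 using eventually_gt_at_top[of 1] by eventually_elim (simp add: Y_def)
 ultimately show ?thesis by (rule Lim_transform_eventually)
 qed
 have "conv_in_distribution (vague_topology ext_plane) M point_proc M' (%m. m) at_top"
 unfolding conv_in_distribution_def
 proof (intro conjI allI impI)
 show "\<forall>\<^sub>F t in at_top. point_proc t : measurable M (borel_of_top (vague_topology ext_plane))"
 using eventually_gt_at_top[of 1] by eventually_elim (rule point_proc_measurable)
 qed (use prob_space_axioms M'.prob_space_axioms idm conv in auto)
 thus ?thesis using ppp by blast
qed

end

section \<open>The longest gap\<close>

subsection \<open>The limit law in exponential coordinates\<close>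

lemma gumbel_real_distribution: "real_distribution gumbel" and gumbel_cdf: "measure gumbel {..x} = exp (- exp (- x))"
proof -
 let ?F = "%x::real. exp (- exp (- x))"
 have 1: "?F x <= ?F y" if "x <= y" for x y using that by simp
 have 2: "continuous (at_right x) ?F" for x by (intro continuous_intros)
 have 3: "(?F \<longlongrightarrow> 0) at_bot" "(?F \<longlongrightarrow> 1) at_top" by real_asymp+
 show "real_distribution gumbel" unfolding gumbel_def by (rule real_distribution_interval_measure[OF 1 2 3])
 have "cdf (interval_measure ?F) x = ?F x" by (simp only: cdf_interval_measure[OF 1 2 3(1)])
 thus "measure gumbel {..x} = ?F x" by (simp add: cdf_def gumbel_def)
qed

lemma gumbel_tail: assumes r: "0 <= r" shows "measure gumbel {x. exp (- x) < r} = 1 - exp (- r)"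
proof (cases "r = 0")
 case True thus ?thesis by (simp add: not_less)
next
 case False
 interpret real_distribution gumbel by (rule gumbel_real_distribution)
 have "{x. exp (- x) < r} = space gumbel - {..- ln r}"
 proof -
 have "exp (- x) < r \<longleftrightarrow> - ln r < x" for x
 proof -
 have "exp (- x) < r \<longleftrightarrow> exp (- x) < exp (ln r)" using False r by simp
 also have "... \<longleftrightarrow> - ln r < x" by (simp only: exp_less_cancel_iff) linarith
 finally show ?thesis .
 qed
 thus ?thesis
 by (intro set_eqI) (simp only: mem_Collect_eq Diff_iff atMost_iff not_le space_eq_univ UNIV_I simp_thms)
 qed
 moreover have "prob (space gumbel - {..- ln r}) = 1 - prob {..- ln r}" by (rule prob_compl) simp
 moreover have "prob {..- ln r} = exp (- r)" unfolding gumbel_cdf using False r by simp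
 ultimately show ?thesis by (simp only:)
qed

lemma exponential_tail:
 assumes a: "0 < a" and r: "0 <= r" "r <= 1"
 shows "measure (density lborel (exponential_density a)) {z. exp (- a * z) < r} = r"
proof (cases "r = 0")
 case True thus ?thesis by (simp add: not_less)
next
 case False
 define s where "s = - ln r/a"
 have s0: "0 <= s" unfolding s_def using r False a by (intro divide_nonneg_pos) auto
 have es: "exp (- a * s) = r" using False r a by (simp add: s_def)
 have "{z. exp (- a * z) < r} = {s<..}" unfolding es[symmetric] using a by auto
 moreover have "emeasure (density lborel (exponential_density a)) {s<..} = emeasure (density lborel (%z. ennreal (a * exp (- a * z)))) {s<..}"
 proof -
 have "(\<integral>\<^sup>+z. ennreal (exponential_density a z) * indicator {s<..} z \<partial>lborel) = (\<integral>\<^sup>+z. ennreal (a * exp (- a * z)) * indicator {s<..} z \<partial>lborel)"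
 proof (rule nn_integral_cong)
 fix z
 show "ennreal (exponential_density a z) * indicator {s<..} z = ennreal (a * exp (- a * z)) * indicator {s<..} z"
 using s0 by (cases "s < z") (simp_all add: exponential_density_def mult.commute)
 qed
 thus ?thesis by (simp add: emeasure_density)
 qed
 ultimately show ?thesis using exp_density_tail[OF a, of s] es r by (simp add: measure_def)
qed

lemma limit_cell_prob:
 assumes a: "0 < a" and h: "0 < h" and c: "real (snd c+1) * h <= 1"
 shows "measure (gumbel \<Otimes>\<^sub>M density lborel (exponential_density a)) {p. (exp (- fst p), exp (- a * snd p)) : cell h c} =
 exp (- (real (fst c) * h)) * (1 - exp (- h)) * h"
proof -
 interpret G: real_distribution gumbel by (rule gumbel_real_distribution)
 interpret E: prob_space "density lborel (exponential_density a)" by (rule prob_space_exponential_density[OF a])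
 let ?A = "{x. exp (- x) < real (fst c+1) * h} - {x. exp (- x) < real (fst c) * h}"
 let ?B = "{z. exp (- a * z) < real (snd c+1) * h} - {z. exp (- a * z) < real (snd c) * h}"
 have eq: "{p. (exp (- fst p), exp (- a * snd p)) : cell h c} = ?A \<times> ?B"
 by (auto simp: cell_def)
 have m: "real k * h <= real (k+1) * h" for k :: nat using h by (intro mult_right_mono) auto
 have s1: "{x::real. exp (- x) < r} : sets borel" for r by measurable
 have s2: "{z::real. exp (- a * z) < r} : sets borel" for r by measurable
 have "G.prob ?A = G.prob {x. exp (- x) < real (fst c+1) * h} - G.prob {x. exp (- x) < real (fst c) * h}"
 using m[of "fst c"] s1 by (intro G.finite_measure_Diff) auto
 also have "... = exp (- (real (fst c) * h)) - exp (- (real (fst c+1) * h))"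
 using h by (simp add: gumbel_tail)
 also have "... = exp (- (real (fst c) * h)) * (1 - exp (- h))"
 by (simp add: algebra_simps mult_exp_exp)
 finally have A: "G.prob ?A = exp (- (real (fst c) * h)) * (1 - exp (- h))" .
 have sc: "real (snd c) * h <= 1" using m[of "snd c"] c by linarith
 have "E.prob ?B = E.prob {z. exp (- a * z) < real (snd c+1) * h} - E.prob {z. exp (- a * z) < real (snd c) * h}"
 using m[of "snd c"] s2 by (intro E.finite_measure_Diff) auto
 also have "... = real (snd c+1) * h - real (snd c) * h"
 by (subst (1 2) exponential_tail[OF a]) (use h c sc in auto)
 also have "... = h" by (simp add: algebra_simps)
 finally have B: "E.prob ?B = h" .
 have "emeasure (gumbel \<Otimes>\<^sub>M density lborel (exponential_density a)) (?A \<times> ?B) = emeasure gumbel ?A * emeasure (density lborel (exponential_density a)) ?B"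
 using s1 s2 by (intro E.emeasure_pair_measure_Times) auto
 thus ?thesis unfolding eq by (simp only: measure_def enn2real_mult) (simp only: measure_def[symmetric] A B)
qed

definition window :: "nat => (nat \<times> nat) set" where
 "window n = {c. fst c+4 <= n * 2^n & snd c+4 <= 2^n}"

definition rows :: "nat => nat \<times> nat => (nat \<times> nat) set" where
 "rows n c = {..<fst c+4} \<times> {..<2^n+2}"

lemma finite_window: "finite (window n)"
 by (rule finite_subset[of _ "{..n * 2^n} \<times> {..2^n}"]) (auto simp: window_def)

lemma window_bound:
 assumes "c : window n"
 shows "(real (fst c)+4) * (1/2^n) <= real n" "(real (snd c)+4) * (1/2^n) <= 1"
proof -
 have c: "fst c+4 <= n * 2^n" "snd c+4 <= 2^n" using assms by (simp_all add: window_def)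
 have "real (fst c+4) <= real (n * 2^n)" "real (snd c+4) <= real (2^n)"
 using c by (simp_all only: of_nat_le_iff)
 hence r: "real (fst c)+4 <= real n * 2^n" "real (snd c)+4 <= 2^n" by simp_all
 have "(real (fst c)+4) * (1/2^n) <= (real n * 2^n) * (1/2^n)" by (rule mult_right_mono[OF r(1)]) simp
 moreover have "(real (snd c)+4) * (1/2^n) <= 2^n * (1/2^n)" by (rule mult_right_mono[OF r(2)]) simp
 ultimately show "(real (fst c)+4) * (1/2^n) <= real n" "(real (snd c)+4) * (1/2^n) <= 1" by simp_all
qed

text \<open>The chance that the first occupied row contains its only point in column \<open>j\<close> is compared with the mass that the limit law gives to the cell; relative errors are \<open>O(n / 2 ^ n)\<close>.\<close>

lemma window_approximation:
 "(%n. \<Sum>c\<in>window n. \<bar>(exp (- ((1/2^n) * (1/2^n) * card (rows n c - {c}))) - exp (- ((1/2^n) * (1/2^n) * card (rows n c)))) -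
 exp (- (real (fst c) * (1/2^n))) * (1 - exp (- (1/2^n))) * (1/2^n)\<bar>) \<longlonglongrightarrow> (0::real)"
 (is "(%n. \<Sum>c\<in>window n. ?d n c) \<longlonglongrightarrow> 0")
proof (rule tendsto_sandwich[OF _ _ tendsto_const])
 show "\<forall>\<^sub>F n in sequentially. 0 <= (\<Sum>c\<in>window n. ?d n c)" by (intro always_eventually allI sum_nonneg) simp
 show "(%n. 2 * (5 * (1/2^n)+2 * (1/2^n) * real n)) \<longlonglongrightarrow> 0" by real_asymp
 show "\<forall>\<^sub>F n in sequentially. (\<Sum>c\<in>window n. ?d n c) <= 2 * (5 * (1/2^n)+2 * (1/2^n) * real n)"
 using eventually_ge_at_top[of 1]
 proof eventually_elim
 case (elim n)
 define h where "h = 1/(2::real)^n"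
 define th where "th = 5 * h+2 * h * real n"
 have h: "0 < h" "h <= 1/2"
 proof -
 have "(2::real)^1 <= 2^n" using elim by (intro power_increasing) auto
 thus "0 < h" "h <= 1/2" by (auto simp: h_def field_simps)
 qed
 have hN: "2^n * h = 1" by (simp add: h_def)
 have th0: "0 <= th" using h by (simp add: th_def)
 have eh: "1 - exp (- h) <= h" "h * (1 - h) <= 1 - exp (- h)"
 proof -
 show "1 - exp (- h) <= h" using exp_ge_add_one_self[of "- h"] by linarith
 have "1 <= (1 - h+h * h) * (1+h)" using h by (simp add: algebra_simps)
 also have "... <= (1 - h+h * h) * exp h"
 proof (rule mult_left_mono[OF exp_ge_add_one_self])
 have "0 <= h * h" by simp
 thus "0 <= 1 - h+h * h" using h by linarith
 qed
 finally have "exp (- h) <= 1 - h+h * h" by (simp add: exp_minus field_simps)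
 thus "h * (1 - h) <= 1 - exp (- h)" by (simp add: algebra_simps)
 qed
 have pointwise: "?d n c <= h * h * exp (- (real (fst c) * h)) * th" if c: "c : window n" for c
 proof -
 define k A where "k = real (fst c)" and "A = h * h * real (card (rows n c))"
 have kb: "(k+4) * h <= real n" using window_bound(1)[OF c] by (simp add: k_def h_def)
 have crow: "real (card (rows n c)) = (k+4) * (2^n+2)" by (simp add: rows_def card_cartesian_product k_def algebra_simps)
 have "c : rows n c" using c by (auto simp: rows_def window_def mem_Times_iff)
 moreover have "c : rows n c ==> real (card (rows n c - {c})) = real (card (rows n c)) - 1"
 proof -
 assume cin: "c : rows n c"
 have fin: "finite (rows n c)" by (simp add: rows_def)
 have "card (rows n c) > 0" using cin fin by (auto simp: card_gt_0_iff)
 thus ?thesis using card_Diff_singleton[OF cin] by (simp add: of_nat_diff)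
 qed
 ultimately have cm: "real (card (rows n c - {c})) = real (card (rows n c)) - 1" by blast
 have Aeq: "A = k * h+4 * h+2 * h * ((k+4) * h)"
 proof -
 have "A = (k+4) * h * (2^n * h)+2 * h * ((k+4) * h)" unfolding A_def crow by (simp add: algebra_simps)
 thus ?thesis unfolding hN by (simp add: algebra_simps)
 qed
 have hk: "0 <= k" by (simp add: k_def)
 have A1: "k * h+h * h <= A"
 proof -
 have "h * h <= 1 * h" using h by (intro mult_right_mono) auto
 moreover have "0 <= 2 * h * ((k+4) * h)" using h hk by simp
 ultimately show ?thesis using Aeq h by linarith
 qed
 have A2: "A <= k * h+(4 * h+2 * h * real n)"
 proof -
 have "2 * h * ((k+4) * h) <= 2 * h * real n" by (rule mult_left_mono[OF kb]) (use h in simp)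
 with Aeq show ?thesis by linarith
 qed
 define p q where "p = exp (- (A - h * h)) - exp (- A)" and "q = exp (- (k * h)) * (1 - exp (- h)) * h"
 have d: "?d n c = \<bar>p - q\<bar>"
 proof -
 have "h * h * (real (card (rows n c)) - 1) = A - h * h" by (simp add: A_def right_diff_distrib)
 thus ?thesis unfolding p_def q_def h_def[symmetric] cm A_def[symmetric] k_def[symmetric] by (simp only:)
 qed
 have E: "0 <= h * h * exp (- (k * h))" using h by simp
 have p1: "p <= h * h * exp (- (k * h))"
 proof -
 have "p = exp (- (A - h * h)) * (1 - exp (- (h * h)))" by (simp add: p_def algebra_simps mult_exp_exp)
 also have "... <= exp (- (k * h)) * (h * h)"
 proof (rule mult_mono)
 show "exp (- (A - h * h)) <= exp (- (k * h))" using A1 by simp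
 show "1 - exp (- (h * h)) <= h * h" using exp_ge_add_one_self[of "- (h * h)"] by linarith
 qed auto
 finally show ?thesis by (simp add: mult.commute)
 qed
 have p2: "h * h * exp (- (k * h)) * (1 - th) <= p"
 proof -
 have "1 - th <= 1 - (4 * h+2 * h * real n)" using h by (simp add: th_def)
 also have "... <= exp (- (4 * h+2 * h * real n))" using exp_ge_add_one_self[of "- (4 * h+2 * h * real n)"] by linarith
 finally have "h * h * exp (- (k * h)) * (1 - th) <= h * h * exp (- (k * h)) * exp (- (4 * h+2 * h * real n))"
 by (rule mult_left_mono[OF _ E])
 also have "... = h * h * exp (- (k * h+(4 * h+2 * h * real n)))" by (simp only: mult.assoc mult_exp_exp minus_add_distrib)
 also have "... <= h * h * exp (- A)" using A2 by (intro mult_left_mono) auto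
 also have "... <= (exp (h * h) - 1) * exp (- A)"
 proof (rule mult_right_mono)
 show "h * h <= exp (h * h) - 1" using exp_ge_add_one_self[of "h * h"] by linarith
 qed simp
 also have "... = p"
 proof -
 have "exp (h * h) * exp (- A) = exp (- (A - h * h))" unfolding mult_exp_exp by (rule arg_cong[where f=exp]) simp
 thus ?thesis by (simp only: left_diff_distrib mult_1_left p_def)
 qed
 finally show ?thesis .
 qed
 have q1: "q <= h * h * exp (- (k * h))"
 proof -
 have "exp (- (k * h)) * h * (1 - exp (- h)) <= exp (- (k * h)) * h * h" by (rule mult_left_mono[OF eh(1)]) (use h in simp)
 thus ?thesis unfolding q_def by (simp only: mult.assoc mult.commute mult.left_commute)
 qed
 have q2: "h * h * exp (- (k * h)) * (1 - th) <= q"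
 proof -
 have "h <= th" using h by (simp add: th_def)
 hence "h * h * exp (- (k * h)) * (1 - th) <= h * h * exp (- (k * h)) * (1 - h)" by (intro mult_left_mono E) simp
 also have "... <= q"
 proof -
 have "exp (- (k * h)) * h * (h * (1 - h)) <= exp (- (k * h)) * h * (1 - exp (- h))" by (rule mult_left_mono[OF eh(2)]) (use h in simp)
 thus ?thesis unfolding q_def by (simp only: mult.assoc mult.commute mult.left_commute)
 qed
 finally show ?thesis .
 qed
 have "h * h * exp (- (k * h)) * (1 - th) = h * h * exp (- (k * h)) - h * h * exp (- (k * h)) * th" by (simp add: algebra_simps)
 hence "\<bar>p - q\<bar> <= h * h * exp (- (k * h)) * th" unfolding abs_le_iff using p1 p2 q1 q2 by linarith
 thus ?thesis unfolding d by (simp only: k_def)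
 qed
 have "(\<Sum>c\<in>window n. ?d n c) <= (\<Sum>c\<in>window n. h * h * exp (- (real (fst c) * h)) * th)"
 by (rule sum_mono) (rule pointwise)
 also have "... <= (\<Sum>c\<in>{..<n * 2^n} \<times> {..<(2::nat)^n}. h * h * exp (- (real (fst c) * h)) * th)"
 proof (rule sum_mono2)
 show "window n <= {..<n * 2^n} \<times> {..<(2::nat)^n}" by (auto simp: window_def)
 qed (use h th0 in simp_all)
 also have "... = (\<Sum>k<n * 2^n. \<Sum>j<(2::nat)^n. h * h * exp (- (real k * h)) * th)"
 unfolding sum.cartesian_product case_prod_beta by (rule refl)
 also have "... = (2^n * h) * h * th * (\<Sum>k<n * 2^n. exp (- h)^k)"
 proof -
 have "(\<Sum>j<(2::nat)^n. h * h * exp (- (real k * h)) * th) = (2^n * h) * h * th * exp (- h)^k" for k :: nat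
 proof -
 have "exp (- h)^k = exp (real k * (- h))" by (rule exp_of_nat_mult[symmetric])
 also have "real k * (- h) = - (real k * h)" by simp
 finally have e: "exp (- (real k * h)) = exp (- h)^k" by (rule sym)
 have "(\<Sum>j<(2::nat)^n. h * h * exp (- (real k * h)) * th) = real (card {..<(2::nat)^n}) * (h * h * exp (- (real k * h)) * th)"
 by (rule sum_constant)
 also have "... = 2^n * (h * h * exp (- h)^k * th)" unfolding e by simp
 finally show ?thesis by (simp only: mult.assoc mult.commute mult.left_commute)
 qed
 thus ?thesis by (simp only: sum_distrib_left)
 qed
 also have "... <= (2^n * h) * h * th * (1/(h * (1/2)))"
 proof (rule mult_left_mono)
 have "(\<Sum>k<n * 2^n. exp (- h)^k) <= 1/(1 - exp (- h))"
 proof -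
 have "(\<Sum>k<n * 2^n. exp (- h)^k) = (1 - exp (- h)^(n * 2^n))/(1 - exp (- h))"
 unfolding sum_gp_strict using h by (subst if_not_P) auto
 also have "... <= 1/(1 - exp (- h))" by (rule divide_right_mono) (use h in simp_all)
 finally show ?thesis .
 qed
 also have "... <= 1/(h * (1/2))"
 proof (rule frac_le)
 have "h * (1/2) <= h * (1 - h)" using h by (intro mult_left_mono) auto
 thus "h * (1/2) <= 1 - exp (- h)" using eh(2) by linarith
 qed (use h in auto)
 finally show "(\<Sum>k<n * 2^n. exp (- h)^k) <= 1/(h * (1/2))" .
 qed (use h th0 in auto)
 also have "... = 2 * th" unfolding hN using h by simp
 finally have "(\<Sum>c\<in>window n. ?d n c) <= 2 * th" .
 thus ?case unfolding th_def h_def .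
 qed
qed

lemma limit_tail_prob:
 assumes a: "0 < a" and r: "0 <= r" and h: "0 <= h" "h <= 1"
 shows "measure (gumbel \<Otimes>\<^sub>M density lborel (exponential_density a)) {p. r <= exp (- fst p) | 1 - h <= exp (- a * snd p)} <= exp (- r)+h"
proof -
 interpret G: real_distribution gumbel by (rule gumbel_real_distribution)
 interpret E: prob_space "density lborel (exponential_density a)" by (rule prob_space_exponential_density[OF a])
 interpret GE: pair_prob_space gumbel "density lborel (exponential_density a)" ..
 have s1: "{x::real. exp (- x) < r} : sets borel" for r by measurable
 have s2: "{z::real. exp (- a * z) < r} : sets borel" for r by measurable
 let ?A = "UNIV - {x. exp (- x) < r}" and ?B = "UNIV - {z. exp (- a * z) < 1 - h}"
 have sA: "?A : sets gumbel" "?B : sets (density lborel (exponential_density a))" using s1 s2 by auto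
 have "{p. r <= exp (- fst p) | 1 - h <= exp (- a * snd p)} = ?A \<times> UNIV Un UNIV \<times> ?B" by (auto simp: not_less)
 moreover have "GE.prob (?A \<times> UNIV Un UNIV \<times> ?B) <= GE.prob (?A \<times> UNIV)+GE.prob (UNIV \<times> ?B)"
 proof (rule measure_Un_le)
 have U: "UNIV : sets gumbel" "UNIV : sets (density lborel (exponential_density a))" by simp_all
 show "?A \<times> UNIV : sets (gumbel \<Otimes>\<^sub>M density lborel (exponential_density a))" by (rule pair_measureI[OF sA(1) U(2)])
 show "UNIV \<times> ?B : sets (gumbel \<Otimes>\<^sub>M density lborel (exponential_density a))" by (rule pair_measureI[OF U(1) sA(2)])
 qed
 ultimately have "GE.prob {p. r <= exp (- fst p) | 1 - h <= exp (- a * snd p)} <= GE.prob (?A \<times> UNIV)+GE.prob (UNIV \<times> ?B)" by (simp only:)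
 also have "GE.prob (?A \<times> UNIV) = G.prob ?A"
 proof -
 have e: "emeasure (gumbel \<Otimes>\<^sub>M density lborel (exponential_density a)) (?A \<times> UNIV) = emeasure gumbel ?A * emeasure (density lborel (exponential_density a)) UNIV"
 by (rule E.emeasure_pair_measure_Times[OF sA(1)]) simp
 have "emeasure (density lborel (exponential_density a)) UNIV = 1" using E.emeasure_space_1 by simp
 thus ?thesis unfolding measure_def e by simp
 qed
 also have "GE.prob (UNIV \<times> ?B) = E.prob ?B"
 proof -
 have e: "emeasure (gumbel \<Otimes>\<^sub>M density lborel (exponential_density a)) (UNIV \<times> ?B) = emeasure gumbel UNIV * emeasure (density lborel (exponential_density a)) ?B"
 by (rule E.emeasure_pair_measure_Times[OF _ sA(2)]) simp
 have "emeasure gumbel UNIV = 1" using G.emeasure_space_1 by simp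
 thus ?thesis unfolding measure_def e by simp
 qed
 also have "G.prob ?A = exp (- r)" using G.prob_compl[of "{x. exp (- x) < r}"] s1 gumbel_tail[OF r] by simp
 also have "E.prob ?B = h" using E.prob_compl[of "{z. exp (- a * z) < 1 - h}"] s2 exponential_tail[OF a, of "1 - h"] h by simp
 finally show ?thesis .
qed

subsection \<open>The longest gap and its position as functions of the configuration\<close>

lemma borel_of_top_euclidean: "sets (borel_of_top (euclidean :: 'b::topological_space topology)) = sets borel"
 "space (borel_of_top (euclidean :: 'b::topological_space topology)) = UNIV"
 unfolding borel_of_top_def borel_def by simp_all

context gap_setting begin

lemma past_indices:
 assumes "om : space M" "0 <= t"
 shows "{i. i : epoch_indices N om & epoch N i om <= t} = {1..N t om}"
proof (intro set_eqI iffI)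
 fix i assume i: "i : {i. i : epoch_indices N om & epoch N i om <= t}"
 hence "1 <= i" "reached i om" "epoch N i om <= t" by (simp_all add: epoch_indices_def reached_def)
 thus "i : {1..N t om}" using epoch_le_iff[OF assms(1) _ assms(2)] by simp
next
 fix i assume i: "i : {1..N t om}"
 hence r: "reached i om" using assms(2) by (auto simp: reached_def)
 thus "i : {i. i : epoch_indices N om & epoch N i om <= t}"
 using i epoch_le_iff[OF assms(1) r assms(2)] by (simp add: epoch_indices_def reached_def[symmetric])
qed

lemma longest_gap_eq:
 assumes "om : space M" "0 <= t"
 shows "longest_gap N t om = Max ((%i. gap N i om) ` {1..N t om})"
proof -
 have "{gap N i om | i. i : epoch_indices N om & epoch N i om <= t} = (%i. gap N i om) ` {i. i : epoch_indices N om & epoch N i om <= t}" by auto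
 thus ?thesis unfolding longest_gap_def past_indices[OF assms] by (simp only:)
qed

lemma gap_measurable: "gap N i : borel_measurable M"
 unfolding gap_def[abs_def] by (intro borel_measurable_diff epoch_meas)

lemma longest_gap_measurable: assumes t: "0 <= t" shows "longest_gap N t : borel_measurable M"
proof -
 have "(%om. Max ((%i. gap N i om) ` {1..n})) : borel_measurable M" for n
 by (rule borel_measurable_Max) (simp_all add: gap_measurable)
 hence "(%om. (%n om. Max ((%i. gap N i om) ` {1..n})) (N t om) om) : borel_measurable M"
 by (rule measurable_compose_countable[OF _ N_meas[OF t]])
 thus ?thesis by (subst measurable_cong[OF longest_gap_eq[OF _ t]])
qed

lemma epoch_le_mono:
 assumes "om : space M" "reached j om" "i <= j" shows "epoch N i om <= epoch N j om"
proof -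
 have e: "0 <= epoch N j om" by (rule epoch_nonneg[OF assms(2)])
 have "j <= N (epoch N j om) om" using epoch_le_iff[OF assms(1,2) e] by simp
 thus ?thesis using epoch_le_iff[OF assms(1) reached_mono[OF assms(2,3)] e] assms(3) by simp
qed

lemma longest_gap_end_eq:
 assumes "om : space M"
 shows "longest_gap_end N t om = (if EX i. 1 <= i & reached i om & gap N i om = longest_gap N t om
 then epoch N (LEAST i. 1 <= i & reached i om & gap N i om = longest_gap N t om) om else (LEAST s. False))"
proof (cases "EX i. 1 <= i & reached i om & gap N i om = longest_gap N t om")
 case True
 let ?p = "%i. 1 <= i & reached i om & gap N i om = longest_gap N t om"
 have L: "?p (LEAST i. ?p i)" using True by (rule LeastI_ex)
 have "longest_gap_end N t om = epoch N (LEAST i. ?p i) om"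
 unfolding longest_gap_end_def
 proof (rule Least_equality)
 show "EX i:epoch_indices N om. epoch N (LEAST i. ?p i) om = epoch N i om & gap N i om = longest_gap N t om"
 using L by (intro bexI[of _ "LEAST i. ?p i"]) (simp_all add: epoch_indices_def reached_def)
 fix s assume "EX i:epoch_indices N om. s = epoch N i om & gap N i om = longest_gap N t om"
 then obtain i where i: "?p i" "s = epoch N i om" by (auto simp: epoch_indices_def reached_def)
 show "epoch N (LEAST i. ?p i) om <= s" unfolding i(2)
 by (rule epoch_le_mono[OF assms]) (use i(1) Least_le[of ?p i] in auto)
 qed
 thus ?thesis using True by simp
next
 case False
 hence "(EX i:epoch_indices N om. s = epoch N i om & gap N i om = longest_gap N t om) = False" for s
 by (auto simp: epoch_indices_def reached_def)
 hence "longest_gap_end N t om = (LEAST s. False)" unfolding longest_gap_end_def by (simp only:)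
 thus ?thesis using False by (simp only: if_False)
qed

lemma longest_gap_end_measurable: assumes t: "0 <= t" shows "longest_gap_end N t : borel_measurable M"
proof -
 let ?p = "%i om. 1 <= i & reached i om & gap N i om = longest_gap N t om"
 have p: "{om : space M. ?p i om} : sets M" for i
 proof -
 have 1: "{om : space M. reached i om} : sets M" by measurable
 have 2: "{om : space M. gap N i om = longest_gap N t om} : sets M"
 by (rule borel_measurable_eq[OF gap_measurable longest_gap_measurable[OF t]])
 show ?thesis by (intro sets.sets_Collect_conj 1 2 sets.sets_Collect_const)
 qed
 have L: "(%om. LEAST i. ?p i om) : measurable M (count_space UNIV)"
 by (rule measurable_Least) (simp only: pred_def p)
 have E: "(%om. epoch N (LEAST i. ?p i om) om) : borel_measurable M"
 by (rule measurable_compose_countable[OF epoch_meas L])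
 have S: "{om : space M. EX i. ?p i om} : sets M" by (rule sets.sets_Collect_countable_Ex[OF p])
 have "(%om. if EX i. ?p i om then epoch N (LEAST i. ?p i om) om else (LEAST s. False)) : borel_measurable M"
 by (rule measurable_If[OF E measurable_const S]) simp
 thus ?thesis by (subst measurable_cong[OF longest_gap_end_eq])
qed

definition "record t om = (lam t * longest_gap N t om - bt t, (t - longest_gap_end N t om)/t * ln t)"

lemma record_measurable: assumes "0 <= t" shows "record t : borel_measurable M"
 unfolding record_def[abs_def]
proof (rule borel_measurable_Pair)
 show "(%om. lam t * longest_gap N t om - bt t) : borel_measurable M"
 by (intro borel_measurable_diff borel_measurable_times borel_measurable_const longest_gap_measurable[OF assms])
 show "(%om. (t - longest_gap_end N t om)/t * ln t) : borel_measurable M"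
 by (intro borel_measurable_diff borel_measurable_times borel_measurable_divide borel_measurable_const longest_gap_end_measurable[OF assms])
qed

text \<open>A surrogate point that is alone in all rows up to a little above its own, and in all columns meeting the past, must come from the longest gap: an actual point at least as extreme would have its surrogate in the same region.\<close>

lemma longest_gap_located:
 assumes om: "om : good n t" and n: "3 <= n" and c: "c : window n" and occ: "occupied n t om Int rows n c = {c}"
 shows "EX i. record t om = (- ln (pa t i om), - ln (qa t i om)/a) & (P t i om, Q t i) : cell (1/2^n) c &
 \<bar>pa t i om - P t i om\<bar> <= 1/2^n & \<bar>qa t i om - Q t i\<bar> <= 1/2^n"
proof -
 define h where "h = 1/(2::real)^n"
 have om': "1 < t" "om : tame" "om : close t (real n) h" "om : space M" "om ~: double t h (cells n)"
 using om by (auto simp: good_def tame_def h_def split: if_splits)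
 have cl: "\<bar>pa t i om - P t i om\<bar> <= h & \<bar>qa t i om - Q t i\<bar> <= h"
 if "(pa t i om < real n & qa t i om < real n) | (P t i om < real n & Q t i < real n)" for i
 using om'(3) that unfolding close_def by blast
 have r: "reached i om" for i using om'(2) by (simp add: tame_def)
 have h: "0 < h" "h <= 1/8" "2^n * h = 1"
 proof -
 have "(2::real)^3 <= 2^n" using n by (intro power_increasing) auto
 hence "1/(2::real)^n <= 1/8" by (intro frac_le) auto
 thus "0 < h" "h <= 1/8" "2^n * h = 1" by (simp_all add: h_def)
 qed
 have n3: "3 <= real n" using n by simp
 have wb: "(real (fst c)+4) * h <= real n" "(real (snd c)+4) * h <= 1" using window_bound[OF c] by (simp_all add: h_def)
 hence wb': "real (fst c) * h+4 * h <= real n" "real (snd c) * h+4 * h <= 1" by (simp_all only: distrib_right)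
 obtain i0 where i0: "(P t i0 om, Q t i0) : cell h c" using occ by (auto simp: occupied_def h_def)
 have PQ0: "P t i0 om < real (fst c) * h+h" "Q t i0 < real (snd c) * h+h"
 using i0 by (auto simp: cell_def algebra_simps)
 have cl0: "\<bar>pa t i0 om - P t i0 om\<bar> <= h" "\<bar>qa t i0 om - Q t i0\<bar> <= h"
 proof -
 have "P t i0 om < real n" "Q t i0 < real n" using PQ0 wb' h n3 by linarith+
 thus "\<bar>pa t i0 om - P t i0 om\<bar> <= h" "\<bar>qa t i0 om - Q t i0\<bar> <= h" using cl[of i0] by blast+
 qed
 have pa0: "pa t i0 om < real (fst c) * h+2 * h" "qa t i0 om < 1" using PQ0 cl0 wb' h by linarith+
 have lt: "0 < ln t" using om'(1) by simp
 have qa_iff: "qa t i om <= 1 \<longleftrightarrow> epoch N (Suc i) om <= t" for i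
 proof -
 have "qa t i om <= 1 \<longleftrightarrow> 0 <= a * ((t - epoch N (Suc i) om)/t * ln t)" by (simp add: qa_def)
 also have "... \<longleftrightarrow> 0 <= t - epoch N (Suc i) om"
 proof -
 have "a * ((t - epoch N (Suc i) om)/t * ln t) = (a * ln t/t) * (t - epoch N (Suc i) om)" by simp
 moreover have "0 < a * ln t/t" using a_pos lt om'(1) by simp
 ultimately show ?thesis by (simp only: zero_le_mult_iff) auto
 qed
 finally show ?thesis by simp
 qed
 have ep0: "epoch N (Suc i0) om <= t" using qa_iff[of i0] pa0(2) by linarith
 have pa_iff: "pa t i om <= pa t i0 om \<longleftrightarrow> gap N (Suc i0) om <= gap N (Suc i) om" for i
 using lam_pos[of t] om'(1) by (simp add: pa_def)
 have uniq: "i = i0" if g: "gap N (Suc i0) om <= gap N (Suc i) om" and e: "epoch N (Suc i) om <= t" for i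
 proof -
 have "pa t i om < real (fst c) * h+2 * h" "qa t i om <= 1" using pa_iff[of i] qa_iff[of i] g e pa0(1) by linarith+
 moreover from this have "\<bar>pa t i om - P t i om\<bar> <= h & \<bar>qa t i om - Q t i\<bar> <= h"
 proof -
 have "pa t i om < real n" "qa t i om < real n" using calculation wb'(1) h n3 by linarith+
 thus ?thesis using cl[of i] by blast
 qed
 ultimately have PQ: "P t i om < real (fst c) * h+3 * h" "Q t i <= 1+h" by linarith+
 have "EX c':cells n. (P t i om, Q t i) : cell h c'"
 unfolding h_def
 proof (rule in_some_cell)
 show "0 <= fst (P t i om, Q t i)" "0 <= snd (P t i om, Q t i)" using P_nonneg[OF om'(1)] Q_nonneg by (simp_all only: fst_conv snd_conv)
 show "fst (P t i om, Q t i) < real n" "snd (P t i om, Q t i) < real n"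
 unfolding fst_conv snd_conv using PQ wb' h n3 by linarith+
 qed
 then obtain c' where c': "c' : cells n" "(P t i om, Q t i) : cell h c'" by blast
 have lo: "real (fst c') * h <= P t i om" "real (snd c') * h <= Q t i" using c'(2) by (auto simp: cell_def)
 have "real (fst c') * h < (real (fst c)+4) * h" using lo(1) PQ(1) h by (simp add: distrib_right)
 hence f: "fst c' < fst c+4" using h by simp
 have "real (snd c') * h < (2^n+2) * h" using lo(2) PQ(2) h by (simp add: distrib_right)
 hence "real (snd c') < real (2^n+2)" using h by simp
 hence s: "snd c' < 2^n+2" by (simp only: of_nat_less_iff)
 have "c' : occupied n t om Int rows n c" using c' f s by (auto simp: occupied_def rows_def h_def mem_Times_iff)
 hence cc: "c' = c" using occ by blast
 show "i = i0"
 proof (rule ccontr)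
 assume "i ~= i0"
 hence "i < i0 | i0 < i" by auto
 thus False using om'(4,5) c' i0 unfolding cc double_def by blast
 qed
 qed
 have fin: "finite {gap N i om | i. i : epoch_indices N om & epoch N i om <= t}"
 proof -
 have "{gap N i om | i. i : epoch_indices N om & epoch N i om <= t} = (%i. gap N i om) ` {i. i : epoch_indices N om & epoch N i om <= t}" by auto
 also have "finite ..." unfolding past_indices[OF om'(4) order_less_imp_le[OF order_less_trans[OF zero_less_one om'(1)]]] by simp
 finally show ?thesis .
 qed
 have L: "longest_gap N t om = gap N (Suc i0) om"
 unfolding longest_gap_def
 proof (rule Max_eqI[OF fin])
 fix y assume "y : {gap N i om | i. i : epoch_indices N om & epoch N i om <= t}"
 then obtain i where i: "y = gap N i om" "i : epoch_indices N om" "epoch N i om <= t" by blast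
 then obtain k where k: "i = Suc k" by (cases i) (auto simp: epoch_indices_def)
 show "y <= gap N (Suc i0) om"
 proof (rule ccontr)
 assume "~ y <= gap N (Suc i0) om"
 hence "k = i0" using uniq[of k] i k by simp
 thus False using \<open>~ y <= gap N (Suc i0) om\<close> i k by simp
 qed
 next
 have "Suc i0 : epoch_indices N om" using r[of "Suc i0"] by (simp add: epoch_indices_def reached_def)
 thus "gap N (Suc i0) om : {gap N i om | i. i : epoch_indices N om & epoch N i om <= t}" using ep0 by blast
 qed
 have E: "longest_gap_end N t om = epoch N (Suc i0) om"
 unfolding longest_gap_end_def L
 proof (rule Least_equality)
 have "Suc i0 : epoch_indices N om" using r[of "Suc i0"] by (simp add: epoch_indices_def reached_def)
 thus "EX i:epoch_indices N om. epoch N (Suc i0) om = epoch N i om & gap N i om = gap N (Suc i0) om" by blast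
 fix s assume "EX i:epoch_indices N om. s = epoch N i om & gap N i om = gap N (Suc i0) om"
 then obtain i where i: "i : epoch_indices N om" "s = epoch N i om" "gap N i om = gap N (Suc i0) om" by blast
 then obtain k where k: "i = Suc k" by (cases i) (auto simp: epoch_indices_def)
 show "epoch N (Suc i0) om <= s"
 proof (cases "s <= t")
 case True
 hence "k = i0" using uniq[of k] i k by simp
 thus ?thesis using i k by simp
 next
 case False thus ?thesis using ep0 by linarith
 qed
 qed
 have "record t om = (- ln (pa t i0 om), - ln (qa t i0 om)/a)"
 using a_pos by (simp add: record_def L E pa_def qa_def)
 thus ?thesis using i0 cl0 by (auto simp: h_def)
qed

subsection \<open>Convergence\<close>

definition "code n t om = (if EX c:window n. occupied n t om Int rows n c = {c}
 then Some (THE c. c : window n & occupied n t om Int rows n c = {c}) else None)"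

lemma code_unique:
 assumes "c : window n" "Z Int rows n c = {c}" "c' : window n" "Z Int rows n c' = {c'}" shows "c = c'"
proof -
 have s: "snd c < 2^n+2" "snd c' < 2^n+2" using assms(1,3) by (auto simp: window_def)
 show ?thesis
 proof (cases "fst c <= fst c'")
 case True
 hence "c : Z Int rows n c'" using assms(2) s by (auto simp: rows_def mem_Times_iff)
 hence "c : {c'}" unfolding assms(4) .
 thus ?thesis by simp
 next
 case False
 hence "c' : Z Int rows n c" using assms(4) s by (auto simp: rows_def mem_Times_iff)
 hence "c' : {c}" unfolding assms(2) .
 thus ?thesis by simp
 qed
qed

lemma code_Some_iff: "code n t om = Some c \<longleftrightarrow> c : window n & occupied n t om Int rows n c = {c}"
proof (cases "EX c:window n. occupied n t om Int rows n c = {c}")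
 case True
 then obtain d where d: "d : window n" "occupied n t om Int rows n d = {d}" by blast
 have "(THE c. c : window n & occupied n t om Int rows n c = {c}) = d"
 proof (rule the_equality)
 show "d : window n & occupied n t om Int rows n d = {d}" using d by (rule conjI)
 show "c = d" if "c : window n & occupied n t om Int rows n c = {c}" for c
 by (rule code_unique[OF conjunct1[OF that] conjunct2[OF that] d])
 qed
 hence cd: "code n t om = Some d" unfolding code_def using True by (simp only: if_True)
 show ?thesis
 proof
 assume "code n t om = Some c"
 hence "d = c" unfolding cd by (simp only: option.inject)
 thus "c : window n & occupied n t om Int rows n c = {c}" using d by blast
 next
 assume *: "c : window n & occupied n t om Int rows n c = {c}"
 have "c = d" by (rule code_unique[OF conjunct1[OF *] conjunct2[OF *] d])
 thus "code n t om = Some c" unfolding cd by (simp only:)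
 qed
next
 case False
 hence "code n t om = None" unfolding code_def by (simp only: if_False)
 thus ?thesis using False by (simp only: option.distinct) blast
qed

lemma code_event: "{om : space M. code n t om = z} : sets M"
proof -
 define g where "g Z = (if EX c:window n. Z Int rows n c = {c}
 then Some (THE c. c : window n & Z Int rows n c = {c}) else None)" for Z
 have cg: "code n t om = g (occupied n t om)" for om unfolding code_def g_def by (rule refl)
 have oc: "occupied n t om : Pow (cells n)" for om by (auto simp: occupied_def)
 have "{om : space M. code n t om = z} = (\<Union>Z\<in>{Z : Pow (cells n). g Z = z}. {om : space M. occupied n t om = Z})"
 unfolding cg using oc by blast
 also have "... : sets M" by (rule sets.finite_UN) (simp, rule occupied_event)
 finally show ?thesis .
qed

lemma code_prob_tendsto:
 assumes n: "3 <= n" and c: "c : window n"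
 shows "((%t. prob {om : space M. code n t om = Some c}) \<longlongrightarrow>
 exp (- ((1/2^n) * (1/2^n) * card (rows n c - {c}))) - exp (- ((1/2^n) * (1/2^n) * card (rows n c)))) at_top"
proof -
 let ?h = "1/2^n :: real"
 have fin: "finite (rows n c)" by (simp add: rows_def)
 have cr: "c : rows n c" using c by (auto simp: rows_def window_def mem_Times_iff)
 have sub: "rows n c <= cells n"
 proof -
 have "(2::nat)^1 <= 2^n" using n by (intro power_increasing) auto
 hence "2^n+2 <= 3 * (2::nat)^n" by simp
 also have "... <= n * 2^n" using n by simp
 finally show ?thesis using c by (auto simp: rows_def cells_def window_def)
 qed
 have "{om : space M. code n t om = Some c} = void t ?h (rows n c - {c}) - void t ?h (rows n c)" for t
 proof -
 have "occupied n t om Int rows n c = {c} \<longleftrightarrow> (ALL i. ALL x:rows n c - {c}. (P t i om, Q t i) ~: cell ?h x) & ~ (ALL i. ALL x:rows n c. (P t i om, Q t i) ~: cell ?h x)" for om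
 proof -
 have "occupied n t om Int rows n c = {x : rows n c. EX i. (P t i om, Q t i) : cell ?h x}"
 using sub by (auto simp: occupied_def)
 thus ?thesis using cr by blast
 qed
 thus ?thesis using c by (auto simp: code_Some_iff void_def)
 qed
 moreover have "prob (void t ?h (rows n c - {c}) - void t ?h (rows n c)) = prob (void t ?h (rows n c - {c})) - prob (void t ?h (rows n c))" for t
 by (rule finite_measure_Diff[OF void_event void_event]) (use fin in \<open>auto simp: void_def\<close>)
 moreover have "((%t. prob (void t ?h (rows n c - {c})) - prob (void t ?h (rows n c))) \<longlongrightarrow>
 exp (- (?h * ?h * card (rows n c - {c}))) - exp (- (?h * ?h * card (rows n c)))) at_top"
 by (intro tendsto_diff void_tendsto) (use fin in auto)
 ultimately show ?thesis by (simp only:)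
qed

end

context gap_setting begin

text \<open>Minimizing the first coordinate over the unit strip of a unit-intensity scatter gives an exponential height and an independent uniform position; in the original coordinates these are a Gumbel and an exponential variable.\<close>

theorem longest_gap_converges:
 "conv_in_distribution euclidean M record (gumbel \<Otimes>\<^sub>M density lborel (exponential_density a)) (%p. p) at_top"
proof -
 interpret G: real_distribution gumbel by (rule gumbel_real_distribution)
 interpret E: prob_space "density lborel (exponential_density a)" by (rule prob_space_exponential_density[OF a_pos])
 interpret GE: pair_prob_space gumbel "density lborel (exponential_density a)" ..
 let ?M = "gumbel \<Otimes>\<^sub>M density lborel (exponential_density a)"
 have prob: "prob_space ?M" by (rule GE.prob_space_axioms)
 have sM: "sets ?M = sets (borel :: (real \<times> real) measure)"
 proof -
 have "sets ?M = sets (borel \<Otimes>\<^sub>M borel :: (real \<times> real) measure)" by (rule sets_pair_measure_cong) simp_all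
 thus ?thesis by (simp only: borel_prod)
 qed
 have spM: "space ?M = UNIV" by (simp add: space_pair_measure)
 define e where "e p = (exp (- fst p), exp (- a * snd p))" for p :: "real \<times> real"
 have em: "e : borel_measurable borel"
 unfolding e_def by (intro borel_measurable_continuous_onI continuous_intros)
 define W where "W n c = {p. e p : cell (1/2^n) c}" for n c
 have Ws: "W n c : sets ?M" for n c
 unfolding sM W_def using measurable_sets_borel[OF em cell_borel, of "1/2^n" c] by (simp only: vimage_def)
 have Wu: "c = c'" if "p : W n c" "p : W n c'" for n p c c'
 using that cell_disjoint[of "1/2^n"] unfolding W_def by fastforce
 define ka' where "ka' n p = (if EX c. p : W n c then Some (THE c. p : W n c) else None)" for n p
 have ka': "ka' n p = Some c \<longleftrightarrow> p : W n c" for n p c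
 proof (cases "EX c. p : W n c")
 case True
 then obtain d where d: "p : W n d" by blast
 have "(THE c. p : W n c) = d"
 proof (rule the_equality)
 show "p : W n d" by (rule d)
 show "c = d" if "p : W n c" for c by (rule Wu[OF that d])
 qed
 hence k: "ka' n p = Some d" using True unfolding ka'_def by (simp only: if_True)
 show ?thesis unfolding k option.inject using d Wu by blast
 next
 case False
 hence "ka' n p = None" unfolding ka'_def by (simp only: if_False)
 thus ?thesis using False by (simp only: option.distinct) blast
 qed
 have ka'ev: "{p : space ?M. ka' n p = z} : sets ?M" for n z
 proof (cases z)
 case None
 have "{p : space ?M. ka' n p = z} = space ?M - (\<Union>c. W n c)"
 using None ka' by (auto simp: ka'_def)
 also have "... : sets ?M"
 by (intro sets.Diff sets.top sets.countable_UN'') (rule countableI_type, rule Ws)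
 finally show ?thesis .
 next
 case (Some c)
 hence "{p : space ?M. ka' n p = z} = W n c" by (auto simp: ka' spM)
 thus ?thesis using Ws by (simp only:)
 qed
 define C where "C n = (if n < 3 then {} else Some ` window n)" for n
 define pp where "pp n z = (case z of None => 0 | Some c =>
 exp (- ((1/2^n) * (1/2^n) * card (rows n c - {c}))) - exp (- ((1/2^n) * (1/2^n) * card (rows n c))))" for n and z :: "(nat \<times> nat) option"
 have pW: "measure ?M {p : space ?M. ka' n p = Some c} = exp (- (real (fst c) * (1/2^n))) * (1 - exp (- (1/2^n))) * (1/2^n)"
 if c: "c : window n" for n c
 proof -
 have "real (snd c+1) * (1/2^n) <= (real (snd c)+4) * (1/2^n)" by (intro mult_right_mono) auto
 hence "real (snd c+1) * (1/2^n) <= 1" using window_bound(2)[OF c] by linarith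
 from limit_cell_prob[OF a_pos _ this] have "measure ?M (W n c) = exp (- (real (fst c) * (1/2^n))) * (1 - exp (- (1/2^n))) * (1/2^n)"
 unfolding W_def e_def by simp
 moreover have "{p : space ?M. ka' n p = Some c} = W n c" by (auto simp: ka' spM)
 ultimately show ?thesis by (simp only:)
 qed
 have approx: "(%n. \<Sum>z\<in>C n. \<bar>pp n z - measure ?M {p : space ?M. ka' n p = z}\<bar>) \<longlonglongrightarrow> 0"
 proof (rule Lim_transform_eventually[OF window_approximation])
 show "\<forall>\<^sub>F n in sequentially. (\<Sum>c\<in>window n. \<bar>(exp (- ((1/2^n) * (1/2^n) * card (rows n c - {c}))) - exp (- ((1/2^n) * (1/2^n) * card (rows n c)))) -
 exp (- (real (fst c) * (1/2^n))) * (1 - exp (- (1/2^n))) * (1/2^n)\<bar>) =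
 (\<Sum>z\<in>C n. \<bar>pp n z - measure ?M {p : space ?M. ka' n p = z}\<bar>)"
 using eventually_ge_at_top[of 3]
 proof eventually_elim
 case (elim n)
 hence "C n = Some ` window n" by (simp add: C_def)
 hence "(\<Sum>z\<in>C n. \<bar>pp n z - measure ?M {p : space ?M. ka' n p = z}\<bar>) =
 (\<Sum>c\<in>window n. \<bar>pp n (Some c) - measure ?M {p : space ?M. ka' n p = Some c}\<bar>)"
 by (simp only: sum.reindex[OF inj_Some] o_def)
 also have "... = (\<Sum>c\<in>window n. \<bar>(exp (- ((1/2^n) * (1/2^n) * card (rows n c - {c}))) - exp (- ((1/2^n) * (1/2^n) * card (rows n c)))) -
 exp (- (real (fst c) * (1/2^n))) * (1 - exp (- (1/2^n))) * (1/2^n)\<bar>)"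
 by (rule sum.cong[OF refl]) (simp only: pW pp_def option.case)
 finally show ?case by (rule sym)
 qed
 qed
 have tail: "(%n. measure ?M {p : space ?M. ~ (p : space ?M & ka' n p : C n)}) \<longlonglongrightarrow> 0"
 proof (rule tendsto_sandwich[OF _ _ tendsto_const])
 show "\<forall>\<^sub>F n in sequentially. 0 <= measure ?M {p : space ?M. ~ (p : space ?M & ka' n p : C n)}" by simp
 have 1: "(%n. exp (- real n)) \<longlonglongrightarrow> 0" by real_asymp
 have 2: "(%n. 3 * (1/2^n) :: real) \<longlonglongrightarrow> 0" by real_asymp
 have "exp (- (real n - 3 * (1/2^n))) = exp (- real n) * exp (3 * (1/2^n))" for n
 unfolding mult_exp_exp by (rule arg_cong[where f=exp]) simp
 thus "(%n. exp (- (real n - 3 * (1/2^n)))+3 * (1/2^n)) \<longlonglongrightarrow> 0"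
 using tendsto_add[OF tendsto_mult[OF 1 tendsto_exp[OF 2]] 2] by simp
 show "\<forall>\<^sub>F n in sequentially. measure ?M {p : space ?M. ~ (p : space ?M & ka' n p : C n)} <= exp (- (real n - 3 * (1/2^n)))+3 * (1/2^n)"
 using eventually_ge_at_top[of 3]
 proof eventually_elim
 case (elim n)
 define h where "h = 1/(2::real)^n"
 have h: "0 < h" "h <= 1/8" "2^n * h = 1"
 proof -
 have "(2::real)^3 <= 2^n" using elim by (intro power_increasing) auto
 hence "1/(2::real)^n <= 1/8" by (intro frac_le) auto
 thus "0 < h" "h <= 1/8" "2^n * h = 1" by (simp_all add: h_def)
 qed
 have n3: "3 <= real n" using elim by simp
 have sub: "{p : space ?M. ~ (p : space ?M & ka' n p : C n)} <= {p. real n - 3 * h <= exp (- fst p) | 1 - 3 * h <= exp (- a * snd p)}"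
 proof
 fix p assume p: "p : {p : space ?M. ~ (p : space ?M & ka' n p : C n)}"
 show "p : {p. real n - 3 * h <= exp (- fst p) | 1 - 3 * h <= exp (- a * snd p)}"
 proof (rule ccontr)
 assume "p ~: {p. real n - 3 * h <= exp (- fst p) | 1 - 3 * h <= exp (- a * snd p)}"
 hence lt: "fst (e p) < real n - 3 * h" "snd (e p) < 1 - 3 * h" by (auto simp: e_def not_le)
 have "EX c:cells n. e p : cell (1/2^n) c"
 proof (rule in_some_cell)
 show "0 <= fst (e p)" "0 <= snd (e p)" by (simp_all add: e_def)
 show "fst (e p) < real n" "snd (e p) < real n" using lt h n3 by linarith+
 qed
 then obtain c where c: "e p : cell h c" by (auto simp: h_def)
 have lo: "real (fst c) * h <= fst (e p)" "real (snd c) * h <= snd (e p)" using c by (auto simp: cell_def mem_Times_iff)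
 have nh: "real n = real n * 2^n * h" using h(3) by (simp only: mult.assoc mult_1_right)
 have "(real (fst c)+3) * h < (real n * 2^n) * h" using lo(1) lt(1) nh unfolding distrib_right by linarith
 hence "real (fst c)+3 < real n * 2^n" using h(1) by (simp only: mult_less_cancel_right_pos)
 hence "real (fst c+3) < real (n * 2^n)" by simp
 hence f: "fst c+3 < n * 2^n" by (simp only: of_nat_less_iff)
 have "(real (snd c)+3) * h < 2^n * h" using lo(2) lt(2) h(3) unfolding distrib_right by linarith
 hence "real (snd c)+3 < 2^n" using h(1) by (simp only: mult_less_cancel_right_pos)
 hence "real (snd c+3) < real (2^n)" by simp
 hence s: "snd c+3 < 2^n" by (simp only: of_nat_less_iff)
 have "c : window n" using f s by (simp add: window_def)
 moreover have "ka' n p = Some c" unfolding ka' W_def using c by (simp add: h_def)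
 ultimately have "ka' n p : C n" using elim by (simp add: C_def)
 thus False using p by blast
 qed
 qed
 have ms: "{p. real n - 3 * h <= exp (- fst p) | 1 - 3 * h <= exp (- a * snd p)} : sets ?M"
 proof -
 have "closed {p :: real \<times> real. real n - 3 * h <= exp (- fst p)}" "closed {p :: real \<times> real. 1 - 3 * h <= exp (- a * snd p)}"
 by (intro closed_Collect_le continuous_intros)+
 hence "closed ({p :: real \<times> real. real n - 3 * h <= exp (- fst p)} Un {p. 1 - 3 * h <= exp (- a * snd p)})" by (rule closed_Un)
 thus ?thesis unfolding sM Collect_disj_eq by (rule borel_closed)
 qed
 have "measure ?M {p : space ?M. ~ (p : space ?M & ka' n p : C n)} <= measure ?M {p. real n - 3 * h <= exp (- fst p) | 1 - 3 * h <= exp (- a * snd p)}"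
 by (rule GE.finite_measure_mono[OF sub ms])
 also have "... <= exp (- (real n - 3 * h))+3 * h"
 by (rule limit_tail_prob[OF a_pos]) (use h n3 in linarith)+
 finally show ?case by (simp only: h_def)
 qed
 qed
 have conv: "((%t. \<integral>om. f (record t om) \<partial>M) \<longlongrightarrow> (\<integral>p. f p \<partial>?M)) at_top"
 if f: "continuous_map euclidean euclideanreal f" and bdd: "bounded (f ` topspace euclidean)" for f :: "real \<times> real => real"
 proof -
 have fc: "continuous_on UNIV f" using f by simp
 have fm: "f : borel_measurable borel" by (rule borel_measurable_continuous_onI[OF fc])
 obtain B where B: "!!p. \<bar>f p\<bar> <= B" using bdd unfolding bounded_iff by auto
 show ?thesis
 proof (rule conv_expectation_codes[OF prob_space_axioms prob, where ka=code and ka'=ka' and C=C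
 and G'="%n. space ?M" and G=good and de=bad_bound and B=B and pp=pp])
 show "\<bar>f (record t om)\<bar> <= B" for t om by (rule B)
 show "\<bar>f p\<bar> <= B" for p by (rule B)
 show "\<forall>\<^sub>F t in at_top. (%om. f (record t om)) : borel_measurable M"
 using eventually_ge_at_top[of 0] by eventually_elim (rule measurable_compose[OF record_measurable fm])
 show "f : borel_measurable ?M" using fm by (simp only: measurable_cong_sets[OF sM refl])
 show "finite (C n)" for n using finite_window by (simp add: C_def)
 show "{om : space M. code n t om = c} : events" for n t c by (rule code_event)
 show "{p : space ?M. ka' n p = c} : sets ?M" for n c by (rule ka'ev)
 show "((%t. prob {om : space M. code n t om = z}) \<longlongrightarrow> pp n z) at_top" if z: "z : C n" for n z
 proof -
 have n: "3 <= n" using z by (auto simp: C_def split: if_splits)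
 then obtain c where c: "c : window n" "z = Some c" using z by (auto simp: C_def)
 show ?thesis unfolding c(2) pp_def option.case by (rule code_prob_tendsto[OF n c(1)])
 qed
 show "(%n. \<Sum>c\<in>C n. \<bar>pp n c - measure ?M {p : space ?M. ka' n p = c}\<bar>) \<longlonglongrightarrow> 0" by (rule approx)
 show "space ?M : sets ?M" by (rule sets.top)
 show "(%n. measure ?M {p : space ?M. ~ (p : space ?M & ka' n p : C n)}) \<longlonglongrightarrow> 0" by (rule tail)
 show "good n t : events" for n t by (rule good_event)
 show "\<forall>\<^sub>F t in at_top. prob (space M - good n t) <= bad_bound n" for n by (rule good_prob)
 show "bad_bound \<longlonglongrightarrow> 0" by (rule bad_bound_tendsto)
 fix p and ep :: real assume ep: "ep > 0"
 define F where "F q = f (- ln (fst q), - ln (snd q)/a)" for q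
 have Fe: "F (e p) = f p" using a_pos by (simp add: F_def e_def)
 have g: "isCont (%q. (- ln (fst q), - ln (snd q)/a)) (e p)"
 by (intro continuous_intros) (use a_pos in \<open>simp_all add: e_def\<close>)
 have f1: "isCont f (- ln (fst (e p)), - ln (snd (e p))/a)" using fc by (simp add: continuous_on_eq_continuous_at)
 have "isCont F (e p)"
 unfolding F_def by (rule isCont_o2[OF g]) (rule f1)
 then obtain d where d: "d > 0" "!!q. dist q (e p) < d ==> dist (F q) (F (e p)) < ep"
 using ep unfolding continuous_at_eps_delta by blast
 have "(%n. 4 * (1/2^n) :: real) \<longlonglongrightarrow> 0" by real_asymp
 hence "\<forall>\<^sub>F n in sequentially. 4 * (1/2^n) < d" using d(1) by (rule order_tendstoD)
 thus "\<forall>\<^sub>F n in sequentially. p : space ?M --> ka' n p : C n -->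
 (ALL t. ALL om:good n t. code n t om = ka' n p --> \<bar>f (record t om) - f p\<bar> <= ep)"
 proof eventually_elim
 case (elim n)
 show ?case
 proof (intro impI allI ballI)
 fix t om assume kC: "ka' n p : C n" and om: "om : good n t" and eq: "code n t om = ka' n p"
 have n: "3 <= n" using kC by (auto simp: C_def split: if_splits)
 obtain c where c: "ka' n p = Some c" using kC n by (auto simp: C_def)
 have pc: "e p : cell (1/2^n) c" using c unfolding ka' W_def by simp
 have cc: "c : window n" "occupied n t om Int rows n c = {c}" using eq unfolding c code_Some_iff by auto
 obtain i where i: "record t om = (- ln (pa t i om), - ln (qa t i om)/a)" "(P t i om, Q t i) : cell (1/2^n) c"
 "\<bar>pa t i om - P t i om\<bar> <= 1/2^n" "\<bar>qa t i om - Q t i\<bar> <= 1/2^n"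
 using longest_gap_located[OF om n cc] by blast
 have "\<bar>pa t i om - fst (e p)\<bar> <= 2 * (1/2^n)" "\<bar>qa t i om - snd (e p)\<bar> <= 2 * (1/2^n)"
 using cell_close[OF i(2) pc] i(3,4) unfolding fst_conv snd_conv by linarith+
 moreover have "dist (pa t i om, qa t i om) (e p) <= \<bar>pa t i om - fst (e p)\<bar> + \<bar>qa t i om - snd (e p)\<bar>"
 unfolding dist_prod_def dist_real_def fst_conv snd_conv by (rule sqrt_sum_squares_le_sum) auto
 ultimately have "dist (pa t i om, qa t i om) (e p) < d" using elim by linarith
 from d(2)[OF this] have "dist (F (pa t i om, qa t i om)) (f p) < ep" unfolding Fe .
 thus "\<bar>f (record t om) - f p\<bar> <= ep" unfolding F_def i(1) dist_real_def fst_conv snd_conv by linarith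
 qed
 qed
 qed
 qed
 show ?thesis unfolding conv_in_distribution_def
 proof (intro conjI allI impI)
 show "prob_space M" "prob_space ?M" by (rule prob_space_axioms, rule prob)
 show "\<forall>\<^sub>F t in at_top. record t : measurable M (borel_of_top euclidean)"
 using eventually_ge_at_top[of 0]
 proof eventually_elim
 case (elim t)
 show ?case unfolding measurable_cong_sets[OF refl borel_of_top_euclidean(1)] by (rule record_measurable[OF elim])
 qed
 show "(%p. p) : measurable ?M (borel_of_top euclidean)"
 by (rule measurable_ident_sets) (simp only: sM borel_of_top_euclidean(1))
 fix f :: "real \<times> real => real"
 assume "continuous_map euclidean euclideanreal f & bounded (f ` topspace euclidean)"
 thus "((%t. \<integral>om. f (record t om) \<partial>M) \<longlongrightarrow> (\<integral>p. f p \<partial>?M)) at_top" by (intro conv) auto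
 qed
qed

end

theorem theorem4p7:
  fixes \<alpha> \<gamma> :: real
    and lam Lam V v l b :: "real \<Rightarrow> real"
    and M :: "'a measure"
    and N :: "real \<Rightarrow> 'a \<Rightarrow> nat"
  assumes "0 < \<alpha>" and "\<alpha> < 1"
    and "poisson_process M lam N"
    and "lam \<in> RV (\<alpha> - 1)"
    and "\<And>t. t > 0 \<Longrightarrow> set_integrable lborel {0<..t} lam"
    and "Lam = cumulative_rate lam"
    and "V = the_inv_into {0..} Lam"
    and "v = (\<lambda>s. 1 / lam (V s))"
    and "\<gamma> = (1 - \<alpha>) / \<alpha>"
    and "l = (\<lambda>t. t powr (- \<gamma>) * v t)"
    and "\<And>\<epsilon> :: real \<Rightarrow> real. (\<forall>t>0. \<epsilon> t > 0) \<Longrightarrow> (\<epsilon> \<longlongrightarrow> 0) at_top \<Longrightarrow>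
           ((\<lambda>t. ln t * (l ((1 + \<epsilon> t) * t) / l t - 1)) \<longlongrightarrow> 0) at_top"
    and "b = (\<lambda>t. ln (Lam t) - ln (ln t) - ln (1 - \<alpha>))"
  shows "conv_in_distribution euclidean
           M (\<lambda>t \<omega>. (lam t * longest_gap N t \<omega> - b t, (t - longest_gap_end N t \<omega>) / t * ln t))
           (gumbel \<Otimes>\<^sub>M density lborel (exponential_density (\<alpha> * (1 - \<alpha>)))) (\<lambda>p. p)
           at_top
       \<and>
         (\<exists>(M' :: (ereal \<times> ereal) measure measure) \<eta>.
           poisson_point_process ext_plane (limit_intensity (\<alpha> * (1 - \<alpha>))) M' \<eta> \<and>
           conv_in_distribution (vague_topology ext_plane)
             M (\<lambda>t \<omega>. point_measure_on ext_plane (epoch_indices N \<omega>)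
                  (\<lambda>i. (ereal (lam t * gap N i \<omega> - b t), ereal ((t - epoch N i \<omega>) / t * ln t))))
             M' \<eta>
             at_top)"
proof -
  interpret rf: rate_function lam \<alpha>
    by unfold_locales (use assms(1,2,4,5) in auto)
  have l_eq: "l = rf.l"
    unfolding assms(10) assms(9) assms(8) assms(7) assms(6)
    by (rule ext) (simp only: rf.l_def rf.v_def rf.V_def rf.ga_def)
  interpret gs: gap_setting lam \<alpha> M N
    by unfold_locales (use assms(3) assms(11)[unfolded l_eq] in auto)
  have b_eq: "b = gs.bt"
    unfolding assms(12) assms(6) by (rule ext) (simp only: gs.bt_def)
  have r_eq: "(\<lambda>t \<omega>. (lam t * longest_gap N t \<omega> - b t, (t - longest_gap_end N t \<omega>) / t * ln t)) = gs.record"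
    unfolding b_eq by (intro ext) (simp only: gs.record_def)
  have p_eq: "(\<lambda>t \<omega>. point_measure_on ext_plane (epoch_indices N \<omega>)
      (\<lambda>i. (ereal (lam t * gap N i \<omega> - b t), ereal ((t - epoch N i \<omega>) / t * ln t)))) = gs.point_proc"
    unfolding b_eq by (intro ext) (rule gs.point_proc_eq)
  show ?thesis
    unfolding r_eq p_eq gs.a_def[symmetric]
    by (rule conjI[OF gs.longest_gap_converges gs.gap_point_process_converges])
qed

end
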